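(* Let $\lambda\in(0,1)$, $c\in\mathbb{R}$, $T>0$, let $k\ge0$ be an integer, and let $u\in H^{k+1}(Q_T)$, $Q_T=\mathbb{R}\times(0,T)$, be a solution of $\partial_tu+c\,\partial_xu=g[u]$ with initial datum $u_0=u(\cdot,0)$. Then there exists a constant $c_{k,T}>0$, independent of $\Delta x$, such that for every $\Delta x>0$ and every solution $\tilde u\in C^1([0,T];H^{\lambda/2}(\mathbb{R}))$ of the linear semidiscrete DG method of degree $k$ on the grid of size $\Delta x$ with initial datum $u_0$, $$\|u(\cdot,T)-\tilde u(\cdot,T)\|_{L^2(\mathbb{R})}\le c_{k,T}\,\Delta x^{k+\frac12}.$$
   Context: All functions are real-valued. Fractional Laplacian: $g=g_\lambda=-(-\partial_x^2)^{\lambda/2}$ (acting in $x$) is defined by $\widehat{g[\varphi]}(\xi)=-|\xi|^\lambda\hat\varphi(\xi)$ (Fourier transform $\hat\varphi(\xi)=\int e^{-ix\xi}\varphi(x)\,dx$). Sobolev space: $H^{\lambda/2}(\mathbb{R})$ has norm $\|u\|_{H^{\lambda/2}}^2=\|u\|_{L^2}^2+\int_{\mathbb{R}}\int_{\mathbb{R}}\frac{[u(z)-u(x)]^2}{|z-x|^{1+\lambda}}dz\,dx$. The operator $g$ maps $H^{\lambda/2}(\mathbb{R})$ into its dual $H^{-\lambda/2}(\mathbb{R})$, and integrals $\int g[u]v$ with $u,v\in H^{\lambda/2}(\mathbb{R})$ are understood as the duality pairing $\langle g[u],v\rangle$. Grid and basis: $x_i=i\Delta x$, $I_i=(x_i,x_{i+1})$,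 $i\in\mathbb{Z}$. For $p=0,\ldots,k$, $\varphi_{p,i}(x)=P_p\big(\tfrac{2(x-x_i)}{\Delta x}-1\big)$ on $I_i$ and $0$ outside $I_i$, where $P_p$ is the standard Legendre polynomial of degree $p$. Linear semidiscrete DG method: find $\tilde u(x,t)=\sum_{i\in\mathbb{Z}}\sum_{p=0}^kU_{p,i}(t)\varphi_{p,i}(x)$ such that for all $q=0,\ldots,k$, $i\in\mathbb{Z}$ and $t\in[0,T]$, $$\tfrac{\Delta x}{2q+1}\tfrac{d}{dt}U_{q,i}=\int_{I_i}c\,\tilde u\,\tfrac{d}{dx}\varphi_{q,i}\,dx+(-1)^qF(\tilde u_i)-F(\tilde u_{i+1})+\int_{I_i}g[\tilde u]\varphi_{q,i}\,dx,$$ $$U_{q,i}(0)=\tfrac{2q+1}{\Delta x}\int_{I_i}u_0(x)\varphi_{q,i}(x)\,dx,$$ where $F(\tilde u_i):=F(\tilde u(x_i^-,t),\tilde u(x_i^+,t))$, $\tilde u(x_i^\pm,t)$ are the right/left limits at $x_i$, and the flux is $F(a,b)=\frac c2(a+b)-\frac{|c|}2(b-a)$. *)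

theory Defs
  imports "HOL-Analysis.Analysis" "HOL-Computational_Algebra.Polynomial"
begin

section \<open>Square-integrable functions and Sobolev spaces of integer order\<close>

text \<open>Elements of the Lebesgue and Sobolev spaces are represented by Borel functions; everything
  below, except for the explicitly piecewise polynomial functions, is invariant under changes on
  null sets.\<close>

definition L2_on :: "'a::euclidean_space set \<Rightarrow> ('a \<Rightarrow> real) \<Rightarrow> bool" where
  "L2_on \<Omega> f \<longleftrightarrow>
     set_borel_measurable lborel \<Omega> f \<and> set_integrable lborel \<Omega> (\<lambda>x. (f x)\<^sup>2)"

definition L2_norm :: "(real \<Rightarrow> real) \<Rightarrow> real" where
  "L2_norm f = sqrt (LINT x|lborel. (f x)\<^sup>2)"

definition partial :: "'a::euclidean_space \<Rightarrow> ('a \<Rightarrow> real) \<Rightarrow> 'a \<Rightarrow> real" where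
  "partial b f = (\<lambda>z. frechet_derivative f (at z) b)"

text \<open>A multi-index is represented by a list of basis vectors, one entry per derivative.\<close>

definition iter_partial :: "'a::euclidean_space list \<Rightarrow> ('a \<Rightarrow> real) \<Rightarrow> 'a \<Rightarrow> real" where
  "iter_partial bs f = foldr partial bs f"

text \<open>Test functions: since every iterated partial derivative is required to be Frechet
  differentiable, hence continuous, this is the space of compactly supported
  infinitely differentiable functions.\<close>

definition test_function :: "'a::euclidean_space set \<Rightarrow> ('a \<Rightarrow> real) \<Rightarrow> bool" where
  "test_function \<Omega> \<phi> \<longleftrightarrow>
     (\<forall>bs. set bs \<subseteq> Basis \<longrightarrow> (\<forall>z. iter_partial bs \<phi> differentiable (at z))) \<and>
     (\<exists>K. compact K \<and> K \<subseteq> \<Omega> \<and> (\<forall>z. z \<notin> K \<longrightarrow> \<phi> z = 0))"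

definition weak_derivative ::
    "'a::euclidean_space set \<Rightarrow> 'a list \<Rightarrow> ('a \<Rightarrow> real) \<Rightarrow> ('a \<Rightarrow> real) \<Rightarrow> bool" where
  "weak_derivative \<Omega> bs f g \<longleftrightarrow>
     (\<forall>\<phi>. test_function \<Omega> \<phi> \<longrightarrow>
        (LINT z:\<Omega>|lborel. f z * iter_partial bs \<phi> z) =
          (- 1) ^ length bs * (LINT z:\<Omega>|lborel. g z * \<phi> z))"

definition sobolev :: "nat \<Rightarrow> 'a::euclidean_space set \<Rightarrow> ('a \<Rightarrow> real) set" where
  "sobolev m \<Omega> = {f. L2_on \<Omega> f \<and>
     (\<forall>bs. set bs \<subseteq> Basis \<and> length bs \<le> m \<longrightarrow> (\<exists>g. L2_on \<Omega> g \<and> weak_derivative \<Omega> bs f g))}"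

section \<open>The fractional Sobolev space of order lam/2\<close>

definition gagliardo_quotient :: "real \<Rightarrow> (real \<Rightarrow> real) \<Rightarrow> real \<times> real \<Rightarrow> real" where
  "gagliardo_quotient lam f = (\<lambda>(x, z). (f z - f x)\<^sup>2 / \<bar>z - x\<bar> powr (1 + lam))"

definition H_frac :: "real \<Rightarrow> (real \<Rightarrow> real) set" where
  "H_frac lam = {f. L2_on UNIV f \<and> integrable lborel (gagliardo_quotient lam f)}"

definition H_frac_norm :: "real \<Rightarrow> (real \<Rightarrow> real) \<Rightarrow> real" where
  "H_frac_norm lam f =
     sqrt ((L2_norm f)\<^sup>2 + (LINT p|lborel. gagliardo_quotient lam f p))"

text \<open>Continuously differentiable curves from the interval [0,T] into this space; at the end
  points the derivative is one-sided. The first argument of a curve is time.\<close>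

definition C1_H_frac :: "real \<Rightarrow> real \<Rightarrow> (real \<Rightarrow> real \<Rightarrow> real) \<Rightarrow> bool" where
  "C1_H_frac lam T w \<longleftrightarrow>
     (\<forall>t\<in>{0..T}. w t \<in> H_frac lam) \<and>
     (\<exists>w'. (\<forall>t\<in>{0..T}. w' t \<in> H_frac lam \<and>
        ((\<lambda>s. H_frac_norm lam (\<lambda>x. (w s x - w t x) / (s - t) - w' t x)) \<longlongrightarrow> 0)
           (at t within {0..T}) \<and>
        ((\<lambda>s. H_frac_norm lam (\<lambda>x. w' s x - w' t x)) \<longlongrightarrow> 0) (at t within {0..T})))"

section \<open>Fourier transform and fractional Laplacian\<close>

text \<open>The Fourier transform of a square-integrable function is the limit in the mean of the
  transforms of its truncations (Plancherel). It is determined up to null sets.\<close>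

definition is_fourier :: "(real \<Rightarrow> real) \<Rightarrow> (real \<Rightarrow> complex) \<Rightarrow> bool" where
  "is_fourier f F \<longleftrightarrow>
     F \<in> borel_measurable lborel \<and>
     integrable lborel (\<lambda>\<xi>. (cmod (F \<xi>))\<^sup>2) \<and>
     ((\<lambda>R. \<integral>\<^sup>+ \<xi>. ennreal ((cmod (F \<xi> -
          (LINT x:{-R..R}|lborel. exp (- (\<i> * complex_of_real (x * \<xi>))) * complex_of_real (f x))))\<^sup>2)
        \<partial>lborel) \<longlongrightarrow> 0) at_top"

definition fourier :: "(real \<Rightarrow> real) \<Rightarrow> real \<Rightarrow> complex" where
  "fourier f = (SOME F. is_fourier f F)"

text \<open>The Fourier transform of g[f].\<close>

definition fourier_g :: "real \<Rightarrow> (real \<Rightarrow> real) \<Rightarrow> real \<Rightarrow> complex" where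
  "fourier_g lam f \<xi> = - (complex_of_real (\<bar>\<xi>\<bar> powr lam) * fourier f \<xi>)"

text \<open>The square-integrable function h equals g[f].\<close>

definition is_g :: "real \<Rightarrow> (real \<Rightarrow> real) \<Rightarrow> (real \<Rightarrow> real) \<Rightarrow> bool" where
  "is_g lam f h \<longleftrightarrow>
     L2_on UNIV f \<and> L2_on UNIV h \<and> (AE \<xi> in lborel. fourier h \<xi> = fourier_g lam f \<xi>)"

text \<open>The duality pairing of g[f] with v. The pairing of a distribution S of order -lam/2 with v is,
  by Parseval's identity for the unnormalised transform used here, 1/(2 pi) times the integral of
  the transform of S against the complex conjugate of the transform of v. The integral is real
  because f and v are.\<close>

definition g_pairing :: "real \<Rightarrow> (real \<Rightarrow> real) \<Rightarrow> (real \<Rightarrow> real) \<Rightarrow> real" where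
  "g_pairing lam f v =
     1 / (2 * pi) * Re (LINT \<xi>|lborel. fourier_g lam f \<xi> * cnj (fourier v \<xi>))"

section \<open>The equation\<close>

text \<open>Functions on the space-time strip take the pair (x, t).\<close>

definition Q :: "real \<Rightarrow> (real \<times> real) set" where
  "Q T = UNIV \<times> {0<..<T}"

text \<open>For a function with square-integrable first derivatives all terms of the
  equation are functions, and the equation holds almost everywhere.\<close>

definition solves_equation :: "real \<Rightarrow> real \<Rightarrow> real \<Rightarrow> (real \<times> real \<Rightarrow> real) \<Rightarrow> bool" where
  "solves_equation lam c T u \<longleftrightarrow>
     (\<exists>ut ux. L2_on (Q T) ut \<and> weak_derivative (Q T) [(0, 1)] u ut \<and>
              L2_on (Q T) ux \<and> weak_derivative (Q T) [(1, 0)] u ux \<and>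
              (AE t in lborel. t \<in> {0<..<T} \<longrightarrow>
                 is_g lam (\<lambda>x. u (x, t)) (\<lambda>x. ut (x, t) + c * ux (x, t))))"

text \<open>The function w is the trace u(.,s), for s in [0,T]: the value at s of the representative of
  u that is continuous in time with values in the square-integrable functions.\<close>

definition time_trace ::
    "real \<Rightarrow> (real \<times> real \<Rightarrow> real) \<Rightarrow> real \<Rightarrow> (real \<Rightarrow> real) \<Rightarrow> bool" where
  "time_trace T u s w \<longleftrightarrow>
     (\<exists>v. (\<forall>t\<in>{0..T}. L2_on UNIV (v t) \<and>
              ((\<lambda>r. L2_norm (\<lambda>x. v r x - v t x)) \<longlongrightarrow> 0) (at t within {0..T})) \<and>
          (AE t in lborel. t \<in> {0<..<T} \<longrightarrow> (AE x in lborel. u (x, t) = v t x)) \<and>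
          w = v s)"

section \<open>The semidiscrete discontinuous Galerkin method\<close>

text \<open>Rodrigues' formula.\<close>

definition legendre :: "nat \<Rightarrow> real poly" where
  "legendre p = smult (1 / (2 ^ p * fact p)) ((pderiv ^^ p) ([:- 1, 0, 1:] ^ p))"

definition grid :: "real \<Rightarrow> int \<Rightarrow> real" where
  "grid \<Delta>x i = of_int i * \<Delta>x"

definition cell :: "real \<Rightarrow> int \<Rightarrow> real set" where
  "cell \<Delta>x i = {grid \<Delta>x i <..< grid \<Delta>x (i + 1)}"

definition basis_fun :: "real \<Rightarrow> nat \<Rightarrow> int \<Rightarrow> real \<Rightarrow> real" where
  "basis_fun \<Delta>x p i x =
     (if x \<in> cell \<Delta>x i then poly (legendre p) (2 * (x - grid \<Delta>x i) / \<Delta>x - 1) else 0)"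

definition flux :: "real \<Rightarrow> real \<Rightarrow> real \<Rightarrow> real" where
  "flux c a b = c / 2 * (a + b) - \<bar>c\<bar> / 2 * (b - a)"

definition flux_at :: "real \<Rightarrow> real \<Rightarrow> (real \<Rightarrow> real) \<Rightarrow> int \<Rightarrow> real" where
  "flux_at c \<Delta>x w i = flux c (Lim (at_left (grid \<Delta>x i)) w) (Lim (at_right (grid \<Delta>x i)) w)"

text \<open>For every x at most one summand of the sum over the cells is nonzero.\<close>

definition dg_solution ::
    "real \<Rightarrow> real \<Rightarrow> nat \<Rightarrow> real \<Rightarrow> real \<Rightarrow> (real \<Rightarrow> real) \<Rightarrow> (real \<Rightarrow> real \<Rightarrow> real) \<Rightarrow> bool" where
  "dg_solution lam c k \<Delta>x T u0 w \<longleftrightarrow>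
     (\<exists>U :: nat \<Rightarrow> int \<Rightarrow> real \<Rightarrow> real.
        (\<forall>t\<in>{0..T}. \<forall>x. w t x = (\<Sum>\<^sub>\<infinity>i. \<Sum>p\<le>k. U p i t * basis_fun \<Delta>x p i x)) \<and>
        (\<forall>q\<le>k. \<forall>i. \<forall>t\<in>{0..T}. \<exists>U'.
           (U q i has_real_derivative U') (at t within {0..T}) \<and>
           \<Delta>x / (2 * real q + 1) * U' =
             (LINT x:cell \<Delta>x i|lborel. c * w t x * deriv (basis_fun \<Delta>x q i) x)
             + (- 1) ^ q * flux_at c \<Delta>x (w t) i - flux_at c \<Delta>x (w t) (i + 1)
             + g_pairing lam (w t) (basis_fun \<Delta>x q i)) \<and>
        (\<forall>q\<le>k. \<forall>i. U q i 0 =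
           (2 * real q + 1) / \<Delta>x * (LINT x:cell \<Delta>x i|lborel. u0 x * basis_fun \<Delta>x q i x)))"

end

(*
Write P for the cellwise projection onto polynomials of degree k, rho = u - P u and theta = U - P u, where U
is the discrete solution. Testing the error equation with theta gives, at almost every time, an energy balance:
the jump terms of the upwind flux control the interface values of rho, and the dissipation -<g theta, theta>
absorbs the pairing <g rho, theta>. There remain squares of interface values of rho and the fractional seminorm
of rho, and both are bounded by D^(2k+1) times norms of u and its (k+1)-st derivative in x. The seminorm bound
holds because piecewise regular functions with jumps belong to the fractional space of order lam/2 < 1/2.

In space u is handled through representatives that are iterated primitives (du Bois-Reymond), in time through
u(t) = C + the integral of the time derivative up to t. The pairing is computed on the Fourier side; Parseval's
identity is only needed against piecewise continuous compactly supported functions.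

The error rho at the final time is not covered by a slice estimate at a single time, since the k+1 derivatives in x
exist only at almost every time. It is compared with a slice at most one mesh size earlier, using k derivatives
in x of the time derivative.
*)
theory Submission
 imports Defs "HOL-Probability.Probability"
begin

text \<open>No Gronwall argument occurs: at a good time the jump terms and the dissipation swallow
  everything quadratic in the discrete error, so one integration in time suffices. Three obstacles
  shape the rest. The scheme is tested with one basis function at a time while the error lives on
  infinitely many cells; the energy balance is therefore written on symmetric finite windows of
  cells, and the fluxes through their ends and the seminorm of the error outside vanish in the limit
  because the coefficients are square summable. The coefficients of the exact solution are only
  absolutely continuous in time, so squares are recovered from derivatives by Fubini's theorem
  (\<open>AC_square\<close>). The mesh size is arbitrary, and on coarse grids, where the natural
  power of the mesh size is too large, other bounds take over. On the Fourier side everything starts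
  from a Parseval formula with a Gaussian factor: it yields Bessel's inequality for
  square-integrable functions of compact support, from which the transform is constructed, and an
  identity for second arguments with jumps. The seminorm estimate rests on mean-square differences
  under shifts by \<open>h\<close>, which stay linear in \<open>h\<close> across jumps.\<close>

lemmas LBINT_cong = Bochner_Integration.integral_cong
lemmas integrable_le = Bochner_Integration.integrable_bound

section \<open>Legendre polynomials\<close>

lemma integral_FTC_open:
 fixes f F :: "real => real"
 assumes "a \<le> b" "!!x. a \<le> x ==> x \<le> b ==> (F has_real_derivative f x) (at x)"
  and "continuous_on {a..b} f"
 shows "(LBINT x:{a<..<b}. f x) = F b - F a"
  and "set_integrable lborel {a<..<b} f"
proof -
 have "set_integrable lborel {a..b} f"
  using borel_integrable_compact[OF compact_Icc assms(3)]
  by (simp add: set_integrable_def indicator_def if_distrib cong: if_cong)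
 then show "set_integrable lborel {a<..<b} f"
  by (rule set_integrable_subset) auto
 have "(LBINT x:{a<..<b}. f x) = (LBINT x:{a..b}. f x)"
  unfolding set_lebesgue_integral_def
  by (rule integral_discrete_difference[where X="{a,b}"]) (auto simp: indicator_def)
 also have "\<dots> = F b - F a"
  unfolding set_lebesgue_integral_def
  by (rule integral_FTC_Icc[OF assms(1)])
    (use assms in \<open>auto intro: has_vector_derivative_at_within simp: has_real_derivative_iff_has_vector_derivative\<close>)
 finally show "(LBINT x:{a<..<b}. f x) = F b - F a" .
qed

lemma poly_pderiv_integral:
 assumes "a \<le> b"
 shows "(LBINT x:{a<..<b}. poly (pderiv p) x) = poly p b - poly p (a::real)"
 by (rule integral_FTC_open[OF assms]) (auto intro!: poly_DERIV continuous_intros)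

lemma set_integrable_poly:
 "set_integrable lborel {a<..<b} (%x. poly p (x::real))"
proof (cases "a \<le> b")
 case True
 have "set_integrable lborel {a..b} (%x. poly p x)"
  using borel_integrable_compact[OF compact_Icc, of a b "poly p"]
  by (simp add: set_integrable_def indicator_def if_distrib continuous_intros cong: if_cong)
 then show ?thesis by (rule set_integrable_subset) auto
qed (simp add: set_integrable_def)

text \<open>The reference interval is open because the cells are open. Taking polynomials rather
  than functions as arguments makes integration by parts an algebraic rule.\<close>

definition pint :: "real poly => real" where
 "pint p = (LBINT x:{-1<..<1}. poly p x)"

lemma pint_add: "pint (p + q) = pint p + pint q"
proof -
 have "poly (p + q) = (%x. poly p x + poly q x)" by auto
 then show ?thesis
  unfolding pint_def by (simp only: set_integral_add(2)[OF set_integrable_poly set_integrable_poly])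
qed

lemma pint_smult: "pint (smult c p) = c * pint p"
proof -
 have "poly (smult c p) = (%x. c * poly p x)" by auto
 then show ?thesis
  unfolding pint_def by (simp only: set_integral_mult_right)
qed

lemma pint_0 [simp]: "pint 0 = 0"
 using pint_smult[of 0 0] by simp

lemma pint_diff: "pint (p - q) = pint p - pint q"
 using pint_add[of "p - q" q] by simp

lemma pint_pderiv: "pint (pderiv p) = poly p 1 - poly p (-1)"
 unfolding pint_def by (rule poly_pderiv_integral) simp

lemma pint_by_parts:
 "pint (pderiv p * q) = poly p 1 * poly q 1 - poly p (-1) * poly q (-1) - pint (p * pderiv q)"
proof -
 have "pint (pderiv p * q) + pint (p * pderiv q) = pint (pderiv (p * q))"
  by (simp add: pderiv_mult pint_add[symmetric] algebra_simps)
 then show ?thesis by (simp add: pint_pderiv)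
qed

text \<open>Differentiating \<open>[:- a, 1:] ^ Suc n * g\<close> leaves
  \<open>[:- a, 1:] ^ n\<close> times a polynomial whose value at \<open>a\<close> is
  \<open>Suc n\<close> times that of \<open>g\<close>. Both claims follow by feeding this new
  cofactor to the induction hypothesis, which is why \<open>g\<close> is arbitrary.\<close>

lemma higher_pderiv_power_root:
 fixes a :: real
 shows "poly ((pderiv ^^ n) ([:- a, 1:] ^ n * g)) a = fact n * poly g a"
  and "j < n ==> poly ((pderiv ^^ j) ([:- a, 1:] ^ n * g)) a = 0"
proof (induction n arbitrary: g j)
 case (Suc n)
 let ?h = "%g. smult (of_nat (Suc n)) g + [:- a, 1:] * pderiv g"
 have *: "pderiv ([:- a, 1:] ^ Suc n * g) = [:- a, 1:] ^ n * ?h g" for g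
  unfolding pderiv_mult pderiv_power_Suc by (simp add: algebra_simps pderiv_pCons)
 {
  case 1
  have "poly ((pderiv ^^ Suc n) ([:- a, 1:] ^ Suc n * g)) a = poly ((pderiv ^^ n) ([:- a, 1:] ^ n * ?h g)) a"
   using arg_cong[OF *, of "%p. poly ((pderiv ^^ n) p) a"] by (simp only: funpow_Suc_right o_apply)
  also have "\<dots> = fact n * poly (?h g) a" by (rule Suc.IH(1))
  also have "\<dots> = fact (Suc n) * poly g a" by simp
  finally show ?case .
 next
  case 2
  show ?case
  proof (cases j)
   case 0
   then show ?thesis by simp
  next
   case (Suc j')
   have "poly ((pderiv ^^ j) ([:- a, 1:] ^ Suc n * g)) a = poly ((pderiv ^^ j') ([:- a, 1:] ^ n * ?h g)) a"
    using arg_cong[OF *, of "%p. poly ((pderiv ^^ j') p) a"] by (simp only: Suc funpow_Suc_right o_apply)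
   also have "\<dots> = 0" using 2 Suc by (intro Suc.IH(2)) auto
   finally show ?thesis .
  qed
 }
qed simp_all

definition rodrigues :: "nat => real poly" where
 "rodrigues n = [:- 1, 0, 1:] ^ n"

text \<open>The factor belonging to either end point is split off, so that
  \<open>higher_pderiv_power_root\<close> applies at 1 and at -1.\<close>

lemma rodrigues_eq:
 "rodrigues n = [:- 1, 1:] ^ n * [:1, 1:] ^ n" "rodrigues n = [:- (- 1), 1:] ^ n * [:- 1, 1:] ^ n"
 by (simp_all add: rodrigues_def power_mult_distrib[symmetric])

lemma higher_pderiv_rodrigues_boundary:
 assumes "j < n"
 shows "poly ((pderiv ^^ j) (rodrigues n)) 1 = 0" "poly ((pderiv ^^ j) (rodrigues n)) (- 1) = 0"
 using higher_pderiv_power_root(2)[OF assms, of 1 "[:1, 1:] ^ n"]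
  higher_pderiv_power_root(2)[OF assms, of "-1" "[:- 1, 1:] ^ n"]
 by (simp_all only: rodrigues_eq(1)[symmetric] rodrigues_eq(2)[symmetric])

lemma legendre_rodrigues: "legendre p = smult (1 / (2 ^ p * fact p)) ((pderiv ^^ p) (rodrigues p))"
 by (simp add: legendre_def rodrigues_def)

lemma legendre_at_1: "poly (legendre p) 1 = 1"
 using higher_pderiv_power_root(1)[of p 1 "[:1, 1:] ^ p"]
 by (simp add: legendre_rodrigues rodrigues_eq(1) poly_power)

lemma legendre_at_minus_1: "poly (legendre p) (- 1) = (- 1) ^ p"
proof -
 have "poly ((pderiv ^^ p) (rodrigues p)) (- 1) = fact p * (- 2) ^ p"
  using higher_pderiv_power_root(1)[of p "-1" "[:- 1, 1:] ^ p"]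
  unfolding rodrigues_eq(2) by (simp add: poly_power)
 moreover have "(- 2 :: real) ^ p = (- 1) ^ p * 2 ^ p"
  by (simp flip: power_mult_distrib)
 ultimately show ?thesis
  by (simp add: legendre_rodrigues)
qed

lemma degree_rodrigues: "degree (rodrigues n) = 2 * n"
 by (simp add: rodrigues_def degree_power_eq)

lemma degree_legendre: "degree (legendre p) = p"
 by (simp add: legendre_rodrigues degree_higher_pderiv degree_rodrigues)

lemma legendre_nonzero: "legendre p \<noteq> 0"
 using legendre_at_1[of p] by auto

text \<open>Each integration by parts moves one derivative to \<open>q\<close>; the boundary terms
  contain fewer than \<open>n\<close> derivatives of \<open>rodrigues n\<close> and vanish because 1
  and -1 are roots of order \<open>n\<close>.\<close>

lemma pint_rodrigues_parts:
 assumes "j \<le> n"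
 shows "pint ((pderiv ^^ n) (rodrigues n) * q)
  = (- 1) ^ j * pint ((pderiv ^^ (n - j)) (rodrigues n) * (pderiv ^^ j) q)"
 using assms
proof (induction j)
 case (Suc j)
 let ?m = "n - Suc j"
 have m: "n - j = Suc ?m" "?m < n" using Suc.prems by auto
 have "pint ((pderiv ^^ n) (rodrigues n) * q)
  = (- 1) ^ j * pint (pderiv ((pderiv ^^ ?m) (rodrigues n)) * (pderiv ^^ j) q)"
  using Suc m by simp
 also have "pint (pderiv ((pderiv ^^ ?m) (rodrigues n)) * (pderiv ^^ j) q)
   = - pint ((pderiv ^^ ?m) (rodrigues n) * (pderiv ^^ Suc j) q)"
  unfolding pint_by_parts higher_pderiv_rodrigues_boundary[OF m(2)] by simp
 finally show ?case by simp
qed simp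

lemma higher_pderiv_eq_0:
 fixes q :: "real poly"
 assumes "degree q < n" shows "(pderiv ^^ n) q = 0"
 using assms by (intro poly_eqI) (simp add: coeff_higher_pderiv coeff_eq_0)

lemma pint_legendre_orth:
 assumes "degree q < p"
 shows "pint (legendre p * q) = 0"
 using pint_rodrigues_parts[of p p q] assms
 by (simp add: legendre_rodrigues pint_smult higher_pderiv_eq_0)

text \<open>A Beta integral with equal exponents. Reading the factor 1 as the derivative of x and
  integrating by parts gives a two-term recurrence in \<open>n\<close>.\<close>

lemma pint_one_minus_square_power:
 "pint ([:1, 0, - 1:] ^ n) = 2 ^ (2 * n + 1) * (fact n)^2 / fact (2 * n + 1)"
proof (induction n)
 case 0
 have "pint 1 = pint (pderiv [:0, 1:])" by (simp add: pderiv_pCons one_pCons)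
 also have "\<dots> = 2" by (subst pint_pderiv) simp
 finally show ?case by simp
next
 case (Suc n)
 let ?w = "[:1, 0, - 1:] :: real poly"
 have 1: "pint (pderiv [:0, 1:] * ?w ^ Suc n) = - pint ([:0, 1:] * pderiv (?w ^ Suc n))"
  by (subst pint_by_parts) (simp add: poly_power)
 \<comment> \<open>The factor x^2 is rewritten as 1 - (1 - x^2), which brings back the powers
   \<open>Suc n\<close> and \<open>n\<close> and closes the recurrence.\<close>
 have 2: "[:0, 1:] * pderiv (?w ^ Suc n) = smult (2 * (1 + of_nat n)) (?w ^ Suc n - ?w ^ n)"
  unfolding pderiv_power_Suc
  by (simp add: pderiv_pCons algebra_simps)
 have "pint (?w ^ Suc n) = - (2 * (1 + real n) * (pint (?w ^ Suc n) - pint (?w ^ n)))"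
  using 1 unfolding 2 by (simp add: pderiv_pCons pint_smult pint_diff del: power_Suc)
 then have "(2 * real n + 3) * pint (?w ^ Suc n) = (2 * real n + 2) * pint (?w ^ n)"
  by (simp add: algebra_simps)
 then have "pint (?w ^ Suc n) = (2 * real n + 2) / (2 * real n + 3) * pint (?w ^ n)"
  by (simp add: field_simps)
 also have "\<dots> = 2 ^ (2 * Suc n + 1) * (fact (Suc n))^2 / fact (2 * Suc n + 1)"
 proof -
  \<comment> \<open>The passage from \<open>n\<close> to \<open>n + 1\<close> with the factorials
    abstracted: \<open>a\<close> = 2n+3 and \<open>b\<close> = 2n+2, so that \<open>b / 2\<close> =
    n+1 extends \<open>fact n\<close> and \<open>a * b\<close> extends
    \<open>fact (2 * n + 1)\<close>.\<close>
  have "b / a * (P * Q / R) = (4 * P) * ((b / 2)^2 * Q) / (a * b * R)"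
   if "a > 0" "b > 0" "R > 0" for a b P Q R :: real
   using that by (simp add: field_simps power2_eq_square)
  from this[of "2 * real n + 3" "2 * real n + 2" "fact (2 * n + 1)" "2 ^ (2 * n + 1)" "(fact n)^2"]
  have "(2 * real n + 2) / (2 * real n + 3) * pint (?w ^ n) =
    (4 * 2 ^ (2 * n + 1)) * (((2 * real n + 2) / 2)^2 * (fact n)^2) /
    ((2 * real n + 3) * (2 * real n + 2) * fact (2 * n + 1))"
   unfolding Suc.IH by simp
  also have "((2 * real n + 2) / 2)^2 * (fact n)^2 = (fact (Suc n))^2"
   by (simp add: power_mult_distrib[symmetric] algebra_simps)
  also have "(2 * real n + 3) * (2 * real n + 2) * fact (2 * n + 1) = fact (2 * Suc n + 1)"
  proof -
   have "2 * Suc n + 1 = Suc (Suc (2 * n + 1))" by simp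
   then show ?thesis
    unfolding fact_Suc by (simp only: fact_Suc of_nat_mult) (simp add: algebra_simps)
  qed
  also have "4 * 2 ^ (2 * n + 1) = (2::real) ^ (2 * Suc n + 1)" by simp
  finally show ?thesis .
 qed
 finally show ?case .
qed

text \<open>All \<open>p\<close> derivatives of one factor are moved to the other by parts. The
  other then carries \<open>2 * p\<close> derivatives of a monic polynomial of degree
  \<open>2 * p\<close>, which is a constant, and a Beta integral remains.\<close>

lemma pint_legendre_square: "pint (legendre p * legendre p) = 2 / (2 * real p + 1)"
proof -
 let ?c = "1 / (2 ^ p * fact p) :: real"
 have D: "(pderiv ^^ p) ((pderiv ^^ p) (rodrigues p)) = [:fact (2 * p):]"
 proof -
  have "(pderiv ^^ (2 * p)) (rodrigues p) = [:fact (2 * p):]"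
  proof (rule poly_eqI)
   fix i
   have lc: "coeff (rodrigues p) (2 * p) = 1"
    using lead_coeff_power[of "[:-1,0,1:]::real poly" p] degree_rodrigues[of p]
    by (simp add: rodrigues_def)
   show "coeff ((pderiv ^^ (2 * p)) (rodrigues p)) i = coeff [:fact (2 * p):] i"
    by (cases i) (auto simp: coeff_higher_pderiv lc pochhammer_fact coeff_eq_0 degree_rodrigues)
  qed
  then show ?thesis by (simp add: mult_2 funpow_add)
 qed
 have neg: "rodrigues p = smult ((- 1) ^ p) ([:1, 0, - 1:] ^ p)"
  unfolding rodrigues_def smult_power[symmetric] by simp
 have "pint (legendre p * legendre p) = ?c * ?c * pint ((pderiv ^^ p) (rodrigues p) * (pderiv ^^ p) (rodrigues p))"
  by (simp add: legendre_rodrigues pint_smult)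
 also have "\<dots> = ?c * ?c * ((- 1) ^ p * pint (rodrigues p * [:fact (2 * p):]))"
  by (subst pint_rodrigues_parts[of p]) (simp_all add: D)
 also have "rodrigues p * [:fact (2 * p):] = smult (fact (2 * p) * (- 1) ^ p) ([:1, 0, - 1:] ^ p)"
  by (simp add: neg)
 also have "?c * ?c * ((- 1) ^ p * pint (smult (fact (2 * p) * (- 1) ^ p) ([:1, 0, - 1:] ^ p)))
   = ?c * ?c * fact (2 * p) * (2 ^ (2 * p + 1) * (fact p)^2 / fact (2 * p + 1))"
  by (simp add: pint_smult pint_one_minus_square_power power_mult_distrib[symmetric])
 also have "\<dots> = 2 / (2 * real p + 1)"
 proof -
  have "?c * ?c * fact (2 * p) * (2 ^ (2 * p + 1) * (fact p)^2 / fact (2 * p + 1))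
   = 2 * (fact (2 * p) / fact (2 * p + 1))"
  proof -
   have "1 / (A * F) * (1 / (A * F)) * G * (2 * (A * A) * (F * F) / R) = 2 * (G / R)"
    if "A > 0" "F > 0" "R > 0" for A F G R :: real
    using that by (simp add: field_simps)
   from this[of "2 ^ p" "fact p" "fact (2 * p + 1)" "fact (2 * p)"] show ?thesis
    by (simp only: power2_eq_square mult_2[of p] power_add power_one_right mult.commute[of "_ * _" 2] zero_less_power fact_gt_zero zero_less_numeral simp_thms)
  qed
  also have "fact (2 * p) / fact (2 * p + 1) = 1 / (2 * real p + 1)"
   using fact_nonzero[of "2 * p", where 'a=real] by (simp add: divide_simps)
  finally show ?thesis by simp
 qed
 finally show ?thesis .
qed

lemma pint_legendre: "pint (legendre p * legendre q) = (if p = q then 2 / (2 * real p + 1) else 0)"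
 using pint_legendre_square[of p] pint_legendre_orth[of "legendre q" p] pint_legendre_orth[of "legendre p" q]
 by (cases p q rule: linorder_cases) (auto simp: degree_legendre mult.commute)

lemma legendre_span:
 fixes q :: "real poly"
 assumes "degree q \<le> k"
 shows "\<exists>c. q = (\<Sum>p\<le>k. smult (c p) (legendre p))"
 using assms
proof (induction k arbitrary: q)
 case 0
 then obtain a where "q = [:a:]" using degree_eq_zeroE by auto
 then show ?case by (intro exI[of _ "%_. a"]) (simp add: legendre_def)
next
 case (Suc k)
 let ?a = "coeff q (Suc k) / coeff (legendre (Suc k)) (Suc k)"
 let ?r = "q - smult ?a (legendre (Suc k))"
 have nz: "coeff (legendre (Suc k)) (Suc k) \<noteq> 0"
  using legendre_nonzero[of "Suc k"] by (metis degree_legendre leading_coeff_0_iff)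
 have "degree ?r \<le> k"
 proof (rule degree_le, intro allI impI)
  fix i assume "k < i"
  then show "coeff ?r i = 0"
   using Suc.prems nz by (cases "i = Suc k") (auto simp: coeff_eq_0 degree_legendre)
 qed
 then obtain c where c: "?r = (\<Sum>p\<le>k. smult (c p) (legendre p))" using Suc.IH by blast
 have "q = (\<Sum>p\<le>k. smult (c p) (legendre p)) + smult ?a (legendre (Suc k))"
  using c by (metis diff_add_cancel)
 then show ?case
  by (intro exI[of _ "c(Suc k := ?a)"]) (auto intro!: sum.cong)
qed

section \<open>Square-integrable functions\<close>

lemma integrable_mult_square:
 fixes f g :: "'a => real"
 assumes "f \<in> borel_measurable M" "g \<in> borel_measurable M"
  and "integrable M (%x. (f x)^2)" "integrable M (%x. (g x)^2)"
 shows "integrable M (%x. f x * g x)"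
proof (rule integrable_le)
 show "integrable M (%x. (f x)^2 + (g x)^2)" using assms by auto
 show "AE x in M. norm (f x * g x) \<le> norm ((f x)^2 + (g x)^2)"
 proof (rule AE_I2)
  fix x
  have "2 * (\<bar>f x\<bar> * \<bar>g x\<bar>) \<le> (f x)^2 + (g x)^2"
   using sum_squares_bound[of "\<bar>f x\<bar>" "\<bar>g x\<bar>"] by (simp add: mult.assoc)
  moreover have "0 \<le> \<bar>f x\<bar> * \<bar>g x\<bar>" by simp
  ultimately have "\<bar>f x\<bar> * \<bar>g x\<bar> \<le> (f x)^2 + (g x)^2" by linarith
  then show "norm (f x * g x) \<le> norm ((f x)^2 + (g x)^2)"
   by (simp add: abs_mult)
 qed
qed (use assms in measurable)

text \<open>The expression in \<open>t\<close> may degenerate. For \<open>C = 0\<close> it is affine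
  and bounded below, hence constant: at the chosen \<open>t\<close> it would equal -1. Otherwise its
  minimum at \<open>t = B / C\<close> is tested.\<close>

lemma quadratic_nonneg_imp_discriminant:
 fixes A B C :: real
 assumes "!!t. A - 2 * t * B + t^2 * C \<ge> 0" "C \<ge> 0"
 shows "B^2 \<le> A * C"
proof (cases "C = 0")
 case True
 have "B = 0"
 proof (rule ccontr)
  assume "B \<noteq> 0"
  with assms(1)[of "(A + 1) / (2 * B)"] True show False by simp
 qed
 then show ?thesis using True by simp
next
 case False
 then have "C > 0" using assms by simp
 then show ?thesis using assms(1)[of "B / C"] by (simp add: field_simps power2_eq_square)
qed

lemma integral_Cauchy_Schwarz:
 fixes f g :: "'a => real"
 assumes "f \<in> borel_measurable M" "g \<in> borel_measurable M"
  and "integrable M (%x. (f x)^2)" "integrable M (%x. (g x)^2)"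
 shows "(LINT x|M. f x * g x)^2 \<le> (LINT x|M. (f x)^2) * (LINT x|M. (g x)^2)"
proof (rule quadratic_nonneg_imp_discriminant)
 fix t :: real
 note [simp] = integrable_mult_square[OF assms]
 have "0 \<le> (LINT x|M. (f x - t * g x)^2)" by simp
 also have "\<dots> = (LINT x|M. (f x)^2 - 2 * t * (f x * g x) + t^2 * (g x)^2)"
  by (rule arg_cong[where f="integral\<^sup>L M"]) (simp add: power2_eq_square algebra_simps)
 also have "\<dots> = (LINT x|M. (f x)^2) - 2 * t * (LINT x|M. f x * g x) + t^2 * (LINT x|M. (g x)^2)"
  using assms by simp
 finally show "0 \<le> \<dots>" .
qed simp

lemma L2_on_mult:
 assumes "L2_on S f" "L2_on S g"
 shows "set_integrable lborel S (%x. f x * g x)"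
proof -
 have sq: "(%x. (indicator S x * h x)^2) = (%x. indicator S x * (h x)^2)" for h :: "'a => real"
  by (auto simp: indicator_def)
 have "integrable lborel (%x. (indicator S x * f x) * (indicator S x * g x))"
  by (rule integrable_mult_square)
    (use assms in \<open>simp_all add: L2_on_def set_borel_measurable_def set_integrable_def sq\<close>)
 also have "(%x. (indicator S x * f x) * (indicator S x * g x)) = (%x. indicator S x *\<^sub>R (f x * g x))"
  by (auto simp: indicator_def)
 finally show ?thesis by (simp add: set_integrable_def)
qed

lemma L2_on_Cauchy_Schwarz:
 assumes "L2_on S f" "L2_on S g"
 shows "(LBINT x:S. f x * g x)^2 \<le> (LBINT x:S. (f x)^2) * (LBINT x:S. (g x)^2)"
proof -
 have sq: "(%x. (indicator S x * h x)^2) = (%x. indicator S x * (h x)^2)" for h :: "'a => real"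
  by (auto simp: indicator_def)
 have m: "(%x. (indicator S x * f x) * (indicator S x * g x)) = (%x. indicator S x * (f x * g x))"
  by (auto simp: indicator_def)
 show ?thesis
  using integral_Cauchy_Schwarz[of "%x. indicator S x * f x" lborel "%x. indicator S x * g x"] assms
  by (simp add: L2_on_def set_borel_measurable_def set_integrable_def sq m set_lebesgue_integral_def)
qed

lemma L2_on_add:
 assumes "L2_on S f" "L2_on S g" shows "L2_on S (%x. f x + g x)"
proof -
 have "set_borel_measurable lborel S (%x. f x + g x)"
  using assms unfolding L2_on_def set_borel_measurable_def by (simp only: scaleR_add_right borel_measurable_add)
 moreover have "set_integrable lborel S (%x. (f x)^2 + (g x)^2 + 2 * (f x * g x))"
  using assms L2_on_mult[OF assms] by (intro set_integral_add set_integrable_mult_right) (auto simp: L2_on_def)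
 ultimately show ?thesis
  by (simp add: L2_on_def power2_sum mult.assoc)
qed

lemma L2_on_cmult:
 assumes "L2_on S f" shows "L2_on S (%x. c * f x)"
 using assms borel_measurable_times[of "%_. c" lborel "%x. indicator S x * f x"]
 unfolding L2_on_def set_borel_measurable_def
 by (auto simp: power_mult_distrib mult.left_commute)

lemma L2_on_diff:
 assumes "L2_on S f" "L2_on S g" shows "L2_on S (%x. f x - g x)"
 using L2_on_add[OF assms(1) L2_on_cmult[OF assms(2), of "-1"]] by simp

lemma L2_on_0 [simp]: "L2_on S (%x. 0)"
 by (simp add: L2_on_def set_borel_measurable_def set_integrable_def)

lemma L2_on_subset:
 assumes "L2_on S f" "R \<subseteq> S" "R \<in> sets borel" shows "L2_on R f"
proof -
 have "(%x. indicator R x *\<^sub>R f x) = (%x. indicator R x * (indicator S x *\<^sub>R f x))"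
  using assms(2) by (auto simp: indicator_def fun_eq_iff)
 then show ?thesis
  using assms unfolding L2_on_def set_borel_measurable_def
  by (auto intro: set_integrable_subset)
qed

lemma L2_on_cong:
 assumes "!!x. x \<in> S ==> f x = g x" shows "L2_on S f \<longleftrightarrow> L2_on S g"
 unfolding L2_on_def set_borel_measurable_def set_integrable_def
 using assms by (intro arg_cong2[where f="(\<and>)"] arg_cong2[where f="(\<in>)"] arg_cong2[where f=integrable])
  (auto simp: indicator_def fun_eq_iff)

lemma L2_on_integral_nonneg: "0 \<le> (LBINT x:S. (f x :: real)^2)"
 unfolding set_lebesgue_integral_def by (rule Bochner_Integration.integral_nonneg) simp

lemma L2_on_integral_subset:
 assumes "L2_on S f" "R \<subseteq> S" "R \<in> sets borel"
 shows "(LBINT x:R. (f x)^2) \<le> (LBINT x:S. (f x)^2)"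
 unfolding set_lebesgue_integral_def
 by (rule integral_mono)
   (use assms L2_on_subset[OF assms] in \<open>auto simp: L2_on_def set_integrable_def indicator_def\<close>)

lemma L2_on_bounded:
 assumes "set_borel_measurable lborel S f" "S \<in> sets lborel" "emeasure lborel S < \<infinity>"
  and "!!x. x \<in> S ==> \<bar>f x\<bar> \<le> M"
 shows "L2_on S f"
proof -
 have sq: "(%x. (indicator S x * f x)^2) = (%x. indicator S x * (f x)^2)"
  by (auto simp: indicator_def)
 have "integrable lborel (%x. indicator S x * (f x)^2)"
 proof (rule integrable_le)
  show "integrable lborel (%x. indicator S x * M^2)"
   using assms by (intro integrable_mult_left integrable_real_indicator) auto
  show "(%x. indicator S x * (f x)^2) \<in> borel_measurable lborel"
   using assms(1) unfolding sq[symmetric] set_borel_measurable_def by simp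
  have "(f x)^2 \<le> M^2" if "x \<in> S" for x
   using assms(4)[OF that] by (metis abs_ge_zero power2_abs power_mono)
  then show "AE x in lborel. norm (indicator S x * (f x)^2) \<le> norm (indicator S x * M^2)"
   by (auto simp: indicator_def)
 qed
 then show ?thesis using assms(1) by (simp add: L2_on_def set_integrable_def)
qed

lemma L2_on_continuous:
 fixes f :: "real => real"
 assumes "continuous_on {a..b} f" shows "L2_on {a<..<b} f"
proof -
 have "bounded (f ` {a..b})"
  by (intro compact_imp_bounded compact_continuous_image assms compact_Icc)
 then obtain M where "!!x. x \<in> {a..b} ==> \<bar>f x\<bar> \<le> M" unfolding bounded_iff by fastforce
 moreover have "set_borel_measurable lborel {a<..<b} f"
  unfolding set_borel_measurable_def
  using borel_measurable_continuous_on_indicator[of "{a<..<b}" f] continuous_on_subset[OF assms, of "{a<..<b}"]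
  by simp (metis atLeastAtMost_eq_cball greaterThanLessThan_subseteq_atLeastAtMost_iff order_refl)
 moreover have "emeasure lborel {a<..<b} < \<infinity>"
  by (rule le_less_trans[OF emeasure_mono[of _ "{a..b}"]]) (auto simp: emeasure_lborel_Icc_eq)
 ultimately show ?thesis by (intro L2_on_bounded[where M=M]) auto
qed

lemma L2_on_interval_integral:
 assumes "L2_on {a<..<b} f" "a \<le> (b::real)"
 shows "set_integrable lborel {a<..<b} f"
  and "(LBINT x:{a<..<b}. f x)^2 \<le> (b - a) * (LBINT x:{a<..<b}. (f x)^2)"
proof -
 have 1: "L2_on {a<..<b} (%_. 1)" by (intro L2_on_continuous continuous_intros)
 have "(LBINT x:{a<..<b}. (1::real)) = b - a"
  unfolding set_lebesgue_integral_def using assms(2) by simp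
 then show "(LBINT x:{a<..<b}. f x)^2 \<le> (b - a) * (LBINT x:{a<..<b}. (f x)^2)"
  using L2_on_Cauchy_Schwarz[OF 1 assms(1)] by simp
 show "set_integrable lborel {a<..<b} f" using L2_on_mult[OF 1 assms(1)] by simp
qed

lemma interval_integral_abs_bound:
 assumes "set_integrable lborel {a<..<b} f" "a \<le> (b::real)" "!!x. x \<in> {a<..<b} ==> \<bar>f x\<bar> \<le> M"
 shows "\<bar>LBINT x:{a<..<b}. f x\<bar> \<le> M * (b - a)"
proof -
 have "\<bar>LBINT x:{a<..<b}. f x\<bar> \<le> (LBINT x. \<bar>indicator {a<..<b} x * f x\<bar>)"
  unfolding set_lebesgue_integral_def using integral_abs_bound[of lborel "%x. indicator {a<..<b} x * f x"] by simp
 also have "\<dots> \<le> (LBINT x. indicator {a<..<b} x * M)"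
 proof (rule integral_mono)
  show "integrable lborel (%x. \<bar>indicator {a<..<b} x * f x\<bar>)"
   using integrable_abs[OF assms(1)[unfolded set_integrable_def]] by simp
  show "integrable lborel (%x. indicator {a<..<b} x * M)"
   using assms(2) by (intro integrable_mult_left integrable_real_indicator) auto
 qed (use assms(3) in \<open>auto simp: indicator_def\<close>)
 also have "\<dots> = M * (b - a)" using assms(2) by simp
 finally show ?thesis .
qed

section \<open>Local projection onto polynomials\<close>

lemma poly_antiderivative: "\<exists>Q :: real poly. pderiv Q = p \<and> degree Q \<le> Suc (degree p)"
proof -
 let ?Q = "\<Sum>i\<le>degree p. monom (coeff p i / of_nat (Suc i)) (Suc i)"
 have "pderiv ?Q = (\<Sum>i\<le>degree p. monom (coeff p i) i)"
 proof -
  have "pderiv (sum f A) = (\<Sum>x\<in>A. pderiv (f x))" for f :: "nat => real poly" and A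
   using higher_pderiv_sum[of 1 f A] by simp
  then show ?thesis by (simp add: pderiv_monom del: of_nat_Suc)
 qed
 also have "\<dots> = p" by (rule poly_as_sum_of_monoms)
 finally have "pderiv ?Q = p" .
 moreover have "degree ?Q \<le> Suc (degree p)"
  by (intro degree_sum_le) (auto intro: order_trans[OF degree_monom_le])
 ultimately show ?thesis by blast
qed

definition ref_coord :: "real => int => real => real" where
 "ref_coord D i x = 2 * (x - grid D i) / D - 1"

text \<open>Unlike \<open>basis_fun\<close> this is not cut off outside the cell. It is continuous
  on the whole line, so its values at the end points of the open cell are the limits from
  inside.\<close>

definition cell_poly :: "real => nat => int => (nat => real) => real => real" where
 "cell_poly D k i c x = (\<Sum>q\<le>k. c q * poly (legendre q) (ref_coord D i x))"

text \<open>\<open>D / (2 * q + 1)\<close> is the squared norm of the basis function on its cell, so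
  these are orthogonal expansion coefficients; the initial condition of the method has exactly this
  form.\<close>

definition coef :: "real => int => (real => real) => nat => real" where
 "coef D i f q = (2 * real q + 1) / D * (LBINT x:cell D i. f x * basis_fun D q i x)"

definition proj :: "real => nat => int => (real => real) => real => real" where
 "proj D k i f = cell_poly D k i (coef D i f)"

abbreviation closed_cell :: "real => int => real set" where
 "closed_cell D i \<equiv> {grid D i..grid D (i + 1)}"

lemma grid_Suc: "grid D (i + 1) = grid D i + D" "grid D (1 + i) = grid D i + D"
 by (simp_all add: grid_def algebra_simps)

lemma basis_fun_cell: "x \<in> cell D i ==> basis_fun D q i x = poly (legendre q) (ref_coord D i x)"
 by (simp add: basis_fun_def ref_coord_def)

lemma ref_coord_bounds: "D > 0 ==> x \<in> closed_cell D i ==> ref_coord D i x \<in> {-1..1}"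
 by (auto simp: ref_coord_def grid_Suc field_simps)

lemma cell_subset: "cell D i \<subseteq> closed_cell D i"
 by (auto simp: cell_def)

lemma cell_sets [measurable, simp]: "cell D i \<in> sets borel"
 by (simp add: cell_def)

lemma ref_coord_deriv: "((ref_coord D i) has_real_derivative 2 / D) (at x)"
proof -
 have "((%x. 2 * (x - grid D i) / D - 1) has_real_derivative 2 / D) (at x)"
  unfolding divide_inverse by (auto intro!: derivative_eq_intros)
 then show ?thesis by (simp add: ref_coord_def[abs_def])
qed

lemma continuous_ref_coord [continuous_intros]: "continuous_on S (ref_coord D i)"
 unfolding ref_coord_def divide_inverse by (intro continuous_intros)

text \<open>The change of variables is carried out on an antiderivative, which reduces it to the
  chain rule and the fundamental theorem.\<close>

lemma cell_integral_poly_ref: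
 assumes "D > 0"
 shows "(LBINT x:cell D i. poly P (ref_coord D i x)) = D / 2 * pint P"
proof -
 obtain Q where Q: "pderiv Q = P" using poly_antiderivative by blast
 have "(LBINT x:cell D i. poly P (ref_coord D i x)) =
  D / 2 * poly Q (ref_coord D i (grid D (i + 1))) - D / 2 * poly Q (ref_coord D i (grid D i))"
  unfolding cell_def
 proof (rule integral_FTC_open)
  fix x
  show "((%x. D / 2 * poly Q (ref_coord D i x)) has_real_derivative poly P (ref_coord D i x)) (at x)"
   using DERIV_cmult[OF DERIV_chain2[OF poly_DERIV[of Q] ref_coord_deriv[of D i x]], of "D / 2"] assms by (simp add: Q)
 qed (use assms in \<open>auto simp: grid_Suc intro!: continuous_intros\<close>)
 also have "\<dots> = D / 2 * (poly Q 1 - poly Q (- 1))"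
  using assms by (simp add: ref_coord_def grid_Suc algebra_simps)
 also have "\<dots> = D / 2 * pint P" by (simp add: Q[symmetric] pint_pderiv)
 finally show ?thesis .
qed

lemma cell_legendre_orth:
 assumes "D > 0"
 shows "(LBINT x:cell D i. poly (legendre p) (ref_coord D i x) * poly (legendre q) (ref_coord D i x))
   = (if p = q then D / (2 * real p + 1) else 0)"
 using cell_integral_poly_ref[OF assms, of i "legendre p * legendre q"] by (cases "p = q") (simp_all add: pint_legendre)

lemma L2_on_cell_continuous: "continuous_on UNIV f ==> L2_on (cell D i) f"
 unfolding cell_def by (rule L2_on_continuous) (rule continuous_on_subset, auto)

lemma continuous_cell_poly [continuous_intros]: "continuous_on S (cell_poly D k i c)"
 unfolding cell_poly_def by (intro continuous_intros)

lemma L2_on_cell_poly [simp]: "L2_on (cell D i) (cell_poly D k i c)"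
 "L2_on (cell D i) (%x. poly (legendre q) (ref_coord D i x))"
 by (intro L2_on_cell_continuous continuous_intros)+

lemma L2_on_cell_polynomial [simp]: "L2_on (cell D i) (poly p)" "L2_on (cell D i) (%x. poly p x)"
 by (intro L2_on_cell_continuous continuous_intros)+

lemma cell_integral_cong:
 assumes "!!x. x \<in> S ==> f x = g x" shows "(LBINT x:S. f x) = (LBINT x:S. (g x :: real))"
 unfolding set_lebesgue_integral_def
 by (rule LBINT_cong) (use assms in \<open>auto simp: indicator_def\<close>)

lemma coef_eq: "coef D i f q = (2 * real q + 1) / D *
  (LBINT x:cell D i. f x * poly (legendre q) (ref_coord D i x))"
 unfolding coef_def by (simp add: basis_fun_cell cong: cell_integral_cong)

lemma cell_integral_eq_coef:
 assumes "D > 0"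
 shows "(LBINT x:cell D i. f x * poly (legendre q) (ref_coord D i x)) = D / (2 * real q + 1) * coef D i f q"
proof -
 have "D / (2 * real q + 1) * ((2 * real q + 1) / D) = 1" using assms by simp
 then show ?thesis unfolding coef_eq by (metis mult.assoc mult_1)
qed

lemma set_integral_sum_real:
 assumes "!!i. i \<in> I ==> set_integrable M S (f i)"
 shows "(LINT x:S|M. (\<Sum>i\<in>I. f i x :: real)) = (\<Sum>i\<in>I. LINT x:S|M. f i x)"
 using assms unfolding set_lebesgue_integral_def set_integrable_def
 by (simp add: sum_distrib_left)

lemma cell_integral_mult_cell_poly:
 assumes "L2_on (cell D i) f" "D > 0"
 shows "(LBINT x:cell D i. f x * cell_poly D k i c x) = (\<Sum>q\<le>k. D / (2 * real q + 1) * c q * coef D i f q)"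
proof -
 have "(LBINT x:cell D i. f x * cell_poly D k i c x)
  = (LBINT x:cell D i. (\<Sum>q\<le>k. c q * (f x * poly (legendre q) (ref_coord D i x))))"
  by (simp add: cell_poly_def sum_distrib_left mult.left_commute)
 also have "\<dots> = (\<Sum>q\<le>k. c q * (D / (2 * real q + 1) * coef D i f q))"
  using assms by (subst set_integral_sum_real)
   (auto intro!: set_integrable_mult_right L2_on_mult simp: cell_integral_eq_coef)
 finally show ?thesis by (simp add: mult_ac)
qed

lemma coef_cell_poly:
 assumes "D > 0" "q \<le> k"
 shows "coef D i (cell_poly D k i c) q = c q"
proof -
 have "(LBINT x:cell D i. cell_poly D k i c x * poly (legendre q) (ref_coord D i x))
  = (LBINT x:cell D i. (\<Sum>p\<le>k. c p * (poly (legendre p) (ref_coord D i x) * poly (legendre q) (ref_coord D i x))))"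
  by (simp add: cell_poly_def sum_distrib_right mult.assoc)
 also have "\<dots> = (\<Sum>p\<le>k. c p * (if p = q then D / (2 * real p + 1) else 0))"
  using assms by (subst set_integral_sum_real)
   (auto intro!: set_integrable_mult_right L2_on_mult simp: cell_legendre_orth)
 also have "\<dots> = c q * (D / (2 * real q + 1))" using assms by (simp add: if_distrib cong: if_cong)
 finally show ?thesis using assms by (simp add: coef_eq)
qed

lemma cell_poly_square:
 assumes "D > 0"
 shows "(LBINT x:cell D i. (cell_poly D k i c x)^2) = (\<Sum>q\<le>k. D / (2 * real q + 1) * (c q)^2)"
 using cell_integral_mult_cell_poly[of D i "cell_poly D k i c" k c] assms
 by (simp add: power2_eq_square coef_cell_poly mult.assoc)

lemma coef_diff:
 assumes "L2_on (cell D i) f" "L2_on (cell D i) g"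
 shows "coef D i (%x. f x - g x) q = coef D i f q - coef D i g q"
 unfolding coef_eq using assms
 by (simp add: algebra_simps set_integral_diff L2_on_mult)

lemma coef_cmult: "coef D i (%x. a * f x) q = a * coef D i f q"
 unfolding coef_eq by (simp add: mult.assoc)

lemma coef_cong: "(!!x. x \<in> cell D i ==> f x = g x) ==> coef D i f q = coef D i g q"
 unfolding coef_def by (simp cong: cell_integral_cong)

lemma cell_poly_diff: "cell_poly D k i c x - cell_poly D k i d x = cell_poly D k i (%q. c q - d q) x"
 by (simp add: cell_poly_def sum_subtractf algebra_simps)

lemma L2_on_proj [simp]: "L2_on (cell D i) (proj D k i f)"
 by (simp add: proj_def)

lemma proj_orth:
 assumes "L2_on (cell D i) f" "D > 0"
 shows "(LBINT x:cell D i. (f x - proj D k i f x) * cell_poly D k i c x) = 0"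
proof -
 have "L2_on (cell D i) (%x. f x - proj D k i f x)" using assms by (intro L2_on_diff) auto
 then show ?thesis
  using assms by (subst cell_integral_mult_cell_poly) (auto simp: coef_diff proj_def coef_cell_poly)
qed

lemma polynomial_eq_cell_poly:
 fixes p :: "real poly"
 assumes "D > 0" "degree p \<le> k"
 shows "\<exists>c. poly p = cell_poly D k i c"
proof -
 let ?q = "pcompose p [:grid D i + D / 2, D / 2:]"
 have "degree ?q \<le> k" using degree_pcompose_le[of p "[:grid D i + D / 2, D / 2:]"] assms
  by (auto split: if_splits)
 then obtain c where c: "?q = (\<Sum>p\<le>k. smult (c p) (legendre p))" using legendre_span by blast
 have "poly p x = cell_poly D k i c x" for x
 proof -
  have "x = grid D i + D / 2 + ref_coord D i x * (D / 2)" using assms by (simp add: ref_coord_def divide_simps)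
  then have "poly p x = poly ?q (ref_coord D i x)" by (simp add: poly_pcompose)
  then show ?thesis by (simp add: c cell_poly_def poly_sum)
 qed
 then show ?thesis by blast
qed

text \<open>Pythagoras: the projection error is orthogonal to the difference of the projection and
  any competitor. Best approximation, \<open>proj_le\<close> and \<open>coef_Bessel\<close> are all
  read off from this identity.\<close>

lemma proj_best:
 assumes "L2_on (cell D i) f" "D > 0"
 shows "(LBINT x:cell D i. (f x - proj D k i f x)^2) + (LBINT x:cell D i. (proj D k i f x - cell_poly D k i c x)^2)
   = (LBINT x:cell D i. (f x - cell_poly D k i c x)^2)"
proof -
 let ?r = "%x. f x - proj D k i f x" and ?s = "cell_poly D k i (%q. coef D i f q - c q)"
 have L: "L2_on (cell D i) ?r" "L2_on (cell D i) ?s" using assms by (auto intro!: L2_on_diff)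
 have s: "proj D k i f x - cell_poly D k i c x = ?s x" for x by (simp add: proj_def cell_poly_diff)
 have "(LBINT x:cell D i. (f x - cell_poly D k i c x)^2)
   = (LBINT x:cell D i. ((?r x)^2 + (?s x)^2) + 2 * (?r x * ?s x))"
  unfolding s[symmetric] by (rule arg_cong[where f="set_lebesgue_integral _ _"])
   (auto simp: power2_eq_square algebra_simps)
 also have "\<dots> = (LBINT x:cell D i. (?r x)^2) + (LBINT x:cell D i. (?s x)^2)
   + 2 * (LBINT x:cell D i. ?r x * ?s x)"
  using L L2_on_mult[OF L] by (subst set_integral_add) (auto simp: L2_on_def)
 finally show ?thesis using proj_orth[OF assms] by (simp add: s)
qed

lemma proj_le:
 assumes "L2_on (cell D i) f" "D > 0"
 shows "(LBINT x:cell D i. (f x - proj D k i f x)^2) \<le> (LBINT x:cell D i. (f x)^2)"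
 using proj_best[OF assms, of k "%_. 0"]
  L2_on_integral_nonneg[of "cell D i" "%x. proj D k i f x - cell_poly D k i (%_. 0) x"]
 by (simp add: cell_poly_def)

lemma coef_Bessel:
 assumes "L2_on (cell D i) f" "D > 0"
 shows "(\<Sum>q\<le>k. D / (2 * real q + 1) * (coef D i f q)^2) \<le> (LBINT x:cell D i. (f x)^2)"
 using proj_best[OF assms, of k "%_. 0"] cell_poly_square[OF assms(2), of i k "coef D i f"]
  L2_on_integral_nonneg[of "cell D i" "%x. f x - proj D k i f x"]
 by (simp add: cell_poly_def proj_def)

lemma legendre_bounds:
 "\<exists>M\<ge>1. \<forall>q\<le>k. \<forall>x\<in>{-1..1}. \<forall>y\<in>{-1..1}. \<bar>poly (legendre q) x\<bar> \<le> M \<and>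
   \<bar>poly (legendre q) x - poly (legendre q) y\<bar> \<le> M * \<bar>x - y\<bar>"
proof -
 have bdd: "\<exists>M. \<forall>x\<in>{-1..1}. \<bar>poly p x\<bar> \<le> M" for p :: "real poly"
 proof -
  have "bounded (poly p ` {-1..1})" by (intro compact_imp_bounded compact_continuous_image continuous_intros compact_Icc)
  then show ?thesis unfolding bounded_iff by fastforce
 qed
 obtain A where A: "!!q x. x \<in> {-1..1} ==> \<bar>poly (legendre q) x\<bar> \<le> A q" using bdd[of "legendre _"] by metis
 obtain B where B: "!!q x. x \<in> {-1..1} ==> \<bar>poly (pderiv (legendre q)) x\<bar> \<le> B q" using bdd[of "pderiv (legendre _)"] by metis
 have A0: "0 \<le> A q" and B0: "0 \<le> B q" for q
  using A[of 0 q] B[of 0 q] abs_ge_zero order_trans by (fastforce+)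
 let ?M = "1 + (\<Sum>q\<le>k. A q + B q)"
 have le: "A q + B q \<le> ?M" if "q \<le> k" for q
  using member_le_sum[of q "{..k}" "%q. A q + B q"] that A0 B0 by (auto intro: add_nonneg_nonneg)
 have "\<bar>poly (legendre q) x\<bar> \<le> ?M \<and> \<bar>poly (legendre q) x - poly (legendre q) y\<bar> \<le> ?M * \<bar>x - y\<bar>"
  if "q \<le> k" "x \<in> {-1..1}" "y \<in> {-1..1}" for q x y
 proof
  show "\<bar>poly (legendre q) x\<bar> \<le> ?M" using le[OF that(1)] A[OF that(2), of q] B0[of q] by linarith
  have "\<bar>poly (legendre q) x - poly (legendre q) y\<bar> \<le> B q * \<bar>x - y\<bar>"
  proof -
   have "norm (poly (legendre q) x - poly (legendre q) y) \<le> B q * norm (x - y)"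
    by (rule field_differentiable_bound[of "{-1..1}" "poly (legendre q)" "poly (pderiv (legendre q))"])
      (use B[of _ q] that(2,3) has_field_derivative_at_within[OF poly_DERIV[of "legendre q"]] in auto)
   then show ?thesis by simp
  qed
  also have "\<dots> \<le> ?M * \<bar>x - y\<bar>" using le[OF that(1)] A0[of q] by (intro mult_right_mono) auto
  finally show "\<bar>poly (legendre q) x - poly (legendre q) y\<bar> \<le> ?M * \<bar>x - y\<bar>" .
 qed
 moreover have "1 \<le> ?M" by (simp add: sum_nonneg A0 B0)
 ultimately show ?thesis by blast
qed

text \<open>An inverse estimate by scaling to the reference interval, uniform in mesh size and cell.
  The second bound is deliberately only linear in \<open>\<bar>x - y\<bar>\<close>, that is, Hoelder
  continuity of order 1/2: a function with square-integrable derivative offers no more, and both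
  kinds have to fit into the class \<open>cellwise\<close>.\<close>

lemma cell_poly_bounds:
 "\<exists>M\<ge>1. \<forall>D>0. \<forall>i c. \<forall>x\<in>closed_cell D i. \<forall>y\<in>closed_cell D i.
   (cell_poly D k i c x)^2 \<le> M * (\<Sum>q\<le>k. (c q)^2) \<and>
   (cell_poly D k i c x - cell_poly D k i c y)^2 \<le> M * (\<bar>x - y\<bar> / D) * (\<Sum>q\<le>k. (c q)^2)"
proof -
 obtain M where M: "M \<ge> 1" and
  b: "!!q x y. q \<le> k ==> x \<in> {-1..1} ==> y \<in> {-1..1} ==> \<bar>poly (legendre q) x\<bar> \<le> M \<and>
   \<bar>poly (legendre q) x - poly (legendre q) y\<bar> \<le> M * \<bar>x - y\<bar>"
  using legendre_bounds[of k] by blast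
 let ?M = "4 * (real k + 1) * M^2"
 have cs: "(\<Sum>q\<le>k. c q * a q)^2 \<le> (real k + 1) * s^2 * (\<Sum>q\<le>k. (c q)^2)"
  if "!!q. q \<le> k ==> \<bar>a q\<bar> \<le> s" for a c :: "nat => real" and s
 proof -
  have "(a q)^2 \<le> s^2" if "q \<le> k" for q
   using \<open>!!q. q \<le> k ==> \<bar>a q\<bar> \<le> s\<close>[OF that] by (metis abs_ge_zero power2_abs power_mono)
  then have "(\<Sum>q\<le>k. (a q)^2) \<le> (\<Sum>q\<le>k. s^2)" by (intro sum_mono) auto
  then have "(\<Sum>q\<le>k. (a q)^2) \<le> (real k + 1) * s^2" by (simp add: algebra_simps)
  then have "(\<Sum>q\<le>k. (c q)^2) * (\<Sum>q\<le>k. (a q)^2) \<le> (\<Sum>q\<le>k. (c q)^2) * ((real k + 1) * s^2)"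
   by (intro mult_left_mono sum_nonneg) auto
  with Cauchy_Schwarz_ineq_sum[of c a "{..k}"] show ?thesis by (simp add: mult_ac)
 qed
 have "(cell_poly D k i c x)^2 \<le> ?M * (\<Sum>q\<le>k. (c q)^2)"
   "(cell_poly D k i c x - cell_poly D k i c y)^2 \<le> ?M * (\<bar>x - y\<bar> / D) * (\<Sum>q\<le>k. (c q)^2)"
  if D: "D > 0" and x: "x \<in> closed_cell D i" and y: "y \<in> closed_cell D i" for D i c x y
 proof -
  let ?S = "\<Sum>q\<le>k. (c q)^2"
  have S: "?S \<ge> 0" by (intro sum_nonneg) auto
  note r = ref_coord_bounds[OF D x] ref_coord_bounds[OF D y]
  have "(cell_poly D k i c x)^2 \<le> (real k + 1) * M^2 * ?S"
   unfolding cell_poly_def by (rule cs) (use b r in blast)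
  also have "\<dots> \<le> ?M * ?S" using S by (intro mult_right_mono) auto
  finally show "(cell_poly D k i c x)^2 \<le> ?M * ?S" .
  have d: "\<bar>ref_coord D i x - ref_coord D i y\<bar> = 2 * \<bar>x - y\<bar> / D"
  proof -
   have "ref_coord D i x - ref_coord D i y = 2 * (x - y) / D" by (simp add: ref_coord_def diff_divide_distrib algebra_simps)
   then show ?thesis using D by (simp only: abs_divide abs_mult abs_numeral abs_of_pos)
  qed
  \<comment> \<open>Inside one cell the ratio is at most 1, so its square may be replaced by the
    ratio itself.\<close>
  have t: "\<bar>x - y\<bar> / D \<le> 1" "0 \<le> \<bar>x - y\<bar> / D" using x y D by (auto simp: grid_Suc)
  have "(cell_poly D k i c x - cell_poly D k i c y)^2
   = (\<Sum>q\<le>k. c q * (poly (legendre q) (ref_coord D i x) - poly (legendre q) (ref_coord D i y)))^2"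
   by (simp add: cell_poly_def sum_subtractf algebra_simps)
  also have "\<dots> \<le> (real k + 1) * (M * (2 * \<bar>x - y\<bar> / D))^2 * ?S"
   by (rule cs) (use b[OF _ r] d in auto)
  finally have fin: "(cell_poly D k i c x - cell_poly D k i c y)^2 \<le> (real k + 1) * (M * (2 * \<bar>x - y\<bar> / D))^2 * ?S" .
  have e: "(real k + 1) * (M * (2 * u / D))^2 * S = ?M * ((u / D) * (u / D)) * S" for u S
   by (simp add: power2_eq_square algebra_simps add_divide_distrib)
  note fin
  also have "(real k + 1) * (M * (2 * \<bar>x - y\<bar> / D))^2 * ?S = ?M * ((\<bar>x - y\<bar> / D) * (\<bar>x - y\<bar> / D)) * ?S"
   by (rule e)
  also have "\<dots> \<le> ?M * (\<bar>x - y\<bar> / D) * ?S"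
   using S by (intro mult_right_mono mult_left_mono mult_left_le[OF t]) auto
  finally show "(cell_poly D k i c x - cell_poly D k i c y)^2 \<le> ?M * (\<bar>x - y\<bar> / D) * ?S" .
 qed
 moreover have "?M \<ge> 1"
 proof -
  have "1 * 1 \<le> (4 * (real k + 1)) * M^2" using M by (intro mult_mono) (auto simp: power2_eq_square mult_ge1_I)
  then show ?thesis by simp
 qed
 ultimately show ?thesis by blast
qed

section \<open>Polynomial approximation of weakly differentiable functions\<close>

text \<open>A concrete form of Sobolev regularity of order \<open>m\<close> on the line: the
  functions below level \<open>m\<close> are absolutely continuous, the last one is only locally
  integrable. For positive \<open>m\<close> the values of \<open>f 0\<close> at grid points are
  therefore meaningful.\<close>

definition primitive_chain :: "nat => (nat => real => real) => bool" where
 "primitive_chain m f \<longleftrightarrow> (\<forall>j<m. \<forall>x y. x \<le> y --> set_integrable lborel {x<..<y} (f (Suc j)) \<and>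
   f j y - f j x = (LBINT s:{x<..<y}. f (Suc j) s))"

lemma primitive_chain_shift:
 "primitive_chain (Suc m) f ==> primitive_chain m (%j. f (Suc j))"
 by (simp add: primitive_chain_def)

text \<open>Induction on the order: the polynomial found for \<open>f 1\<close> is integrated and
  fitted to \<open>f 0\<close> at \<open>a\<close>. Cauchy-Schwarz gives the factor
  \<open>\<bar>x - y\<bar>\<close> in the base case. Later stages use the supremum bound of the
  previous remainder, obtained with \<open>y = a\<close>; of the two lengths gained one is estimated
  by \<open>D\<close> so that the Hoelder form persists.\<close>

lemma taylor_remainder:
 assumes "primitive_chain (Suc m) f" "L2_on {a<..<a + D} (f (Suc m))" "D > 0"
 shows "\<exists>p. degree p \<le> m \<and> poly p a = f 0 a \<and> (\<forall>x\<in>{a..a + D}. \<forall>y\<in>{a..a + D}.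
   ((f 0 x - poly p x) - (f 0 y - poly p y))^2
    \<le> \<bar>x - y\<bar> * D ^ (2 * m) * (LBINT s:{a<..<a + D}. (f (Suc m) s)^2))"
 using assms(1,2)
proof (induction m arbitrary: f)
 case 0
 let ?N = "LBINT s:{a<..<a + D}. (f (Suc 0) s)^2"
 have *: "(f 0 x - f 0 y)^2 \<le> (y - x) * ?N" if "x \<le> y" "x \<in> {a..a + D}" "y \<in> {a..a + D}" for x y
 proof -
  have L: "L2_on {x<..<y} (f (Suc 0))" by (rule L2_on_subset[OF 0(2)]) (use that in auto)
  have "(f 0 x - f 0 y)^2 = (LBINT s:{x<..<y}. f (Suc 0) s)^2"
   using 0(1) that(1) unfolding primitive_chain_def by (metis power2_commute lessI)
  also have "\<dots> \<le> (y - x) * (LBINT s:{x<..<y}. (f (Suc 0) s)^2)"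
   by (rule L2_on_interval_integral[OF L that(1)])
  also have "\<dots> \<le> (y - x) * ?N"
   using that by (intro mult_left_mono L2_on_integral_subset[OF 0(2)]) auto
  finally show ?thesis .
 qed
 have "(f 0 x - f 0 y)^2 \<le> \<bar>x - y\<bar> * ?N" if "x \<in> {a..a + D}" "y \<in> {a..a + D}" for x y
  using *[of x y] *[of y x] that by (cases "x \<le> y") (auto simp: power2_commute abs_minus_commute)
 then show ?case by (intro exI[of _ "[:f 0 a:]"]) auto
next
 case (Suc m)
 let ?N = "LBINT s:{a<..<a + D}. (f (Suc (Suc m)) s)^2"
 obtain p where p: "degree p \<le> m" "poly p a = f 1 a" and
  b: "!!x y. x \<in> {a..a + D} ==> y \<in> {a..a + D} ==>
   ((f 1 x - poly p x) - (f 1 y - poly p y))^2 \<le> \<bar>x - y\<bar> * D ^ (2 * m) * ?N"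
  using Suc.IH[OF primitive_chain_shift[OF Suc.prems(1)] Suc.prems(2)] by auto
 let ?S = "D * D ^ (2 * m) * ?N"
 have N: "?N \<ge> 0" by (rule L2_on_integral_nonneg)
 then have S: "?S \<ge> 0" using assms(3) by simp
 have sup: "\<bar>f 1 x - poly p x\<bar> \<le> sqrt ?S" if "x \<in> {a..a + D}" for x
 proof -
  have "(f 1 x - poly p x)^2 \<le> \<bar>x - a\<bar> * D ^ (2 * m) * ?N" using b[OF that, of a] p assms(3) by simp
  also have "\<dots> \<le> ?S" using that assms(3) N by (intro mult_right_mono) auto
  finally show ?thesis using real_le_rsqrt[of "\<bar>f 1 x - poly p x\<bar>"] by simp
 qed
 obtain Q where Q: "pderiv Q = p" "degree Q \<le> Suc (degree p)" using poly_antiderivative by blast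
 let ?p = "Q + [:f 0 a - poly Q a:]"
 have *: "((f 0 x - poly ?p x) - (f 0 y - poly ?p y))^2 \<le> (y - x) * (D * ?S)"
  if "x \<le> y" "x \<in> {a..a + D}" "y \<in> {a..a + D}" for x y
 proof -
  have f1: "set_integrable lborel {x<..<y} (f 1)" "f 0 y - f 0 x = (LBINT s:{x<..<y}. f 1 s)"
   using Suc.prems(1) that(1) by (auto simp: primitive_chain_def)
  have "(f 0 y - poly ?p y) - (f 0 x - poly ?p x) = (LBINT s:{x<..<y}. f 1 s - poly p s)"
   using f1 poly_pderiv_integral[OF that(1), of Q] set_integrable_poly[of x y p]
   by (simp add: set_integral_diff Q)
  moreover have "\<bar>LBINT s:{x<..<y}. f 1 s - poly p s\<bar> \<le> sqrt ?S * (y - x)"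
   by (rule interval_integral_abs_bound) (use f1 that sup set_integrable_poly[of x y p] in auto)
  ultimately have "\<bar>(f 0 x - poly ?p x) - (f 0 y - poly ?p y)\<bar> \<le> sqrt ?S * (y - x)"
   by (simp add: abs_minus_commute)
  then have "((f 0 x - poly ?p x) - (f 0 y - poly ?p y))^2 \<le> (sqrt ?S * (y - x))^2"
   by (metis abs_ge_zero power2_abs power_mono)
  also have "\<dots> = ?S * (y - x) * (y - x)" using S by (simp add: power_mult_distrib power2_eq_square[of "y - x"])
  also have "\<dots> \<le> ?S * (y - x) * D" using that S N assms(3) by (intro mult_left_mono mult_nonneg_nonneg) auto
  finally show ?thesis by (simp add: mult_ac)
 qed
 have "((f 0 x - poly ?p x) - (f 0 y - poly ?p y))^2 \<le> \<bar>x - y\<bar> * D ^ (2 * Suc m) * ?N"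
  if "x \<in> {a..a + D}" "y \<in> {a..a + D}" for x y
 proof (cases "x \<le> y")
  case True
  then show ?thesis using *[of x y] that by (simp add: mult_ac)
 next
  case False
  then have "((f 0 y - poly ?p y) - (f 0 x - poly ?p x))^2 \<le> \<bar>x - y\<bar> * D ^ (2 * Suc m) * ?N"
   using *[of y x] that by (simp add: mult_ac)
  then show ?thesis by (simp only: power2_commute[of "f 0 y - _"])
 qed
 moreover have "degree ?p \<le> Suc m" using Q p by (intro degree_add_le) auto
 ultimately show ?case by (intro exI[of _ ?p]) auto
qed

lemma cell_eq: "cell D i = {grid D i<..<grid D i + D}"
 by (simp add: cell_def grid_Suc)

lemma cell_integral_bound:
 assumes "L2_on (cell D i) f" "D > 0" "!!x. x \<in> cell D i ==> (f x)^2 \<le> S"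
 shows "(LBINT x:cell D i. (f x)^2) \<le> S * D"
 using interval_integral_abs_bound[of "grid D i" "grid D i + D" "%x. (f x)^2" S] assms
 unfolding cell_eq L2_on_def by auto

text \<open>The projection is at least as good as the Taylor polynomial at the left end point. The
  case \<open>m = Suc k\<close> serves slices of the solution, the case \<open>m = k\<close> its
  time derivative, which has one derivative in \<open>x\<close> less.\<close>

lemma proj_error_L2:
 assumes "D > 0" "m \<le> Suc k" "primitive_chain m f" "L2_on (cell D i) (f m)" "L2_on (cell D i) (f 0)"
 shows "(LBINT x:cell D i. (f 0 x - proj D k i (f 0) x)^2) \<le> D ^ (2 * m) * (LBINT x:cell D i. (f m x)^2)"
proof (cases m)
 case 0
 then show ?thesis using proj_le[OF assms(5,1), of k] by simp
next
 case (Suc n)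
 let ?a = "grid D i" and ?N = "LBINT x:cell D i. (f m x)^2"
 obtain p where p: "degree p \<le> n" "poly p ?a = f 0 ?a" and
  b: "!!x y. x \<in> {?a..?a + D} ==> y \<in> {?a..?a + D} ==>
   ((f 0 x - poly p x) - (f 0 y - poly p y))^2 \<le> \<bar>x - y\<bar> * D ^ (2 * n) * ?N"
  using taylor_remainder[of n f ?a D] assms unfolding Suc cell_eq by auto
 have N: "?N \<ge> 0" by (rule L2_on_integral_nonneg)
 obtain c where c: "poly p = cell_poly D k i c"
  using polynomial_eq_cell_poly[OF assms(1), of p k i] p assms(2) Suc by auto
 have L: "L2_on (cell D i) (%x. f 0 x - poly p x)" using assms(5) by (intro L2_on_diff) auto
 have "(LBINT x:cell D i. (f 0 x - proj D k i (f 0) x)^2) \<le> (LBINT x:cell D i. (f 0 x - poly p x)^2)"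
  using proj_best[OF assms(5,1), of k c] L2_on_integral_nonneg[of "cell D i" "%x. proj D k i (f 0) x - poly p x"]
  unfolding c by linarith
 also have "\<dots> \<le> (D * D ^ (2 * n) * ?N) * D"
 proof (rule cell_integral_bound[OF L assms(1)])
  fix x assume "x \<in> cell D i"
  then have x: "x \<in> {?a..?a + D}" by (auto simp: cell_eq)
  have "(f 0 x - poly p x)^2 \<le> \<bar>x - ?a\<bar> * D ^ (2 * n) * ?N" using b[OF x, of ?a] p assms(1) by simp
  also have "\<dots> \<le> D * D ^ (2 * n) * ?N" using x N assms(1) by (intro mult_right_mono) auto
  finally show "(f 0 x - poly p x)^2 \<le> D * D ^ (2 * n) * ?N" .
 qed
 also have "\<dots> = D ^ (2 * m) * ?N" by (simp add: Suc)
 finally show ?thesis .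
qed

lemma square_diff_le: "(a - b)^2 \<le> 2 * a^2 + 2 * (b::real)^2"
 using zero_le_power2[of "a + b"] by (simp add: power2_eq_square algebra_simps)

text \<open>The projection reproduces the Taylor polynomial, so its error is that of the remainder
  \<open>r\<close>. Bessel's inequality bounds the coefficients of \<open>r\<close> by its mean
  square, and \<open>cell_poly_bounds\<close> turns them back into pointwise bounds; the constant
  depends on \<open>k\<close> alone.\<close>

lemma proj_error_pointwise:
 "\<exists>C\<ge>1. \<forall>D>0. \<forall>i f. primitive_chain (Suc k) f --> L2_on (cell D i) (f (Suc k)) --> L2_on (cell D i) (f 0) -->
   (\<forall>x\<in>closed_cell D i. \<forall>y\<in>closed_cell D i.
    (f 0 x - proj D k i (f 0) x)^2 \<le> C * (D ^ (2 * k) * (LBINT x:cell D i. (f (Suc k) x)^2)) * D \<and>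
    ((f 0 x - proj D k i (f 0) x) - (f 0 y - proj D k i (f 0) y))^2
     \<le> C * (D ^ (2 * k) * (LBINT x:cell D i. (f (Suc k) x)^2)) * \<bar>x - y\<bar>)"
proof -
 obtain M where M: "M \<ge> 1" and Mb: "!!D i c x y. D > 0 ==> x \<in> closed_cell D i ==> y \<in> closed_cell D i ==>
   (cell_poly D k i c x)^2 \<le> M * (\<Sum>q\<le>k. (c q)^2) \<and>
   (cell_poly D k i c x - cell_poly D k i c y)^2 \<le> M * (\<bar>x - y\<bar> / D) * (\<Sum>q\<le>k. (c q)^2)"
  using cell_poly_bounds[of k] by blast
 let ?K = "M * (2 * real k + 1)"
 let ?C = "2 + 2 * ?K"
 have "(f 0 x - proj D k i (f 0) x)^2 \<le> ?C * B * D \<and>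
    ((f 0 x - proj D k i (f 0) x) - (f 0 y - proj D k i (f 0) y))^2 \<le> ?C * B * \<bar>x - y\<bar>"
  if D: "D > 0" and f: "primitive_chain (Suc k) f" "L2_on (cell D i) (f (Suc k))" "L2_on (cell D i) (f 0)"
   and x: "x \<in> closed_cell D i" and y: "y \<in> closed_cell D i"
   and B: "B = D ^ (2 * k) * (LBINT x:cell D i. (f (Suc k) x)^2)" for D i f x y B
 proof -
  let ?a = "grid D i"
  obtain p where p: "degree p \<le> k" "poly p ?a = f 0 ?a" and
   b: "!!x y. x \<in> {?a..?a + D} ==> y \<in> {?a..?a + D} ==>
    ((f 0 x - poly p x) - (f 0 y - poly p y))^2 \<le> \<bar>x - y\<bar> * B"
   using taylor_remainder[of k f ?a D] D f unfolding cell_eq B by (auto simp: mult.assoc)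
  have B0: "B \<ge> 0" using D unfolding B by (intro mult_nonneg_nonneg L2_on_integral_nonneg) auto
  obtain c where c: "poly p = cell_poly D k i c" using polynomial_eq_cell_poly[OF D p(1)] by blast
  define r where "r = (%x. f 0 x - poly p x)"
  have L: "L2_on (cell D i) r" unfolding r_def using f by (intro L2_on_diff) auto
  have rb: "(r x)^2 \<le> B * D" if "x \<in> {?a..?a + D}" for x
  proof -
   have "(r x)^2 \<le> \<bar>x - ?a\<bar> * B" using b[OF that, of ?a] p D by (simp add: r_def)
   also have "\<dots> \<le> D * B" using that B0 by (intro mult_right_mono) auto
   finally show ?thesis by (simp add: mult.commute)
  qed
  have coefs: "coef D i (f 0) q = coef D i r q + c q" if "q \<le> k" for q
  proof -
   have "coef D i r q = coef D i (f 0) q - coef D i (poly p) q"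
    unfolding r_def using f by (intro coef_diff) auto
   then show ?thesis unfolding c using that D by (simp add: coef_cell_poly)
  qed
  have pr: "f 0 x - proj D k i (f 0) x = r x - proj D k i r x" for x
  proof -
   have "proj D k i (f 0) x = proj D k i r x + poly p x"
    unfolding proj_def c cell_poly_def by (simp add: coefs algebra_simps sum.distrib)
   then show ?thesis by (simp add: r_def)
  qed
  \<comment> \<open>The weights \<open>D / (2 * q + 1)\<close> in Bessel's inequality are smallest
    at \<open>q = k\<close>, whence the factor in front.\<close>
  have "(\<Sum>q\<le>k. (coef D i r q)^2) \<le> (2 * real k + 1) / D * (\<Sum>q\<le>k. D / (2 * real q + 1) * (coef D i r q)^2)"
   unfolding sum_distrib_left
  proof (rule sum_mono)
   fix q assume "q \<in> {..k}"
   then have "1 \<le> (2 * real k + 1) / (2 * real q + 1)" by (simp add: field_simps)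
   also have "\<dots> = (2 * real k + 1) / D * (D / (2 * real q + 1))" using D by simp
   finally have "1 * (coef D i r q)^2 \<le> (2 * real k + 1) / D * (D / (2 * real q + 1)) * (coef D i r q)^2"
    by (intro mult_right_mono) auto
   then show "(coef D i r q)^2 \<le> (2 * real k + 1) / D * (D / (2 * real q + 1) * (coef D i r q)^2)"
    by (simp only: mult.assoc mult_1)
  qed
  also have "\<dots> \<le> (2 * real k + 1) / D * (B * D * D)"
  proof (rule mult_left_mono)
   have "(LBINT x:cell D i. (r x)^2) \<le> B * D * D"
    by (rule cell_integral_bound[OF L D]) (use rb in \<open>auto simp: cell_eq\<close>)
   then show "(\<Sum>q\<le>k. D / (2 * real q + 1) * (coef D i r q)^2) \<le> B * D * D"
    using coef_Bessel[OF L D, of k] by linarith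
  qed (use D in auto)
  also have "\<dots> = (2 * real k + 1) * (B * D)" using D by simp
  finally have sum: "(\<Sum>q\<le>k. (coef D i r q)^2) \<le> (2 * real k + 1) * (B * D)" .
  have "(proj D k i r x)^2 \<le> M * (\<Sum>q\<le>k. (coef D i r q)^2)"
   using Mb[OF D x x] by (simp add: proj_def)
  also have "\<dots> \<le> M * ((2 * real k + 1) * (B * D))" using M sum by (intro mult_left_mono) auto
  finally have 1: "(proj D k i r x)^2 \<le> ?K * (B * D)" by (simp add: mult.assoc)
  have "(proj D k i r x - proj D k i r y)^2 \<le> M * (\<bar>x - y\<bar> / D) * (\<Sum>q\<le>k. (coef D i r q)^2)"
   using Mb[OF D x y] by (simp add: proj_def)
  also have "\<dots> \<le> M * (\<bar>x - y\<bar> / D) * ((2 * real k + 1) * (B * D))" using M D sum by (intro mult_left_mono) auto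
  also have "\<dots> = ?K * (B * \<bar>x - y\<bar>)" using D by simp
  finally have 2: "(proj D k i r x - proj D k i r y)^2 \<le> ?K * (B * \<bar>x - y\<bar>)" .
  have "(r x - proj D k i r x)^2 \<le> ?C * B * D"
   using square_diff_le[of "r x" "proj D k i r x"] 1 rb[of x] x
   by (simp add: grid_Suc algebra_simps)
  moreover have "((r x - proj D k i r x) - (r y - proj D k i r y))^2 \<le> ?C * B * \<bar>x - y\<bar>"
   using square_diff_le[of "r x - r y" "proj D k i r x - proj D k i r y"] 2 b[of x y] x y
   by (simp add: grid_Suc algebra_simps r_def)
  ultimately show ?thesis unfolding pr by blast
 qed
 moreover have "?C \<ge> 1" using M by simp
 ultimately show ?thesis by blast
qed

section \<open>The Fourier transform on square-integrable functions\<close>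

definition FT :: "(real => real) => real => complex" where
 "FT f xi = (LBINT x. exp (- (\<i> * complex_of_real (x * xi))) * complex_of_real (f x))"

text \<open>Compact support makes such functions integrable, so their transform is the plain
  integral \<open>FT\<close>. Truncations of square-integrable functions and the basis functions are
  of this kind.\<close>

definition L2c :: "(real => real) => bool" where
 "L2c f \<longleftrightarrow> f \<in> borel_measurable borel \<and> integrable lborel (%x. (f x)^2) \<and> (\<exists>R. \<forall>x. R < \<bar>x\<bar> --> f x = 0)"

lemma L2_on_UNIV: "L2_on UNIV f \<longleftrightarrow> f \<in> borel_measurable borel \<and> integrable lborel (%x. (f x)^2)"
 by (simp add: L2_on_def set_borel_measurable_def set_integrable_def)

lemma L2c_integrable:
 assumes "L2c f" shows "integrable lborel f"
proof -
 obtain R where R: "!!x. R < \<bar>x\<bar> ==> f x = 0" and m: "f \<in> borel_measurable borel"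
  and i: "integrable lborel (%x. (f x)^2)"
  using assms by (auto simp: L2c_def)
 have "integrable lborel (indicator {-R..R} :: real => real)"
  by (intro integrable_real_indicator) (auto simp: emeasure_lborel_Icc_eq)
 moreover have "(indicator {-R..R} x)^2 = (indicator {-R..R} x :: real)" for x :: real by (simp add: indicator_def)
 ultimately have "integrable lborel (%x. f x * indicator {-R..R} x)"
  by (intro integrable_mult_square) (use m i in auto)
 also have "(%x. f x * indicator {-R..R} x) = f"
 proof
  fix x show "f x * indicator {-R..R} x = f x"
   using R[of x] by (cases "R < \<bar>x\<bar>") (auto simp: indicator_def)
 qed
 finally show ?thesis .
qed

lemma norm_exp_i [simp]: "cmod (exp (- (\<i> * complex_of_real x))) = 1" "cmod (exp (\<i> * complex_of_real x)) = 1"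
 by (simp_all add: norm_exp_eq_Re)

lemma borel_measurable_cnj:
 assumes "f \<in> borel_measurable M" shows "(%x. cnj (f x)) \<in> borel_measurable M"
proof -
 have "cnj \<in> borel_measurable borel"
  by (rule borel_measurable_continuous_onI) (intro continuous_on_cnj continuous_on_id)
 from measurable_compose[OF assms this] show ?thesis .
qed

lemma FT_measurable [measurable]:
 assumes [measurable]: "f \<in> borel_measurable borel" shows "FT f \<in> borel_measurable borel"
 unfolding FT_def[abs_def] by measurable

lemma FT_integrable:
 assumes "integrable lborel f"
 shows "integrable lborel (%x. exp (- (\<i> * complex_of_real (x * xi))) * complex_of_real (f x))"
 by (rule integrable_le[OF assms])
   (use assms in \<open>auto simp: norm_mult simp del: of_real_mult\<close>)

lemma FT_bound:
 assumes "integrable lborel f" shows "cmod (FT f xi) \<le> (LBINT x. \<bar>f x\<bar>)"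
proof -
 have "cmod (FT f xi) \<le> (LBINT x. cmod (exp (- (\<i> * complex_of_real (x * xi))) * complex_of_real (f x)))"
  unfolding FT_def by (rule integral_norm_bound)
 then show ?thesis by (simp add: norm_mult del: of_real_mult)
qed

lemma FT_lin:
 assumes "integrable lborel f" "integrable lborel g"
 shows "FT (%x. a * f x + b * g x) xi = a * FT f xi + b * FT g xi"
proof -
 note [simp] = FT_integrable[OF assms(1)] FT_integrable[OF assms(2)]
 have "FT (%x. a * f x + b * g x) xi = (LBINT x. a * (exp (- (\<i> * complex_of_real (x * xi))) * complex_of_real (f x))
   + b * (exp (- (\<i> * complex_of_real (x * xi))) * complex_of_real (g x)))"
  unfolding FT_def by (rule LBINT_cong) (simp_all add: algebra_simps)
 then show ?thesis by (simp add: FT_def del: of_real_mult)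
qed

lemma FT_diff:
 assumes "integrable lborel f" "integrable lborel g"
 shows "FT (%x. f x - g x) xi = FT f xi - FT g xi"
 using FT_lin[OF assms, of 1 "-1" xi] by simp

text \<open>A kernel of modulus 1 keeps the double integral absolutely convergent, so Fubini
  applies. It is used with both signs of the exponent.\<close>

lemma kernel_swap:
 fixes K :: "real => real => complex" and m :: "real => complex" and f :: "real => real"
 assumes [measurable]: "(%(x, y). K x y) \<in> borel_measurable (borel \<Otimes>\<^sub>M borel)"
  and K: "!!x y. cmod (K x y) = 1" and f: "integrable lborel f" and m: "integrable lborel m"
 shows "(LBINT y. (LBINT x. K x y * f x) * m y) = (LBINT x. f x * (LBINT y. K x y * m y))"
proof -
 have [measurable]: "f \<in> borel_measurable borel" "m \<in> borel_measurable borel" using f m by auto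
 have "integrable (lborel \<Otimes>\<^sub>M lborel) (%(x, y). K x y * f x * m y)"
 proof (rule lborel_pair.Fubini_integrable)
  show "(%(x, y). K x y * f x * m y) \<in> borel_measurable (lborel \<Otimes>\<^sub>M lborel)"
   by (simp add: split_beta' cong: measurable_cong_sets) measurable
  have "integrable lborel (%x. \<bar>f x\<bar> * (LBINT y. cmod (m y)))"
   using f by auto
  then show "integrable lborel (%x. LBINT y. norm (case (x, y) of (x, y) => K x y * f x * m y))"
   by (simp add: norm_mult K)
  show "AE x in lborel. integrable lborel (%y. case (x, y) of (x, y) => K x y * f x * m y)"
  proof (rule AE_I2)
   fix x
   show "integrable lborel (%y. case (x, y) of (x, y) => K x y * f x * m y)"
    unfolding prod.case
    by (rule integrable_le[OF integrable_mult_right[of "complex_of_real (f x)" lborel m]])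
      (use m in \<open>auto simp: norm_mult K\<close>)
  qed
 qed
 from lborel_pair.Fubini_integral[OF this]
 have "(LBINT y. LBINT x. K x y * f x * m y) = (LBINT x. LBINT y. K x y * f x * m y)" .
 also have "(LBINT x. LBINT y. K x y * f x * m y) = (LBINT x. f x * (LBINT y. K x y * m y))"
  by (intro LBINT_cong refl)
    (simp add: mult.commute[of "K _ _"] mult.assoc flip: integral_mult_right_zero)
 finally show ?thesis by simp
qed

section \<open>Gaussian regularisation, Bessel's inequality and Parseval's identity\<close>

lemma FT_gaussian:
 assumes "s > 0"
 shows "(LBINT xi. exp (- (\<i> * complex_of_real (z * xi))) * std_normal_density (s * xi))
   = sqrt (2 * pi) * normal_density 0 s z"
proof -
 \<comment> \<open>The transform of the Gaussian is the characteristic function of the standard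
   normal distribution at \<open>- z / s\<close>, up to the substitution
   \<open>x = s * xi\<close>.\<close>
 have "complex_of_real (exp (- ((- z / s)\<^sup>2) / 2)) = char std_normal_distribution (- z / s)"
  by (simp add: char_std_normal_distribution)
 also have "\<dots> = (LBINT x. std_normal_density x *\<^sub>R iexp (- z / s * x))"
  unfolding char_def by (rule integral_density) auto
 also have "\<dots> = \<bar>s\<bar> *\<^sub>R (LBINT x. std_normal_density (0 + s * x) *\<^sub>R iexp (- z / s * (0 + s * x)))"
  using assms by (intro lborel_integral_real_affine) auto
 also have "\<dots> = s * (LBINT xi. exp (- (\<i> * complex_of_real (z * xi))) * std_normal_density (s * xi))"
  using assms by (simp add: scaleR_conv_of_real mult.commute)
 finally have "(LBINT xi. exp (- (\<i> * complex_of_real (z * xi))) * std_normal_density (s * xi))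
  = complex_of_real (exp (- ((- z / s)\<^sup>2) / 2) / s)"
  using assms by (simp add: field_simps)
 also have "exp (- ((- z / s)\<^sup>2) / 2) / s = sqrt (2 * pi) * normal_density 0 s z"
  using assms by (simp add: normal_density_def real_sqrt_mult field_simps power2_eq_square)
 finally show ?thesis by simp
qed

lemma integrable_std_normal_scaled:
 assumes "s \<noteq> 0" shows "integrable lborel (%xi. std_normal_density (s * xi))"
 using lborel_integrable_real_affine[OF integrable_normal_density[of 1 0, OF zero_less_one] assms, of 0] by (simp only: add_0_left)

lemma integral_normal_shift:
 fixes g :: "real => real"
 assumes "s > 0"
 shows "(LBINT y. g y * normal_density 0 s (x - y)) = (LBINT z. g (x + s * z) * std_normal_density z)"
proof -
 have "(LBINT y. g y * normal_density 0 s (x - y))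
   = \<bar>s\<bar> *\<^sub>R (LBINT z. g (x + s * z) * normal_density 0 s (x - (x + s * z)))"
  using assms by (intro lborel_integral_real_affine) auto
 also have "\<dots> = (LBINT z. s * (g (x + s * z) * normal_density 0 s (x - (x + s * z))))"
  using assms by simp
 also have "\<dots> = (LBINT z. g (x + s * z) * std_normal_density z)"
  using assms by (intro LBINT_cong)
   (auto simp: normal_density_def real_sqrt_mult power_mult_distrib field_simps)
 finally show ?thesis .
qed

text \<open>The Gaussian factor makes the integral over \<open>xi\<close> converge absolutely, so it
  can be carried out before those over the two space variables. It becomes a normal density in their
  difference, that is, an averaging of \<open>g\<close> at scale \<open>s\<close>.\<close>

lemma FT_regularized_Parseval:
 assumes f: "integrable lborel f" and g: "integrable lborel g" and s: "s > 0"
 shows "(LBINT xi. FT f xi * cnj (FT g xi) * std_normal_density (s * xi))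
  = complex_of_real (sqrt (2 * pi) * (LBINT x. f x * (LBINT z. g (x + s * z) * std_normal_density z)))"
proof -
 have [measurable]: "f \<in> borel_measurable borel" "g \<in> borel_measurable borel" using f g by auto
 let ?w = "%xi. complex_of_real (std_normal_density (s * xi))"
 let ?e = "%x xi. exp (- (\<i> * complex_of_real (x * xi)))"
 have w: "integrable lborel ?w" using integrable_std_normal_scaled[of s] s by simp
 have cg: "cnj (FT g xi) = (LBINT y. exp (\<i> * complex_of_real (y * xi)) * g y)" for xi
 proof -
  have "cnj (FT g xi) = (LBINT y. cnj (exp (- (\<i> * complex_of_real (y * xi))) * complex_of_real (g y)))"
   unfolding FT_def by (rule Bochner_Integration.integral_cnj[symmetric])
  also have "\<dots> = (LBINT y. exp (\<i> * complex_of_real (y * xi)) * g y)"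
   by (intro LBINT_cong refl) (simp add: exp_cnj)
  finally show ?thesis .
 qed
 have i1: "integrable lborel (%xi. cnj (FT g xi) * ?w xi)"
 proof (rule integrable_le[OF integrable_mult_right[OF w, of "complex_of_real (LBINT x. \<bar>g x\<bar>)"]])
  have "norm (LBINT x. \<bar>g x\<bar>) = (LBINT x. \<bar>g x\<bar>)" by simp
  then show "AE xi in lborel. norm (cnj (FT g xi) * ?w xi) \<le> norm (complex_of_real (LBINT x. \<bar>g x\<bar>) * ?w xi)"
   using FT_bound[OF g] by (auto simp: norm_mult intro!: mult_right_mono)
  show "(%xi. cnj (FT g xi) * ?w xi) \<in> borel_measurable lborel"
   by (intro borel_measurable_times borel_measurable_cnj) auto
 qed
 have outer: "(LBINT xi. ?e x xi * (cnj (FT g xi) * ?w xi))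
   = complex_of_real (sqrt (2 * pi) * (LBINT z. g (x + s * z) * std_normal_density z))" for x
 proof -
  have i2: "integrable lborel (%xi. ?e x xi * ?w xi)"
   by (rule integrable_le[OF w]) (auto simp: norm_mult simp del: of_real_mult)
  have inner: "(LBINT xi. exp (\<i> * complex_of_real (y * xi)) * (?e x xi * ?w xi))
    = sqrt (2 * pi) * normal_density 0 s (x - y)" for y
  proof -
   have "(LBINT xi. exp (\<i> * complex_of_real (y * xi)) * (?e x xi * ?w xi)) = (LBINT xi. ?e (x - y) xi * ?w xi)"
   proof (rule LBINT_cong[OF refl])
    fix xi
    have "exp (\<i> * complex_of_real (y * xi)) * ?e x xi = ?e (x - y) xi"
     unfolding exp_add[symmetric] by (rule arg_cong[where f=exp]) (simp add: algebra_simps)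
    then show "exp (\<i> * complex_of_real (y * xi)) * (?e x xi * ?w xi) = ?e (x - y) xi * ?w xi"
     by (simp only: mult.assoc[symmetric])
   qed
   then show ?thesis by (simp only: FT_gaussian[OF s])
  qed
  have "(LBINT xi. ?e x xi * (cnj (FT g xi) * ?w xi))
   = (LBINT xi. (LBINT y. exp (\<i> * complex_of_real (y * xi)) * g y) * (?e x xi * ?w xi))"
   by (simp add: cg mult_ac)
  also have "\<dots> = (LBINT y. g y * (LBINT xi. exp (\<i> * complex_of_real (y * xi)) * (?e x xi * ?w xi)))"
   by (rule kernel_swap[OF _ _ g i2]) (auto simp del: of_real_mult)
  also have "\<dots> = (LBINT y. g y * complex_of_real (sqrt (2 * pi) * normal_density 0 s (x - y)))"
   by (simp only: inner)
  also have "\<dots> = complex_of_real (sqrt (2 * pi) * (LBINT y. g y * normal_density 0 s (x - y)))"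
   unfolding of_real_mult[symmetric] integral_complex_of_real
   by (rule arg_cong[where f=complex_of_real])
    (subst integral_mult_right_zero[symmetric], simp only: mult.left_commute)
  finally show ?thesis by (simp only: integral_normal_shift[OF s])
 qed
 have "(LBINT xi. FT f xi * cnj (FT g xi) * ?w xi)
  = (LBINT x. f x * (LBINT xi. ?e x xi * (cnj (FT g xi) * ?w xi)))"
  using kernel_swap[OF _ _ f i1, of ?e] by (simp add: FT_def mult.assoc)
 also have "\<dots> = (LBINT x. f x * complex_of_real (sqrt (2 * pi) * (LBINT z. g (x + s * z) * std_normal_density z)))"
  by (simp only: outer)
 also have "\<dots> = complex_of_real (sqrt (2 * pi) * (LBINT x. f x * (LBINT z. g (x + s * z) * std_normal_density z)))"
  unfolding of_real_mult[symmetric] integral_complex_of_real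
  by (rule arg_cong[where f=complex_of_real])
    (subst integral_mult_right_zero[symmetric], simp only: mult.left_commute)
 finally show ?thesis .
qed

lemma abs_integral_le_nn_integral:
 fixes f :: "'a => real"
 shows "ennreal \<bar>LINT x|M. f x\<bar> \<le> (\<integral>\<^sup>+ x. ennreal \<bar>f x\<bar> \<partial>M)"
 using integral_norm_bound_ennreal[of M f] by (cases "integrable M f") (auto simp: not_integrable_integral_eq)

text \<open>The product is at most the mean of \<open>(f x)^2\<close> and
  \<open>(f (x + s * z))^2\<close>, integrated against a probability density, and both squares have
  the same integral by translation invariance. Extended non-negative integrals allow the exchange of
  order without prior integrability.\<close>

lemma regularized_Bessel:
 assumes "f \<in> borel_measurable borel" "integrable lborel (%x. (f x)^2)" and s: "s > 0"
 shows "\<bar>LBINT x. f x * (LBINT z. f (x + s * z) * std_normal_density z)\<bar> \<le> (LBINT x. (f x)^2)"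
proof -
 note [measurable] = assms(1)
 let ?I = "ennreal (LBINT x. (f x)^2)"
 have I: "(\<integral>\<^sup>+ x. ennreal ((f x)^2) \<partial>lborel) = ?I"
  using assms(2) by (simp add: nn_integral_eq_integral)
 have n1: "(\<integral>\<^sup>+ z. ennreal (std_normal_density z) \<partial>lborel) = 1"
  by (subst nn_integral_eq_integral) auto
 have "ennreal \<bar>LBINT x. f x * (LBINT z. f (x + s * z) * std_normal_density z)\<bar>
  \<le> (\<integral>\<^sup>+ x. ennreal \<bar>f x * (LBINT z. f (x + s * z) * std_normal_density z)\<bar> \<partial>lborel)"
  by (rule abs_integral_le_nn_integral)
 also have "\<dots> \<le> (\<integral>\<^sup>+ x. (\<integral>\<^sup>+ z. ennreal \<bar>f x * (f (x + s * z) * std_normal_density z)\<bar> \<partial>lborel) \<partial>lborel)"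
  by (intro nn_integral_mono) (simp flip: integral_mult_right_zero add: abs_integral_le_nn_integral)
 also have "\<dots> \<le> (\<integral>\<^sup>+ x. (\<integral>\<^sup>+ z. ennreal ((f x)^2 / 2) * ennreal (std_normal_density z)
   + ennreal ((f (x + s * z))^2 / 2) * ennreal (std_normal_density z) \<partial>lborel) \<partial>lborel)"
 proof (intro nn_integral_mono)
  fix x z :: real
  have "\<bar>f x\<bar> * \<bar>f (x + s * z)\<bar> \<le> (f x)^2 / 2 + (f (x + s * z))^2 / 2"
   using sum_squares_bound[of "\<bar>f x\<bar>" "\<bar>f (x + s * z)\<bar>"] by (simp add: field_simps)
  then have "\<bar>f x * (f (x + s * z) * std_normal_density z)\<bar> \<le> ((f x)^2 / 2 + (f (x + s * z))^2 / 2) * std_normal_density z"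
   unfolding abs_mult mult.assoc[symmetric] by (simp add: mult_right_mono)
  then show "ennreal \<bar>f x * (f (x + s * z) * std_normal_density z)\<bar>
   \<le> ennreal ((f x)^2 / 2) * ennreal (std_normal_density z) + ennreal ((f (x + s * z))^2 / 2) * ennreal (std_normal_density z)"
   by (simp add: ennreal_mult'[symmetric] ennreal_plus[symmetric] ennreal_leI algebra_simps del: ennreal_plus)
 qed
 also have "\<dots> = (\<integral>\<^sup>+ x. ennreal ((f x)^2 / 2) \<partial>lborel)
   + (\<integral>\<^sup>+ x. (\<integral>\<^sup>+ z. ennreal ((f (x + s * z))^2 / 2) * ennreal (std_normal_density z) \<partial>lborel) \<partial>lborel)"
  by (simp add: nn_integral_add nn_integral_cmult n1)
 also have "(\<integral>\<^sup>+ x. (\<integral>\<^sup>+ z. ennreal ((f (x + s * z))^2 / 2) * ennreal (std_normal_density z) \<partial>lborel) \<partial>lborel)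
   = (\<integral>\<^sup>+ z. (\<integral>\<^sup>+ x. ennreal ((f (x + s * z))^2 / 2) * ennreal (std_normal_density z) \<partial>lborel) \<partial>lborel)"
  by (rule lborel_pair.Fubini'[symmetric]) (simp add: split_beta' cong: measurable_cong_sets)
 also have "\<dots> = (\<integral>\<^sup>+ z. (\<integral>\<^sup>+ x. ennreal ((f x)^2 / 2) \<partial>lborel) * ennreal (std_normal_density z) \<partial>lborel)"
 proof (intro nn_integral_cong)
  fix z :: real
  have "(\<integral>\<^sup>+ x. ennreal ((f x)^2 / 2) \<partial>lborel) = (\<integral>\<^sup>+ x. ennreal ((f (x + s * z))^2 / 2) \<partial>lborel)"
   by (subst nn_integral_real_affine[of _ 1 "s * z"]) (auto simp: add.commute)
  then show "(\<integral>\<^sup>+ x. ennreal ((f (x + s * z))^2 / 2) * ennreal (std_normal_density z) \<partial>lborel)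
   = (\<integral>\<^sup>+ x. ennreal ((f x)^2 / 2) \<partial>lborel) * ennreal (std_normal_density z)"
   by (simp add: nn_integral_multc)
 qed
 also have "\<dots> = (\<integral>\<^sup>+ x. ennreal ((f x)^2 / 2) \<partial>lborel)"
  by (simp add: nn_integral_cmult n1)
 also have "(\<integral>\<^sup>+ x. ennreal ((f x)^2 / 2) \<partial>lborel) = ennreal ((LBINT x. (f x)^2) / 2)"
  using assms(2) by (subst nn_integral_eq_integral) auto
 also have "ennreal ((LBINT x. (f x)^2) / 2) + ennreal ((LBINT x. (f x)^2) / 2) = ?I"
  by (subst ennreal_plus[symmetric]) auto
 finally show ?thesis by (subst (asm) ennreal_le_iff) auto
qed

text \<open>The regularised formula for \<open>f\<close> with itself, where the Gaussian factor
  tends to 1. Fatou's lemma gives the inequality without any continuity of \<open>f\<close>.\<close>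

lemma FT_Bessel_nn:
 assumes "L2c f"
 shows "(\<integral>\<^sup>+ xi. ennreal ((cmod (FT f xi))^2) \<partial>lborel) \<le> ennreal (2 * pi * (LBINT x. (f x)^2))"
proof -
 have f[measurable]: "f \<in> borel_measurable borel" and i: "integrable lborel (%x. (f x)^2)" using assms by (auto simp: L2c_def)
 have fi: "integrable lborel f" by (rule L2c_integrable[OF assms])
 let ?u = "%n xi. ennreal ((cmod (FT f xi))^2 * (sqrt (2 * pi) * std_normal_density (1 / real (Suc n) * xi)))"
 have lim: "(%n. ?u n xi) \<longlonglongrightarrow> ennreal ((cmod (FT f xi))^2)" for xi
 proof -
  have "(%n. 1 / real (Suc n) * xi) \<longlonglongrightarrow> 0 * xi" by (intro tendsto_mult LIMSEQ_Suc[OF lim_1_over_n] tendsto_const)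
  then have "(%n. exp (- (1 / real (Suc n) * xi)\<^sup>2 / 2)) \<longlonglongrightarrow> exp (- (0 * xi)\<^sup>2 / 2)"
   by (intro tendsto_exp tendsto_divide tendsto_minus tendsto_power tendsto_const) simp_all
  then have "(%n. sqrt (2 * pi) * std_normal_density (1 / real (Suc n) * xi)) \<longlonglongrightarrow> 1"
   unfolding std_normal_density_def by simp
  from tendsto_mult[OF tendsto_const[of "(cmod (FT f xi))^2"] this]
  show ?thesis by (intro tendsto_ennrealI) simp
 qed
 have bound: "integral\<^sup>N lborel (?u n) \<le> ennreal (2 * pi * (LBINT x. (f x)^2))" for n
 proof -
  let ?s = "1 / real (Suc n)"
  let ?h = "%xi. FT f xi * cnj (FT f xi) * std_normal_density (?s * xi)"
  have h: "?h xi = complex_of_real ((cmod (FT f xi))^2 * std_normal_density (?s * xi))" for xi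
   by (simp add: complex_norm_square[symmetric] del: of_real_power)
  let ?B = "LBINT x. \<bar>f x\<bar>"
  have ih: "integrable lborel (%xi. (cmod (FT f xi))^2 * std_normal_density (?s * xi))"
  proof (rule integrable_le[OF integrable_mult_right[OF integrable_std_normal_scaled[of ?s], of "?B^2"]])
   show "AE xi in lborel. norm ((cmod (FT f xi))^2 * std_normal_density (?s * xi)) \<le> norm (?B^2 * std_normal_density (?s * xi))"
    using FT_bound[OF fi] by (auto simp: abs_mult intro!: mult_right_mono power_mono)
  qed auto
  have "complex_of_real (LBINT xi. (cmod (FT f xi))^2 * std_normal_density (?s * xi)) = (LBINT xi. ?h xi)"
   unfolding h by (simp only: integral_complex_of_real)
  also have "\<dots> = complex_of_real (sqrt (2 * pi) * (LBINT x. f x * (LBINT z. f (x + ?s * z) * std_normal_density z)))"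
   by (rule FT_regularized_Parseval[OF fi fi]) auto
  finally have "(LBINT xi. (cmod (FT f xi))^2 * std_normal_density (?s * xi))
   = sqrt (2 * pi) * (LBINT x. f x * (LBINT z. f (x + ?s * z) * std_normal_density z))"
   unfolding of_real_eq_iff .
  also have "\<dots> \<le> sqrt (2 * pi) * (LBINT x. (f x)^2)"
   using regularized_Bessel[OF f i, of ?s] by (intro mult_left_mono) (auto simp: abs_le_iff)
  finally have "sqrt (2 * pi) * (LBINT xi. (cmod (FT f xi))^2 * std_normal_density (?s * xi))
    \<le> sqrt (2 * pi) * (sqrt (2 * pi) * (LBINT x. (f x)^2))" by (intro mult_left_mono) auto
  also have "\<dots> = 2 * pi * (LBINT x. (f x)^2)" by (simp add: mult.assoc[symmetric])
  finally have *: "sqrt (2 * pi) * (LBINT xi. (cmod (FT f xi))^2 * std_normal_density (?s * xi)) \<le> 2 * pi * (LBINT x. (f x)^2)" .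
  have "integral\<^sup>N lborel (?u n) = ennreal (LBINT xi. sqrt (2 * pi) * ((cmod (FT f xi))^2 * std_normal_density (?s * xi)))"
   using ih by (subst nn_integral_eq_integral[symmetric]) (auto simp: mult_ac)
  also have "\<dots> = ennreal (sqrt (2 * pi) * (LBINT xi. (cmod (FT f xi))^2 * std_normal_density (?s * xi)))" by simp
  also have "\<dots> \<le> ennreal (2 * pi * (LBINT x. (f x)^2))" by (intro ennreal_leI *)
  finally show ?thesis .
 qed
 have "(\<integral>\<^sup>+ xi. ennreal ((cmod (FT f xi))^2) \<partial>lborel) = (\<integral>\<^sup>+ xi. liminf (%n. ?u n xi) \<partial>lborel)"
  by (intro nn_integral_cong lim_imp_Liminf[symmetric] lim) simp
 also have "\<dots> \<le> liminf (%n. integral\<^sup>N lborel (?u n))"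
  by (rule nn_integral_liminf) simp
 also have "\<dots> \<le> ennreal (2 * pi * (LBINT x. (f x)^2))"
  by (rule order_trans[OF Liminf_mono[OF always_eventually[OF allI[OF bound]]]]) (simp add: Liminf_const)
 finally show ?thesis .
qed

lemma FT_square_integrable:
 assumes "L2c f" shows "integrable lborel (%xi. (cmod (FT f xi))^2)"
proof (rule integrableI_nonneg)
 show "(%xi. (cmod (FT f xi))^2) \<in> borel_measurable lborel"
  using FT_measurable[of f] assms by (auto simp: L2c_def)
 show "(\<integral>\<^sup>+ xi. ennreal ((cmod (FT f xi))^2) \<partial>lborel) < \<infinity>"
  using FT_Bessel_nn[OF assms] by (metis ennreal_less_top infinity_ennreal_def le_less_trans)
qed auto

lemma FT_Parseval:
 assumes "L2c f" "L2c g" and M: "!!x. \<bar>g x\<bar> \<le> M" and cont: "AE x in lborel. isCont g x"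
 shows "(LBINT xi. FT f xi * cnj (FT g xi)) = complex_of_real (2 * pi * (LBINT x. f x * g x))"
proof -
 have [measurable]: "f \<in> borel_measurable borel" "g \<in> borel_measurable borel" using assms by (auto simp: L2c_def)
 have f: "integrable lborel f" and g: "integrable lborel g" using assms L2c_integrable by auto
 have [measurable]: "FT f \<in> borel_measurable borel" "FT g \<in> borel_measurable borel" by measurable
 have prod_m: "(%xi. FT f xi * cnj (FT g xi)) \<in> borel_measurable borel"
  by (intro borel_measurable_times borel_measurable_cnj) measurable
 let ?s = "%n. 1 / real (Suc n)"
 have s0: "?s \<longlonglongrightarrow> 0" by (rule LIMSEQ_Suc[OF lim_1_over_n])
 let ?W = "%n x. LBINT z. g (x + ?s n * z) * std_normal_density z"
 let ?l = "%n. (LBINT xi. FT f xi * cnj (FT g xi) * (sqrt (2 * pi) * std_normal_density (?s n * xi)))"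
 have eq: "?l n = complex_of_real (2 * pi * (LBINT x. f x * ?W n x))" for n
 proof -
  have "?l n = sqrt (2 * pi) * (LBINT xi. FT f xi * cnj (FT g xi) * std_normal_density (?s n * xi))"
   by (subst integral_mult_right_zero[symmetric]) (simp add: mult_ac)
  also have "\<dots> = sqrt (2 * pi) * complex_of_real (sqrt (2 * pi) * (LBINT x. f x * ?W n x))"
   by (subst FT_regularized_Parseval[OF f g]) auto
  also have "\<dots> = complex_of_real (2 * pi * (LBINT x. f x * ?W n x))"
   unfolding of_real_mult[symmetric] mult.assoc[symmetric] by simp
  finally show ?thesis .
 qed
 have ifg: "integrable lborel (%xi. cmod (FT f xi) * cmod (FT g xi))"
  by (rule integrable_mult_square) (use FT_square_integrable assms in auto)
 have "?l \<longlonglongrightarrow> (LBINT xi. FT f xi * cnj (FT g xi))"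
 proof (rule integral_dominated_convergence[where w="%xi. cmod (FT f xi) * cmod (FT g xi)"])
  show "AE xi in lborel. (%n. FT f xi * cnj (FT g xi) * complex_of_real (sqrt (2 * pi) * std_normal_density (?s n * xi))) \<longlonglongrightarrow> FT f xi * cnj (FT g xi)"
  proof (rule AE_I2)
   fix xi
   have "(%n. ?s n * xi) \<longlonglongrightarrow> 0 * xi" by (intro tendsto_mult s0 tendsto_const)
   then have "(%n. exp (- (?s n * xi)\<^sup>2 / 2)) \<longlonglongrightarrow> exp (- (0 * xi)\<^sup>2 / 2)"
    by (intro tendsto_exp tendsto_divide tendsto_minus tendsto_power tendsto_const) simp_all
   then have "(%n. complex_of_real (sqrt (2 * pi) * std_normal_density (?s n * xi))) \<longlonglongrightarrow> complex_of_real 1"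
    unfolding std_normal_density_def by (intro tendsto_of_real) simp
   from tendsto_mult[OF tendsto_const[of "FT f xi * cnj (FT g xi)"] this]
   show "(%n. FT f xi * cnj (FT g xi) * complex_of_real (sqrt (2 * pi) * std_normal_density (?s n * xi))) \<longlonglongrightarrow> FT f xi * cnj (FT g xi)"
    by simp
  qed
  fix n
  have "sqrt (2 * pi) * std_normal_density z \<le> 1" for z
   by (simp add: std_normal_density_def)
  then show "AE xi in lborel. norm (FT f xi * cnj (FT g xi) * complex_of_real (sqrt (2 * pi) * std_normal_density (?s n * xi))) \<le> cmod (FT f xi) * cmod (FT g xi)"
   by (intro AE_I2) (simp add: norm_mult mult_left_le del: of_real_mult)
  show "(%xi. FT f xi * cnj (FT g xi) * complex_of_real (sqrt (2 * pi) * std_normal_density (?s n * xi))) \<in> borel_measurable lborel"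
  proof -
   have "(%xi. FT f xi * cnj (FT g xi) * complex_of_real (sqrt (2 * pi) * std_normal_density (?s n * xi))) \<in> borel_measurable borel"
    by (rule borel_measurable_times[OF prod_m]) measurable
   then show ?thesis by simp
  qed
 qed (use ifg prod_m in auto)
 moreover have "?l \<longlonglongrightarrow> complex_of_real (2 * pi * (LBINT x. f x * g x))"
  unfolding eq
 proof (intro tendsto_of_real tendsto_mult tendsto_const)
  have W: "?W n x = (LBINT z. g (x + ?s n * z) * std_normal_density z)" for n x ..
  have M0: "0 \<le> M" using M[of 0] by linarith
  have Wb: "\<bar>?W n x\<bar> \<le> M" for n x
  proof -
   have "\<bar>?W n x\<bar> \<le> (LBINT z. \<bar>g (x + ?s n * z) * std_normal_density z\<bar>)" by (rule integral_abs_bound)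
   also have "\<dots> \<le> (LBINT z. M * std_normal_density z)"
   proof (rule Bochner_Integration.integral_mono)
    show "integrable lborel (%z. \<bar>g (x + ?s n * z) * std_normal_density z\<bar>)"
     by (rule integrable_le[OF integrable_mult_right[OF integrable_normal_density[of 1 0, OF zero_less_one], of M]])
       (use M M0 in \<open>auto simp: abs_mult intro!: mult_right_mono\<close>)
   qed (use M in \<open>auto simp: abs_mult intro!: mult_right_mono\<close>)
   finally show ?thesis by simp
  qed
  show "(%n. LBINT x. f x * ?W n x) \<longlonglongrightarrow> (LBINT x. f x * g x)"
  proof (rule integral_dominated_convergence[where w="%x. M * \<bar>f x\<bar>"])
   show "AE x in lborel. (%n. f x * ?W n x) \<longlonglongrightarrow> f x * g x"
    using cont
   proof eventually_elim
    fix x assume c: "isCont g x"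
    have "(%n. ?W n x) \<longlonglongrightarrow> (LBINT z. g x * std_normal_density z)"
    proof (rule integral_dominated_convergence[where w="%z. M * std_normal_density z"])
     show "AE z in lborel. (%n. g (x + ?s n * z) * std_normal_density z) \<longlonglongrightarrow> g x * std_normal_density z"
     proof (rule AE_I2)
      fix z
      have "(%n. x + ?s n * z) \<longlonglongrightarrow> x + 0 * z" by (intro tendsto_intros s0)
      then have "(%n. g (x + ?s n * z)) \<longlonglongrightarrow> g x"
       using c isCont_tendsto_compose by fastforce
      then show "(%n. g (x + ?s n * z) * std_normal_density z) \<longlonglongrightarrow> g x * std_normal_density z"
       by (intro tendsto_intros)
     qed
    qed (use M in \<open>auto simp: abs_mult intro!: mult_right_mono\<close>)
    then show "(%n. f x * ?W n x) \<longlonglongrightarrow> f x * g x" by (intro tendsto_intros) simp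
   qed
   show "AE x in lborel. norm (f x * ?W n x) \<le> M * \<bar>f x\<bar>" for n
    using mult_right_mono[OF Wb[where n=n] abs_ge_zero] by (intro AE_I2) (simp add: abs_mult mult.commute)
  qed (use f in auto)
 qed
 ultimately show ?thesis by (rule LIMSEQ_unique)
qed

section \<open>Extension of the transform to all square-integrable functions\<close>

definition truncate :: "real => (real => real) => real => real" where
 "truncate R f x = indicator {-R..R} x * f x"

lemma truncate_square: "(truncate R f x)^2 = indicator {-R..R} x * (f x)^2"
 by (simp add: truncate_def indicator_def)

lemma truncate_measurable [measurable]: "f \<in> borel_measurable borel ==> truncate R f \<in> borel_measurable borel"
 unfolding truncate_def[abs_def] by measurable

lemma L2c_truncate:
 assumes "L2_on UNIV f" shows "L2c (truncate R f)"
proof -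
 have [measurable]: "f \<in> borel_measurable borel" and i: "integrable lborel (%x. (f x)^2)" using assms by (auto simp: L2_on_UNIV)
 have "integrable lborel (%x. (truncate R f x)^2)"
  by (rule integrable_le[OF i]) (auto simp: truncate_square indicator_def)
 moreover have "\<exists>R'. \<forall>x. R' < \<bar>x\<bar> --> truncate R f x = 0"
  by (rule exI[of _ R]) (auto simp: truncate_def indicator_def)
 ultimately show ?thesis by (simp add: L2c_def)
qed

lemma FT_truncate:
 "(LBINT x:{-R..R}. exp (- (\<i> * complex_of_real (x * xi))) * complex_of_real (f x)) = FT (truncate R f) xi"
 unfolding FT_def set_lebesgue_integral_def truncate_def
 by (rule LBINT_cong) (auto simp: indicator_def)

lemma L2c_diff:
 assumes "L2c f" "L2c g" shows "L2c (%x. f x - g x)"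
proof -
 obtain R where "!!x. R < \<bar>x\<bar> ==> f x = 0" using assms by (auto simp: L2c_def)
 moreover obtain S where "!!x. S < \<bar>x\<bar> ==> g x = 0" using assms by (auto simp: L2c_def)
 ultimately have "\<forall>x. max R S < \<bar>x\<bar> --> f x - g x = 0" by auto
 moreover have "L2_on UNIV (%x. f x - g x)"
  using assms by (intro L2_on_diff) (auto simp: L2_on_UNIV L2c_def)
 ultimately show ?thesis unfolding L2c_def L2_on_UNIV by blast
qed

text \<open>Extended real values allow distances to be estimated before square integrability of a
  limit is known. Squaring costs a factor 2 in the triangle inequality.\<close>

definition sqdist :: "(real => complex) => (real => complex) => ennreal" where
 "sqdist F G = (\<integral>\<^sup>+ xi. ennreal ((cmod (F xi - G xi))^2) \<partial>lborel)"

lemma sqdist_commute: "sqdist F G = sqdist G F"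
 by (simp add: sqdist_def norm_minus_commute)

lemma norm_diff_square_le: "(cmod (a - b))^2 \<le> 2 * (cmod (a - c))^2 + 2 * (cmod (c - b))^2"
proof -
 have "cmod (a - b) \<le> cmod (a - c) + cmod (c - b)" using norm_triangle_ineq[of "a - c" "c - b"] by simp
 then have "(cmod (a - b))^2 \<le> (cmod (a - c) + cmod (c - b))^2" by (intro power_mono) auto
 also have "\<dots> \<le> 2 * (cmod (a - c))^2 + 2 * (cmod (c - b))^2"
  using sum_squares_bound[of "cmod (a - c)" "cmod (c - b)"] by (simp add: power2_sum)
 finally show ?thesis .
qed

lemma sqdist_triangle:
 assumes [measurable]: "F \<in> borel_measurable borel" "G \<in> borel_measurable borel" "H \<in> borel_measurable borel"
 shows "sqdist F G \<le> 2 * sqdist F H + 2 * sqdist H G"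
proof -
 have "sqdist F G \<le> (\<integral>\<^sup>+ xi. 2 * ennreal ((cmod (F xi - H xi))^2) + 2 * ennreal ((cmod (H xi - G xi))^2) \<partial>lborel)"
  unfolding sqdist_def
 proof (rule nn_integral_mono)
  fix xi
  have "ennreal ((cmod (F xi - G xi))^2) \<le> ennreal (2 * (cmod (F xi - H xi))^2 + 2 * (cmod (H xi - G xi))^2)"
   by (intro ennreal_leI norm_diff_square_le)
  then show "ennreal ((cmod (F xi - G xi))^2) \<le> 2 * ennreal ((cmod (F xi - H xi))^2) + 2 * ennreal ((cmod (H xi - G xi))^2)"
   by (simp add: ennreal_mult')
 qed
 also have "\<dots> = 2 * sqdist F H + 2 * sqdist H G"
  unfolding sqdist_def by (simp add: nn_integral_add nn_integral_cmult)
 finally show ?thesis .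
qed

lemma sqdist_FT:
 assumes "L2c f" "L2c g"
 shows "sqdist (FT f) (FT g) \<le> ennreal (2 * pi * (LBINT x. (f x - g x)^2))"
 using FT_Bessel_nn[OF L2c_diff[OF assms]]
 by (simp add: sqdist_def FT_diff L2c_integrable assms)

definition tail_sq :: "(real => real) => real => real" where
 "tail_sq f R = (LBINT x. (f x - truncate R f x)^2)"

lemma tail_sq_tendsto:
 assumes "L2_on UNIV f" shows "(tail_sq f \<longlongrightarrow> 0) at_top"
proof -
 have [measurable]: "f \<in> borel_measurable borel" and i: "integrable lborel (%x. (f x)^2)" using assms by (auto simp: L2_on_UNIV)
 have "((%R. LBINT x. (f x - truncate R f x)^2) \<longlongrightarrow> (LINT x|(lborel::real measure). 0)) at_top"
 proof (rule integral_dominated_convergence_at_top[where w="%x. (f x)^2"])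
  show "\<forall>\<^sub>F R in at_top. AE x in lborel. norm ((f x - truncate R f x)^2) \<le> (f x)^2"
   by (intro always_eventually allI AE_I2) (auto simp: truncate_def indicator_def)
  show "AE x in lborel. ((%R. (f x - truncate R f x)^2) \<longlongrightarrow> 0) at_top"
  proof (rule AE_I2)
   fix x
   have "\<forall>\<^sub>F R in at_top. (f x - truncate R f x)^2 = 0"
    using eventually_ge_at_top[of "\<bar>x\<bar>"] by eventually_elim (auto simp: truncate_def indicator_def)
   then show "((%R. (f x - truncate R f x)^2) \<longlongrightarrow> 0) at_top" by (rule tendsto_eventually)
  qed
 qed (use i in auto)
 then show ?thesis by (simp add: tail_sq_def[abs_def])
qed

lemma tail_sq_diff:
 assumes "L2_on UNIV f"
 shows "(LBINT x. (truncate R f x - truncate S f x)^2) \<le> 2 * tail_sq f R + 2 * tail_sq f S"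
proof -
 have L: "L2_on UNIV (%x. f x - truncate R f x)" for R
  using L2c_truncate[OF assms] assms by (intro L2_on_diff) (auto simp: L2c_def L2_on_UNIV)
 have L2: "L2_on UNIV (%x. truncate R f x - truncate S f x)"
  using L2c_truncate[OF assms] by (intro L2_on_diff) (auto simp: L2c_def L2_on_UNIV)
 have "(LBINT x. (truncate R f x - truncate S f x)^2)
   \<le> (LBINT x. 2 * (f x - truncate R f x)^2 + 2 * (f x - truncate S f x)^2)"
 proof (rule Bochner_Integration.integral_mono)
  fix x show "(truncate R f x - truncate S f x)^2 \<le> 2 * (f x - truncate R f x)^2 + 2 * (f x - truncate S f x)^2"
   using square_diff_le[of "f x - truncate S f x" "f x - truncate R f x"] by simp
 qed (use L L2 in \<open>auto simp: L2_on_UNIV\<close>)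
 also have "\<dots> = 2 * tail_sq f R + 2 * tail_sq f S"
  using L by (simp add: L2_on_UNIV tail_sq_def)
 finally show ?thesis .
qed

lemma tail_sq_nonneg: "0 \<le> tail_sq f R"
 by (simp add: tail_sq_def)

lemma sqdist_FT_truncate:
 assumes "L2_on UNIV f"
 shows "sqdist (FT (truncate R f)) (FT (truncate S f)) \<le> ennreal (4 * pi * (tail_sq f R + tail_sq f S))"
 by (rule order_trans[OF sqdist_FT[OF L2c_truncate[OF assms] L2c_truncate[OF assms]]])
   (use mult_left_mono[OF tail_sq_diff[OF assms, of R S], of "2 * pi"] in \<open>auto intro!: ennreal_leI simp: algebra_simps\<close>)

lemma is_fourier_iff:
 "is_fourier f F \<longleftrightarrow> F \<in> borel_measurable borel \<and> integrable lborel (%xi. (cmod (F xi))^2) \<and>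
   ((%R. sqdist F (FT (truncate R f))) \<longlongrightarrow> 0) at_top"
 unfolding is_fourier_def sqdist_def by (simp add: FT_truncate del: of_real_mult)

lemma summable_imp_convergent:
 fixes a :: "nat => 'a::banach"
 assumes "summable (%n. norm (a (Suc n) - a n))" shows "convergent a"
proof -
 have "summable (%n. a (Suc n) - a n)" by (rule summable_norm_cancel[OF assms])
 then have "convergent (%n. \<Sum>i<n. a (Suc i) - a i)" by (simp add: summable_iff_convergent)
 then have "convergent (%n. a n - a 0)" by (simp add: sum_lessThan_telescope)
 then have "convergent (%n. (a n - a 0) + a 0)" by (intro convergent_add convergent_const)
 then show ?thesis by simp
qed

text \<open>The Riesz-Fischer argument: the series of \<open>4 ^ n\<close> times the squared
  increments has finite integral, so it converges at almost every point, where the increments are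
  eventually at most \<open>(1 / 2) ^ n\<close>.\<close>

lemma fast_Cauchy_AE_convergent:
 fixes F :: "nat => real => complex"
 assumes [measurable]: "!!n. F n \<in> borel_measurable borel"
  and d: "!!n. sqdist (F (Suc n)) (F n) \<le> ennreal (K * (1 / 8) ^ n)" and K: "K \<ge> 0"
 shows "AE xi in lborel. convergent (%n. F n xi)"
proof -
 let ?d = "%n xi. cmod (F (Suc n) xi - F n xi)"
 have "(\<integral>\<^sup>+ xi. (\<Sum>n. ennreal (4 ^ n * (?d n xi)^2)) \<partial>lborel) = (\<Sum>n. \<integral>\<^sup>+ xi. ennreal (4 ^ n * (?d n xi)^2) \<partial>lborel)"
  by (rule nn_integral_suminf) measurable
 also have "\<dots> \<le> (\<Sum>n. ennreal (K * (1 / 2) ^ n))"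
 proof (rule suminf_le)
  fix n
  have "(\<integral>\<^sup>+ xi. ennreal (4 ^ n * (?d n xi)^2) \<partial>lborel) = ennreal (4 ^ n) * sqdist (F (Suc n)) (F n)"
   unfolding sqdist_def by (simp add: ennreal_mult' nn_integral_cmult)
  also have "\<dots> \<le> ennreal (4 ^ n) * ennreal (K * (1 / 8) ^ n)" by (intro mult_left_mono d) simp
  also have "\<dots> = ennreal (K * (1 / 2) ^ n)"
  proof -
   have "(4::real) ^ n * (1 / 8) ^ n = (4 * (1 / 8)) ^ n" by (rule power_mult_distrib[symmetric])
   then have "(4::real) ^ n * (K * (1 / 8) ^ n) = K * (1 / 2) ^ n" by (simp only: mult.left_commute) simp
   then show ?thesis by (metis ennreal_mult' zero_le_numeral zero_le_power)
  qed
  finally show "(\<integral>\<^sup>+ xi. ennreal (4 ^ n * (?d n xi)^2) \<partial>lborel) \<le> ennreal (K * (1 / 2) ^ n)" .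
 qed auto
 also have "\<dots> < \<infinity>"
 proof -
  have "(\<Sum>n. ennreal (K * (1 / 2) ^ n)) = ennreal (\<Sum>n. K * (1 / 2) ^ n)"
   by (rule suminf_ennreal2) (auto simp: K intro!: summable_mult summable_geometric)
  then show ?thesis by simp
 qed
 finally have "(\<integral>\<^sup>+ xi. (\<Sum>n. ennreal (4 ^ n * (?d n xi)^2)) \<partial>lborel) \<noteq> \<infinity>" by simp
 then have "AE xi in lborel. (\<Sum>n. ennreal (4 ^ n * (?d n xi)^2)) \<noteq> \<infinity>"
  by (intro nn_integral_PInf_AE) auto
 then show ?thesis
 proof eventually_elim
  fix xi assume "(\<Sum>n. ennreal (4 ^ n * (?d n xi)^2)) \<noteq> \<infinity>"
  then have "summable (%n. 4 ^ n * (?d n xi)^2)"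
   by (intro summable_suminf_not_top) simp_all
  then have "(%n. 4 ^ n * (?d n xi)^2) \<longlonglongrightarrow> 0" by (rule summable_LIMSEQ_zero)
  from LIMSEQ_D[OF this zero_less_one]
  obtain N where "!!n. n \<ge> N ==> norm (4 ^ n * (?d n xi)^2 - 0) < 1" by blast
  then have N: "4 ^ n * (?d n xi)^2 < 1" if "n \<ge> N" for n using that by simp
  have "norm (?d n xi) \<le> (1 / 2) ^ n" if "n \<ge> N" for n
  proof -
   have "(2 ^ n * a)^2 = (2^2) ^ n * a^2" for a :: real
    by (metis power_mult_distrib power_mult mult.commute)
   then have "(2 ^ n * ?d n xi)^2 < 1^2" using N[OF that] by simp
   then have "2 ^ n * ?d n xi < 1" by (rule power_less_imp_less_base) simp
   then have "?d n xi \<le> 1 / 2 ^ n" by (simp add: pos_le_divide_eq mult.commute)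
   then show ?thesis by (simp add: power_one_over)
  qed
  then have "summable (%n. ?d n xi)"
   by (rule summable_comparison_test'[rotated]) simp_all
  then show "convergent (%n. F n xi)" by (rule summable_imp_convergent)
 qed
qed

text \<open>Radii whose tails are below \<open>(1 / 8) ^ n\<close> give a limit at almost every
  frequency. Fatou's lemma then bounds its distance to the transform of every truncation, not only
  of those in the sequence, by the corresponding tail.\<close>

lemma fourier_exists:
 assumes "L2_on UNIV f" shows "\<exists>F. is_fourier f F"
proof -
 have [measurable]: "f \<in> borel_measurable borel" using assms by (simp add: L2_on_UNIV)
 have "\<exists>R. tail_sq f R \<le> (1 / 8) ^ n" for n
 proof -
  have "\<forall>\<^sub>F R in at_top. tail_sq f R < (1 / 8) ^ n"
   using order_tendstoD(2)[OF tail_sq_tendsto[OF assms], of "(1 / 8) ^ n"] by simp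
  then show ?thesis using eventually_happens by (force intro: less_imp_le)
 qed
 then obtain R where R: "!!n. tail_sq f (R n) \<le> (1 / 8) ^ n" by metis
 let ?F = "%n. FT (truncate (R n) f)"
 have "sqdist (?F (Suc n)) (?F n) \<le> ennreal (8 * pi * (1 / 8) ^ n)" for n
 proof (rule order_trans[OF sqdist_FT_truncate[OF assms]], rule ennreal_leI)
  have "tail_sq f (R (Suc n)) \<le> (1 / 8) ^ n" using R[of "Suc n"] by (simp add: field_simps)
  then show "4 * pi * (tail_sq f (R (Suc n)) + tail_sq f (R n)) \<le> 8 * pi * (1 / 8) ^ n"
   using R[of n] by simp
 qed
 then have conv: "AE xi in lborel. convergent (%n. ?F n xi)"
  by (intro fast_Cauchy_AE_convergent[where K="8 * pi"]) auto
 define F where "F = (%xi. lim (%n. ?F n xi))"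
 have F[measurable]: "F \<in> borel_measurable borel"
  unfolding F_def by (rule borel_measurable_lim_metric) measurable
 have lim0: "(%n. tail_sq f (R n)) \<longlonglongrightarrow> 0"
  by (rule tendsto_sandwich[of "%_. 0" _ _ "%n. (1 / 8) ^ n"]) (auto simp: tail_sq_nonneg R intro!: LIMSEQ_power_zero)
 have bound: "sqdist F (FT (truncate S f)) \<le> ennreal (4 * pi * tail_sq f S)" for S
 proof -
  let ?v = "%n xi. ennreal ((cmod (?F n xi - FT (truncate S f) xi))^2)"
  have "sqdist F (FT (truncate S f)) = (\<integral>\<^sup>+ xi. liminf (%n. ?v n xi) \<partial>lborel)"
   unfolding sqdist_def
  proof (rule nn_integral_cong_AE, use conv in eventually_elim)
   fix xi assume "convergent (%n. ?F n xi)"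
   then have "(%n. ?F n xi) \<longlonglongrightarrow> F xi" unfolding F_def by (simp add: convergent_LIMSEQ_iff)
   then have "(%n. ?v n xi) \<longlonglongrightarrow> ennreal ((cmod (F xi - FT (truncate S f) xi))^2)"
    by (intro tendsto_intros)
   then show "ennreal ((cmod (F xi - FT (truncate S f) xi))^2) = liminf (%n. ?v n xi)"
    by (intro lim_imp_Liminf[symmetric]) auto
  qed
  also have "\<dots> \<le> liminf (%n. integral\<^sup>N lborel (?v n))" by (rule nn_integral_liminf) measurable
  also have "\<dots> \<le> liminf (%n. ennreal (4 * pi * (tail_sq f (R n) + tail_sq f S)))"
   by (intro Liminf_mono always_eventually allI) (use sqdist_FT_truncate[OF assms] in \<open>simp add: sqdist_def\<close>)
  also have "\<dots> = ennreal (4 * pi * (0 + tail_sq f S))"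
   by (intro lim_imp_Liminf tendsto_intros lim0) simp
  finally show ?thesis by simp
 qed
 have "((%S. ennreal (4 * pi * tail_sq f S)) \<longlongrightarrow> ennreal (4 * pi * 0)) at_top"
  by (intro tendsto_intros tail_sq_tendsto assms)
 then have t0: "((%S. sqdist F (FT (truncate S f))) \<longlongrightarrow> 0) at_top"
  by (intro tendsto_sandwich[of "%_. 0" "%S. sqdist F (FT (truncate S f))" at_top]) (auto simp: bound)
 have "integrable lborel (%xi. (cmod (F xi))^2)"
 proof (rule integrableI_nonneg)
  have "sqdist F (%_. 0) \<le> 2 * sqdist F (FT (truncate 0 f)) + 2 * sqdist (FT (truncate 0 f)) (%_. 0)"
   by (rule sqdist_triangle) measurable
  also have "\<dots> < \<infinity>"
   using bound[of 0] FT_Bessel_nn[OF L2c_truncate[OF assms, of 0]]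
   by (auto simp: sqdist_def ennreal_mult_less_top intro!: le_less_trans[OF _ ennreal_less_top])
  finally show "(\<integral>\<^sup>+ xi. ennreal ((cmod (F xi))^2) \<partial>lborel) < \<infinity>" by (simp add: sqdist_def)
 qed auto
 then show ?thesis using t0 F unfolding is_fourier_iff by blast
qed

lemma is_fourier_fourier: "L2_on UNIV f ==> is_fourier f (fourier f)"
 unfolding fourier_def using fourier_exists by (rule someI_ex)

lemma fourier_measurable: "L2_on UNIV f ==> fourier f \<in> borel_measurable borel"
 and fourier_square_integrable: "L2_on UNIV f ==> integrable lborel (%xi. (cmod (fourier f xi))^2)"
 and fourier_tendsto: "L2_on UNIV f ==> ((%R. sqdist (fourier f) (FT (truncate R f))) \<longlongrightarrow> 0) at_top"
 using is_fourier_fourier[of f] unfolding is_fourier_iff by blast+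

lemma sqdist_0_AE:
 assumes [measurable]: "F \<in> borel_measurable borel" "G \<in> borel_measurable borel" and "sqdist F G = 0"
 shows "AE xi in lborel. F xi = G xi"
proof -
 have "AE xi in lborel. ennreal ((cmod (F xi - G xi))^2) = 0"
  using assms(3) unfolding sqdist_def by (subst (asm) nn_integral_0_iff_AE) auto
 then show ?thesis by eventually_elim (simp add: ennreal_eq_0_iff)
qed

lemma is_fourier_unique:
 assumes "is_fourier f F" "is_fourier f G" and f: "f \<in> borel_measurable borel"
 shows "AE xi in lborel. F xi = G xi"
proof (rule sqdist_0_AE)
 show m: "F \<in> borel_measurable borel" "G \<in> borel_measurable borel" using assms by (auto simp: is_fourier_iff)
 have le: "sqdist F G \<le> 2 * sqdist F (FT (truncate R f)) + 2 * sqdist G (FT (truncate R f))" for R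
  using sqdist_triangle[OF m FT_measurable[OF truncate_measurable[OF f]]] by (simp add: sqdist_commute)
 have "((%R. 2 * sqdist F (FT (truncate R f)) + 2 * sqdist G (FT (truncate R f))) \<longlongrightarrow> 2 * 0 + 2 * 0) at_top"
  using assms by (intro tendsto_add ennreal_tendsto_cmult) (auto simp: is_fourier_iff)
 then have "sqdist F G \<le> 2 * 0 + 2 * 0"
  by (rule tendsto_lowerbound) (auto simp: le)
 then show "sqdist F G = 0" by simp
qed

lemma fourier_L2c:
 assumes "L2c f" shows "AE xi in lborel. fourier f xi = FT f xi"
proof (rule is_fourier_unique[of f])
 have L: "L2_on UNIV f" using assms by (simp add: L2c_def L2_on_UNIV)
 then show "is_fourier f (fourier f)" by (rule is_fourier_fourier)
 show "f \<in> borel_measurable borel" using assms by (simp add: L2c_def)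
 obtain R where R: "!!x. R < \<bar>x\<bar> ==> f x = 0" using assms by (auto simp: L2c_def)
 have "\<forall>\<^sub>F S in at_top. sqdist (FT f) (FT (truncate S f)) = 0"
  using eventually_ge_at_top[of R]
 proof eventually_elim
  fix S assume "R \<le> S"
  then have "truncate S f = f" using R by (force simp: truncate_def indicator_def)
  then show "sqdist (FT f) (FT (truncate S f)) = 0" by (simp add: sqdist_def)
 qed
 then show "is_fourier f (FT f)"
  using FT_square_integrable[OF assms] FT_measurable[of f] assms
  by (auto simp: is_fourier_iff L2c_def intro: tendsto_eventually)
qed

text \<open>The combination of the two chosen transforms satisfies \<open>is_fourier\<close> for the
  combined function. As representatives are chosen independently, equality can be expected almost
  everywhere only.\<close>

lemma fourier_lin:
 assumes "L2_on UNIV f" "L2_on UNIV g"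
 shows "AE xi in lborel. fourier (%x. a * f x + b * g x) xi = a * fourier f xi + b * fourier g xi"
proof -
 let ?h = "%x. a * f x + b * g x" and ?H = "%xi. a * fourier f xi + b * fourier g xi"
 have L: "L2_on UNIV ?h" using assms by (intro L2_on_add L2_on_cmult)
 note [measurable] = fourier_measurable[OF assms(1)] fourier_measurable[OF assms(2)]
 have [measurable]: "f \<in> borel_measurable borel" "g \<in> borel_measurable borel" using assms by (auto simp: L2_on_UNIV)
 have n: "(cmod (x + y))^2 \<le> 2 * (cmod x)^2 + 2 * (cmod y)^2" for x y
  using norm_diff_square_le[of x "- y" 0] by simp
 have "integrable lborel (%xi. (cmod (?H xi))^2)"
 proof (rule integrable_le)
  show "integrable lborel (%xi. 2 * a^2 * (cmod (fourier f xi))^2 + 2 * b^2 * (cmod (fourier g xi))^2)"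
   using assms by (intro Bochner_Integration.integrable_add integrable_mult_right fourier_square_integrable)
  show "AE xi in lborel. norm ((cmod (?H xi))^2) \<le> norm (2 * a^2 * (cmod (fourier f xi))^2 + 2 * b^2 * (cmod (fourier g xi))^2)"
  proof (rule AE_I2)
   fix xi
   show "norm ((cmod (?H xi))^2) \<le> norm (2 * a^2 * (cmod (fourier f xi))^2 + 2 * b^2 * (cmod (fourier g xi))^2)"
    using n[of "a * fourier f xi" "b * fourier g xi"] by (simp add: norm_mult power_mult_distrib)
  qed
 qed measurable
 moreover have "((%R. sqdist ?H (FT (truncate R ?h))) \<longlongrightarrow> 0) at_top"
 proof -
  let ?u = "%R. ennreal (2 * a^2) * sqdist (fourier f) (FT (truncate R f)) + ennreal (2 * b^2) * sqdist (fourier g) (FT (truncate R g))"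
  have "(?u \<longlongrightarrow> ennreal (2 * a^2) * 0 + ennreal (2 * b^2) * 0) at_top"
   by (intro tendsto_add ennreal_tendsto_cmult fourier_tendsto assms) auto
  then have u: "(?u \<longlongrightarrow> 0) at_top" by simp
  have "sqdist ?H (FT (truncate R ?h)) \<le> ?u R" for R
  proof -
   have tr: "truncate R ?h = (%x. a * truncate R f x + b * truncate R g x)"
    by (auto simp: truncate_def algebra_simps)
   have "sqdist ?H (FT (truncate R ?h)) \<le> (\<integral>\<^sup>+ xi. ennreal (2 * a^2) * ennreal ((cmod (fourier f xi - FT (truncate R f) xi))^2)
     + ennreal (2 * b^2) * ennreal ((cmod (fourier g xi - FT (truncate R g) xi))^2) \<partial>lborel)"
    unfolding sqdist_def
   proof (rule nn_integral_mono)
    fix xi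
    have "?H xi - FT (truncate R ?h) xi = a * (fourier f xi - FT (truncate R f) xi) + b * (fourier g xi - FT (truncate R g) xi)"
     unfolding tr by (subst FT_lin) (auto intro: L2c_integrable L2c_truncate assms simp: algebra_simps)
    then have "(cmod (?H xi - FT (truncate R ?h) xi))^2 \<le> 2 * a^2 * (cmod (fourier f xi - FT (truncate R f) xi))^2
      + 2 * b^2 * (cmod (fourier g xi - FT (truncate R g) xi))^2"
     using n[of "a * (fourier f xi - FT (truncate R f) xi)" "b * (fourier g xi - FT (truncate R g) xi)"]
     by (simp add: norm_mult power_mult_distrib)
    then show "ennreal ((cmod (?H xi - FT (truncate R ?h) xi))^2) \<le> ennreal (2 * a^2) * ennreal ((cmod (fourier f xi - FT (truncate R f) xi))^2)
      + ennreal (2 * b^2) * ennreal ((cmod (fourier g xi - FT (truncate R g) xi))^2)"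
     by (subst ennreal_mult'[symmetric], simp)+ (simp add: ennreal_plus[symmetric] ennreal_leI del: ennreal_plus)
   qed
   also have "\<dots> = ?u R" unfolding sqdist_def by (simp add: nn_integral_add nn_integral_cmult)
   finally show ?thesis .
  qed
  then show ?thesis
   by (intro tendsto_sandwich[OF _ _ tendsto_const u]) auto
 qed
 ultimately have "is_fourier ?h ?H" by (simp add: is_fourier_iff)
 then show ?thesis using is_fourier_unique[OF is_fourier_fourier[OF L]] by simp
qed

text \<open>Here equality holds everywhere: the truncated transforms coincide, so the two predicates
  from which the choice is made are the same.\<close>

lemma fourier_cong_AE:
 assumes "AE x in lborel. f x = g x" "f \<in> borel_measurable borel" "g \<in> borel_measurable borel"
 shows "fourier f = fourier g"
proof -
 note [measurable] = assms(2,3)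
 have "FT (truncate R f) = FT (truncate R g)" for R
 proof
  fix xi
  show "FT (truncate R f) xi = FT (truncate R g) xi"
   unfolding FT_def
  proof (rule integral_cong_AE)
   show "AE x in lborel. exp (- (\<i> * complex_of_real (x * xi))) * complex_of_real (truncate R f x)
     = exp (- (\<i> * complex_of_real (x * xi))) * complex_of_real (truncate R g x)"
    using assms(1) by eventually_elim (simp add: truncate_def)
  qed measurable
 qed
 then have "is_fourier f = is_fourier g" by (intro ext) (simp add: is_fourier_iff)
 then show ?thesis by (simp add: fourier_def)
qed

lemma integrable_cmult_square:
 fixes F G :: "real => complex"
 assumes [measurable]: "F \<in> borel_measurable borel" "G \<in> borel_measurable borel"
  and "integrable lborel (%xi. (cmod (F xi))^2)" "integrable lborel (%xi. (cmod (G xi))^2)"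
 shows "integrable lborel (%xi. F xi * cnj (G xi))"
  and "(cmod (LBINT xi. F xi * cnj (G xi)))^2 \<le> (LBINT xi. (cmod (F xi))^2) * (LBINT xi. (cmod (G xi))^2)"
proof -
 have i: "integrable lborel (%xi. cmod (F xi) * cmod (G xi))"
  by (rule integrable_mult_square) (use assms in auto)
 have m: "(%xi. F xi * cnj (G xi)) \<in> borel_measurable lborel"
  using assms by (intro borel_measurable_times borel_measurable_cnj) auto
 show "integrable lborel (%xi. F xi * cnj (G xi))"
  by (rule integrable_le[OF i m]) (auto simp: norm_mult)
 have "cmod (LBINT xi. F xi * cnj (G xi)) \<le> (LBINT xi. cmod (F xi * cnj (G xi)))" by (rule integral_norm_bound)
 also have "\<dots> = (LBINT xi. cmod (F xi) * cmod (G xi))" by (simp add: norm_mult)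
 finally have "(cmod (LBINT xi. F xi * cnj (G xi)))^2 \<le> (LBINT xi. cmod (F xi) * cmod (G xi))^2"
  by (intro power_mono) auto
 also have "\<dots> \<le> (LBINT xi. (cmod (F xi))^2) * (LBINT xi. (cmod (G xi))^2)"
  by (rule integral_Cauchy_Schwarz) (use assms in auto)
 finally show "(cmod (LBINT xi. F xi * cnj (G xi)))^2 \<le> (LBINT xi. (cmod (F xi))^2) * (LBINT xi. (cmod (G xi))^2)" .
qed

text \<open>Truncating \<open>f\<close> beyond the support of \<open>g\<close> does not change the
  right-hand side, while the transforms of the truncations converge in the mean; Cauchy-Schwarz
  makes the difference vanish.\<close>

lemma fourier_Parseval:
 assumes f: "L2_on UNIV f" and g: "L2c g" and "!!x. \<bar>g x\<bar> \<le> M" and "AE x in lborel. isCont g x"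
 shows "(LBINT xi. fourier f xi * cnj (fourier g xi)) = complex_of_real (2 * pi * (LBINT x. f x * g x))"
proof -
 have gm[measurable]: "g \<in> borel_measurable borel" and fm[measurable]: "f \<in> borel_measurable borel"
  using f g by (auto simp: L2c_def L2_on_UNIV)
 have gL: "L2_on UNIV g" using g by (auto simp: L2c_def L2_on_UNIV)
 note [measurable] = fourier_measurable[OF f] fourier_measurable[OF gL]
 obtain S where S: "!!x. S < \<bar>x\<bar> ==> g x = 0" using g by (auto simp: L2c_def)
 let ?I = "LBINT xi. fourier f xi * cnj (FT g xi)"
 let ?p = "complex_of_real (2 * pi * (LBINT x. f x * g x))"
 let ?G = "LBINT xi. (cmod (FT g xi))^2"
 have i1: "integrable lborel (%xi. fourier f xi * cnj (FT g xi))"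
  by (rule integrable_cmult_square) (use f g in \<open>auto intro: fourier_square_integrable FT_square_integrable\<close>)
 have key: "ennreal ((cmod (?I - ?p))^2) \<le> ennreal ?G * sqdist (fourier f) (FT (truncate R f))" if "R \<ge> S" for R
 proof -
  have T: "L2c (truncate R f)" by (rule L2c_truncate[OF f])
  have i2: "integrable lborel (%xi. FT (truncate R f) xi * cnj (FT g xi))"
   by (rule integrable_cmult_square) (use T g in \<open>auto intro: FT_square_integrable\<close>)
  have "(LBINT x. truncate R f x * g x) = (LBINT x. f x * g x)"
   by (rule LBINT_cong) (use S that in \<open>force simp: truncate_def indicator_def\<close>)+
  then have "?p = (LBINT xi. FT (truncate R f) xi * cnj (FT g xi))"
   using FT_Parseval[OF T g assms(3,4)] by simp
  then have d: "?I - ?p = (LBINT xi. (fourier f xi - FT (truncate R f) xi) * cnj (FT g xi))"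
   using i1 i2 by (simp add: algebra_simps)
  have i3: "integrable lborel (%xi. (cmod (fourier f xi - FT (truncate R f) xi))^2)"
  proof (rule integrable_le)
   show "integrable lborel (%xi. 2 * (cmod (fourier f xi))^2 + 2 * (cmod (FT (truncate R f) xi))^2)"
    using f T by (intro Bochner_Integration.integrable_add integrable_mult_right fourier_square_integrable FT_square_integrable)
   show "AE xi in lborel. norm ((cmod (fourier f xi - FT (truncate R f) xi))^2)
     \<le> norm (2 * (cmod (fourier f xi))^2 + 2 * (cmod (FT (truncate R f) xi))^2)"
    using norm_diff_square_le[of "fourier f _" "FT (truncate R f) _" 0] by (intro AE_I2) simp
  qed measurable
  have "(cmod (?I - ?p))^2 \<le> (LBINT xi. (cmod (fourier f xi - FT (truncate R f) xi))^2) * ?G"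
   unfolding d by (rule integrable_cmult_square) (use i3 g in \<open>auto intro: FT_square_integrable\<close>)
  then have "ennreal ((cmod (?I - ?p))^2) \<le> ennreal ?G * ennreal (LBINT xi. (cmod (fourier f xi - FT (truncate R f) xi))^2)"
   by (simp add: ennreal_mult'[symmetric] ennreal_leI mult.commute)
  also have "ennreal (LBINT xi. (cmod (fourier f xi - FT (truncate R f) xi))^2) = sqdist (fourier f) (FT (truncate R f))"
   unfolding sqdist_def using i3 by (simp add: nn_integral_eq_integral)
  finally show ?thesis .
 qed
 have "((%R. ennreal ?G * sqdist (fourier f) (FT (truncate R f))) \<longlongrightarrow> ennreal ?G * 0) at_top"
  by (intro ennreal_tendsto_cmult fourier_tendsto f) simp
 then have "ennreal ((cmod (?I - ?p))^2) \<le> ennreal ?G * 0"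
  by (rule tendsto_lowerbound[OF _ eventually_mono[OF eventually_ge_at_top[of S] key]])
   (auto simp: trivial_limit_at_top_linorder)
 then have "?I = ?p" by (simp add: ennreal_eq_0_iff)
 moreover have "(LBINT xi. fourier f xi * cnj (fourier g xi)) = ?I"
 proof (rule integral_cong_AE)
  show "AE xi in lborel. fourier f xi * cnj (fourier g xi) = fourier f xi * cnj (FT g xi)"
   using fourier_L2c[OF g] by eventually_elim simp
 qed (intro borel_measurable_times borel_measurable_cnj, measurable)+
 ultimately show ?thesis by simp
qed

section \<open>The fractional seminorm of piecewise regular functions\<close>

lemma AE_in_cell:
 assumes "D > 0" shows "AE x in lborel. \<exists>i. x \<in> cell D i"
proof -
 have "AE x in lborel. x \<notin> range (grid D)"
  by (rule AE_not_in) (auto intro!: countable_imp_null_set_lborel)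
 then show ?thesis
 proof eventually_elim
  fix x assume n: "x \<notin> range (grid D)"
  let ?i = "\<lfloor>x / D\<rfloor>"
  have "of_int ?i * D \<le> x" "x < (of_int ?i + 1) * D"
   using assms by (simp_all add: pos_le_divide_eq[symmetric] pos_divide_less_eq[symmetric])
  moreover have "x \<noteq> grid D ?i" using n by auto
  ultimately have "x \<in> cell D ?i" by (auto simp: cell_def grid_def)
  then show "\<exists>i. x \<in> cell D i" ..
 qed
qed

text \<open>The grid points form a null set and the cells are enumerated by
  \<open>int_decode\<close>. Bounds for all finite sets of cells are the form in which summability
  over the grid is expressed throughout.\<close>

lemma nn_integral_cells_le:
 assumes "D > 0" and [measurable]: "h \<in> borel_measurable borel"
  and F: "!!F. finite F ==> (\<Sum>i\<in>F. \<integral>\<^sup>+ x. h x * indicator (cell D i) x \<partial>lborel) \<le> M"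
 shows "(\<integral>\<^sup>+ x. h x \<partial>lborel) \<le> M"
proof -
 have "(\<integral>\<^sup>+ x. h x \<partial>lborel) \<le> (\<integral>\<^sup>+ x. (\<Sum>n. h x * indicator (cell D (int_decode n)) x) \<partial>lborel)"
 proof (rule nn_integral_mono_AE, use AE_in_cell[OF assms(1)] in eventually_elim)
  fix x assume "\<exists>i. x \<in> cell D i"
  then obtain i where i: "x \<in> cell D i" by blast
  have "h x = (\<Sum>n\<in>{int_encode i}. h x * indicator (cell D (int_decode n)) x)" using i by simp
  also have "\<dots> \<le> (\<Sum>n. h x * indicator (cell D (int_decode n)) x)" by (rule sum_le_suminf) auto
  finally show "h x \<le> (\<Sum>n. h x * indicator (cell D (int_decode n)) x)" .
 qed
 also have "\<dots> = (\<Sum>n. \<integral>\<^sup>+ x. h x * indicator (cell D (int_decode n)) x \<partial>lborel)"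
  by (rule nn_integral_suminf) measurable
 also have "\<dots> \<le> M"
 proof (rule suminf_le_const)
  fix n
  have "(\<Sum>j<n. \<integral>\<^sup>+ x. h x * indicator (cell D (int_decode j)) x \<partial>lborel)
    = (\<Sum>i\<in>int_decode ` {..<n}. \<integral>\<^sup>+ x. h x * indicator (cell D i) x \<partial>lborel)"
   by (rule sum.reindex_cong[symmetric, where l=int_decode]) (auto intro: inj_on_inverseI[of _ int_encode])
  then show "(\<Sum>j<n. \<integral>\<^sup>+ x. h x * indicator (cell D (int_decode j)) x \<partial>lborel) \<le> M"
   using F[of "int_decode ` {..<n}"] by simp
 qed simp
 finally show ?thesis .
qed

text \<open>The class to which the fractional seminorm bound applies, containing projection errors
  and piecewise polynomials alike. Within a cell it asks for Hoelder continuity of order 1/2 with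
  budget \<open>B i\<close>; jumps between cells are arbitrary apart from the supremum
  bound.\<close>

definition cellwise :: "real => (int => real) => (real => real) => bool" where
 "cellwise D B f \<longleftrightarrow> f \<in> borel_measurable borel \<and> (\<forall>i. 0 \<le> B i) \<and>
   (\<forall>i. \<forall>x\<in>cell D i. (f x)^2 \<le> D * B i) \<and>
   (\<forall>i. \<forall>x\<in>cell D i. \<forall>y\<in>cell D i. (f x - f y)^2 \<le> B i * \<bar>x - y\<bar>)"

lemma nn_integral_cell_const:
 assumes "D > 0" "c \<ge> 0"
 shows "(\<integral>\<^sup>+ x. ennreal c * indicator (cell D i) x \<partial>lborel) = ennreal (c * D)"
 using assms by (simp add: nn_integral_cmult_indicator cell_eq ennreal_mult)

lemma cellwise_L2_nn:
 assumes "cellwise D B f" "D > 0" and M: "!!F. finite F ==> sum B F \<le> M"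
 shows "(\<integral>\<^sup>+ x. ennreal ((f x)^2) \<partial>lborel) \<le> ennreal (D^2 * M)"
proof (rule nn_integral_cells_le[OF assms(2)])
 have f[measurable]: "f \<in> borel_measurable borel" and B: "!!i. 0 \<le> B i" and b: "!!i x. x \<in> cell D i ==> (f x)^2 \<le> D * B i"
  using assms(1) by (auto simp: cellwise_def)
 show "(%x. ennreal ((f x)^2)) \<in> borel_measurable borel" by measurable
 fix F :: "int set" assume F: "finite F"
 have "(\<Sum>i\<in>F. \<integral>\<^sup>+ x. ennreal ((f x)^2) * indicator (cell D i) x \<partial>lborel)
   \<le> (\<Sum>i\<in>F. \<integral>\<^sup>+ x. ennreal (D * B i) * indicator (cell D i) x \<partial>lborel)"
  by (intro sum_mono nn_integral_mono) (auto simp: indicator_def b intro!: ennreal_leI)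
 also have "\<dots> = (\<Sum>i\<in>F. ennreal (D * B i * D))"
  using assms(2) B by (intro sum.cong refl nn_integral_cell_const) auto
 also have "\<dots> = ennreal (\<Sum>i\<in>F. D * B i * D)"
  using assms(2) B by (intro sum_ennreal) auto
 also have "\<dots> = ennreal (D^2 * sum B F)"
  by (simp add: sum_distrib_left power2_eq_square mult_ac)
 also have "\<dots> \<le> ennreal (D^2 * M)" using M[OF F] by (intro ennreal_leI mult_left_mono) auto
 finally show "(\<Sum>i\<in>F. \<integral>\<^sup>+ x. ennreal ((f x)^2) * indicator (cell D i) x \<partial>lborel) \<le> ennreal (D^2 * M)" .
qed

lemma cellwise_L2:
 assumes "cellwise D B f" "D > 0" "!!F. finite F ==> sum B F \<le> M"
 shows "L2_on UNIV f" "(LBINT x. (f x)^2) \<le> D^2 * M"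
proof -
 have f: "f \<in> borel_measurable borel" using assms(1) by (simp add: cellwise_def)
 have "integrable lborel (%x. (f x)^2)"
  by (rule integrableI_nonneg) (use f le_less_trans[OF cellwise_L2_nn[OF assms] ennreal_less_top] in auto)
 then show "L2_on UNIV f" using f by (simp add: L2_on_UNIV)
 have "0 \<le> M" using assms(3)[of "{}"] by simp
 then show "(LBINT x. (f x)^2) \<le> D^2 * M"
  using cellwise_L2_nn[OF assms] \<open>integrable lborel (%x. (f x)^2)\<close>
  by (simp add: nn_integral_eq_integral)
qed

text \<open>If \<open>h < D\<close>, the points \<open>x\<close> and \<open>x + h\<close> share a
  cell unless \<open>x\<close> lies within \<open>h\<close> of the right end, where the supremum
  bounds of two neighbouring cells act on a set of measure \<open>h\<close>. Hoelder continuity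
  contributes 1 and the two cells contribute 2 each to the factor 5. For larger shifts the norm of
  \<open>f\<close> itself is used.\<close>

lemma cellwise_shift:
 assumes c: "cellwise D B f" and D: "D > 0" and M: "!!F. finite F ==> sum B F \<le> M" and h: "h > 0"
 shows "(\<integral>\<^sup>+ x. ennreal ((f (x + h) - f x)^2) \<partial>lborel) \<le> ennreal (if h < D then 5 * h * D * M else 4 * D^2 * M)"
proof (cases "h < D")
 case True
 have f[measurable]: "f \<in> borel_measurable borel" and B: "!!i. 0 \<le> B i" and b: "!!i x. x \<in> cell D i ==> (f x)^2 \<le> D * B i"
  and l: "!!i x y. x \<in> cell D i ==> y \<in> cell D i ==> (f x - f y)^2 \<le> B i * \<bar>x - y\<bar>"
  using c by (auto simp: cellwise_def)
 let ?J = "%i. {grid D (i + 1) - h<..<grid D (i + 1)}"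
 have pt: "(f (x + h) - f x)^2 \<le> B i * h + 2 * D * (B i + B (i + 1)) * indicator (?J i) x"
  if x: "x \<in> cell D i" and ne: "x \<noteq> grid D (i + 1) - h" for x i
 proof (cases "x < grid D (i + 1) - h")
  case True
  then have "x + h \<in> cell D i" using x h by (auto simp: cell_def)
  from l[OF this x] have "(f (x + h) - f x)^2 \<le> B i * h" using h by simp
  moreover have "indicator (?J i) x = (0::real)" using True by simp
  ultimately show ?thesis by simp
 next
  case False
  then have J: "x \<in> ?J i" using x ne by (auto simp: cell_def)
  have "x + h \<in> cell D (i + 1)" using J x \<open>h < D\<close> h by (auto simp: cell_eq grid_Suc)
  then have "(f (x + h) - f x)^2 \<le> 2 * (D * B (i + 1)) + 2 * (D * B i)"
   using square_diff_le[of "f (x + h)" "f x"] b[of "x + h" "i + 1"] b[OF x] by simp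
  also have "\<dots> \<le> B i * h + 2 * D * (B i + B (i + 1))" using B h by (simp add: algebra_simps)
  finally show ?thesis using J by simp
 qed
 have "(\<integral>\<^sup>+ x. ennreal ((f (x + h) - f x)^2) \<partial>lborel) \<le> ennreal (5 * h * D * M)"
 proof (rule nn_integral_cells_le[OF D])
  fix F :: "int set" assume F: "finite F"
  have one: "(\<integral>\<^sup>+ x. ennreal ((f (x + h) - f x)^2) * indicator (cell D i) x \<partial>lborel)
    \<le> ennreal (B i * h * D + 2 * D * (B i + B (i + 1)) * h)" for i
  proof -
   have "(\<integral>\<^sup>+ x. ennreal ((f (x + h) - f x)^2) * indicator (cell D i) x \<partial>lborel)
    \<le> (\<integral>\<^sup>+ x. ennreal (B i * h) * indicator (cell D i) x + ennreal (2 * D * (B i + B (i + 1))) * indicator (?J i) x \<partial>lborel)"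
   proof (rule nn_integral_mono_AE, use AE_lborel_singleton[of "grid D (i + 1) - h"] in eventually_elim)
    fix x assume ne: "x \<noteq> grid D (i + 1) - h"
    have nn: "0 \<le> B i * h" "0 \<le> 2 * D * (B i + B (i + 1))" using B h D by (auto intro!: mult_nonneg_nonneg add_nonneg_nonneg)
    have "ennreal ((f (x + h) - f x)^2) \<le> ennreal (B i * h) + ennreal (2 * D * (B i + B (i + 1))) * indicator (?J i) x"
     if "x \<in> cell D i"
    proof (cases "x \<in> ?J i")
     case True
     then show ?thesis using ennreal_leI[OF pt[OF that ne]] nn
      by (simp only: indicator_simps mult_1_right ennreal_plus[symmetric])
    next
     case False
     then have "indicator (?J i) x = (0::real)" "indicator (?J i) x = (0::ennreal)" by (simp_all add: indicator_def)
     then show ?thesis using ennreal_leI[OF pt[OF that ne]] by simp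
    qed
    then show "ennreal ((f (x + h) - f x)^2) * indicator (cell D i) x
      \<le> ennreal (B i * h) * indicator (cell D i) x + ennreal (2 * D * (B i + B (i + 1))) * indicator (?J i) x"
     by (cases "x \<in> cell D i") auto
   qed
   also have "\<dots> = ennreal (B i * h * D) + ennreal (2 * D * (B i + B (i + 1))) * ennreal h"
    using B h D by (subst nn_integral_add) (auto simp: cell_eq nn_integral_cmult_indicator ennreal_mult')
   also have "\<dots> = ennreal (B i * h * D + 2 * D * (B i + B (i + 1)) * h)"
    using B h D by (simp add: ennreal_mult'[symmetric] ennreal_plus[symmetric] add_nonneg_nonneg del: ennreal_plus)
   finally show ?thesis .
  qed
  have "(\<Sum>i\<in>F. \<integral>\<^sup>+ x. ennreal ((f (x + h) - f x)^2) * indicator (cell D i) x \<partial>lborel)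
    \<le> (\<Sum>i\<in>F. ennreal (B i * h * D + 2 * D * (B i + B (i + 1)) * h))"
   by (intro sum_mono one)
  also have "\<dots> = ennreal (\<Sum>i\<in>F. B i * h * D + 2 * D * (B i + B (i + 1)) * h)"
   using B h D by (intro sum_ennreal) (auto intro!: add_nonneg_nonneg mult_nonneg_nonneg)
  also have "(\<Sum>i\<in>F. B i * h * D + 2 * D * (B i + B (i + 1)) * h) = h * D * (3 * sum B F + 2 * (\<Sum>i\<in>F. B (i + 1)))"
   by (simp add: sum.distrib algebra_simps flip: sum_distrib_left sum_distrib_right)
  also have "(\<Sum>i\<in>F. B (i + 1)) = sum B ((%i. i + 1) ` F)"
   by (subst sum.reindex) (auto simp: inj_on_def)
  also have "ennreal (h * D * (3 * sum B F + 2 * sum B ((%i. i + 1) ` F))) \<le> ennreal (h * D * (3 * M + 2 * M))"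
   using M[OF F] M[of "(%i. i + 1) ` F"] F h D by (intro ennreal_leI mult_left_mono add_mono) auto
  finally show "(\<Sum>i\<in>F. \<integral>\<^sup>+ x. ennreal ((f (x + h) - f x)^2) * indicator (cell D i) x \<partial>lborel) \<le> ennreal (5 * h * D * M)"
   by (simp add: algebra_simps)
 qed measurable
 then show ?thesis using True by simp
next
 case False
 have [measurable]: "f \<in> borel_measurable borel" using c by (simp add: cellwise_def)
 have "(\<integral>\<^sup>+ x. ennreal ((f (x + h) - f x)^2) \<partial>lborel) \<le> (\<integral>\<^sup>+ x. 2 * ennreal ((f (x + h))^2) + 2 * ennreal ((f x)^2) \<partial>lborel)"
 proof (rule nn_integral_mono)
  fix x
  have "ennreal ((f (x + h) - f x)^2) \<le> ennreal (2 * (f (x + h))^2 + 2 * (f x)^2)" by (intro ennreal_leI square_diff_le)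
  then show "ennreal ((f (x + h) - f x)^2) \<le> 2 * ennreal ((f (x + h))^2) + 2 * ennreal ((f x)^2)"
   by (simp add: ennreal_mult')
 qed
 also have "\<dots> = 2 * (\<integral>\<^sup>+ x. ennreal ((f (x + h))^2) \<partial>lborel) + 2 * (\<integral>\<^sup>+ x. ennreal ((f x)^2) \<partial>lborel)"
  by (simp add: nn_integral_add nn_integral_cmult)
 also have "(\<integral>\<^sup>+ x. ennreal ((f (x + h))^2) \<partial>lborel) = (\<integral>\<^sup>+ x. ennreal ((f x)^2) \<partial>lborel)"
  using nn_integral_real_affine[of "%x. ennreal ((f x)^2)" 1 h] by (simp add: add.commute)
 also have "2 * (\<integral>\<^sup>+ x. ennreal ((f x)^2) \<partial>lborel) + 2 * (\<integral>\<^sup>+ x. ennreal ((f x)^2) \<partial>lborel)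
   \<le> 2 * ennreal (D^2 * M) + 2 * ennreal (D^2 * M)"
  by (intro add_mono mult_left_mono cellwise_L2_nn[OF c D M]) auto
 also have "\<dots> = ennreal (4 * D^2 * M)"
 proof -
  have "0 \<le> M" using M[of "{}"] by simp
  have "2 * ennreal (D^2 * M) = ennreal (2 * (D^2 * M))" by (simp add: ennreal_mult')
  then show ?thesis using \<open>0 \<le> M\<close> by (simp add: ennreal_plus[symmetric] del: ennreal_plus)
 qed
 finally show ?thesis using False by simp
qed

lemma FT_shift_diff:
 assumes "L2c f"
 shows "L2c (%x. f (x + h) - f x)" "FT (%x. f (x + h) - f x) xi = (exp (\<i> * complex_of_real (h * xi)) - 1) * FT f xi"
proof -
 have m[measurable]: "f \<in> borel_measurable borel" and i: "integrable lborel (%x. (f x)^2)" using assms by (auto simp: L2c_def)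
 obtain R where R: "!!x. R < \<bar>x\<bar> ==> f x = 0" using assms by (auto simp: L2c_def)
 have s: "L2c (%x. f (x + h))"
  unfolding L2c_def
 proof (intro conjI exI[of _ "R + \<bar>h\<bar>"] allI impI)
  show "integrable lborel (%x. (f (x + h))^2)"
   using lborel_integrable_real_affine[OF i, of 1 h] by (simp add: add.commute)
  show "f (x + h) = 0" if "R + \<bar>h\<bar> < \<bar>x\<bar>" for x using that by (intro R) linarith
 qed measurable
 then show "L2c (%x. f (x + h) - f x)" using assms by (intro L2c_diff)
 have "FT (%x. f (x + h)) xi = (LBINT x. exp (- (\<i> * complex_of_real ((- h + x) * xi))) * complex_of_real (f x))"
  unfolding FT_def by (subst lborel_integral_real_affine[of 1 _ "- h"]) auto
 also have "\<dots> = exp (\<i> * complex_of_real (h * xi)) * FT f xi"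
  unfolding FT_def integral_mult_right_zero[symmetric]
 proof (rule LBINT_cong[OF refl])
  fix x
  have "exp (- (\<i> * complex_of_real ((- h + x) * xi))) = exp (\<i> * complex_of_real (h * xi)) * exp (- (\<i> * complex_of_real (x * xi)))"
   unfolding exp_add[symmetric] by (rule arg_cong[where f=exp]) (simp add: algebra_simps)
  then show "exp (- (\<i> * complex_of_real ((- h + x) * xi))) * complex_of_real (f x)
   = exp (\<i> * complex_of_real (h * xi)) * (exp (- (\<i> * complex_of_real (x * xi))) * complex_of_real (f x))"
   by (simp only: mult.assoc)
 qed
 finally show "FT (%x. f (x + h) - f x) xi = (exp (\<i> * complex_of_real (h * xi)) - 1) * FT f xi"
  using s assms by (simp add: FT_diff L2c_integrable algebra_simps)
qed

lemma cmod_exp_minus_1: "(cmod (exp (\<i> * complex_of_real t) - 1))^2 = 2 - 2 * cos t"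
proof -
 have "(cmod (exp (\<i> * complex_of_real t) - 1))^2 = (cos t - 1)^2 + (sin t)^2"
  by (simp add: cmod_power2 Re_exp Im_exp)
 also have "\<dots> = (sin t)^2 + (cos t)^2 + 1 - 2 * cos t" by (simp add: power2_eq_square algebra_simps)
 finally show ?thesis by simp
qed

text \<open>Only the scale \<open>h \<approx> 1/\<bar>xi\<bar>\<close> is used.\<close>

lemma weight_lower_bound:
 assumes lam: "0 < lam"
 shows "ennreal (2 powr (- 1 - lam) * (2 - 2 * cos 1)) * ennreal (\<bar>xi\<bar> powr lam)
  \<le> (\<integral>\<^sup>+ h. ennreal (h powr (- 1 - lam) * (cmod (exp (\<i> * complex_of_real (h * xi)) - 1))^2) * indicator {0<..} h \<partial>lborel)"
proof (cases "xi = 0")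
 case False
 let ?r = "\<bar>xi\<bar>"
 have r: "?r > 0" using False by simp
 have "cos 1 < (1::real)" using cos_monotone_0_pi[of 0 1] pi_gt3 by simp
 let ?c = "(2 / ?r) powr (- 1 - lam) * (2 - 2 * cos 1)"
 have "ennreal (2 powr (- 1 - lam) * (2 - 2 * cos 1)) * ennreal (?r powr lam) = ennreal (?c * (1 / ?r))"
 proof -
  have "(2 / ?r) powr (- 1 - lam) = 2 powr (- 1 - lam) * ?r powr (1 + lam)"
  proof -
   have "(- 1 - lam) = - (1 + lam)" by simp
   then have "?r powr (- 1 - lam) = inverse (?r powr (1 + lam))" by (simp only: powr_minus)
   moreover have "(2 / ?r) powr (- 1 - lam) = 2 powr (- 1 - lam) / ?r powr (- 1 - lam)"
    using r by (simp add: powr_divide)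
   ultimately show ?thesis by (simp only: divide_inverse inverse_inverse_eq)
  qed
  moreover have "?r powr (1 + lam) = ?r * ?r powr lam" using r by (simp add: powr_add)
  ultimately have "?c * (1 / ?r) = 2 powr (- 1 - lam) * (2 - 2 * cos 1) * ?r powr lam"
   using r by simp
  then show ?thesis using \<open>cos 1 < 1\<close> by (simp add: ennreal_mult'[symmetric])
 qed
 also have "\<dots> = (\<integral>\<^sup>+ h. ennreal ?c * indicator {1 / ?r..2 / ?r} h \<partial>lborel)"
  using r \<open>cos 1 < 1\<close> by (simp add: nn_integral_cmult_indicator ennreal_mult'[symmetric] divide_right_mono diff_divide_distrib[symmetric])
 also have "\<dots> \<le> (\<integral>\<^sup>+ h. ennreal (h powr (- 1 - lam) * (cmod (exp (\<i> * complex_of_real (h * xi)) - 1))^2) * indicator {0<..} h \<partial>lborel)"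
 proof (rule nn_integral_mono)
  fix h :: real
  have "?c \<le> h powr (- 1 - lam) * (cmod (exp (\<i> * complex_of_real (h * xi)) - 1))^2" if h: "h \<in> {1 / ?r..2 / ?r}"
  proof (rule mult_mono)
   have h0: "h > 0" using h r by (auto intro: less_le_trans[of _ "1 / ?r"])
   have "(2 / ?r) powr (- (1 + lam)) \<le> h powr (- (1 + lam))"
    using h h0 r lam by (intro powr_mono2') auto
   then show "(2 / ?r) powr (- 1 - lam) \<le> h powr (- 1 - lam)" by simp
   have "cos (h * xi) = cos (h * ?r)" by (cases "xi \<ge> 0") auto
   also have "\<dots> \<le> cos 1"
   proof -
    have "1 \<le> h * ?r" "h * ?r \<le> 2" using h r by (auto simp: field_simps)
    then show ?thesis using pi_gt3 by (intro cos_monotone_0_pi_le) auto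
   qed
   finally show "2 - 2 * cos 1 \<le> (cmod (exp (\<i> * complex_of_real (h * xi)) - 1))^2"
    by (simp only: cmod_exp_minus_1)
  qed (use \<open>cos 1 < 1\<close> in auto)
  moreover have "h > 0" if "h \<in> {1 / ?r..2 / ?r}" using that r by (auto intro: less_le_trans[of _ "1 / ?r"])
  ultimately show "ennreal ?c * indicator {1 / ?r..2 / ?r} h
    \<le> ennreal (h powr (- 1 - lam) * (cmod (exp (\<i> * complex_of_real (h * xi)) - 1))^2) * indicator {0<..} h"
   by (auto simp: indicator_def intro!: ennreal_leI)
 qed
 finally show ?thesis .
qed simp

text \<open>Near 0 the linear growth leaves \<open>h powr (- lam)\<close>, integrable since
  \<open>lam < 1\<close>; at infinity the constant bound leaves \<open>h powr (- 1 - lam)\<close>,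
  integrable since \<open>lam > 0\<close>. Both parts scale like
  \<open>D powr (2 - lam)\<close>.\<close>

lemma shift_weight_integral:
 assumes lam: "0 < lam" "lam < 1" and D: "D > 0" and M: "M \<ge> 0"
 shows "(\<integral>\<^sup>+ h. ennreal (h powr (- 1 - lam)) * indicator {0<..} h * ennreal (if h < D then 5 * h * D * M else 4 * D^2 * M) \<partial>lborel)
   \<le> ennreal ((5 / (1 - lam) + 4 / lam) * D powr (2 - lam) * M)"
proof -
 have "(\<integral>\<^sup>+ h. ennreal (h powr (- 1 - lam)) * indicator {0<..} h * ennreal (if h < D then 5 * h * D * M else 4 * D^2 * M) \<partial>lborel)
  \<le> (\<integral>\<^sup>+ h. ennreal (5 * D * M) * (ennreal (h powr (- lam)) * indicator {0..D} h)
     + ennreal (4 * D^2 * M) * (ennreal (h powr (- 1 - lam)) * indicator {D..} h) \<partial>lborel)"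
 proof (rule nn_integral_mono)
  fix h :: real
  have "h powr (- 1 - lam) * (5 * h * D * M) = 5 * D * M * h powr (- lam)" if "0 < h"
   using that by (simp add: powr_diff powr_minus field_simps)
  moreover have "0 \<le> 5 * D * M" "0 \<le> 4 * D^2 * M" using D M by auto
  ultimately show "ennreal (h powr (- 1 - lam)) * indicator {0<..} h * ennreal (if h < D then 5 * h * D * M else 4 * D^2 * M)
    \<le> ennreal (5 * D * M) * (ennreal (h powr (- lam)) * indicator {0..D} h)
     + ennreal (4 * D^2 * M) * (ennreal (h powr (- 1 - lam)) * indicator {D..} h)"
   using D M by (cases "h \<le> 0"; cases "h < D")
    (auto simp: indicator_def ennreal_mult'[symmetric] ennreal_mult''[symmetric] mult.commute intro!: ennreal_leI)
 qed
 also have "\<dots> = ennreal (5 * D * M) * ennreal (D powr (- lam + 1) / (- lam + 1)) + ennreal (4 * D^2 * M) * ennreal (- (D powr (- 1 - lam + 1)) / (- 1 - lam + 1))"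
 proof -
  have "(\<integral>\<^sup>+ h. ennreal (h powr (- lam)) * indicator {0..D} h \<partial>lborel) = ennreal (D powr (- lam + 1) / (- lam + 1))"
   by (rule nn_integral_has_integral_lebesgue'[OF _ has_integral_powr_from_0]) (use lam D in auto)
  moreover have "(\<integral>\<^sup>+ h. ennreal (h powr (- 1 - lam)) * indicator {D..} h \<partial>lborel) = ennreal (- (D powr (- 1 - lam + 1)) / (- 1 - lam + 1))"
   by (rule nn_integral_has_integral_lebesgue'[OF _ has_integral_powr_to_inf]) (use lam D in auto)
  ultimately show ?thesis by (subst nn_integral_add) (auto simp: nn_integral_cmult)
 qed
 also have "\<dots> = ennreal (5 * D * M * (D powr (1 - lam) / (1 - lam)) + 4 * D^2 * M * (D powr (- lam) / lam))"
  using lam D M by (simp add: ennreal_mult'[symmetric] ennreal_plus[symmetric] del: ennreal_plus)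
 also have "5 * D * M * (D powr (1 - lam) / (1 - lam)) + 4 * D^2 * M * (D powr (- lam) / lam) = (5 / (1 - lam) + 4 / lam) * D powr (2 - lam) * M"
 proof -
  have 1: "D powr (2 - lam) = D * D powr (1 - lam)" using D powr_add[of D 1 "1 - lam"] by simp
  have 2: "D powr (2 - lam) = D^2 * D powr (- lam)" using D powr_add[of D 2 "- lam"] by (simp add: powr_numeral)
  have "5 * D * M * (D powr (1 - lam) / (1 - lam)) = 5 / (1 - lam) * D powr (2 - lam) * M" unfolding 1 by simp
  moreover have "4 * D^2 * M * (D powr (- lam) / lam) = 4 / lam * D powr (2 - lam) * M" unfolding 2 by simp
  ultimately show ?thesis by (simp only: distrib_right)
 qed
 finally show ?thesis by simp
qed

text \<open>The numerator combines the factor \<open>2 * pi\<close> of Bessel's inequality with the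
  constant of \<open>shift_weight_integral\<close>; the denominator is the constant of
  \<open>weight_lower_bound\<close>.\<close>

definition gag_const :: "real => real" where
 "gag_const lam = 2 * pi * (5 / (1 - lam) + 4 / lam) / (2 powr (- 1 - lam) * (2 - 2 * cos 1))"

lemma gag_denominator_pos: "0 < (2::real) powr (- 1 - lam) * (2 - 2 * cos 1)"
 using cos_monotone_0_pi[of 0 1] pi_gt3 by simp

lemma gag_const_nonneg: "0 < lam ==> lam < 1 ==> 0 \<le> gag_const lam"
 unfolding gag_const_def using gag_denominator_pos[of lam] by (intro divide_nonneg_nonneg mult_nonneg_nonneg add_nonneg_nonneg) auto

text \<open>The weight \<open>\<bar>xi\<bar> powr lam\<close> is dominated by an integral over
  shifts \<open>h\<close> of the squared multiplier that belongs to the difference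
  \<open>f (x + h) - f x\<close>. Tonelli, Bessel's inequality for each shift and
  \<open>cellwise_shift\<close> do the rest.\<close>

lemma cellwise_FT_seminorm:
 assumes lam: "0 < lam" "lam < 1" and c: "cellwise D B f" and D: "D > 0"
  and M: "!!F. finite F ==> sum B F \<le> M" and f: "L2c f"
 shows "(\<integral>\<^sup>+ xi. ennreal (\<bar>xi\<bar> powr lam * (cmod (FT f xi))^2) \<partial>lborel) \<le> ennreal (gag_const lam * D powr (2 - lam) * M)"
proof -
 have M0: "0 \<le> M" using M[of "{}"] by simp
 have [measurable]: "f \<in> borel_measurable borel" using f by (simp add: L2c_def)
 let ?k = "2 powr (- 1 - lam) * (2 - 2 * cos 1)"
 let ?w = "%h::real. ennreal (h powr (- 1 - lam)) * indicator {0<..} h"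
 let ?e = "%h xi. exp (\<i> * complex_of_real (h * xi)) - 1"
 have k: "?k > 0" by (rule gag_denominator_pos)
 have "ennreal ?k * (\<integral>\<^sup>+ xi. ennreal (\<bar>xi\<bar> powr lam * (cmod (FT f xi))^2) \<partial>lborel)
  = (\<integral>\<^sup>+ xi. ennreal ?k * ennreal (\<bar>xi\<bar> powr lam) * ennreal ((cmod (FT f xi))^2) \<partial>lborel)"
  by (subst nn_integral_cmult[symmetric]) (auto simp: ennreal_mult mult.assoc)
 also have "\<dots> \<le> (\<integral>\<^sup>+ xi. (\<integral>\<^sup>+ h. ennreal (h powr (- 1 - lam) * (cmod (?e h xi))^2) * indicator {0<..} h \<partial>lborel) * ennreal ((cmod (FT f xi))^2) \<partial>lborel)"
  by (intro nn_integral_mono mult_right_mono weight_lower_bound lam) auto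
 also have "\<dots> = (\<integral>\<^sup>+ xi. (\<integral>\<^sup>+ h. ?w h * ennreal ((cmod (FT (%x. f (x + h) - f x) xi))^2) \<partial>lborel) \<partial>lborel)"
 proof (rule nn_integral_cong)
  fix xi
  have "(\<integral>\<^sup>+ h. ennreal (h powr (- 1 - lam) * (cmod (?e h xi))^2) * indicator {0<..} h \<partial>lborel) * ennreal ((cmod (FT f xi))^2)
   = (\<integral>\<^sup>+ h. ennreal (h powr (- 1 - lam) * (cmod (?e h xi))^2) * indicator {0<..} h * ennreal ((cmod (FT f xi))^2) \<partial>lborel)"
   by (rule nn_integral_multc[symmetric]) measurable
  also have "\<dots> = (\<integral>\<^sup>+ h. ?w h * ennreal ((cmod (FT (%x. f (x + h) - f x) xi))^2) \<partial>lborel)"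
   by (intro nn_integral_cong)
     (simp add: FT_shift_diff(2)[OF f] norm_mult power_mult_distrib ennreal_mult mult_ac del: of_real_mult)
  finally show "(\<integral>\<^sup>+ h. ennreal (h powr (- 1 - lam) * (cmod (?e h xi))^2) * indicator {0<..} h \<partial>lborel) * ennreal ((cmod (FT f xi))^2)
   = (\<integral>\<^sup>+ h. ?w h * ennreal ((cmod (FT (%x. f (x + h) - f x) xi))^2) \<partial>lborel)" .
 qed
 also have "\<dots> = (\<integral>\<^sup>+ h. (\<integral>\<^sup>+ xi. ?w h * ennreal ((cmod (FT (%x. f (x + h) - f x) xi))^2) \<partial>lborel) \<partial>lborel)"
  unfolding FT_shift_diff(2)[OF f]
  by (rule lborel_pair.Fubini') (simp add: split_beta' cong: measurable_cong_sets)
 also have "\<dots> \<le> (\<integral>\<^sup>+ h. ?w h * (ennreal (2 * pi) * ennreal (if h < D then 5 * h * D * M else 4 * D^2 * M)) \<partial>lborel)"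
 proof (rule nn_integral_mono)
  fix h :: real
  have L: "L2c (%x. f (x + h) - f x)" by (rule FT_shift_diff(1)[OF f])
  have "(\<integral>\<^sup>+ xi. ennreal ((cmod (FT (%x. f (x + h) - f x) xi))^2) \<partial>lborel) \<le> ennreal (2 * pi * (LBINT x. (f (x + h) - f x)^2))"
   by (rule FT_Bessel_nn[OF L])
  also have "\<dots> = ennreal (2 * pi) * (\<integral>\<^sup>+ x. ennreal ((f (x + h) - f x)^2) \<partial>lborel)"
   using L by (subst nn_integral_eq_integral) (auto simp: L2c_def ennreal_mult)
  finally have *: "(\<integral>\<^sup>+ xi. ennreal ((cmod (FT (%x. f (x + h) - f x) xi))^2) \<partial>lborel)
    \<le> ennreal (2 * pi) * (\<integral>\<^sup>+ x. ennreal ((f (x + h) - f x)^2) \<partial>lborel)" .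
  have [measurable]: "(%xi. FT (%x. f (x + h) - f x) xi) \<in> borel_measurable borel"
   using FT_measurable[of "%x. f (x + h) - f x"] by simp
  have "(\<integral>\<^sup>+ xi. ?w h * ennreal ((cmod (FT (%x. f (x + h) - f x) xi))^2) \<partial>lborel)
   = ?w h * (\<integral>\<^sup>+ xi. ennreal ((cmod (FT (%x. f (x + h) - f x) xi))^2) \<partial>lborel)"
   by (rule nn_integral_cmult) measurable
  also have "\<dots> \<le> ?w h * (ennreal (2 * pi) * ennreal (if h < D then 5 * h * D * M else 4 * D^2 * M))"
  proof (cases "h > 0")
   case True
   show ?thesis
    by (intro mult_left_mono order_trans[OF *] cellwise_shift[OF c D M True]) auto
  qed simp
  finally show "(\<integral>\<^sup>+ xi. ?w h * ennreal ((cmod (FT (%x. f (x + h) - f x) xi))^2) \<partial>lborel)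
   \<le> ?w h * (ennreal (2 * pi) * ennreal (if h < D then 5 * h * D * M else 4 * D^2 * M))" .
 qed
 also have "\<dots> = ennreal (2 * pi) * (\<integral>\<^sup>+ h. ?w h * ennreal (if h < D then 5 * h * D * M else 4 * D^2 * M) \<partial>lborel)"
  by (subst nn_integral_cmult[symmetric]) (auto simp: mult_ac)
 also have "\<dots> \<le> ennreal (2 * pi) * ennreal ((5 / (1 - lam) + 4 / lam) * D powr (2 - lam) * M)"
  by (intro mult_left_mono shift_weight_integral lam D M0) auto
 also have "\<dots> = ennreal ?k * ennreal (gag_const lam * D powr (2 - lam) * M)"
 proof -
  have "2 * pi * ((5 / (1 - lam) + 4 / lam) * D powr (2 - lam) * M) = ?k * (gag_const lam * D powr (2 - lam) * M)"
  proof -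
   have "a * (x * P * M) = r * (a * x / r * P * M)" if "r > 0" for a x P r :: real
    using that by simp
   from this[OF k] show ?thesis unfolding gag_const_def .
  qed
  moreover have "ennreal (2 * pi) * ennreal X = ennreal (2 * pi * X)" for X
   by (rule ennreal_mult'[symmetric]) simp
  moreover have "ennreal ?k * ennreal X = ennreal (?k * X)" for X
   using k by (intro ennreal_mult'[symmetric] less_imp_le)
  ultimately show ?thesis by (simp only:)
 qed
 finally show ?thesis
  using k by (subst (asm) ennreal_mult_le_mult_iff) auto
qed

text \<open>Cutting at a multiple of \<open>D\<close> removes whole cells, so no jump arises inside
  a cell and the budgets of the remaining cells are unchanged.\<close>

lemma cellwise_truncate:
 assumes "cellwise D B f" "D > 0"
 shows "cellwise D (%i. if - int N \<le> i \<and> i < int N then B i else 0) (truncate (real N * D) f)"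
proof -
 have t: "truncate (real N * D) f x = (if - int N \<le> i \<and> i < int N then f x else 0)" if x: "x \<in> cell D i" for x i
 proof (cases "- int N \<le> i \<and> i < int N")
  case True
  have "- (real N * D) \<le> of_int i * D" using True assms(2)
   by (metis minus_mult_left mult_right_mono less_imp_le of_int_le_iff of_int_minus of_int_of_nat_eq)
  moreover have "(of_int i + 1) * D \<le> real N * D"
  proof (rule mult_right_mono)
   have "of_int (i + 1) \<le> (of_int (int N) :: real)" using True by (simp only: of_int_le_iff) auto
   then show "of_int i + 1 \<le> real N" by simp
  qed (use assms in auto)
  ultimately show ?thesis using x True by (auto simp: truncate_def cell_def grid_def indicator_def)
 next
  case False
  then consider "i + 1 \<le> - int N" | "int N \<le> i" by linarith
  then have "x \<notin> {- (real N * D)..real N * D}"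
  proof cases
   case 1
   then have "of_int (i + 1) \<le> (of_int (- int N) :: real)" by (simp only: of_int_le_iff)
   then have "of_int (i + 1) * D \<le> of_int (- int N) * D" using assms(2) by (intro mult_right_mono) auto
   then show ?thesis using x by (auto simp: cell_def grid_def)
  next
   case 2
   then have "of_int (int N) \<le> (of_int i :: real)" by (simp only: of_int_le_iff)
   then have "of_int (int N) * D \<le> of_int i * D" using assms(2) by (intro mult_right_mono) auto
   then show ?thesis using x by (auto simp: cell_def grid_def)
  qed
  then show ?thesis using False by (auto simp: truncate_def)
 qed
 show ?thesis
  using assms(1) truncate_measurable[of f "real N * D"] unfolding cellwise_def by (auto simp: t)
qed

section \<open>The weighted transform and the pairing with the fractional Laplacian\<close>

definition weighted :: "real => (real => real) => real => complex" where
 "weighted lam f xi = complex_of_real (\<bar>xi\<bar> powr (lam / 2)) * fourier f xi"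

text \<open>Splitting the symbol \<open>\<bar>xi\<bar> powr lam\<close> evenly between the two
  arguments turns the duality pairing into an inner product of square-integrable functions; this
  predicate is the Fourier-side counterpart of the fractional space.\<close>

definition H_fourier :: "real => (real => real) => bool" where
 "H_fourier lam f \<longleftrightarrow> L2_on UNIV f \<and> integrable lborel (%xi. (cmod (weighted lam f xi))^2)"

definition semi_sq :: "real => (real => real) => real" where
 "semi_sq lam f = (LBINT xi. (cmod (weighted lam f xi))^2)"

lemma powr_half_square: "(\<bar>xi\<bar> powr (lam / 2))^2 = \<bar>xi\<bar> powr (lam :: real)" for xi :: real
 unfolding power2_eq_square powr_add[symmetric] by simp

lemma cmod_weighted: "(cmod (weighted lam f xi))^2 = \<bar>xi\<bar> powr lam * (cmod (fourier f xi))^2"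
 by (simp add: weighted_def norm_mult power_mult_distrib powr_half_square)

lemma weighted_measurable: "L2_on UNIV f ==> weighted lam f \<in> borel_measurable borel"
 using fourier_measurable[of f] unfolding weighted_def[abs_def] by simp

text \<open>On a bounded frequency window the weight is bounded, so mean convergence of the
  transforms of truncations carries the bound of \<open>cellwise_FT_seminorm\<close> over to
  \<open>fourier f\<close>. Fatou's lemma lets the window grow. The extra factor 2 is that of the
  squared triangle inequality.\<close>

lemma cellwise_H_fourier:
 assumes lam: "0 < lam" "lam < 1" and c: "cellwise D B f" and D: "D > 0"
  and M: "!!F. finite F ==> sum B F \<le> M"
 shows "H_fourier lam f" "semi_sq lam f \<le> 2 * gag_const lam * D powr (2 - lam) * M"
proof -
 have L: "L2_on UNIV f" by (rule cellwise_L2[OF c D M])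
 have [measurable]: "f \<in> borel_measurable borel" using L by (simp add: L2_on_UNIV)
 note [measurable] = fourier_measurable[OF L]
 have M0: "0 \<le> M" using M[of "{}"] by simp
 let ?S = "gag_const lam * D powr (2 - lam) * M"
 have S0: "?S \<ge> 0" using gag_const_nonneg[OF lam] M0 by auto
 have tr: "(\<integral>\<^sup>+ xi. ennreal (\<bar>xi\<bar> powr lam * (cmod (FT (truncate (real N * D) f) xi))^2) \<partial>lborel) \<le> ennreal ?S" for N
 proof (rule cellwise_FT_seminorm[OF lam cellwise_truncate[OF c D] D _ L2c_truncate[OF L]])
  fix F :: "int set" assume F: "finite F"
  have "sum (%i. if - int N \<le> i \<and> i < int N then B i else 0) F \<le> sum B F"
   using c by (intro sum_mono) (auto simp: cellwise_def)
  then show "sum (%i. if - int N \<le> i \<and> i < int N then B i else 0) F \<le> M" using M[OF F] by linarith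
 qed
 have lim: "(%N. sqdist (fourier f) (FT (truncate (real N * D) f))) \<longlonglongrightarrow> 0"
 proof (rule filterlim_compose[OF fourier_tendsto[OF L]])
  show "filterlim (%N. real N * D) at_top sequentially"
   using D by (intro filterlim_tendsto_pos_mult_at_top[OF tendsto_const, of D] filterlim_real_sequentially
     | subst mult.commute)+
 qed
 have cut: "(\<integral>\<^sup>+ xi. ennreal (\<bar>xi\<bar> powr lam * (cmod (fourier f xi))^2) * indicator {- real K..real K} xi \<partial>lborel) \<le> ennreal (2 * ?S)" for K
 proof -
  have "(\<integral>\<^sup>+ xi. ennreal (\<bar>xi\<bar> powr lam * (cmod (fourier f xi))^2) * indicator {- real K..real K} xi \<partial>lborel)
    \<le> ennreal (2 * ?S) + ennreal (2 * real K powr lam) * sqdist (fourier f) (FT (truncate (real N * D) f))" for N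
  proof -
   let ?G = "FT (truncate (real N * D) f)"
   have "(\<integral>\<^sup>+ xi. ennreal (\<bar>xi\<bar> powr lam * (cmod (fourier f xi))^2) * indicator {- real K..real K} xi \<partial>lborel)
    \<le> (\<integral>\<^sup>+ xi. 2 * ennreal (\<bar>xi\<bar> powr lam * (cmod (?G xi))^2) + ennreal (2 * real K powr lam) * ennreal ((cmod (fourier f xi - ?G xi))^2) \<partial>lborel)"
   proof (rule nn_integral_mono)
    fix xi
    have "\<bar>xi\<bar> powr lam * (cmod (fourier f xi))^2 \<le> 2 * (\<bar>xi\<bar> powr lam * (cmod (?G xi))^2) + 2 * real K powr lam * (cmod (fourier f xi - ?G xi))^2"
     if "xi \<in> {- real K..real K}"
    proof -
     have "\<bar>xi\<bar> powr lam \<le> real K powr lam" using that lam by (intro powr_mono2) auto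
     then have "\<bar>xi\<bar> powr lam * (cmod (fourier f xi - ?G xi))^2 \<le> real K powr lam * (cmod (fourier f xi - ?G xi))^2"
      by (intro mult_right_mono) auto
     moreover have "\<bar>xi\<bar> powr lam * (cmod (fourier f xi))^2 \<le> \<bar>xi\<bar> powr lam * (2 * (cmod (fourier f xi - ?G xi))^2 + 2 * (cmod (?G xi))^2)"
      using norm_diff_square_le[of "fourier f xi" 0 "?G xi"] by (intro mult_left_mono) auto
     ultimately show ?thesis by (simp add: algebra_simps)
    qed
    then show "ennreal (\<bar>xi\<bar> powr lam * (cmod (fourier f xi))^2) * indicator {- real K..real K} xi
     \<le> 2 * ennreal (\<bar>xi\<bar> powr lam * (cmod (?G xi))^2) + ennreal (2 * real K powr lam) * ennreal ((cmod (fourier f xi - ?G xi))^2)"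
    proof (cases "xi \<in> {- real K..real K}")
     case True
     have e: "2 * ennreal X + ennreal Y * ennreal Z = ennreal (2 * X + Y * Z)" if "X \<ge> 0" "Y \<ge> 0" "Z \<ge> 0" for X Y Z
      using that by (simp add: ennreal_mult')
     show ?thesis
      using True ennreal_leI[OF \<open>xi \<in> {- real K..real K} ==> _\<close>[OF True]] by (subst e) (auto simp: mult.assoc)
    qed simp
   qed
   also have "\<dots> = 2 * (\<integral>\<^sup>+ xi. ennreal (\<bar>xi\<bar> powr lam * (cmod (?G xi))^2) \<partial>lborel) + ennreal (2 * real K powr lam) * sqdist (fourier f) ?G"
    unfolding sqdist_def by (simp add: nn_integral_add nn_integral_cmult)
   also have "\<dots> \<le> 2 * ennreal ?S + ennreal (2 * real K powr lam) * sqdist (fourier f) ?G"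
    by (intro add_mono mult_left_mono tr) auto
   also have "2 * ennreal ?S = ennreal (2 * ?S)" using S0 by (simp add: ennreal_mult' del: ennreal_numeral flip: ennreal_numeral)
   finally show ?thesis .
  qed
  moreover have "(%N. ennreal (2 * ?S) + ennreal (2 * real K powr lam) * sqdist (fourier f) (FT (truncate (real N * D) f)))
    \<longlonglongrightarrow> ennreal (2 * ?S) + ennreal (2 * real K powr lam) * 0"
   by (intro tendsto_add tendsto_const ennreal_tendsto_cmult lim) simp
  ultimately show ?thesis
   by (intro LIMSEQ_le_const[of "%N. ennreal (2 * ?S) + ennreal (2 * real K powr lam) * sqdist (fourier f) (FT (truncate (real N * D) f))"]) auto
 qed
 have "(\<integral>\<^sup>+ xi. ennreal (\<bar>xi\<bar> powr lam * (cmod (fourier f xi))^2) \<partial>lborel)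
  = (\<integral>\<^sup>+ xi. liminf (%K. ennreal (\<bar>xi\<bar> powr lam * (cmod (fourier f xi))^2) * indicator {- real K..real K} xi) \<partial>lborel)"
 proof (rule nn_integral_cong)
  fix xi
  obtain K0 :: nat where K0: "\<bar>xi\<bar> \<le> real K0" using real_arch_simple by blast
  have "\<forall>\<^sub>F K in sequentially. ennreal (\<bar>xi\<bar> powr lam * (cmod (fourier f xi))^2) * indicator {- real K..real K} xi = ennreal (\<bar>xi\<bar> powr lam * (cmod (fourier f xi))^2)"
   using eventually_ge_at_top[of K0]
  proof eventually_elim
   fix K assume "K0 \<le> K"
   then have "real K0 \<le> real K" by simp
   then have "xi \<in> {- real K..real K}" using K0 by auto
   then show "ennreal (\<bar>xi\<bar> powr lam * (cmod (fourier f xi))^2) * indicator {- real K..real K} xi = ennreal (\<bar>xi\<bar> powr lam * (cmod (fourier f xi))^2)" by simp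
  qed
  then show "ennreal (\<bar>xi\<bar> powr lam * (cmod (fourier f xi))^2)
   = liminf (%K. ennreal (\<bar>xi\<bar> powr lam * (cmod (fourier f xi))^2) * indicator {- real K..real K} xi)"
   by (intro lim_imp_Liminf[symmetric] tendsto_eventually) auto
 qed
 also have "\<dots> \<le> liminf (%K. \<integral>\<^sup>+ xi. ennreal (\<bar>xi\<bar> powr lam * (cmod (fourier f xi))^2) * indicator {- real K..real K} xi \<partial>lborel)"
  by (rule nn_integral_liminf) measurable
 also have "\<dots> \<le> ennreal (2 * ?S)"
  by (rule order_trans[OF Liminf_mono[OF always_eventually[OF allI[OF cut]]]]) (simp add: Liminf_const)
 finally have fin: "(\<integral>\<^sup>+ xi. ennreal ((cmod (weighted lam f xi))^2) \<partial>lborel) \<le> ennreal (2 * ?S)"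
  by (simp add: cmod_weighted)
 have i: "integrable lborel (%xi. (cmod (weighted lam f xi))^2)"
  by (rule integrableI_nonneg) (use weighted_measurable[OF L] le_less_trans[OF fin ennreal_less_top] in auto)
 then show "H_fourier lam f" using L by (simp add: H_fourier_def)
 show "semi_sq lam f \<le> 2 * gag_const lam * D powr (2 - lam) * M"
  using fin i S0 by (simp add: nn_integral_eq_integral semi_sq_def mult.assoc)
qed

lemma weighted_lin:
 assumes "L2_on UNIV f" "L2_on UNIV g"
 shows "AE xi in lborel. weighted lam (%x. a * f x + b * g x) xi = a * weighted lam f xi + b * weighted lam g xi"
 using fourier_lin[OF assms, of a b] by eventually_elim (simp add: weighted_def algebra_simps)

lemma H_fourier_lin:
 assumes "H_fourier lam f" "H_fourier lam g"
 shows "H_fourier lam (%x. a * f x + b * g x)"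
proof -
 have L: "L2_on UNIV f" "L2_on UNIV g" using assms by (auto simp: H_fourier_def)
 have Lh: "L2_on UNIV (%x. a * f x + b * g x)" using L by (intro L2_on_add L2_on_cmult)
 have "integrable lborel (%xi. (cmod (weighted lam (%x. a * f x + b * g x) xi))^2)"
 proof (rule integrable_le)
  show "integrable lborel (%xi. 2 * a^2 * (cmod (weighted lam f xi))^2 + 2 * b^2 * (cmod (weighted lam g xi))^2)"
   using assms by (auto simp: H_fourier_def)
  show "(%xi. (cmod (weighted lam (%x. a * f x + b * g x) xi))^2) \<in> borel_measurable lborel"
   using weighted_measurable[OF Lh, of lam] by simp
  show "AE xi in lborel. norm ((cmod (weighted lam (%x. a * f x + b * g x) xi))^2)
    \<le> norm (2 * a^2 * (cmod (weighted lam f xi))^2 + 2 * b^2 * (cmod (weighted lam g xi))^2)"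
   using weighted_lin[OF L, of lam a b]
  proof eventually_elim
   fix xi assume e: "weighted lam (%x. a * f x + b * g x) xi = a * weighted lam f xi + b * weighted lam g xi"
   show "norm ((cmod (weighted lam (%x. a * f x + b * g x) xi))^2)
    \<le> norm (2 * a^2 * (cmod (weighted lam f xi))^2 + 2 * b^2 * (cmod (weighted lam g xi))^2)"
    using norm_diff_square_le[of "a * weighted lam f xi" "- (b * weighted lam g xi)" 0]
    unfolding e by (simp add: norm_mult power_mult_distrib)
  qed
 qed
 then show ?thesis using Lh by (simp add: H_fourier_def)
qed

lemma weighted_product:
 "fourier_g lam f xi * cnj (fourier v xi) = - (weighted lam f xi * cnj (weighted lam v xi))"
proof -
 have "complex_of_real (\<bar>xi\<bar> powr lam) = complex_of_real (\<bar>xi\<bar> powr (lam / 2)) * complex_of_real (\<bar>xi\<bar> powr (lam / 2))"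
  unfolding of_real_mult[symmetric] powr_half_square[of xi lam, symmetric] power2_eq_square ..
 then show ?thesis by (simp add: fourier_g_def weighted_def)
qed

lemma g_pairing_weighted:
 "g_pairing lam f v = - (1 / (2 * pi)) * Re (LBINT xi. weighted lam f xi * cnj (weighted lam v xi))"
 by (simp add: g_pairing_def weighted_product)

lemma weighted_integrable:
 assumes "H_fourier lam f" "H_fourier lam v"
 shows "integrable lborel (%xi. weighted lam f xi * cnj (weighted lam v xi))"
 using assms by (intro integrable_cmult_square) (auto simp: H_fourier_def weighted_measurable)

lemma g_pairing_lin_left:
 assumes "H_fourier lam f" "H_fourier lam g" "H_fourier lam v"
 shows "g_pairing lam (%x. a * f x + b * g x) v = a * g_pairing lam f v + b * g_pairing lam g v"
proof -
 have L: "L2_on UNIV f" "L2_on UNIV g" "L2_on UNIV v" using assms by (auto simp: H_fourier_def)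
 have "(LBINT xi. weighted lam (%x. a * f x + b * g x) xi * cnj (weighted lam v xi))
  = (LBINT xi. a * (weighted lam f xi * cnj (weighted lam v xi)) + b * (weighted lam g xi * cnj (weighted lam v xi)))"
 proof (rule integral_cong_AE)
  show "AE xi in lborel. weighted lam (%x. a * f x + b * g x) xi * cnj (weighted lam v xi)
   = a * (weighted lam f xi * cnj (weighted lam v xi)) + b * (weighted lam g xi * cnj (weighted lam v xi))"
   using weighted_lin[OF L(1,2), of lam a b] by eventually_elim (simp add: algebra_simps)
 qed (use borel_measurable_integrable[OF weighted_integrable[OF H_fourier_lin[OF assms(1,2)] assms(3)]]
    borel_measurable_integrable[OF weighted_integrable[OF assms(1,3)]]
    borel_measurable_integrable[OF weighted_integrable[OF assms(2,3)]] in auto)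
 also have "\<dots> = a * (LBINT xi. weighted lam f xi * cnj (weighted lam v xi)) + b * (LBINT xi. weighted lam g xi * cnj (weighted lam v xi))"
  using weighted_integrable assms by simp
 finally show ?thesis unfolding g_pairing_weighted by (simp add: algebra_simps)
qed

lemma g_pairing_commute: "g_pairing lam f v = g_pairing lam v f"
proof -
 have "(LBINT xi. weighted lam v xi * cnj (weighted lam f xi)) = cnj (LBINT xi. weighted lam f xi * cnj (weighted lam v xi))"
  unfolding Bochner_Integration.integral_cnj[symmetric] by (simp add: mult.commute)
 then show ?thesis unfolding g_pairing_weighted by simp
qed

lemma g_pairing_self: "g_pairing lam f f = - (semi_sq lam f / (2 * pi))"
proof -
 have "(LBINT xi. weighted lam f xi * cnj (weighted lam f xi)) = (LBINT xi. complex_of_real ((cmod (weighted lam f xi))^2))"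
  by (simp add: complex_norm_square[symmetric] del: of_real_power)
 then show ?thesis unfolding g_pairing_weighted semi_sq_def by (simp del: of_real_power)
qed

lemma semi_sq_nonneg: "0 \<le> semi_sq lam f"
 by (simp add: semi_sq_def)

lemma g_pairing_Cauchy_Schwarz:
 assumes "H_fourier lam f" "H_fourier lam v"
 shows "(2 * pi * g_pairing lam f v)^2 \<le> semi_sq lam f * semi_sq lam v"
proof -
 let ?I = "LBINT xi. weighted lam f xi * cnj (weighted lam v xi)"
 have "2 * pi * g_pairing lam f v = - Re ?I" unfolding g_pairing_weighted by simp
 then have "(2 * pi * g_pairing lam f v)^2 = (Re ?I)^2" by simp
 also have "\<dots> \<le> (cmod ?I)^2" using abs_Re_le_cmod[of ?I] by (metis abs_ge_zero power2_abs power_mono)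
 also have "\<dots> \<le> semi_sq lam f * semi_sq lam v"
  unfolding semi_sq_def using assms
  by (intro integrable_cmult_square) (auto simp: H_fourier_def weighted_measurable)
 finally show ?thesis .
qed

text \<open>The transform and its product with \<open>\<bar>xi\<bar> powr lam\<close> are both
  square integrable, and the weight in between is covered by \<open>t \<le> 1 + t^2\<close>.\<close>

lemma is_g_H_fourier:
 assumes "is_g lam f h" "0 < lam" shows "H_fourier lam f"
proof -
 have L: "L2_on UNIV f" "L2_on UNIV h" and e: "AE xi in lborel. fourier h xi = fourier_g lam f xi"
  using assms by (auto simp: is_g_def)
 have "integrable lborel (%xi. (cmod (weighted lam f xi))^2)"
 proof (rule integrable_le)
  show "integrable lborel (%xi. (cmod (fourier f xi))^2 + (cmod (fourier h xi))^2)"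
   using L fourier_square_integrable by auto
  show "(%xi. (cmod (weighted lam f xi))^2) \<in> borel_measurable lborel" using weighted_measurable[OF L(1), of lam] by simp
  show "AE xi in lborel. norm ((cmod (weighted lam f xi))^2) \<le> norm ((cmod (fourier f xi))^2 + (cmod (fourier h xi))^2)"
   using e
  proof eventually_elim
   fix xi assume e: "fourier h xi = fourier_g lam f xi"
   let ?t = "\<bar>xi\<bar> powr lam" and ?F = "(cmod (fourier f xi))^2"
   have h: "(cmod (fourier h xi))^2 = ?t^2 * ?F" unfolding e fourier_g_def by (simp add: norm_mult power_mult_distrib)
   have "0 \<le> ?t" by simp
   then have "?t \<le> 1 + ?t^2" using sum_squares_bound[of 1 ?t] unfolding power_one by linarith
   then have "?t * ?F \<le> (1 + ?t^2) * ?F" by (intro mult_right_mono) auto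
   then show "norm ((cmod (weighted lam f xi))^2) \<le> norm (?F + (cmod (fourier h xi))^2)"
    unfolding h cmod_weighted by (simp add: algebra_simps)
  qed
 qed
 then show ?thesis using L by (simp add: H_fourier_def)
qed

text \<open>Where the fractional Laplacian is a square-integrable function, Parseval's identity
  makes the pairing an ordinary integral. This connects the equation, which holds pointwise almost
  everywhere, with the scheme.\<close>

lemma is_g_pairing:
 assumes "is_g lam f h" and v: "L2c v" "!!x. \<bar>v x\<bar> \<le> M" "AE x in lborel. isCont v x"
 shows "g_pairing lam f v = (LBINT x. h x * v x)"
proof -
 have L: "L2_on UNIV f" "L2_on UNIV h" "L2_on UNIV v" and e: "AE xi in lborel. fourier h xi = fourier_g lam f xi"
  using assms by (auto simp: is_g_def L2c_def L2_on_UNIV)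
 have [measurable]: "(%xi. cnj (fourier v xi)) \<in> borel_measurable borel" by (rule borel_measurable_cnj[OF fourier_measurable[OF L(3)]])
 note [measurable] = fourier_measurable[OF L(1)] fourier_measurable[OF L(2)]
 have "(LBINT xi. fourier_g lam f xi * cnj (fourier v xi)) = (LBINT xi. fourier h xi * cnj (fourier v xi))"
 proof (rule integral_cong_AE)
  show "AE xi in lborel. fourier_g lam f xi * cnj (fourier v xi) = fourier h xi * cnj (fourier v xi)"
   using e by eventually_elim simp
 qed (simp_all add: fourier_g_def)
 then show ?thesis using fourier_Parseval[OF L(2) v] by (simp add: g_pairing_def)
qed

section \<open>Test functions and the du Bois-Reymond lemma\<close>

text \<open>Derivatives are quantified existentially at each order, so closure under sums, products
  and affine substitutions is a direct induction with the rules of differentiation.\<close>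

fun Ck :: "nat => (real => real) => bool" where
 "Ck 0 f = continuous_on UNIV f"
| "Ck (Suc n) f = (\<exists>f'. (\<forall>x. (f has_real_derivative f' x) (at x)) \<and> Ck n f')"

definition smooth :: "(real => real) => bool" where
 "smooth f \<longleftrightarrow> (\<forall>n. Ck n f)"

lemma Ck_Suc_D: "Ck (Suc n) f ==> Ck n f"
proof (induction n arbitrary: f)
 case 0
 then obtain f' where "!!x. (f has_real_derivative f' x) (at x)" by auto
 then have "isCont f x" for x by (rule DERIV_isCont)
 then show ?case by (simp add: continuous_on_eq_continuous_at)
next
 case (Suc n)
 then obtain f' where "!!x. (f has_real_derivative f' x) (at x)" "Ck (Suc n) f'" by auto
 with Suc.IH[of f'] show ?case by auto
qed

lemma Ck_const: "Ck n (%x. c)"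
proof (induction n arbitrary: c)
 case (Suc n)
 have "\<forall>x. ((%x. c) has_real_derivative 0) (at x)" by simp
 then show ?case using Suc[of 0] unfolding Ck.simps by (intro exI[of _ "%x. 0"]) simp
qed simp

lemma Ck_add: "Ck n f ==> Ck n g ==> Ck n (%x. f x + g x)"
proof (induction n arbitrary: f g)
 case (Suc n)
 then obtain f' g' where "!!x. (f has_real_derivative f' x) (at x)" "Ck n f'"
  "!!x. (g has_real_derivative g' x) (at x)" "Ck n g'" by auto
 with Suc.IH[of f' g'] show ?case
  unfolding Ck.simps by (intro exI[of _ "%x. f' x + g' x"]) (simp add: DERIV_add)
qed (auto intro: continuous_intros)

lemma Ck_mult: "Ck n f ==> Ck n g ==> Ck n (%x. f x * g x)"
proof (induction n arbitrary: f g)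
 case (Suc n)
 then obtain f' g' where d: "!!x. (f has_real_derivative f' x) (at x)" "Ck n f'"
  "!!x. (g has_real_derivative g' x) (at x)" "Ck n g'" by auto
 have "Ck n (%x. f' x * g x + g' x * f x)"
  using d Ck_Suc_D[OF Suc.prems(1)] Ck_Suc_D[OF Suc.prems(2)] by (intro Ck_add Suc.IH)
 then show ?case using DERIV_mult[OF d(1) d(3)] unfolding Ck.simps
  by (intro exI[of _ "%x. f' x * g x + g' x * f x"]) simp
qed (auto intro: continuous_intros)

lemma Ck_affine: "Ck n f ==> Ck n (%x. f (a * x + b))"
proof (induction n arbitrary: f)
 case 0
 then have "continuous_on UNIV f" by simp
 moreover have "continuous_on UNIV (%x. a * x + b)" by (intro continuous_intros)
 ultimately show ?case using continuous_on_compose2[of UNIV f UNIV "%x. a * x + b"] by simp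
next
 case (Suc n)
 then obtain f' where d: "!!x. (f has_real_derivative f' x) (at x)" "Ck n f'" by auto
 have "((%x. f (a * x + b)) has_real_derivative f' (a * x + b) * a) (at x)" for x
  by (rule DERIV_chain2[OF d(1)]) (auto intro!: derivative_eq_intros)
 moreover have "Ck n (%x. f' (a * x + b) * a)" by (rule Ck_mult[OF Suc.IH[OF d(2)] Ck_const])
 ultimately show ?case unfolding Ck.simps by (intro exI[of _ "%x. f' (a * x + b) * a"]) simp
qed

lemma smooth_const [simp]: "smooth (%x. c)"
 unfolding smooth_def by (intro allI Ck_const)

lemma smooth_add: "smooth f ==> smooth g ==> smooth (%x. f x + g x)"
 unfolding smooth_def by (simp only: Ck_add simp_thms)

lemma smooth_mult: "smooth f ==> smooth g ==> smooth (%x. f x * g x)"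
 unfolding smooth_def by (simp only: Ck_mult simp_thms)

lemma smooth_affine: "smooth f ==> smooth (%x. f (a * x + b))"
 unfolding smooth_def using Ck_affine by meson

lemma smooth_continuous: "smooth f ==> continuous_on S f"
 unfolding smooth_def using Ck.simps(1) continuous_on_subset by blast

lemma smooth_derivative:
 assumes "smooth f" obtains f' where "smooth f'" "!!x. (f has_real_derivative f' x) (at x)"
proof -
 obtain f' where f': "!!n x. (f has_real_derivative f' n x) (at x)" "!!n. Ck n (f' n)"
 proof -
  have "\<forall>n. \<exists>f'. (\<forall>x. (f has_real_derivative f' x) (at x)) \<and> Ck n f'"
   using assms unfolding smooth_def by (intro allI) (metis Ck.simps(2))
  from choice[OF this] show ?thesis using that by blast
 qed
 \<comment> \<open>Each order supplies its own derivative, but derivatives are unique, so one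
   function serves all orders.\<close>
 have "f' n = f' 0" for n using DERIV_unique[OF f'(1) f'(1)] by blast
 then have "smooth (f' 0)" using f'(2) unfolding smooth_def by metis
 then show ?thesis using that f'(1) by blast
qed

lemma smooth_primitive:
 assumes "smooth f'" "!!x. (f has_real_derivative f' x) (at x)" shows "smooth f"
 unfolding smooth_def
proof
 fix n show "Ck n f"
  using assms unfolding smooth_def by (blast intro: Ck_Suc_D Ck.simps(2)[THEN iffD2])
qed

section \<open>Smooth functions of compact support on the line\<close>

definition flat :: "nat => real => real" where
 "flat m x = (if x > 0 then exp (- 1 / x) / x ^ m else 0)"

lemma flat_tendsto: "((%x. exp (- 1 / x) / x ^ m) \<longlongrightarrow> 0) (at_right (0::real))"
proof -
 have "((%y. y ^ m / exp y) \<longlongrightarrow> 0) (at_top :: real filter)" by (rule tendsto_power_div_exp_0)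
 then have "((%x. (inverse x) ^ m / exp (inverse x)) \<longlongrightarrow> 0) (at_right (0::real))"
  by (rule filterlim_compose) (rule filterlim_inverse_at_top_right)
 then show ?thesis by (simp add: exp_minus divide_inverse power_inverse mult.commute)
qed

text \<open>The family is closed under differentiation: the inner derivative of the exponential
  raises the order of the pole by 2, the power rule by 1. At 0 the exponential beats every power, so
  the difference quotients vanish from the right as well.\<close>

lemma flat_DERIV: "(flat m has_real_derivative (flat (m + 2) x - real m * flat (m + 1) x)) (at x)"
proof (cases x "0::real" rule: linorder_cases)
 case less
 have "((%x. 0) has_real_derivative 0) (at x)" by simp
 then have "(flat m has_real_derivative 0) (at x)"
  by (rule has_field_derivative_transform_within_open[of _ _ _ "{..<0}"]) (use less in \<open>auto simp: flat_def\<close>)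
 then show ?thesis using less by (simp add: flat_def)
next
 case equal
 have "((%h. (flat m (0 + h) - flat m 0) / h) \<longlongrightarrow> 0) (at 0)"
 proof (rule filterlim_split_at)
  have "\<forall>\<^sub>F h in at_left (0::real). (flat m (0 + h) - flat m 0) / h = 0"
   by (simp add: eventually_at_filter flat_def)
  then show "((%h. (flat m (0 + h) - flat m 0) / h) \<longlongrightarrow> 0) (at_left 0)" by (rule tendsto_eventually)
  have "\<forall>\<^sub>F h in at_right (0::real). exp (- 1 / h) / h ^ (m + 1) = (flat m (0 + h) - flat m 0) / h"
   using eventually_at_right_less[of "0::real"] by eventually_elim (simp add: flat_def)
  then show "((%h. (flat m (0 + h) - flat m 0) / h) \<longlongrightarrow> 0) (at_right 0)"
   by (rule Lim_transform_eventually[OF flat_tendsto])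
 qed
 then show ?thesis using equal by (simp add: DERIV_def flat_def)
next
 case greater
 have "((%x. exp (- 1 / x) / x ^ m) has_real_derivative (flat (m + 2) x - real m * flat (m + 1) x)) (at x)"
 proof -
  have "((%x. exp (- inverse x) * inverse x ^ m) has_real_derivative
    exp (- inverse x) * inverse (x ^ 2) * inverse x ^ m - exp (- inverse x) * (real m * inverse x ^ (m + 1))) (at x)"
  proof -
   have i: "(inverse has_real_derivative - inverse (x ^ 2)) (at x)"
    using greater DERIV_inverse[of x] by (simp add: numeral_2_eq_2)
   have e: "((%x. exp (- inverse x)) has_real_derivative exp (- inverse x) * inverse (x ^ 2)) (at x)"
    using DERIV_chain2[OF DERIV_exp DERIV_minus[OF i]] by simp
   have p: "((%x. inverse x ^ m) has_real_derivative real m * inverse x ^ (m - 1) * (- inverse (x ^ 2))) (at x)"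
    using DERIV_power[OF i, of m] by (simp add: mult_ac)
   have eq: "real m * inverse x ^ (m - 1) * (- inverse (x ^ 2)) = - (real m * inverse x ^ (m + 1))"
    by (cases m) (auto simp: power2_eq_square power_inverse)
   then show ?thesis using DERIV_mult[OF e p] by (elim DERIV_cong) (simp only: eq, simp add: algebra_simps)
  qed
  then show ?thesis using greater by (simp add: flat_def divide_inverse power_inverse power2_eq_square mult_ac)
 qed
 then show ?thesis
  by (rule has_field_derivative_transform_within_open[of _ _ _ "{0<..}"]) (use greater in \<open>auto simp: flat_def\<close>)
qed

lemma smooth_flat: "smooth (flat m)"
proof -
 have "Ck n (flat m)" for n
 proof (induction n arbitrary: m)
  case 0
  then show ?case using DERIV_isCont[OF flat_DERIV] by (simp add: continuous_on_eq_continuous_at)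
 next
  case (Suc n)
  have "Ck n (%x. flat (m + 2) x + (- real m) * flat (m + 1) x)"
   by (intro Ck_add Ck_mult Ck_const Suc)
  then show ?case using flat_DERIV[of m] unfolding Ck.simps
   by (intro exI[of _ "%x. flat (m + 2) x - real m * flat (m + 1) x"]) simp
 qed
 then show ?thesis by (simp add: smooth_def)
qed

definition TF :: "real => real => (real => real) => bool" where
 "TF l r theta \<longleftrightarrow> smooth theta \<and> (\<exists>a b. l < a \<and> a \<le> b \<and> b < r \<and> (\<forall>x. x \<notin> {a..b} --> theta x = 0))"

text \<open>\<open>n\<close> is a steepness: for fixed end points the functions tend to the
  indicator of the open interval. For \<open>b \<le> a\<close> the function is identically
  zero.\<close>

definition bump :: "nat => real => real => real => real" where
 "bump n a b x = flat 0 (real n * (x - a)) * flat 0 (real n * (b - x))"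

lemma flat0_bounds: "0 \<le> flat 0 x" "flat 0 x \<le> 1"
 by (auto simp: flat_def)

lemma bump_bounds: "0 \<le> bump n a b x" "bump n a b x \<le> 1"
 unfolding bump_def using flat0_bounds by (auto intro: mult_nonneg_nonneg mult_le_one)

lemma bump_zero: "x \<notin> {a<..<b} ==> bump n a b x = 0"
 by (auto simp: bump_def flat_def zero_less_mult_iff)

lemma smooth_bump: "smooth (bump n a b)"
proof -
 have "smooth (%x. flat 0 (real n * x + - (real n * a)) * flat 0 ((- real n) * x + real n * b))"
  by (rule smooth_mult[OF smooth_affine[OF smooth_flat] smooth_affine[OF smooth_flat]])
 then show ?thesis by (simp add: bump_def[abs_def] algebra_simps)
qed

lemma TF_bump: "l < a ==> b < r ==> l < r ==> TF l r (bump n a b)"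
proof (cases "a \<le> b")
 case True
 assume "l < a" "b < r"
 then show ?thesis unfolding TF_def using smooth_bump bump_zero[of _ a b] True
  by (intro conjI exI[of _ a] exI[of _ b]) auto
next
 case False
 assume "l < a" "b < r" "l < r"
 moreover obtain m where "l < m" "m < r" using \<open>l < r\<close> dense by blast
 ultimately show ?thesis unfolding TF_def using smooth_bump bump_zero[of _ a b n] False
  by (intro conjI exI[of _ m]) auto
qed

lemma flat0_tendsto:
 assumes "filterlim g at_top F" shows "((%n. flat 0 (g n)) \<longlongrightarrow> 1) F"
proof -
 have "((%n. exp (- inverse (g n))) \<longlongrightarrow> exp (- 0)) F"
  by (intro tendsto_intros tendsto_inverse_0_at_top assms)
 moreover have "\<forall>\<^sub>F n in F. exp (- inverse (g n)) = flat 0 (g n)"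
  using filterlim_at_top_dense[THEN iffD1, OF assms, rule_format, of 0]
  by eventually_elim (simp add: flat_def divide_inverse)
 ultimately show ?thesis using Lim_transform_eventually by force
qed

text \<open>The end points move with \<open>n\<close> because the supports have to stay in the
  interior while the limit is the indicator of the full interval, outside of which all members
  vanish.\<close>

lemma bump_tendsto:
 assumes a: "a' \<longlonglongrightarrow> a" "!!n. a \<le> a' n" and b: "b' \<longlonglongrightarrow> b" "!!n. b' n \<le> b"
 shows "(%n. bump n (a' n) (b' n) x) \<longlonglongrightarrow> indicator {a<..<b} x"
proof (cases "x \<in> {a<..<b}")
 case True
 have "filterlim (%n. real n * (x - a' n)) at_top sequentially"
  by (rule filterlim_at_top_mult_tendsto_pos[of _ "x - a"])
    (use True a in \<open>auto intro!: tendsto_intros filterlim_real_sequentially\<close>)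
 moreover have "filterlim (%n. real n * (b' n - x)) at_top sequentially"
  by (rule filterlim_at_top_mult_tendsto_pos[of _ "b - x"])
    (use True b in \<open>auto intro!: tendsto_intros filterlim_real_sequentially\<close>)
 ultimately have "(%n. bump n (a' n) (b' n) x) \<longlonglongrightarrow> 1 * 1"
  unfolding bump_def by (intro tendsto_mult flat0_tendsto)
 then show ?thesis using True by simp
next
 case False
 have "bump n (a' n) (b' n) x = 0" for n
 proof (rule bump_zero)
  show "x \<notin> {a' n<..<b' n}" using False a(2)[of n] b(2)[of n] by auto
 qed
 then show ?thesis using False by simp
qed

lemma TF_smooth: "TF l r theta ==> smooth theta"
 by (simp add: TF_def)

lemma TF_bounded: assumes "TF l r theta" shows "\<exists>M. \<forall>x. \<bar>theta x\<bar> \<le> M"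
proof -
 obtain a b where ab: "!!x. x \<notin> {a..b} ==> theta x = 0" using assms by (auto simp: TF_def)
 have "bounded (theta ` {a..b})"
  by (intro compact_imp_bounded compact_continuous_image compact_Icc smooth_continuous TF_smooth[OF assms])
 then obtain M where M: "!!x. x \<in> {a..b} ==> \<bar>theta x\<bar> \<le> M" unfolding bounded_iff by fastforce
 have "\<bar>theta x\<bar> \<le> max M 0" for x using M[of x] ab[of x] by (cases "x \<in> {a..b}") auto
 then show ?thesis by blast
qed

lemma smooth_measurable: "smooth theta ==> theta \<in> borel_measurable borel"
 by (intro borel_measurable_continuous_onI smooth_continuous)

lemma TF_zero_outside: "TF l r theta ==> x \<notin> {l<..<r} ==> theta x = 0"
 by (force simp: TF_def)

lemma TF_derivative:
 assumes "TF l r theta" "!!x. (theta has_real_derivative theta' x) (at x)"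
 shows "TF l r theta'"
proof -
 obtain a b where ab: "l < a" "a \<le> b" "b < r" "!!x. x \<notin> {a..b} ==> theta x = 0" using assms by (auto simp: TF_def)
 obtain f' where f': "smooth f'" "!!x. (theta has_real_derivative f' x) (at x)" using smooth_derivative[OF TF_smooth[OF assms(1)]] by blast
 have "f' = theta'" using DERIV_unique[OF f'(2) assms(2)] by blast
 moreover have "theta' x = 0" if "x \<notin> {a..b}" for x
 proof -
  have "((%x. 0) has_real_derivative 0) (at x)" by simp
  then have "(theta has_real_derivative 0) (at x)"
   by (rule has_field_derivative_transform_within_open[of _ _ _ "- {a..b}"]) (use ab that in auto)
  then show ?thesis using DERIV_unique assms(2) by blast
 qed
 ultimately show ?thesis using f' ab by (auto simp: TF_def)
qed

lemma TF_integrable: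
 assumes "TF l r theta" shows "integrable lborel theta"
proof -
 obtain a b where ab: "!!x. x \<notin> {a..b} ==> theta x = 0" using assms by (auto simp: TF_def)
 have "integrable lborel (%x. indicator {a..b} x *\<^sub>R theta x)"
  using borel_integrable_compact[OF compact_Icc smooth_continuous[OF TF_smooth[OF assms]], of a b]
  by (simp add: indicator_def if_distrib cong: if_cong)
 also have "(%x. indicator {a..b} x *\<^sub>R theta x) = theta" using ab by (auto simp: indicator_def fun_eq_iff)
 finally show ?thesis .
qed

lemma TF_lin: assumes "TF l r theta" "TF l r psi" shows "TF l r (%x. \<alpha> * theta x + \<beta> * psi x)"
proof -
 obtain a b where ab: "l < a" "a \<le> b" "b < r" "!!x. x \<notin> {a..b} ==> theta x = 0" using assms by (auto simp: TF_def)
 obtain c d where cd: "l < c" "c \<le> d" "d < r" "!!x. x \<notin> {c..d} ==> psi x = 0" using assms by (auto simp: TF_def)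
 have "\<alpha> * theta x + \<beta> * psi x = 0" if "x \<notin> {min a c..max b d}" for x
 proof -
  have "x \<notin> {a..b}" "x \<notin> {c..d}" using that by auto
  then show ?thesis using ab(4)[of x] cd(4)[of x] by simp
 qed
 moreover have "smooth (%x. \<alpha> * theta x + \<beta> * psi x)" using assms by (auto simp: TF_def intro!: smooth_add smooth_mult)
 ultimately show ?thesis unfolding TF_def using ab cd
  by (intro conjI exI[of _ "min a c"] exI[of _ "max b d"]) auto
qed

lemma TF_integral_upto:
 assumes "TF l r theta" "!!x. (theta has_real_derivative theta' x) (at x)"
 shows "(LBINT y. indicator {s<..} y * theta' y) = - theta s"
proof -
 obtain a b where ab: "!!x. x \<notin> {a..b} ==> theta' x = 0" using TF_derivative[OF assms] by (auto simp: TF_def)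
 obtain c d where cd: "!!x. x \<notin> {c..d} ==> theta x = 0" using assms by (auto simp: TF_def)
 \<comment> \<open>A point at or beyond \<open>s\<close> and to the right of the supports of
   \<open>theta\<close> and \<open>theta'\<close>, where \<open>theta\<close> already
   vanishes.\<close>
 let ?e = "max s (max b d + 1)"
 have "(LBINT y. indicator {s<..} y * theta' y) = (LBINT y:{s<..<?e}. theta' y)"
  unfolding set_lebesgue_integral_def
 proof (rule LBINT_cong[OF refl])
  fix y show "indicator {s<..} y * theta' y = indicator {s<..<?e} y *\<^sub>R theta' y"
   using ab[of y] by (cases "y \<in> {a..b}") (auto simp: indicator_def)
 qed
 also have "\<dots> = theta ?e - theta s"
  by (rule integral_FTC_open) (use assms TF_derivative[OF assms] in \<open>auto intro: smooth_continuous TF_smooth\<close>)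
 also have "\<dots> = - theta s"
 proof (cases "s < max b d + 1")
  case True
  then have "?e \<notin> {c..d}" by auto
  then show ?thesis using cd[of ?e] by simp
 next
  case False
  then have "s \<notin> {c..d}" "?e = s" by auto
  then show ?thesis using cd[of s] by simp
 qed
 finally show ?thesis .
qed

text \<open>A primitive that vanishes to the left of the support vanishes to the right of it as well
  precisely because the total integral is zero.\<close>

lemma TF_primitive:
 assumes "TF l r \<eta>" "(LBINT x. \<eta> x) = 0"
 obtains H where "TF l r H" "!!x. (H has_real_derivative \<eta> x) (at x)"
proof -
 obtain a b where ab: "l < a" "a \<le> b" "b < r" "!!x. x \<notin> {a..b} ==> \<eta> x = 0" using assms by (auto simp: TF_def)
 have c: "isCont \<eta> x" for x
  using smooth_continuous[OF TF_smooth[OF assms(1)], of UNIV] by (simp add: continuous_on_eq_continuous_at)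
 obtain G where G: "!!x. (G has_vector_derivative \<eta> x) (at x)"
  using einterval_antiderivative[of "-\<infinity>" "\<infinity>" \<eta>] c by auto
 define H where "H x = G x - G a" for x
 have H: "(H has_real_derivative \<eta> x) (at x)" for x
  unfolding H_def using DERIV_diff[OF G[of x, folded has_real_derivative_iff_has_vector_derivative] DERIV_const[of "G a"]] by simp
 have FTC: "(LBINT y:{x<..<y}. \<eta> y) = H y - H x" if "x \<le> y" for x y
  by (rule integral_FTC_open[OF that H smooth_continuous[OF TF_smooth[OF assms(1)]]])
 have "H x = 0" if "x \<notin> {a..b}" for x
 proof (cases "x < a")
  case True
  have "(LBINT y:{x<..<a}. \<eta> y) = 0" unfolding set_lebesgue_integral_def
   by (rule integral_eq_zero_AE) (use ab in \<open>auto simp: indicator_def\<close>)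
  then show ?thesis using FTC[of x a] True by (simp add: H_def)
 next
  case False
  then have xb: "b < x" using that by auto
  have ax: "a < x" using xb ab by simp
  have "(LBINT y:{a<..<x}. \<eta> y) = (LBINT y. \<eta> y)" unfolding set_lebesgue_integral_def
  proof (rule integral_discrete_difference[where X="{a}"])
   fix y assume "y \<notin> {a}"
   then show "indicator {a<..<x} y *\<^sub>R \<eta> y = \<eta> y" using ab(4)[of y] xb by (cases "y \<in> {a..b}") auto
  qed auto
  then show ?thesis using FTC[of a x] ax assms(2) by (simp add: H_def)
 qed
 then have "TF l r H" using ab smooth_primitive[OF TF_smooth[OF assms(1)] H] by (auto simp: TF_def)
 then show ?thesis using that H by blast
qed

section \<open>Products of one-dimensional test functions in the plane\<close>

lemma Basis_real2: "(Basis :: (real \<times> real) set) = {(1, 0), (0, 1)}"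
 by (auto simp: Basis_prod_def)

lemma tensor_has_derivative:
 assumes "!!x. (f has_real_derivative f' x) (at x)" "!!x. (g has_real_derivative g' x) (at x)"
 shows "((%z. f (fst z) * g (snd z)) has_derivative (%h. f' (fst z) * fst h * g (snd z) + f (fst z) * (g' (snd z) * snd h))) (at z)"
proof -
 have 1: "((%z. f (fst z)) has_derivative (%h. f' (fst z) * fst h)) (at z)"
  using has_derivative_compose[of fst fst z UNIV f "(*) (f' (fst z))"] assms(1)[of "fst z"]
  by (simp add: has_field_derivative_def has_derivative_fst)
 have 2: "((%z. g (snd z)) has_derivative (%h. g' (snd z) * snd h)) (at z)"
  using has_derivative_compose[of snd snd z UNIV g "(*) (g' (snd z))"] assms(2)[of "snd z"]
  by (simp add: has_field_derivative_def has_derivative_snd)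
 show ?thesis using has_derivative_mult[OF 1 2] by (simp add: algebra_simps)
qed

lemma partial_tensor:
 assumes "!!x. (f has_real_derivative f' x) (at x)" "!!x. (g has_real_derivative g' x) (at x)"
 shows "partial (1, 0) (%z. f (fst z) * g (snd z)) = (%z. f' (fst z) * g (snd z))"
  and "partial (0, 1) (%z. f (fst z) * g (snd z)) = (%z. f (fst z) * g' (snd z))"
 unfolding partial_def using frechet_derivative_at[OF tensor_has_derivative[OF assms], symmetric]
 by (auto simp: fun_eq_iff)

lemma iter_partial_tensor:
 assumes "smooth f" "smooth g" "set bs \<subseteq> Basis"
 shows "\<exists>f' g'. smooth f' \<and> smooth g' \<and> iter_partial bs (%z::real \<times> real. f (fst z) * g (snd z)) = (%z. f' (fst z) * g' (snd z))"
 using assms(3)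
proof (induction bs)
 case Nil
 then show ?case using assms by (auto simp: iter_partial_def)
next
 case (Cons b bs)
 then obtain f1 g1 where 1: "smooth f1" "smooth g1" "iter_partial bs (%z::real \<times> real. f (fst z) * g (snd z)) = (%z. f1 (fst z) * g1 (snd z))"
  by auto
 obtain f2 where 2: "smooth f2" "!!x. (f1 has_real_derivative f2 x) (at x)" using smooth_derivative[OF 1(1)] by blast
 obtain g2 where 3: "smooth g2" "!!x. (g1 has_real_derivative g2 x) (at x)" using smooth_derivative[OF 1(2)] by blast
 have "iter_partial (b # bs) (%z::real \<times> real. f (fst z) * g (snd z)) = partial b (%z. f1 (fst z) * g1 (snd z))"
  using 1(3) by (simp add: iter_partial_def)
 moreover have "b = (1, 0) \<or> b = (0, 1)" using Cons.prems by (auto simp: Basis_real2)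
 ultimately show ?case using partial_tensor[OF 2(2) 3(2)] 1(1,2) 2(1) 3(1)
  by (elim disjE) (force intro!: exI)+
qed

lemma test_function_tensor:
 assumes "TF l r theta" "TF p q psi" "{l<..<r} \<times> {p<..<q} \<subseteq> \<Omega>"
 shows "test_function \<Omega> (%z. theta (fst z) * psi (snd z))"
proof -
 obtain a b where ab: "l < a" "b < r" "!!x. x \<notin> {a..b} ==> theta x = 0" using assms by (auto simp: TF_def)
 obtain c d where cd: "p < c" "d < q" "!!x. x \<notin> {c..d} ==> psi x = 0" using assms by (auto simp: TF_def)
 have "compact ({a..b} \<times> {c..d})" by (intro compact_Times compact_Icc)
 moreover have "{a..b} \<times> {c..d} \<subseteq> \<Omega>" using assms(3) ab cd by force
 moreover have "theta (fst z) * psi (snd z) = 0" if "z \<notin> {a..b} \<times> {c..d}" for z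
  using that ab(3)[of "fst z"] cd(3)[of "snd z"] by (cases z) auto
 moreover have "iter_partial bs (%z. theta (fst z) * psi (snd z)) differentiable (at z)" if bs: "set bs \<subseteq> Basis" for bs and z :: "real \<times> real"
 proof -
  obtain f g where fg: "smooth f" "smooth g" "iter_partial bs (%z::real \<times> real. theta (fst z) * psi (snd z)) = (%z. f (fst z) * g (snd z))"
   using iter_partial_tensor[OF TF_smooth[OF assms(1)] TF_smooth[OF assms(2)] bs] by blast
  obtain f' where f': "!!x. (f has_real_derivative f' x) (at x)" using smooth_derivative[OF fg(1)] by metis
  obtain g' where g': "!!x. (g has_real_derivative g' x) (at x)" using smooth_derivative[OF fg(2)] by metis
  show ?thesis unfolding fg(3) using tensor_has_derivative[OF f' g'] differentiableI by blast
 qed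
 ultimately show ?thesis unfolding test_function_def by blast
qed

text \<open>The positive and the negative part of \<open>f\<close> are densities of two measures
  that agree on boxes, a generator closed under intersection. So the measures, and hence the
  densities, agree.\<close>

lemma AE_zero_if_box_integrals_zero:
 fixes f :: "'a::euclidean_space => real"
 assumes f: "integrable lborel f" and z: "!!a b. (LBINT x. indicator (box a b) x * f x) = 0"
 shows "AE x in lborel. f x = 0"
proof -
 have [measurable]: "f \<in> borel_measurable borel" using f by auto
 let ?P = "%x. ennreal (f x)" and ?N = "%x. ennreal (- f x)"
 have e: "emeasure (density lborel ?P) (box a b) = emeasure (density lborel ?N) (box a b)" for a b
 proof -
  have i: "integrable lborel (%x. indicator (box a b) x * f x)"
   by (rule integrable_le[OF f]) (auto simp: indicator_def)
  let ?X = "\<integral>\<^sup>+ x. ennreal (indicator (box a b) x * f x) \<partial>lborel"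
  let ?Y = "\<integral>\<^sup>+ x. ennreal (- (indicator (box a b) x * f x)) \<partial>lborel"
  have "enn2real ?X = enn2real ?Y"
   using real_lebesgue_integral_def[OF i] z[of a b] by simp
  moreover have "?X < \<infinity>" "?Y < \<infinity>" using i by (auto simp: real_integrable_def less_top)
  ultimately have "?X = ?Y" by (metis ennreal_enn2real infinity_ennreal_def)
  moreover have "emeasure (density lborel ?P) (box a b) = ?X"
   by (simp add: emeasure_density) (rule nn_integral_cong, auto simp: indicator_def)
  moreover have "emeasure (density lborel ?N) (box a b) = ?Y"
   by (simp add: emeasure_density) (rule nn_integral_cong, auto simp: indicator_def)
  ultimately show ?thesis by simp
 qed
 have "density lborel ?P = density lborel ?N"
 proof (rule measure_eqI_generator_eq)
  let ?E = "range (%(a, b). box a b :: 'a set)"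
  show "Int_stable ?E" by (auto simp: Int_stable_def box_Int_box)
  show "?E \<subseteq> Pow UNIV" "sets (density lborel ?P) = sigma_sets UNIV ?E" "sets (density lborel ?N) = sigma_sets UNIV ?E"
   by (simp_all add: borel_eq_box)
  let ?A = "%n::nat. box (- (real n *\<^sub>R One)) (real n *\<^sub>R One) :: 'a set"
  show "range ?A \<subseteq> ?E" "(\<Union>i. ?A i) = UNIV" unfolding UN_box_eq_UNIV by auto
  show "emeasure (density lborel ?P) (?A i) \<noteq> \<infinity>" for i
  proof -
   have "emeasure (density lborel ?P) (?A i) \<le> (\<integral>\<^sup>+ x. ?P x \<partial>lborel)"
    by (simp add: emeasure_density) (rule nn_integral_mono, auto simp: indicator_def)
   also have "\<dots> < \<infinity>" using f by (auto simp: real_integrable_def less_top)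
   finally show ?thesis by simp
  qed
  show "emeasure (density lborel ?P) X = emeasure (density lborel ?N) X" if "X \<in> ?E" for X using that e by auto
 qed
 then have "AE x in lborel. ?P x = ?N x"
  using f by (intro sigma_finite_measure.density_unique[OF sigma_finite_lborel]) auto
 then show ?thesis
 proof eventually_elim
  fix x assume "ennreal (f x) = ennreal (- f x)"
  then show "f x = 0" by (cases "f x \<ge> 0") (auto simp: ennreal_neg ennreal_eq_0_iff)
 qed
qed

section \<open>Fubini in the plane and the du Bois-Reymond lemma\<close>

lemma lborel2_Fubini:
 fixes h :: "real \<times> real => real"
 assumes "integrable lborel h"
 shows "(LBINT w. h w) = (LBINT z. LBINT y. h (y, z))"
  and "AE z in lborel. integrable lborel (%y. h (y, z))"
  and "integrable lborel (%z. LBINT y. h (y, z))"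
  and "(LBINT w. h w) = (LBINT y. LBINT z. h (y, z))"
  and "AE y in lborel. integrable lborel (%z. h (y, z))"
  and "integrable lborel (%y. LBINT z. h (y, z))"
proof -
 have i: "integrable (lborel \<Otimes>\<^sub>M lborel) (%(y, z). h (y, z))"
  using assms by (simp add: lborel_prod)
 show "(LBINT w. h w) = (LBINT z. LBINT y. h (y, z))"
  using lborel_pair.integral_snd[OF i] by (simp add: lborel_prod)
 show "AE z in lborel. integrable lborel (%y. h (y, z))" by (rule lborel_pair.AE_integrable_snd[OF i])
 show "integrable lborel (%z. LBINT y. h (y, z))" by (rule lborel_pair.integrable_snd[OF i])
 show "(LBINT w. h w) = (LBINT y. LBINT z. h (y, z))"
  using lborel_pair.integral_fst[OF i] by (simp add: lborel_prod)
 show "AE y in lborel. integrable lborel (%z. h (y, z))" by (rule lborel_pair.AE_integrable_fst[OF i])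
 show "integrable lborel (%y. LBINT z. h (y, z))" by (rule lborel_pair.integrable_fst[OF i])
qed

lemma borel_measurable_pair_iff:
 "h \<in> borel_measurable (borel :: (real \<times> real) measure) \<longleftrightarrow> h \<in> borel_measurable (borel \<Otimes>\<^sub>M borel)"
 by (simp add: borel_prod)

lemma integrable_tensor:
 fixes f g :: "real => real"
 assumes "integrable lborel f" "integrable lborel g"
 shows "integrable lborel (%w. f (fst w) * g (snd w))"
proof -
 have [measurable]: "f \<in> borel_measurable borel" "g \<in> borel_measurable borel" using assms by auto
 have "integrable (lborel \<Otimes>\<^sub>M lborel) (%w. f (fst w) * g (snd w))"
 proof (rule lborel_pair.Fubini_integrable)
  show "(%w. f (fst w) * g (snd w)) \<in> borel_measurable (lborel \<Otimes>\<^sub>M lborel)"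
   by (simp cong: measurable_cong_sets)
  show "integrable lborel (%x. LBINT y. norm (f (fst (x, y)) * g (snd (x, y))))"
   using assms by (simp add: abs_mult)
  show "AE x in lborel. integrable lborel (%y. f (fst (x, y)) * g (snd (x, y)))"
   using assms by simp
 qed
 then show ?thesis by (simp add: lborel_prod)
qed

lemma integrable_mult_bounded:
 fixes h g :: "'a => real"
 assumes "integrable M h" "g \<in> borel_measurable M" "!!x. \<bar>g x\<bar> \<le> K"
 shows "integrable M (%x. h x * g x)"
proof (rule integrable_le)
 show "integrable M (%x. K * h x)" using assms by simp
 have "0 \<le> K" using assms(3) abs_ge_zero order_trans by blast
 then show "AE x in M. norm (h x * g x) \<le> norm (K * h x)"
  using assms(3) by (intro AE_I2) (simp add: abs_mult mult.commute mult_right_mono)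
qed (use assms in auto)

text \<open>Fubini on the triangle \<open>s < y\<close>. It replaces integration by parts for
  absolutely continuous functions: in the du Bois-Reymond lemma, on the cells, and for the square of
  a primitive.\<close>

lemma primitive_swap:
 fixes f m :: "real => real"
 assumes f: "integrable lborel f" and m: "integrable lborel m"
 shows "(LBINT y. (LBINT s. (if s < y then f s else 0)) * m y)
  = (LBINT s. f s * (LBINT y. indicator {s<..} y * m y))"
proof -
 have [measurable]: "f \<in> borel_measurable borel" "m \<in> borel_measurable borel" using assms by auto
 let ?h = "%w. (if fst w < snd w then f (fst w) else 0) * m (snd w)"
 have i: "integrable lborel ?h"
 proof (rule integrable_le[OF integrable_tensor[OF f m]])
  show "?h \<in> borel_measurable lborel" by (simp add: borel_measurable_pair_iff) measurable
 qed (auto simp: abs_mult)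
 have "(LBINT y. (LBINT s. (if s < y then f s else 0)) * m y) = (LBINT y. LBINT s. ?h (s, y))"
  unfolding fst_conv snd_conv by simp
 also have "\<dots> = (LBINT s. LBINT y. ?h (s, y))"
  using lborel2_Fubini(1)[OF i] lborel2_Fubini(4)[OF i] by simp
 also have "\<dots> = (LBINT s. f s * (LBINT y. indicator {s<..} y * m y))"
 proof (rule LBINT_cong[OF refl])
  fix s
  have "(LBINT y. ?h (s, y)) = (LBINT y. f s * (indicator {s<..} y * m y))"
   by (rule LBINT_cong) (auto simp: indicator_def)
  then show "(LBINT y. ?h (s, y)) = f s * (LBINT y. indicator {s<..} y * m y)" by simp
 qed
 finally show ?thesis .
qed

text \<open>After subtracting the primitive of \<open>B\<close>, the remainder annihilates all derivatives of test
 functions in the first variable, hence depends on the second variable only.\<close>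

lemma du_Bois_Reymond:
 fixes A B :: "real \<times> real => real"
 assumes lr: "l < r" and pq: "p < q" and A: "integrable lborel A" and B: "integrable lborel B"
  and zero: "!!w. w \<notin> {l<..<r} \<times> {p<..<q} ==> A w = 0 \<and> B w = 0"
  and weak: "!!theta theta' psi. TF l r theta ==> TF p q psi ==> (!!x. (theta has_real_derivative theta' x) (at x)) ==>
    (LBINT w. A w * (theta' (fst w) * psi (snd w))) = - (LBINT w. B w * (theta (fst w) * psi (snd w)))"
 shows "\<exists>C. AE z in lborel. AE y in lborel. y \<in> {l<..<r} -->
   A (y, z) = C z + (LBINT s. (if s < y then B (s, z) else 0))"
proof -
 have Am[measurable]: "A \<in> borel_measurable borel" and Bm[measurable]: "B \<in> borel_measurable borel" using A B by auto
 have Bm'[measurable]: "B \<in> borel_measurable (borel \<Otimes>\<^sub>M borel)" using Bm by (simp add: borel_measurable_pair_iff)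
 define F where "F w = (LBINT s. (if s < fst w then B (s, snd w) else 0))" for w :: "real \<times> real"
 have F_pair: "F (y, z) = (LBINT s. (if s < y then B (s, z) else 0))" for y z
  unfolding F_def fst_conv snd_conv ..
 have Fm[measurable]: "F \<in> borel_measurable borel"
 proof -
  have "(%w. LBINT s. (if s < fst w then B (s, snd w) else 0)) \<in> borel_measurable ((borel :: real measure) \<Otimes>\<^sub>M (borel :: real measure))"
   by measurable
  then show ?thesis unfolding F_def[abs_def] by (simp add: borel_prod)
 qed
 define I where "I w = (indicator {l<..<r} (fst w) :: real)" for w :: "real \<times> real"
 have Im[measurable]: "I \<in> borel_measurable borel" unfolding I_def[abs_def] by (simp add: borel_measurable_pair_iff)
 have iI: "integrable lborel (indicator {l<..<r} :: real => real)" using lr by (intro integrable_real_indicator) auto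
 define b1 where "b1 z = (LBINT s. \<bar>B (s, z)\<bar>)" for z
 have b1: "integrable lborel b1" unfolding b1_def[abs_def] using lborel2_Fubini(3)[of "%w. \<bar>B w\<bar>"] B by simp
 have Fb: "\<bar>F (y, z)\<bar> \<le> b1 z" if "integrable lborel (%s. B (s, z))" for y z
 proof -
  have "\<bar>F (y, z)\<bar> \<le> (LBINT s. \<bar>(if s < y then B (s, z) else 0)\<bar>)" unfolding F_def fst_conv snd_conv by (rule integral_abs_bound)
  also have "\<dots> \<le> b1 z" unfolding b1_def
  proof (rule Bochner_Integration.integral_mono)
   show "integrable lborel (%s. \<bar>(if s < y then B (s, z) else 0)\<bar>)"
    by (rule integrable_le[OF that]) (use that in auto)
  qed (use that in auto)
  finally show ?thesis .
 qed
 \<comment> \<open>The bound \<open>Fb\<close> holds only at second coordinates where the slice of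
   \<open>B\<close> is integrable; measurability of this set lifts the statement from almost every
   line to almost every point of the plane.\<close>
 have AEz: "AE w in (lborel :: (real \<times> real) measure). integrable lborel (%s. B (s, snd w))"
 proof -
  have [measurable]: "Measurable.pred (borel :: real measure) (%z. integrable lborel (%s. B (s, z)))"
   by measurable
  have "{w \<in> space ((lborel :: real measure) \<Otimes>\<^sub>M (lborel :: real measure)). integrable lborel (%s. B (s, snd w))} \<in> sets (lborel \<Otimes>\<^sub>M lborel)"
  proof -
   have "Measurable.pred ((borel :: real measure) \<Otimes>\<^sub>M (borel :: real measure)) (%w. integrable lborel (%s. B (s, snd w)))"
    by measurable
   then show ?thesis by (simp add: pred_def space_pair_measure cong: sets_pair_measure_cong)
  qed
  then have "AE w in ((lborel :: real measure) \<Otimes>\<^sub>M (lborel :: real measure)). integrable lborel (%s. B (s, snd w))"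
   by (rule lborel_pair.AE_pair_measure) (use lborel2_Fubini(2)[OF B] in simp)
  then show ?thesis unfolding lborel_prod .
 qed
 have IF: "integrable lborel (%w. I w * F w)"
 proof (rule integrable_le)
  show "integrable lborel (%w. indicator {l<..<r} (fst w) * b1 (snd w))" by (rule integrable_tensor[OF iI b1])
  show "AE w in lborel. norm (I w * F w) \<le> norm (indicator {l<..<r} (fst w) * b1 (snd w))"
   using AEz
  proof eventually_elim
   fix w :: "real \<times> real" assume "integrable lborel (%s. B (s, snd w))"
   from Fb[OF this, of "fst w"] have "\<bar>F w\<bar> \<le> \<bar>b1 (snd w)\<bar>" by simp
   then show "norm (I w * F w) \<le> norm (indicator {l<..<r} (fst w) * b1 (snd w))"
    unfolding I_def by (simp add: abs_mult mult_left_mono)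
  qed
 qed measurable
 \<comment> \<open>The remainder. The primitive of \<open>B\<close> is cut off to the interval
   because it does not vanish to the right of it.\<close>
 define d where "d w = A w - I w * F w" for w
 have d: "integrable lborel d" unfolding d_def[abs_def] using A IF by auto
 have dm[measurable]: "d \<in> borel_measurable borel" using d by auto
 have zF: "F (y, z) = 0" if "z \<notin> {p<..<q}" for y z
 proof -
  have "B (s, z) = 0" for s using zero that by auto
  then show ?thesis unfolding F_def fst_conv snd_conv by (simp cong: if_cong)
 qed
 have dzero: "d w = 0" if "w \<notin> {l<..<r} \<times> {p<..<q}" for w
  using that zero[OF that] zF[of "snd w" "fst w"] by (cases w) (auto simp: d_def I_def indicator_def)
 have prod_bdd: "(%w. theta (fst w) * psi (snd w)) \<in> borel_measurable lborel \<and> (\<exists>K. \<forall>w. \<bar>theta (fst w) * psi (snd w)\<bar> \<le> K)"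
  if theta: "TF l r theta" and psi: "TF p q psi" for theta psi
 proof
  have [measurable]: "theta \<in> borel_measurable borel" "psi \<in> borel_measurable borel"
   using that by (auto intro: smooth_measurable TF_smooth)
  show "(%w. theta (fst w) * psi (snd w)) \<in> borel_measurable lborel" by (simp add: borel_measurable_pair_iff)
  obtain K1 K2 where "!!x. \<bar>theta x\<bar> \<le> K1" "!!x. \<bar>psi x\<bar> \<le> K2" using TF_bounded[OF theta] TF_bounded[OF psi] by blast
  then have "\<bar>theta (fst w) * psi (snd w)\<bar> \<le> K1 * K2" for w
   unfolding abs_mult by (intro mult_mono) (auto intro: order_trans[OF abs_ge_zero])
  then show "\<exists>K. \<forall>w. \<bar>theta (fst w) * psi (snd w)\<bar> \<le> K" by blast
 qed
 have bi: "integrable lborel (%w. h w * (theta (fst w) * psi (snd w)))"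
  if "integrable lborel h" "TF l r theta" "TF p q psi" for h :: "real \<times> real => real" and theta psi
  using prod_bdd[OF that(2,3)] that(1) integrable_mult_bounded by blast
 have d0: "(LBINT w. d w * (theta' (fst w) * psi (snd w))) = 0"
  if theta: "TF l r theta" and psi: "TF p q psi" and der: "!!x. (theta has_real_derivative theta' x) (at x)" for theta theta' psi
 proof -
  have theta': "TF l r theta'" by (rule TF_derivative[OF theta der])
  have "(LBINT w. (I w * F w) * (theta' (fst w) * psi (snd w)))
    = (LBINT z. LBINT y. (I (y, z) * F (y, z)) * (theta' y * psi z))"
   using lborel2_Fubini(1)[OF bi[OF IF theta' psi]] by simp
  also have "\<dots> = (LBINT z. LBINT y. - (B (y, z) * (theta y * psi z)))"
  proof (rule integral_cong_AE)
   show "(%z. LBINT y. (I (y, z) * F (y, z)) * (theta' y * psi z)) \<in> borel_measurable lborel"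
    using borel_measurable_integrable[OF lborel2_Fubini(3)[OF bi[OF IF theta' psi]]] by simp
   show "(%z. LBINT y. - (B (y, z) * (theta y * psi z))) \<in> borel_measurable lborel"
    using borel_measurable_integrable[OF lborel2_Fubini(3)[OF bi[OF B theta psi]]] by simp
   show "AE z in lborel. (LBINT y. (I (y, z) * F (y, z)) * (theta' y * psi z)) = (LBINT y. - (B (y, z) * (theta y * psi z)))"
    using lborel2_Fubini(2)[OF B]
   proof eventually_elim
    fix z assume bz: "integrable lborel (%y. B (y, z))"
    have "(LBINT y. (I (y, z) * F (y, z)) * (theta' y * psi z)) = (LBINT y. psi z * ((LBINT s. (if s < y then B (s, z) else 0)) * theta' y))"
    proof (rule LBINT_cong[OF refl])
     fix y show "I (y, z) * F (y, z) * (theta' y * psi z) = psi z * ((LBINT s. (if s < y then B (s, z) else 0)) * theta' y)"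
      using TF_zero_outside[OF theta', of y] by (cases "y \<in> {l<..<r}") (auto simp: I_def F_pair)
    qed
    also have "\<dots> = psi z * (LBINT y. (LBINT s. (if s < y then B (s, z) else 0)) * theta' y)" by simp
    also have "\<dots> = psi z * (LBINT s. B (s, z) * - theta s)"
     by (subst primitive_swap[OF bz TF_integrable[OF theta']]) (simp only: TF_integral_upto[OF theta der])
    also have "\<dots> = (LBINT y. - (B (y, z) * (theta y * psi z)))"
     by (subst integral_mult_right_zero[symmetric]) (simp add: mult_ac)
    finally show "(LBINT y. (I (y, z) * F (y, z)) * (theta' y * psi z)) = (LBINT y. - (B (y, z) * (theta y * psi z)))" .
   qed
  qed
  also have "\<dots> = - (LBINT w. B w * (theta (fst w) * psi (snd w)))"
   using lborel2_Fubini(1)[OF bi[OF B theta psi]] by simp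
  finally have "(LBINT w. (I w * F w) * (theta' (fst w) * psi (snd w))) = (LBINT w. A w * (theta' (fst w) * psi (snd w)))"
   using weak[OF theta psi der] by simp
  then show ?thesis
   using bi[OF A theta' psi] bi[OF IF theta' psi] by (simp add: d_def left_diff_distrib)
 qed
 obtain theta0 where theta0: "TF l r theta0" "(LBINT x. theta0 x) = 1"
 proof -
  define a b where "a = l + (r - l) / 3" and "b = r - (r - l) / 3"
  have ab: "l < a" "a < b" "b < r" using lr by (auto simp: a_def b_def field_simps)
  have T: "TF l r (bump 1 a b)" using ab lr by (intro TF_bump) auto
  have "(LBINT x. bump 1 a b x) \<noteq> 0"
  proof
   assume "(LBINT x. bump 1 a b x) = 0"
   then have "AE x in lborel. bump 1 a b x = 0"
    by (subst (asm) integral_nonneg_eq_0_iff_AE[OF TF_integrable[OF T]]) (auto simp: bump_bounds)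
   then have "AE x in lborel. x \<notin> {a<..<b}"
    by eventually_elim (auto simp: bump_def flat_def)
   then have "emeasure lborel {a<..<b} = 0"
    by (subst (asm) AE_iff_measurable[of "{a<..<b}"]) auto
   then show False using ab by simp
  qed
  then have "(LBINT x. (1 / (LBINT x. bump 1 a b x)) * bump 1 a b x + 0 * bump 1 a b x) = 1" by simp
  with TF_lin[OF T T] show ?thesis using that by blast
 qed
 have [measurable]: "theta0 \<in> borel_measurable borel" by (rule smooth_measurable[OF TF_smooth[OF theta0(1)]])
 \<comment> \<open>The candidate for the constant of integration on each line: the mean of the
   remainder with weight \<open>theta0\<close>, which has integral 1.\<close>
 define C where "C z = (LBINT y. d (y, z) * theta0 y)" for z
 obtain K0 where K0: "!!x. \<bar>theta0 x\<bar> \<le> K0" using TF_bounded[OF theta0(1)] by blast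
 have id0: "integrable lborel (%w. d w * theta0 (fst w))"
  by (rule integrable_mult_bounded[OF d _ K0]) (simp add: borel_measurable_pair_iff)
 have C: "integrable lborel C" unfolding C_def[abs_def] using lborel2_Fubini(3)[OF id0] by simp
 have Cz: "C z = 0" if "z \<notin> {p<..<q}" for z
 proof -
  have "d (y, z) = 0" for y using dzero that by auto
  then show ?thesis by (simp add: C_def)
 qed
 define D where "D w = d w - indicator {l<..<r} (fst w) * C (snd w)" for w
 have IC: "integrable lborel (%w. indicator {l<..<r} (fst w) * C (snd w))" by (rule integrable_tensor[OF iI C])
 have D: "integrable lborel D" unfolding D_def[abs_def] using d IC by auto
 have Dzero: "D w = 0" if "w \<notin> {l<..<r} \<times> {p<..<q}" for w
  using dzero[OF that] Cz[of "snd w"] that by (cases w) (auto simp: D_def indicator_def)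
 have Dtest: "(LBINT w. D w * (theta (fst w) * psi (snd w))) = 0" if theta: "TF l r theta" and psi: "TF p q psi" for theta psi
 proof -
  let ?m = "LBINT x. theta x"
  \<comment> \<open>After subtraction of its integral times \<open>theta0\<close> the test function
    has mean zero, so it is the derivative of a test function, and such derivatives are annihilated
    by \<open>d\<close>.\<close>
  have T: "TF l r (%x. 1 * theta x + (- ?m) * theta0 x)" by (rule TF_lin[OF theta theta0(1)])
  have "(LBINT x. 1 * theta x + (- ?m) * theta0 x) = 0"
   using TF_integrable[OF theta] TF_integrable[OF theta0(1)] theta0(2) by simp
  from TF_primitive[OF T this] obtain H where H: "TF l r H" "!!x. (H has_real_derivative 1 * theta x + (- ?m) * theta0 x) (at x)"
   by blast
  have "0 = (LBINT w. d w * ((1 * theta (fst w) + (- ?m) * theta0 (fst w)) * psi (snd w)))"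
   using d0[OF H(1) psi H(2)] by simp
  also have "\<dots> = (LBINT w. d w * (theta (fst w) * psi (snd w)) - ?m * (d w * (theta0 (fst w) * psi (snd w))))"
   by (rule LBINT_cong) (auto simp: algebra_simps)
  also have "\<dots> = (LBINT w. d w * (theta (fst w) * psi (snd w))) - ?m * (LBINT w. d w * (theta0 (fst w) * psi (snd w)))"
   using bi[OF d theta psi] bi[OF d theta0(1) psi] by simp
  finally have 1: "(LBINT w. d w * (theta (fst w) * psi (snd w))) = ?m * (LBINT w. d w * (theta0 (fst w) * psi (snd w)))" by simp
  have 2: "(LBINT w. d w * (theta0 (fst w) * psi (snd w))) = (LBINT z. C z * psi z)"
   using lborel2_Fubini(1)[OF bi[OF d theta0(1) psi]] by (simp add: C_def mult.assoc[symmetric])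
  have "(LBINT w. (indicator {l<..<r} (fst w) * C (snd w)) * (theta (fst w) * psi (snd w)))
   = (LBINT z. LBINT y. (indicator {l<..<r} y * C z) * (theta y * psi z))"
   using lborel2_Fubini(1)[OF bi[OF IC theta psi]] by simp
  also have "\<dots> = (LBINT z. LBINT y. (C z * psi z) * theta y)"
  proof (intro LBINT_cong refl)
   fix z y show "(indicator {l<..<r} y * C z) * (theta y * psi z) = (C z * psi z) * theta y"
    using TF_zero_outside[OF theta, of y] by (cases "y \<in> {l<..<r}") auto
  qed
  also have "\<dots> = ?m * (LBINT z. C z * psi z)" by simp
  finally have 3: "(LBINT w. (indicator {l<..<r} (fst w) * C (snd w)) * (theta (fst w) * psi (snd w))) = ?m * (LBINT z. C z * psi z)" .
  show ?thesis unfolding D_def left_diff_distrib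
   by (subst Bochner_Integration.integral_diff[OF bi[OF d theta psi] bi[OF IC theta psi]]) (simp only: 1 2 3 diff_self)
 qed
 have "AE w in lborel. D w = 0"
 proof (rule AE_zero_if_box_integrals_zero[OF D])
  fix a b :: "real \<times> real"
  \<comment> \<open>The box is intersected with the rectangle and shrunk by
    \<open>inverse (real (Suc n))\<close> on each side, so that the approximating bumps are
    admissible test functions.\<close>
  define theta where "theta n = bump n (max (fst a) l + inverse (real (Suc n))) (min (fst b) r - inverse (real (Suc n)))" for n
  define psi where "psi n = bump n (max (snd a) p + inverse (real (Suc n))) (min (snd b) q - inverse (real (Suc n)))" for n
  have ip: "0 \<le> inverse (real (Suc n))" for n by simp
  have inv0: "(%n. inverse (real (Suc n))) \<longlonglongrightarrow> 0" by (rule LIMSEQ_inverse_real_of_nat)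
  have t: "TF l r (theta n)" "TF p q (psi n)" for n
  proof -
   have e: "l' < max x l' + e" "min y r' - e < r'" if "e > 0" for x y l' r' e :: real
    using that by linarith+
   have i0: "inverse (real (Suc n)) > 0" by simp
   show "TF l r (theta n)" "TF p q (psi n)"
    unfolding theta_def psi_def by (intro TF_bump e[OF i0] lr pq)+
  qed
  have lim\<theta>: "(%n. theta n x) \<longlonglongrightarrow> indicator {max (fst a) l<..<min (fst b) r} x" for x
   unfolding theta_def
  proof (rule bump_tendsto)
   show "(%n. max (fst a) l + inverse (real (Suc n))) \<longlonglongrightarrow> max (fst a) l" using tendsto_add[OF tendsto_const inv0] by simp
   show "(%n. min (fst b) r - inverse (real (Suc n))) \<longlonglongrightarrow> min (fst b) r" using tendsto_diff[OF tendsto_const inv0] by simp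
   show "min (fst b) r - inverse (real (Suc n)) \<le> min (fst b) r" for n using ip[of n] by linarith
  qed auto
  have lim\<psi>: "(%n. psi n x) \<longlonglongrightarrow> indicator {max (snd a) p<..<min (snd b) q} x" for x
   unfolding psi_def
  proof (rule bump_tendsto)
   show "(%n. max (snd a) p + inverse (real (Suc n))) \<longlonglongrightarrow> max (snd a) p" using tendsto_add[OF tendsto_const inv0] by simp
   show "(%n. min (snd b) q - inverse (real (Suc n))) \<longlonglongrightarrow> min (snd b) q" using tendsto_diff[OF tendsto_const inv0] by simp
   show "min (snd b) q - inverse (real (Suc n)) \<le> min (snd b) q" for n using ip[of n] by linarith
  qed auto
  have boxeq: "indicator (box a b) w * D w = D w * (indicator {max (fst a) l<..<min (fst b) r} (fst w) * indicator {max (snd a) p<..<min (snd b) q} (snd w))" for w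
  proof (cases "w \<in> {l<..<r} \<times> {p<..<q}")
   case True
   have "w \<in> box a b \<longleftrightarrow> fst w \<in> {max (fst a) l<..<min (fst b) r} \<and> snd w \<in> {max (snd a) p<..<min (snd b) q}"
    using True by (cases w; cases a; cases b) (auto simp: box_def Basis_real2)
   then show ?thesis by (auto simp: indicator_def)
  qed (simp add: Dzero)
  have "(%n. LBINT w. D w * (theta n (fst w) * psi n (snd w))) \<longlonglongrightarrow> (LBINT w. indicator (box a b) w * D w)"
  proof (rule integral_dominated_convergence[where w="%w. \<bar>D w\<bar>"])
   show "(%w. indicator (box a b) w * D w) \<in> borel_measurable lborel" using D by auto
   show "(%w. D w * (theta n (fst w) * psi n (snd w))) \<in> borel_measurable lborel" for n
    using bi[OF D t] by auto
   show "integrable lborel (%w. \<bar>D w\<bar>)" using D by auto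
   show "AE w in lborel. (%n. D w * (theta n (fst w) * psi n (snd w))) \<longlonglongrightarrow> indicator (box a b) w * D w"
    unfolding boxeq by (intro AE_I2 tendsto_mult tendsto_const lim\<theta> lim\<psi>)
   show "AE w in lborel. norm (D w * (theta n (fst w) * psi n (snd w))) \<le> \<bar>D w\<bar>" for n
   proof (rule AE_I2)
    fix w :: "real \<times> real"
    have "\<bar>theta n (fst w)\<bar> \<le> 1" "\<bar>psi n (snd w)\<bar> \<le> 1" unfolding theta_def psi_def using bump_bounds by (simp_all add: abs_le_iff)
    then have "\<bar>theta n (fst w)\<bar> * \<bar>psi n (snd w)\<bar> \<le> 1" by (intro mult_le_one) auto
    then show "norm (D w * (theta n (fst w) * psi n (snd w))) \<le> \<bar>D w\<bar>"
     by (simp add: abs_mult mult_left_le)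
   qed
  qed
  then show "(LBINT w. indicator (box a b) w * D w) = 0"
   using Dtest[OF t] by (simp add: LIMSEQ_const_iff)
 qed
 then have "AE w in (lborel \<Otimes>\<^sub>M lborel). D w = 0" unfolding lborel_prod .
 from lborel_pair.AE_pair[OF this] have "AE y in lborel. AE z in lborel. D (y, z) = 0" .
 moreover have "{w \<in> space (lborel \<Otimes>\<^sub>M lborel). D (fst w, snd w) = 0} \<in> sets (lborel \<Otimes>\<^sub>M lborel)"
 proof -
  have "D \<in> borel_measurable borel" using borel_measurable_integrable[OF D] by simp
  then have "{w \<in> space borel. D w = 0} \<in> sets borel" by measurable
  then show ?thesis unfolding lborel_prod by simp
 qed
 ultimately have "AE z in lborel. AE y in lborel. D (y, z) = 0"
  using lborel_pair.AE_commute[of "%y z. D (y, z) = 0"] by simp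
 then have "AE z in lborel. AE y in lborel. y \<in> {l<..<r} --> A (y, z) = C z + (LBINT s. (if s < y then B (s, z) else 0))"
 proof (rule eventually_mono)
  fix z assume "AE y in lborel. D (y, z) = 0"
  then show "AE y in lborel. y \<in> {l<..<r} --> A (y, z) = C z + (LBINT s. (if s < y then B (s, z) else 0))"
   by (rule eventually_mono) (auto simp: D_def d_def I_def F_pair)
 qed
 then show ?thesis by blast
qed

section \<open>From weak derivatives to primitives in space and in time\<close>

lemma lborel2_swap:
 fixes h :: "real \<times> real => real"
 assumes "h \<in> borel_measurable borel"
 shows "(LBINT w. h (snd w, fst w)) = (LBINT w. h w)"
  and "integrable lborel h ==> integrable lborel (%w. h (snd w, fst w))"
 using lborel_pair.integral_product_swap[of h] lborel_pair.integrable_product_swap[of h] assms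
 by (simp_all add: lborel_prod split_beta' borel_measurable_pair_iff cong: measurable_cong_sets)

lemma L2_on_box_integrable:
 fixes a :: "real \<times> real => real"
 assumes "L2_on S a" "{l<..<r} \<times> {p<..<q} \<subseteq> S"
 shows "integrable lborel (%w. indicator ({l<..<r} \<times> {p<..<q}) w * a w)"
proof -
 let ?R = "{l<..<r} \<times> {p<..<q}"
 have R: "?R = box (l, p) (r, q)" by (auto simp: box_def Basis_real2)
 have 1: "L2_on ?R a" by (rule L2_on_subset[OF assms]) (simp add: R)
 have "L2_on ?R (%_. 1)"
 proof (rule L2_on_bounded[where M=1])
  show "set_borel_measurable lborel ?R (%_. 1 :: real)"
   unfolding set_borel_measurable_def real_scaleR_def mult_1_right R by simp
  show "?R \<in> sets lborel" by (simp add: R)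
  show "emeasure lborel ?R < \<infinity>" unfolding R using emeasure_lborel_box_finite by blast
 qed simp
 from L2_on_mult[OF this 1] show ?thesis by (simp add: set_integrable_def)
qed

lemma integral_indicator_tensor:
 fixes a :: "real \<times> real => real"
 assumes "TF l r theta" "TF p q psi" "{l<..<r} \<times> {p<..<q} \<subseteq> S"
 shows "(LBINT w:S. a w * (theta (fst w) * psi (snd w)))
   = (LBINT w. (indicator ({l<..<r} \<times> {p<..<q}) w * a w) * (theta (fst w) * psi (snd w)))"
 unfolding set_lebesgue_integral_def
proof (rule LBINT_cong[OF refl])
 fix w :: "real \<times> real"
 show "indicator S w *\<^sub>R (a w * (theta (fst w) * psi (snd w))) = indicator ({l<..<r} \<times> {p<..<q}) w * a w * (theta (fst w) * psi (snd w))"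
 proof (cases "w \<in> {l<..<r} \<times> {p<..<q}")
  case True
  then show ?thesis using assms(3) by auto
 next
  case False
  then have "theta (fst w) * psi (snd w) = 0"
   using TF_zero_outside[OF assms(1), of "fst w"] TF_zero_outside[OF assms(2), of "snd w"] by (cases w) auto
  then show ?thesis by simp
 qed
qed

text \<open>Only the windows from \<open>- real n\<close> to \<open>real n\<close> occur, so the
  exceptional null sets that arise for different windows are countably many.\<close>

definition weak_x :: "real => (real \<times> real => real) => (real \<times> real => real) => bool" where
 "weak_x T a b \<longleftrightarrow> (\<forall>n::nat. \<forall>theta theta' psi. TF (- real n) (real n) theta --> TF 0 T psi --> (\<forall>x. (theta has_real_derivative theta' x) (at x)) -->
   (LBINT z:Q T. a z * (theta' (fst z) * psi (snd z))) = - (LBINT z:Q T. b z * (theta (fst z) * psi (snd z))))"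

definition weak_t :: "real => (real \<times> real => real) => (real \<times> real => real) => bool" where
 "weak_t T a b \<longleftrightarrow> (\<forall>n::nat. \<forall>theta psi psi'. TF (- real n) (real n) theta --> TF 0 T psi --> (\<forall>x. (psi has_real_derivative psi' x) (at x)) -->
   (LBINT z:Q T. a z * (theta (fst z) * psi' (snd z))) = - (LBINT z:Q T. b z * (theta (fst z) * psi (snd z))))"

text \<open>Two windows give functions with the same increments that agree somewhere in the smaller
  window, hence all over it. The local functions therefore fit together to one primitive on the
  line.\<close>

lemma primitive_glue:
 fixes a b :: "real => real"
 assumes loc: "!!n. n > 0 ==> \<exists>C. AE x in lborel. x \<in> {- real n<..<real n} --> a x = C + (LBINT s. (if s < x then indicator {- real n<..<real n} s * b s else 0))"
  and b: "L2_on UNIV b"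
 shows "\<exists>f. (AE x in lborel. f x = a x) \<and> (\<forall>x y. x \<le> y --> set_integrable lborel {x<..<y} b \<and> f y - f x = (LBINT s:{x<..<y}. b s))"
proof -
 have bi: "set_integrable lborel {x<..<y} b" if "x \<le> y" for x y
  by (rule L2_on_interval_integral(1)[OF L2_on_subset[OF b]]) (use that in auto)
 let ?P = "%n x. (LBINT s. (if s < x then indicator {- real n<..<real n} s * b s else 0))"
 obtain C where C: "!!n. n > 0 ==> AE x in lborel. x \<in> {- real n<..<real n} --> a x = C n + ?P n x"
 proof -
  have "\<forall>n. \<exists>C. n > 0 --> (AE x in lborel. x \<in> {- real n<..<real n} --> a x = C + ?P n x)"
   using loc by blast
  from choice[OF this] show ?thesis using that by blast
 qed
 have P: "?P n x = (LBINT s:{- real n<..<x}. b s)" if "x \<in> {- real n<..<real n}" for n x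
  unfolding set_lebesgue_integral_def
  by (rule LBINT_cong) (use that in \<open>auto simp: indicator_def\<close>)
 define h where "h n x = C n + (LBINT s:{- real n<..<x}. b s)" for n x
 have hC: "AE x in lborel. x \<in> {- real n<..<real n} --> a x = h n x" if "n > 0" for n
  using C[OF that] by eventually_elim (auto simp: h_def P)
 have split: "(LBINT s:{x<..<z}. b s) = (LBINT s:{x<..<y}. b s) + (LBINT s:{y<..<z}. b s)"
  if "x \<le> y" "y \<le> z" for x y z
 proof -
  have "(LBINT s:{x<..<z}. b s) = (LBINT s. indicator {x<..<y} s *\<^sub>R b s + indicator {y<..<z} s *\<^sub>R b s)"
   unfolding set_lebesgue_integral_def
   by (rule integral_discrete_difference[where X="{y}"]) (use that in \<open>auto simp: indicator_def\<close>)
  then show ?thesis using bi[OF that(1)] bi[OF that(2)] by (simp add: set_integrable_def set_lebesgue_integral_def)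
 qed
 have hdiff: "h n y - h n x = (LBINT s:{x<..<y}. b s)" if "- real n \<le> x" "x \<le> y" for n x y
  using split[OF that] by (simp add: h_def)
 have heq: "h m x = h n x" if nm: "0 < n" "n \<le> m" and x: "x \<in> {- real n<..<real n}" for m n x
 proof -
  have "AE x in lborel. x \<in> {- real n<..<real n} --> h m x = h n x"
  proof -
   have "m > 0" using nm by simp
   from hC[OF nm(1)] hC[OF this] show ?thesis by eventually_elim (use nm in auto)
  qed
  moreover have "\<not> (AE x in lborel. x \<notin> {- real n<..<real n})"
  proof
   assume "AE x in lborel. x \<notin> {- real n<..<real n}"
   then have "emeasure lborel {- real n<..<real n} = 0"
    by (subst (asm) AE_iff_measurable[of "{- real n<..<real n}"]) auto
   then show False using nm by simp
  qed
  ultimately obtain y where y: "y \<in> {- real n<..<real n}" "h m y = h n y"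
  proof -
   have "\<exists>y. y \<in> {- real n<..<real n} \<and> h m y = h n y"
   proof (rule ccontr)
    assume c: "\<not> (\<exists>y. y \<in> {- real n<..<real n} \<and> h m y = h n y)"
    have "AE x in lborel. x \<notin> {- real n<..<real n}"
     using \<open>AE x in lborel. x \<in> {- real n<..<real n} --> h m x = h n x\<close> by eventually_elim (use c in blast)
    with \<open>\<not> (AE x in lborel. x \<notin> {- real n<..<real n})\<close> show False by simp
   qed
   then show ?thesis using that by blast
  qed
  have mn: "real n \<le> real m" using nm by simp
  show ?thesis
  proof (cases "x \<le> y")
   case True
   then show ?thesis using hdiff[of m x y] hdiff[of n x y] x y mn by auto
  next
   case False
   then show ?thesis using hdiff[of m y x] hdiff[of n y x] x y mn by auto
  qed
 qed
 define N where "N x = nat \<lceil>\<bar>x\<bar>\<rceil> + 1" for x :: real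
 have N: "x \<in> {- real (N x)<..<real (N x)}" "N x > 0" for x
 proof -
  have "real (N x) = real (nat \<lceil>\<bar>x\<bar>\<rceil>) + 1" by (simp only: N_def of_nat_add of_nat_1)
  then have "\<bar>x\<bar> < real (N x)" using real_nat_ceiling_ge[of "\<bar>x\<bar>"] by linarith
  then show "x \<in> {- real (N x)<..<real (N x)}" by auto
 qed (simp add: N_def)
 define f where "f x = h (N x) x" for x
 have fm: "f x = h m x" if "N x \<le> m" for x m using heq[OF N(2) that N(1)] by (simp add: f_def)
 have "f y - f x = (LBINT s:{x<..<y}. b s)" if "x \<le> y" for x y
 proof -
  let ?m = "max (N x) (N y)"
  have "real (N x) \<le> real ?m" by simp
  then have "- real ?m \<le> x" using N(1)[of x] by auto
  then show ?thesis using hdiff[OF _ that, of ?m] fm[of x ?m] fm[of y ?m] by simp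
 qed
 moreover have "AE x in lborel. f x = a x"
 proof -
  have "AE x in lborel. \<forall>n. n > 0 --> x \<in> {- real n<..<real n} --> a x = h n x"
   unfolding AE_all_countable using hC by auto
  then show ?thesis
  proof eventually_elim
   fix x assume "\<forall>n. n > 0 --> x \<in> {- real n<..<real n} --> a x = h n x"
   with N[of x] have "a x = h (N x) x" by blast
   then show "f x = a x" by (simp add: f_def)
  qed
 qed
 ultimately show ?thesis using bi by blast
qed

lemma L2_on_Q_slices:
 assumes "L2_on (Q T) b"
 shows "AE t in lborel. t \<in> {0<..<T} --> L2_on UNIV (%x. b (x, t))"
proof -
 have i: "integrable lborel (%w. indicator (Q T) w * (b w)^2)" and m: "(%w. indicator (Q T) w * b w) \<in> borel_measurable borel"
  using assms by (auto simp: L2_on_def set_integrable_def set_borel_measurable_def)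
 have m': "(%w. indicator (Q T) w * b w) \<in> borel_measurable (borel \<Otimes>\<^sub>M borel)" using m by (simp add: borel_measurable_pair_iff)
 show ?thesis using lborel2_Fubini(2)[OF i]
 proof eventually_elim
  fix t assume it: "integrable lborel (%x. indicator (Q T) (x, t) * (b (x, t))^2)"
  show "t \<in> {0<..<T} --> L2_on UNIV (%x. b (x, t))"
  proof
   assume t: "t \<in> {0<..<T}"
   have "(%x. indicator (Q T) (x, t) * b (x, t)) \<in> borel_measurable borel"
    using measurable_compose[OF measurable_Pair2'[of t borel borel] m'] by simp
   then show "L2_on UNIV (%x. b (x, t))" using it t by (simp add: L2_on_UNIV Q_def)
  qed
 qed
qed

text \<open>At almost every time the du Bois-Reymond lemma applies on all windows at once, with
  constants depending on window and time; \<open>primitive_glue\<close> removes the dependence on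
  the window.\<close>

lemma weak_x_representative:
 assumes T: "T > 0" and a: "L2_on (Q T) a" and b: "L2_on (Q T) b" and w: "weak_x T a b"
 shows "AE t in lborel. t \<in> {0<..<T} --> (\<exists>f. (AE x in lborel. f x = a (x, t)) \<and>
   (\<forall>x y. x \<le> y --> set_integrable lborel {x<..<y} (%s. b (s, t)) \<and> f y - f x = (LBINT s:{x<..<y}. b (s, t))))"
proof -
 let ?I = "%n::nat. {- real n<..<real n} \<times> {0<..<T}"
 have loc: "\<exists>C. AE t in lborel. AE x in lborel. x \<in> {- real n<..<real n} -->
   indicator (?I n) (x, t) * a (x, t) = C t + (LBINT s. (if s < x then indicator (?I n) (s, t) * b (s, t) else 0))" if n: "n > 0" for n
 proof (rule du_Bois_Reymond[where p=0 and q=T])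
  have sub: "?I n \<subseteq> Q T" by (auto simp: Q_def)
  show "integrable lborel (%w. indicator (?I n) w * a w)" "integrable lborel (%w. indicator (?I n) w * b w)"
   by (intro L2_on_box_integrable[OF a sub] L2_on_box_integrable[OF b sub])+
  fix theta theta' psi assume t: "TF (- real n) (real n) theta" "TF 0 T psi" "!!x. (theta has_real_derivative theta' x) (at x)"
  show "(LBINT w. (indicator (?I n) w * a w) * (theta' (fst w) * psi (snd w))) = - (LBINT w. (indicator (?I n) w * b w) * (theta (fst w) * psi (snd w)))"
   using w t unfolding weak_x_def
   by (subst (1 2) integral_indicator_tensor[OF _ t(2) sub, symmetric]) (auto intro: TF_derivative)
 qed (use n T in auto)
 have "\<forall>n. \<exists>C. n > 0 --> (AE t in lborel. AE x in lborel. x \<in> {- real n<..<real n} -->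
   indicator (?I n) (x, t) * a (x, t) = C t + (LBINT s. (if s < x then indicator (?I n) (s, t) * b (s, t) else 0)))"
  using loc by blast
 from choice[OF this] obtain C where C: "!!n. n > 0 ==> AE t in lborel. AE x in lborel. x \<in> {- real n<..<real n} -->
   indicator (?I n) (x, t) * a (x, t) = C n t + (LBINT s. (if s < x then indicator (?I n) (s, t) * b (s, t) else 0))"
  by blast
 then have "AE t in lborel. \<forall>n. n > 0 --> (AE x in lborel. x \<in> {- real n<..<real n} -->
   indicator (?I n) (x, t) * a (x, t) = C n t + (LBINT s. (if s < x then indicator (?I n) (s, t) * b (s, t) else 0)))"
  unfolding AE_all_countable by auto
 then show ?thesis using L2_on_Q_slices[OF b]
 proof eventually_elim
  fix t assume h: "\<forall>n. n > 0 --> (AE x in lborel. x \<in> {- real n<..<real n} -->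
    indicator (?I n) (x, t) * a (x, t) = C n t + (LBINT s. (if s < x then indicator (?I n) (s, t) * b (s, t) else 0)))"
   and L: "t \<in> {0<..<T} --> L2_on UNIV (%x. b (x, t))"
  show "t \<in> {0<..<T} --> (\<exists>f. (AE x in lborel. f x = a (x, t)) \<and>
    (\<forall>x y. x \<le> y --> set_integrable lborel {x<..<y} (%s. b (s, t)) \<and> f y - f x = (LBINT s:{x<..<y}. b (s, t))))"
  proof
   assume t: "t \<in> {0<..<T}"
   show "\<exists>f. (AE x in lborel. f x = a (x, t)) \<and>
    (\<forall>x y. x \<le> y --> set_integrable lborel {x<..<y} (%s. b (s, t)) \<and> f y - f x = (LBINT s:{x<..<y}. b (s, t)))"
   proof (rule primitive_glue[OF _ L[rule_format, OF t]])
    fix n :: nat assume "n > 0"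
    then have "AE x in lborel. x \<in> {- real n<..<real n} -->
      a (x, t) = C n t + (LBINT s. (if s < x then indicator {- real n<..<real n} s * b (s, t) else 0))"
    proof -
     assume n: "n > 0"
     have e: "(if s < x then indicator (?I n) (s, t) * b (s, t) else 0) = (if s < x then indicator {- real n<..<real n} s * b (s, t) else 0)" for s x
      using t by (simp add: indicator_def)
     show ?thesis using h[rule_format, OF n]
      by (rule eventually_mono) (use t in \<open>simp only: e, simp add: indicator_def\<close>)
    qed
    then show "\<exists>C. AE x in lborel. x \<in> {- real n<..<real n} -->
      a (x, t) = C + (LBINT s. (if s < x then indicator {- real n<..<real n} s * b (s, t) else 0))" by blast
   qed
  qed
 qed
qed

text \<open>The du Bois-Reymond lemma with the coordinates exchanged. The time interval is bounded,
  so windows are used only to exhaust the space variable.\<close>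

lemma weak_t_representative:
 assumes T: "T > 0" and a: "L2_on (Q T) a" and b: "L2_on (Q T) b" and w: "weak_t T a b"
 shows "AE x in lborel. \<exists>C. AE t in lborel. t \<in> {0<..<T} --> a (x, t) = C + (LBINT s:{0<..<t}. b (x, s))"
proof -
 let ?I = "%n::nat. {- real n<..<real n} \<times> {0<..<T}" and ?J = "%n::nat. {0<..<T} \<times> {- real n<..<real n}"
 have loc: "\<exists>C. AE x in lborel. AE t in lborel. t \<in> {0<..<T} -->
   indicator (?J n) (t, x) * a (x, t) = C x + (LBINT s. (if s < t then indicator (?J n) (s, x) * b (x, s) else 0))" if n: "n > 0" for n
 proof -
  let ?A = "%w. indicator (?J n) w * a (snd w, fst w)" and ?B = "%w. indicator (?J n) w * b (snd w, fst w)"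
  have sub: "?I n \<subseteq> Q T" by (auto simp: Q_def)
  have ind: "indicator (?J n) w = (indicator (?I n) (snd w, fst w) :: real)" for w by (cases w) (auto simp: indicator_def)
  have ia: "integrable lborel (%w. indicator (?I n) w * a w)" and ib: "integrable lborel (%w. indicator (?I n) w * b w)"
   by (intro L2_on_box_integrable[OF a sub] L2_on_box_integrable[OF b sub])+
  have "\<exists>C. AE x in lborel. AE t in lborel. t \<in> {0<..<T} --> ?A (t, x) = C x + (LBINT s. (if s < t then ?B (s, x) else 0))"
  proof (rule du_Bois_Reymond[where p="- real n" and q="real n"])
   show "integrable lborel ?A" "integrable lborel ?B"
    using lborel2_swap(2)[OF _ ia] lborel2_swap(2)[OF _ ib] ia ib unfolding ind by auto
   fix psi psi' theta assume t: "TF 0 T psi" "TF (- real n) (real n) theta" "!!x. (psi has_real_derivative psi' x) (at x)"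
   have [measurable]: "theta \<in> borel_measurable borel" "psi \<in> borel_measurable borel" "psi' \<in> borel_measurable borel"
    using t TF_derivative[OF t(1,3)] by (auto intro: smooth_measurable TF_smooth)
   have sw: "(LBINT w. (indicator (?J n) w * g (snd w, fst w)) * (\<phi> (fst w) * theta (snd w))) = (LBINT z:Q T. g z * (theta (fst z) * \<phi> (snd z)))"
    if g: "integrable lborel (%w. indicator (?I n) w * g w)" and \<phi>: "TF 0 T \<phi>" for g :: "real \<times> real => real" and \<phi>
   proof -
    have [measurable]: "\<phi> \<in> borel_measurable borel" using \<phi> by (auto intro: smooth_measurable TF_smooth)
    have "(%w. (indicator (?I n) w * g w) * (theta (fst w) * \<phi> (snd w))) \<in> borel_measurable borel"
    proof (rule borel_measurable_times)
     show "(%w. indicator (?I n) w * g w) \<in> borel_measurable borel" using borel_measurable_integrable[OF g] by simp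
     show "(%w. theta (fst w) * \<phi> (snd w)) \<in> borel_measurable borel" by (simp add: borel_measurable_pair_iff)
    qed
    from lborel2_swap(1)[OF this] show ?thesis
     unfolding integral_indicator_tensor[OF t(2) \<phi> sub] ind by (simp add: mult_ac)
   qed
   show "(LBINT w. ?A w * (psi' (fst w) * theta (snd w))) = - (LBINT w. ?B w * (psi (fst w) * theta (snd w)))"
    unfolding sw[OF ia TF_derivative[OF t(1,3)]] sw[OF ib t(1)] using w t unfolding weak_t_def by blast
  qed (use n T in auto)
  then show ?thesis by (simp only: fst_conv snd_conv)
 qed
 have "AE x in lborel. x \<in> {- real n<..<real n} --> (\<exists>C. AE t in lborel. t \<in> {0<..<T} --> a (x, t) = C + (LBINT s:{0<..<t}. b (x, s)))"
  if n: "n > 0" for n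
 proof -
  obtain C where "AE x in lborel. AE t in lborel. t \<in> {0<..<T} -->
    indicator (?J n) (t, x) * a (x, t) = C x + (LBINT s. (if s < t then indicator (?J n) (s, x) * b (x, s) else 0))"
   using loc[OF n] by blast
  then show ?thesis
  proof eventually_elim
   fix x assume h: "AE t in lborel. t \<in> {0<..<T} -->
     indicator (?J n) (t, x) * a (x, t) = C x + (LBINT s. (if s < t then indicator (?J n) (s, x) * b (x, s) else 0))"
   show "x \<in> {- real n<..<real n} --> (\<exists>C. AE t in lborel. t \<in> {0<..<T} --> a (x, t) = C + (LBINT s:{0<..<t}. b (x, s)))"
   proof (intro impI exI[of _ "C x"])
    assume x: "x \<in> {- real n<..<real n}"
    show "AE t in lborel. t \<in> {0<..<T} --> a (x, t) = C x + (LBINT s:{0<..<t}. b (x, s))"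
     using h
    proof eventually_elim
     fix t assume h: "t \<in> {0<..<T} -->
      indicator (?J n) (t, x) * a (x, t) = C x + (LBINT s. (if s < t then indicator (?J n) (s, x) * b (x, s) else 0))"
     show "t \<in> {0<..<T} --> a (x, t) = C x + (LBINT s:{0<..<t}. b (x, s))"
     proof
      assume t: "t \<in> {0<..<T}"
      have "(LBINT s. (if s < t then indicator (?J n) (s, x) * b (x, s) else 0)) = (LBINT s:{0<..<t}. b (x, s))"
       unfolding set_lebesgue_integral_def
       by (rule LBINT_cong) (use x t in \<open>auto simp: indicator_def\<close>)
      then show "a (x, t) = C x + (LBINT s:{0<..<t}. b (x, s))" using h t x by simp
     qed
    qed
   qed
  qed
 qed
 then have "AE x in lborel. \<forall>n::nat. n > 0 --> x \<in> {- real n<..<real n} --> (\<exists>C. AE t in lborel. t \<in> {0<..<T} --> a (x, t) = C + (LBINT s:{0<..<t}. b (x, s)))"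
  unfolding AE_all_countable by auto
 then show ?thesis
 proof eventually_elim
  fix x :: real assume h: "\<forall>n::nat. n > 0 --> x \<in> {- real n<..<real n} --> (\<exists>C. AE t in lborel. t \<in> {0<..<T} --> a (x, t) = C + (LBINT s:{0<..<t}. b (x, s)))"
  obtain n :: nat where "\<bar>x\<bar> < real n" using reals_Archimedean2 by blast
  then have "real n > 0" "x \<in> {- real n<..<real n}" by auto
  then have "n > 0" "x \<in> {- real n<..<real n}" by simp_all
  then show "\<exists>C. AE t in lborel. t \<in> {0<..<T} --> a (x, t) = C + (LBINT s:{0<..<t}. b (x, s))" using h by blast
 qed
qed

lemma iter_partial_append: "iter_partial (bs @ [b]) \<phi> = iter_partial bs (partial b \<phi>)"
 by (simp add: iter_partial_def)

lemma test_function_derivative_tensor: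
 assumes "TF (- real n) (real n) theta" "TF 0 T psi"
 shows "test_function (Q T) (%z. theta (fst z) * psi (snd z))"
 by (rule test_function_tensor[OF assms]) (auto simp: Q_def)

text \<open>\<open>iter_partial\<close> is a right fold, so the entry at the end of the list acts
  first on the test function. Testing the longer derivative of \<open>u\<close> with a product
  amounts to testing the shorter one with the product differentiated in \<open>x\<close>.\<close>

lemma weak_derivative_weak_x:
 assumes a: "weak_derivative (Q T) bs u a" and b: "weak_derivative (Q T) (bs @ [(1, 0)]) u b"
 shows "weak_x T a b"
 unfolding weak_x_def
proof (intro allI impI)
 fix n :: nat and theta theta' psi
 assume t: "TF (- real n) (real n) theta" "TF 0 T psi" "\<forall>x. (theta has_real_derivative theta' x) (at x)"
 obtain psi' where psi': "!!x. (psi has_real_derivative psi' x) (at x)" using smooth_derivative[OF TF_smooth[OF t(2)]] by blast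
 have d: "partial (1, 0) (%z. theta (fst z) * psi (snd z)) = (%z. theta' (fst z) * psi (snd z))"
  by (rule partial_tensor(1)[OF _ psi']) (use t in auto)
 let ?s = "(- 1) ^ length bs :: real"
 let ?\<phi> = "%z. theta (fst z) * psi (snd z)" and ?\<phi>' = "%z. theta' (fst z) * psi (snd z)"
 have "TF (- real n) (real n) theta'" by (rule TF_derivative[OF t(1)]) (use t(3) in blast)
 from test_function_derivative_tensor[OF this t(2)]
 have 1: "(LBINT z:Q T. u z * iter_partial bs ?\<phi>' z) = ?s * (LBINT z:Q T. a z * ?\<phi>' z)"
  using a unfolding weak_derivative_def by blast
 from test_function_derivative_tensor[OF t(1,2)]
 have "(LBINT z:Q T. u z * iter_partial (bs @ [(1, 0)]) ?\<phi> z) = (- 1) ^ length (bs @ [(1::real, 0::real)]) * (LBINT z:Q T. b z * ?\<phi> z)"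
  using b unfolding weak_derivative_def by blast
 then have 2: "(LBINT z:Q T. u z * iter_partial bs ?\<phi>' z) = ?s * - (LBINT z:Q T. b z * ?\<phi> z)"
  unfolding iter_partial_append d by simp
 show "(LBINT z:Q T. a z * ?\<phi>' z) = - (LBINT z:Q T. b z * ?\<phi> z)"
 proof -
  have "?s * (LBINT z:Q T. a z * ?\<phi>' z) = ?s * - (LBINT z:Q T. b z * ?\<phi> z)"
   using 1 2 by (rule trans[OF sym])
  then show ?thesis by (subst (asm) mult_left_cancel) simp_all
 qed
qed

lemma weak_derivative_weak_t:
 assumes b: "weak_derivative (Q T) [(0, 1)] u b"
 shows "weak_t T u b"
 unfolding weak_t_def
proof (intro allI impI)
 fix n :: nat and theta psi psi'
 assume t: "TF (- real n) (real n) theta" "TF 0 T psi" "\<forall>x. (psi has_real_derivative psi' x) (at x)"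
 obtain theta' where theta': "!!x. (theta has_real_derivative theta' x) (at x)" using smooth_derivative[OF TF_smooth[OF t(1)]] by blast
 have d: "partial (0, 1) (%z. theta (fst z) * psi (snd z)) = (%z. theta (fst z) * psi' (snd z))"
  by (rule partial_tensor(2)[OF theta']) (use t in auto)
 show "(LBINT z:Q T. u z * (theta (fst z) * psi' (snd z))) = - (LBINT z:Q T. b z * (theta (fst z) * psi (snd z)))"
  using b test_function_derivative_tensor[OF t(1,2)] unfolding weak_derivative_def by (auto simp: iter_partial_def d)
qed

lemma weak_derivative_Nil: "weak_derivative \<Omega> [] u u"
 by (simp add: weak_derivative_def iter_partial_def)

section \<open>The energy inequality at a fixed time\<close>

text \<open>\<open>f0\<close> is merely a primitive, so the formula is obtained from
  \<open>primitive_swap\<close> for \<open>f1\<close> and \<open>P'\<close> cut off to the interval,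
  evaluating the inner integral on either side.\<close>

lemma integration_by_parts_primitive:
 assumes ab: "a \<le> b" and f: "!!x y. x \<le> y ==> f0 y - f0 x = (LBINT s:{x<..<y}. f1 s)"
  and L: "L2_on {a<..<b} f0" "L2_on {a<..<b} f1"
  and P: "!!x. (P has_real_derivative P' x) (at x)" "continuous_on {a..b} P'"
 shows "(LBINT x:{a<..<b}. f1 x * P x) = f0 b * P b - f0 a * P a - (LBINT x:{a<..<b}. f0 x * P' x)"
proof -
 let ?I = "indicator {a<..<b} :: real => real"
 have LP: "L2_on {a<..<b} P" by (intro L2_on_continuous continuous_at_imp_continuous_on ballI DERIV_isCont[OF P(1)])
 have LP': "L2_on {a<..<b} P'" by (rule L2_on_continuous[OF P(2)])
 have i1: "set_integrable lborel {a<..<b} f1" by (rule L2_on_interval_integral[OF L(2) ab])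
 have iP: "set_integrable lborel {a<..<b} P'" by (rule L2_on_interval_integral[OF LP' ab])
 have "(LBINT y. (LBINT s. (if s < y then ?I s * f1 s else 0)) * (?I y * P' y))
   = (LBINT s. (?I s * f1 s) * (LBINT y. indicator {s<..} y * (?I y * P' y)))"
  by (rule primitive_swap) (use i1 iP in \<open>simp_all add: set_integrable_def\<close>)
 also have "(LBINT y. (LBINT s. (if s < y then ?I s * f1 s else 0)) * (?I y * P' y))
   = (LBINT y:{a<..<b}. f0 y * P' y - f0 a * P' y)"
  unfolding set_lebesgue_integral_def
 proof (rule LBINT_cong[OF refl])
  fix y
  have e: "(LBINT s. (if s < y then ?I s * f1 s else 0)) = f0 y - f0 a" if y: "y \<in> {a<..<b}"
  proof -
   have "(LBINT s. (if s < y then ?I s * f1 s else 0)) = (LBINT s:{a<..<y}. f1 s)"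
    unfolding set_lebesgue_integral_def by (rule LBINT_cong) (use y in \<open>auto simp: indicator_def\<close>)
   then show ?thesis using f[of a y] y by simp
  qed
  show "(LBINT s. (if s < y then ?I s * f1 s else 0)) * (?I y * P' y) = ?I y *\<^sub>R (f0 y * P' y - f0 a * P' y)"
  proof (cases "y \<in> {a<..<b}")
   case True
   show ?thesis unfolding e[OF True] using True by (simp add: algebra_simps)
  qed simp
 qed
 also have "\<dots> = (LBINT y:{a<..<b}. f0 y * P' y) - f0 a * (P b - P a)"
  using L2_on_mult[OF L(1) LP'] iP integral_FTC_open(1)[OF ab P(1) P(2)] by (simp add: set_integral_diff)
 also have "(LBINT s. (?I s * f1 s) * (LBINT y. indicator {s<..} y * (?I y * P' y)))
   = (LBINT s:{a<..<b}. f1 s * P b - f1 s * P s)"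
  unfolding set_lebesgue_integral_def
 proof (rule LBINT_cong[OF refl])
  fix s
  have e: "(LBINT y. indicator {s<..} y * (?I y * P' y)) = P b - P s" if s: "s \<in> {a<..<b}"
  proof -
   have "(LBINT y. indicator {s<..} y * (?I y * P' y)) = (LBINT y:{s<..<b}. P' y)"
    unfolding set_lebesgue_integral_def by (rule LBINT_cong) (use s in \<open>auto simp: indicator_def\<close>)
   also have "\<dots> = P b - P s"
    by (rule integral_FTC_open(1)[OF _ P(1)]) (use s in \<open>auto intro: continuous_on_subset[OF P(2)]\<close>)
   finally show ?thesis .
  qed
  show "(?I s * f1 s) * (LBINT y. indicator {s<..} y * (?I y * P' y)) = ?I s *\<^sub>R (f1 s * P b - f1 s * P s)"
  proof (cases "s \<in> {a<..<b}")
   case True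
   show ?thesis unfolding e[OF True] using True by (simp add: algebra_simps)
  qed simp
 qed
 also have "\<dots> = P b * (f0 b - f0 a) - (LBINT s:{a<..<b}. f1 s * P s)"
  using L2_on_mult[OF L(2) LP] i1 f[OF ab] by (simp add: set_integral_diff mult.commute)
 finally show ?thesis by (simp add: algebra_simps)
qed

section \<open>Piecewise polynomials on the whole line and sums over the grid\<close>

definition glob :: "real => nat => (int => nat => real) => real => real" where
 "glob D k V x = (let i = \<lfloor>x / D\<rfloor> in if x \<in> cell D i then cell_poly D k i (V i) x else 0)"

lemma cell_floor:
 assumes "D > 0" "x \<in> cell D i" shows "\<lfloor>x / D\<rfloor> = i"
proof -
 have "of_int i * D < x" "x < (of_int i + 1) * D" using assms(2) by (auto simp: cell_def grid_def)
 then have "of_int i < x / D" "x / D < of_int i + 1" using assms(1) by (auto simp: field_simps)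
 then show ?thesis by linarith
qed

lemma glob_cell: "D > 0 ==> x \<in> cell D i ==> glob D k V x = cell_poly D k i (V i) x"
 by (simp add: glob_def cell_floor)

text \<open>Grid points belong to no cell, and the value 0 there agrees with
  \<open>basis_fun\<close>.\<close>

lemma glob_outside: "\<forall>i. x \<notin> cell D i ==> glob D k V x = 0"
 by (simp add: glob_def Let_def)

lemma glob_diff: "glob D k U x - glob D k V x = glob D k (%i q. U i q - V i q) x"
 by (simp add: glob_def Let_def cell_poly_diff)

lemma glob_measurable [measurable]: "glob D k V \<in> borel_measurable borel"
proof -
 have "(%x. (if x \<in> cell D i then cell_poly D k i (V i) x else 0)) \<in> borel_measurable borel" for i
 proof -
  have [measurable]: "cell_poly D k i (V i) \<in> borel_measurable borel"
   by (rule borel_measurable_continuous_onI[OF continuous_cell_poly])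
  show ?thesis by measurable
 qed
 then show ?thesis
  unfolding glob_def[abs_def] Let_def
  by (intro measurable_compose_countable[where f="%i x. (if x \<in> cell D i then cell_poly D k i (V i) x else 0)" and g="%x. \<lfloor>x / D\<rfloor>"])
    (auto, measurable)
qed

definition csq :: "nat => (int => nat => real) => int => real" where
 "csq k V i = (\<Sum>q\<le>k. (V i q)^2)"

lemma csq_nonneg: "0 \<le> csq k V i"
 by (simp add: csq_def sum_nonneg)

text \<open>The factor \<open>M / D\<close> is forced by the scaling of \<open>cellwise\<close>,
  where the supremum bound is \<open>D\<close> times the budget.\<close>

lemma cellwise_glob:
 "\<exists>M\<ge>1. \<forall>D>0. \<forall>V. cellwise D (%i. M / D * csq k V i) (glob D k V)"
proof -
 obtain M where M: "M \<ge> 1" and b: "!!D i c x y. D > 0 ==> x \<in> closed_cell D i ==> y \<in> closed_cell D i ==>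
   (cell_poly D k i c x)^2 \<le> M * (\<Sum>q\<le>k. (c q)^2) \<and>
   (cell_poly D k i c x - cell_poly D k i c y)^2 \<le> M * (\<bar>x - y\<bar> / D) * (\<Sum>q\<le>k. (c q)^2)"
  using cell_poly_bounds[of k] by blast
 have "cellwise D (%i. M / D * csq k V i) (glob D k V)" if D: "D > 0" for D V
  unfolding cellwise_def
 proof (intro conjI allI ballI)
  show "0 \<le> M / D * csq k V i" for i using M D csq_nonneg by simp
  fix i x assume x: "x \<in> cell D i"
  then have cx: "x \<in> closed_cell D i" using cell_subset by blast
  show "(glob D k V x)^2 \<le> D * (M / D * csq k V i)" using b[OF D cx cx, of "V i"] D x by (simp add: glob_cell csq_def)
  fix y assume y: "y \<in> cell D i"
  then have cy: "y \<in> closed_cell D i" using cell_subset by blast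
  show "(glob D k V x - glob D k V y)^2 \<le> M / D * csq k V i * \<bar>x - y\<bar>"
   using b[OF D cx cy, of "V i"] D x y by (simp add: glob_cell csq_def mult_ac)
 qed measurable
 then show ?thesis using M by blast
qed

text \<open>The tail bound is the supremum of all finite sums minus the sum over the symmetric
  window. The supremum is nearly attained on a finite set, which lies in some such window.\<close>

lemma int_family_tails:
 fixes b :: "int => real"
 assumes b: "!!i. 0 \<le> b i" and M: "!!F. finite F ==> sum b F \<le> M"
 obtains \<tau> where "\<tau> \<longlonglongrightarrow> 0" "!!N F. finite F ==> F \<inter> {- int N..<int N} = {} ==> sum b F \<le> \<tau> N"
proof -
 define S where "S = (SUP F\<in>{F. finite F}. sum b F)"
 have bdd: "bdd_above (sum b ` {F. finite F})" by (rule bdd_aboveI2[of _ _ M]) (use M in auto)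
 have le: "sum b F \<le> S" if "finite F" for F unfolding S_def by (rule cSUP_upper[OF _ bdd]) (use that in auto)
 define \<tau> where "\<tau> N = S - sum b {- int N..<int N}" for N
 have "\<tau> \<longlonglongrightarrow> 0"
 proof (rule LIMSEQ_I)
  fix e :: real assume "0 < e"
  then have "S - e < (SUP F\<in>{F. finite F}. sum b F)" by (simp add: S_def)
  then have "\<exists>F\<in>{F. finite F}. S - e < sum b F" by (subst (asm) less_cSUP_iff[OF _ bdd]) auto
  then obtain F where F: "finite F" "S - e < sum b F" by auto
  obtain N0 where N0: "F \<subseteq> {- int N0..<int N0}"
  proof -
   have "finite ((%i. nat \<bar>i\<bar>) ` F)" using F by simp
   then obtain m where m: "!!i. i \<in> F ==> nat \<bar>i\<bar> \<le> m" by (metis finite_nat_set_iff_bounded_le imageI)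
   have "F \<subseteq> {- int (Suc m)..<int (Suc m)}"
   proof
    fix i assume "i \<in> F" then show "i \<in> {- int (Suc m)..<int (Suc m)}" using m[of i] by auto
   qed
   then show ?thesis using that by blast
  qed
  have "norm (\<tau> N - 0) < e" if "N \<ge> N0" for N
  proof -
   have "F \<subseteq> {- int N..<int N}" using N0 that by force
   then have "sum b F \<le> sum b {- int N..<int N}" using b by (intro sum_mono2) auto
   then show ?thesis using F(2) le[of "{- int N..<int N}"] by (simp add: \<tau>_def)
  qed
  then show "\<exists>no. \<forall>n\<ge>no. norm (\<tau> n - 0) < e" by blast
 qed
 moreover have "sum b F \<le> \<tau> N" if "finite F" "F \<inter> {- int N..<int N} = {}" for N F
  using le[of "F \<union> {- int N..<int N}"] that by (simp add: \<tau>_def sum.union_disjoint)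
 ultimately show ?thesis using that by blast
qed

text \<open>The offset \<open>m\<close> is there because an interface sees the cells on both of its
  sides.\<close>

lemma int_family_tendsto_0:
 fixes b :: "int => real"
 assumes b: "!!i. 0 \<le> b i" and M: "!!F. finite F ==> sum b F \<le> M"
 shows "(%N. b (int N + m)) \<longlonglongrightarrow> 0" "(%N. b (- int N + m)) \<longlonglongrightarrow> 0"
proof -
 have 1: "(%N. b (int N)) \<longlonglongrightarrow> 0 \<and> (%N. b (- int N)) \<longlonglongrightarrow> 0" if b: "!!i. 0 \<le> b i" and M: "!!F. finite F ==> sum b F \<le> M" for b :: "int => real"
 proof -
  obtain \<tau> where \<tau>: "\<tau> \<longlonglongrightarrow> 0" "!!N F. finite F ==> F \<inter> {- int N..<int N} = {} ==> sum b F \<le> \<tau> N"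
   using int_family_tails[OF b M] by blast
  have "b (int N) \<le> \<tau> N" for N using \<tau>(2)[of "{int N}" N] by simp
  moreover have "b (- int (Suc N)) \<le> \<tau> N" for N using \<tau>(2)[of "{- int (Suc N)}" N] by simp
  ultimately have "(%N. b (int N)) \<longlonglongrightarrow> 0" "(%N. b (- int (Suc N))) \<longlonglongrightarrow> 0"
   by (auto intro!: tendsto_sandwich[OF _ _ tendsto_const \<tau>(1)] always_eventually b)
  then show ?thesis using LIMSEQ_imp_Suc[of "%N. b (- int N)"] by blast
 qed
 have "sum (%i. b (i + m)) F \<le> M" if "finite F" for F
  using M[of "(%i. i + m) ` F"] that by (simp add: sum.reindex inj_on_def)
 from 1[of "%i. b (i + m)", OF b this] show "(%N. b (int N + m)) \<longlonglongrightarrow> 0" "(%N. b (- int N + m)) \<longlonglongrightarrow> 0" by auto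
qed

lemma sum_cells_le_integral:
 assumes f: "L2_on UNIV f" and D: "D > 0" and F: "finite F"
 shows "(\<Sum>i\<in>F. LBINT x:cell D i. (f x)^2) \<le> (LBINT x. (f x)^2)"
proof -
 have i: "integrable lborel (%x. (f x)^2)" and L: "L2_on (cell D i) f" for i
  using f L2_on_subset[OF f, of "cell D i"] by (auto simp: L2_on_UNIV)
 have ii: "integrable lborel (%x. indicator (cell D i) x * (f x)^2)" for i using L by (simp add: L2_on_def set_integrable_def)
 have "(\<Sum>i\<in>F. LBINT x:cell D i. (f x)^2) = (LBINT x. (\<Sum>i\<in>F. indicator (cell D i) x * (f x)^2))"
  unfolding set_lebesgue_integral_def using ii by simp
 also have "\<dots> \<le> (LBINT x. (f x)^2)"
 proof (rule Bochner_Integration.integral_mono)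
  fix x
  have "(\<Sum>i\<in>F. indicator (cell D i) x * (f x)^2) = (\<Sum>i\<in>F. if i = \<lfloor>x / D\<rfloor> then indicator (cell D i) x * (f x)^2 else 0)"
   by (intro sum.cong refl) (auto simp: indicator_def cell_floor[OF D])
  also have "\<dots> \<le> (f x)^2" using F by (simp add: indicator_def)
  finally show "(\<Sum>i\<in>F. indicator (cell D i) x * (f x)^2) \<le> (f x)^2" .
 qed (use ii i in auto)
 finally show ?thesis .
qed

lemma H_fourier_0: "H_fourier lam (%x. 0)" if "H_fourier lam v"
 using H_fourier_lin[OF that that, of 0 0] by simp

lemma g_pairing_lin_right:
 assumes "H_fourier lam f" "H_fourier lam g" "H_fourier lam v"
 shows "g_pairing lam v (%x. a * f x + b * g x) = a * g_pairing lam v f + b * g_pairing lam v g"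
 using g_pairing_lin_left[OF assms, of a b] by (simp add: g_pairing_commute[of lam v])

lemma g_pairing_sum_right:
 assumes v: "H_fourier lam v" and f: "!!j. H_fourier lam (f j)" and J: "finite J"
 shows "H_fourier lam (%x. \<Sum>j\<in>J. a j * f j x) \<and> g_pairing lam v (%x. \<Sum>j\<in>J. a j * f j x) = (\<Sum>j\<in>J. a j * g_pairing lam v (f j))"
 using J
proof (induction J)
 case empty
 show ?case using H_fourier_0[OF v] g_pairing_lin_right[OF v v v, of 0 0] by simp
next
 case (insert j J)
 show ?case using insert H_fourier_lin[OF f[of j], of "%x. \<Sum>j\<in>J. a j * f j x" "a j" 1]
   g_pairing_lin_right[OF f[of j] _ v, of "%x. \<Sum>j\<in>J. a j * f j x" "a j" 1]
  by simp
qed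

lemma basis_fun_glob:
 assumes "D > 0" "q \<le> k"
 shows "basis_fun D q i x = glob D k (%j p. if j = i \<and> p = q then 1 else 0) x"
proof (cases "x \<in> cell D i")
 case True
 have "(\<Sum>p\<le>k. (if i = i \<and> p = q then 1 else 0) * poly (legendre p) (ref_coord D i x))
   = (\<Sum>p\<le>k. if p = q then poly (legendre p) (ref_coord D i x) else 0)" by (intro sum.cong) auto
 then show ?thesis using assms True by (simp add: basis_fun_cell glob_cell cell_poly_def)
next
 case False
 then have "x \<in> cell D \<lfloor>x / D\<rfloor> ==> \<lfloor>x / D\<rfloor> \<noteq> i" by auto
 with False show ?thesis by (auto simp: glob_def Let_def basis_fun_def cell_poly_def intro!: sum.neutral)
qed

lemma cell_poly_deriv:
 "(cell_poly D k i c has_real_derivative (\<Sum>q\<le>k. c q * (2 / D * poly (pderiv (legendre q)) (ref_coord D i x)))) (at x)"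
proof -
 have "((%x. \<Sum>q\<le>k. c q * poly (legendre q) (ref_coord D i x)) has_real_derivative
   (\<Sum>q\<le>k. c q * (2 / D * poly (pderiv (legendre q)) (ref_coord D i x)))) (at x)"
 proof (intro DERIV_sum DERIV_cmult)
  fix q show "((%x. poly (legendre q) (ref_coord D i x)) has_real_derivative 2 / D * poly (pderiv (legendre q)) (ref_coord D i x)) (at x)"
   using DERIV_chain2[OF poly_DERIV[of "legendre q"] ref_coord_deriv[of D i x]] by (simp add: mult.commute)
 qed
 then show ?thesis by (simp add: cell_poly_def[abs_def])
qed

lemma cell_poly_ends:
 assumes "D > 0"
 shows "cell_poly D k i c (grid D i) = (\<Sum>q\<le>k. (- 1) ^ q * c q)" "cell_poly D k i c (grid D (i + 1)) = (\<Sum>q\<le>k. c q)"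
 using assms by (simp_all add: cell_poly_def ref_coord_def grid_Suc legendre_at_1 legendre_at_minus_1 mult.commute)

lemma deriv_basis_fun:
 assumes "D > 0" "x \<in> cell D i"
 shows "deriv (basis_fun D q i) x = 2 / D * poly (pderiv (legendre q)) (ref_coord D i x)"
proof (rule DERIV_imp_deriv)
 have "((%x. poly (legendre q) (ref_coord D i x)) has_real_derivative 2 / D * poly (pderiv (legendre q)) (ref_coord D i x)) (at x)"
  using DERIV_chain2[OF poly_DERIV[of "legendre q"] ref_coord_deriv[of D i x]] by (simp add: mult.commute)
 then show "(basis_fun D q i has_real_derivative 2 / D * poly (pderiv (legendre q)) (ref_coord D i x)) (at x)"
  by (rule has_field_derivative_transform_within_open[of _ _ _ "cell D i"]) (use assms in \<open>auto simp: basis_fun_cell cell_def\<close>)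
qed

text \<open>Legendre polynomials take the values 1 and \<open>(- 1) ^ q\<close> at the ends of the
  reference interval, so the limit from the left is the plain sum over cell \<open>i - 1\<close> and
  the limit from the right the alternating sum over cell \<open>i\<close>.\<close>

lemma flux_at_glob:
 assumes D: "D > 0"
 shows "flux_at c D (glob D k U) i = flux c (\<Sum>q\<le>k. U (i - 1) q) (\<Sum>q\<le>k. (- 1) ^ q * U i q)"
proof -
 have cont: "isCont (cell_poly D k j (U j)) x" for j x by (rule DERIV_isCont[OF cell_poly_deriv])
 have "(glob D k U \<longlongrightarrow> cell_poly D k (i - 1) (U (i - 1)) (grid D i)) (at_left (grid D i))"
 proof (rule Lim_transform_eventually)
  show "(cell_poly D k (i - 1) (U (i - 1)) \<longlongrightarrow> cell_poly D k (i - 1) (U (i - 1)) (grid D i)) (at_left (grid D i))"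
   using cont[where j="i - 1" and x="grid D i"] by (auto simp: isCont_def intro: tendsto_within_subset)
  have "\<forall>\<^sub>F x in at_left (grid D i). x \<in> {grid D (i - 1)<..<grid D i}"
   using D by (intro eventually_at_leftI[of "grid D (i - 1)"]) (auto simp: grid_def)
  then show "\<forall>\<^sub>F x in at_left (grid D i). cell_poly D k (i - 1) (U (i - 1)) x = glob D k U x"
   by eventually_elim (simp add: glob_cell[OF D, of _ "i - 1"] cell_def)
 qed
 then have l: "Lim (at_left (grid D i)) (glob D k U) = (\<Sum>q\<le>k. U (i - 1) q)"
  using cell_poly_ends(2)[OF D, of k "i - 1" "U (i - 1)"] by (simp add: tendsto_Lim)
 have "(glob D k U \<longlongrightarrow> cell_poly D k i (U i) (grid D i)) (at_right (grid D i))"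
 proof (rule Lim_transform_eventually)
  show "(cell_poly D k i (U i) \<longlongrightarrow> cell_poly D k i (U i) (grid D i)) (at_right (grid D i))"
   using cont[where j=i and x="grid D i"] by (auto simp: isCont_def intro: tendsto_within_subset)
  have "\<forall>\<^sub>F x in at_right (grid D i). x \<in> {grid D i<..<grid D (i + 1)}"
   using D by (intro eventually_at_rightI[of _ "grid D (i + 1)"]) (auto simp: grid_Suc)
  then show "\<forall>\<^sub>F x in at_right (grid D i). cell_poly D k i (U i) x = glob D k U x"
   by eventually_elim (simp add: glob_cell[OF D, of _ i] cell_def)
 qed
 then have "Lim (at_right (grid D i)) (glob D k U) = (\<Sum>q\<le>k. (- 1) ^ q * U i q)"
  using cell_poly_ends(1)[OF D, of k i "U i"] by (simp add: tendsto_Lim)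
 with l show ?thesis by (simp add: flux_at_def)
qed

text \<open>These are the properties that Parseval's identity asks of its second argument;
  continuity can fail only at the two end points of the cell.\<close>

lemma basis_fun_test:
 assumes "D > 0"
 shows "L2c (basis_fun D q i)" "\<exists>M. \<forall>x. \<bar>basis_fun D q i x\<bar> \<le> M" "AE x in lborel. isCont (basis_fun D q i) x"
proof -
 have g: "basis_fun D q i = glob D q (%j p. if j = i \<and> p = q then 1 else 0)"
  using basis_fun_glob[OF assms order_refl] by blast
 have m: "basis_fun D q i \<in> borel_measurable borel" unfolding g by measurable
 obtain M where M: "!!x. x \<in> {-1..1} ==> \<bar>poly (legendre q) x\<bar> \<le> M" using legendre_bounds[of q] by blast
 have M0: "0 \<le> M" using M[of 0] by (meson abs_ge_zero atLeastAtMost_iff neg_le_0_iff_le order_trans zero_le_one)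
 have b: "\<bar>basis_fun D q i x\<bar> \<le> M" for x
 proof (cases "x \<in> cell D i")
  case True
  then have "ref_coord D i x \<in> {-1..1}" using ref_coord_bounds[OF assms] cell_subset by blast
  then show ?thesis using M True by (simp add: basis_fun_cell)
 qed (simp add: basis_fun_def M0)
 then show "\<exists>M. \<forall>x. \<bar>basis_fun D q i x\<bar> \<le> M" by blast
 have "L2_on (cell D i) (basis_fun D q i)"
  using L2_on_cell_poly(2)[of D i q] by (subst L2_on_cong[where g="%x. poly (legendre q) (ref_coord D i x)"]) (auto simp: basis_fun_cell)
 then have "integrable lborel (%x. indicator (cell D i) x * (basis_fun D q i x)^2)" by (simp add: L2_on_def set_integrable_def)
 also have "(%x. indicator (cell D i) x * (basis_fun D q i x)^2) = (%x. (basis_fun D q i x)^2)"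
  by (auto simp: basis_fun_def indicator_def)
 finally have "integrable lborel (%x. (basis_fun D q i x)^2)" .
 moreover have "basis_fun D q i x = 0" if "\<bar>grid D i\<bar> + \<bar>grid D (i + 1)\<bar> < \<bar>x\<bar>" for x
  using that by (auto simp: basis_fun_def cell_def)
 ultimately show "L2c (basis_fun D q i)" using m unfolding L2c_def by blast
 have "AE x in lborel. x \<noteq> grid D i \<and> x \<noteq> grid D (i + 1)"
  using AE_lborel_singleton[of "grid D i"] AE_lborel_singleton[of "grid D (i + 1)"] by eventually_elim simp
 then show "AE x in lborel. isCont (basis_fun D q i) x"
 proof eventually_elim
  fix x assume x: "x \<noteq> grid D i \<and> x \<noteq> grid D (i + 1)"
  show "isCont (basis_fun D q i) x"
  proof (cases "x \<in> cell D i")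
   case True
   have "isCont (%x. poly (legendre q) (ref_coord D i x)) x"
    using DERIV_isCont[OF DERIV_chain2[OF poly_DERIV[of "legendre q"] ref_coord_deriv[of D i x]]] by simp
   moreover have "\<forall>\<^sub>F y in nhds x. y \<in> cell D i" using True by (intro eventually_nhds_in_open) (auto simp: cell_def)
   then have "\<forall>\<^sub>F y in nhds x. basis_fun D q i y = poly (legendre q) (ref_coord D i y)"
    by eventually_elim (simp add: basis_fun_cell)
   ultimately show ?thesis by (simp add: isCont_cong)
  next
   case False
   then have "x \<in> - closed_cell D i" using x by (auto simp: cell_def)
   then have "\<forall>\<^sub>F y in nhds x. y \<in> - closed_cell D i" by (intro eventually_nhds_in_open) auto
   then have "\<forall>\<^sub>F y in nhds x. basis_fun D q i y = 0"
    by eventually_elim (auto simp: basis_fun_def cell_def)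
   then show ?thesis by (simp add: isCont_cong)
  qed
 qed
qed

text \<open>One frozen time. \<open>f\<close> is the chain of representatives of the solution and
  its derivatives in \<open>x\<close>, \<open>ut\<close> its time derivative and \<open>h\<close>
  its fractional Laplacian. \<open>U'\<close> is just a family of numbers satisfying the scheme, so
  no differentiation in time enters.\<close>

locale dg_slice =
 fixes lam c D :: real and k :: nat and f :: "nat => real => real" and ut h :: "real => real"
  and U U' :: "int => nat => real"
 assumes lam: "0 < lam" "lam < 1" and D: "D > 0"
  and chain: "primitive_chain (Suc k) f"
  and L: "L2_on UNIV (f 0)" "L2_on UNIV (f 1)" "L2_on UNIV (f (Suc k))" "L2_on UNIV ut"
  and is_g: "is_g lam (f 0) h" and eqn: "AE x in lborel. h x = ut x + c * f 1 x"
  and LU: "L2_on UNIV (glob D k U)"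
  and dg: "!!q i. q \<le> k ==> D / (2 * real q + 1) * U' i q =
    (LBINT x:cell D i. c * glob D k U x * deriv (basis_fun D q i) x) + (- 1) ^ q * flux_at c D (glob D k U) i
    - flux_at c D (glob D k U) (i + 1) + g_pairing lam (glob D k U) (basis_fun D q i)"
begin

text \<open>\<open>Th\<close> holds the coefficients of theta. \<open>\<alpha> i\<close> and
  \<open>\<beta> i\<close> are the traces of theta at grid point \<open>i\<close> from the left and
  from the right, \<open>\<rho>l i\<close> and \<open>\<rho>r i\<close> those of the projection
  error, and \<open>\<Phi> i\<close> is the error of the numerical flux.\<close>

definition "Acoef i q = coef D i (f 0) q"
definition "Th i q = U i q - Acoef i q"
definition "\<rho> x = f 0 x - glob D k Acoef x"
definition "\<alpha> i = (\<Sum>q\<le>k. Th (i - 1) q)"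
definition "\<beta> i = (\<Sum>q\<le>k. (- 1) ^ q * Th i q)"
definition "\<Phi> i = flux_at c D (glob D k U) i - c * f 0 (grid D i)"
definition "\<rho>l i = f 0 (grid D i) - proj D k (i - 1) (f 0) (grid D i)"
definition "\<rho>r i = f 0 (grid D i) - proj D k i (f 0) (grid D i)"
definition "Nsq i = (LBINT x:cell D i. (f (Suc k) x)^2)"
definition "N2 = (LBINT x. (f (Suc k) x)^2)"

lemma L_cell: "L2_on (cell D i) (f 0)" "L2_on (cell D i) (f 1)" "L2_on (cell D i) (f (Suc k))" "L2_on (cell D i) ut"
 using L by (auto intro: L2_on_subset)

lemma proj_Acoef: "proj D k i (f 0) = cell_poly D k i (Acoef i)"
 by (simp add: proj_def Acoef_def[abs_def])

lemma sum_Nsq: "finite F ==> sum Nsq F \<le> N2"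
 unfolding Nsq_def N2_def by (rule sum_cells_le_integral[OF L(3) D])

lemma Nsq_nonneg: "0 \<le> Nsq i"
 unfolding Nsq_def by (rule L2_on_integral_nonneg)

lemma glob_Th: "glob D k Th x = glob D k U x - glob D k Acoef x"
 by (simp add: glob_diff Th_def[abs_def])

text \<open>The projection is linear and reproduces the discrete solution, so \<open>Th\<close>
  consists of the coefficients of the total error. Square summability follows from square
  integrability of that error, before any estimate for the scheme.\<close>

lemma Th_Bessel: "finite F ==> (\<Sum>i\<in>F. D / (2 * real k + 1) * csq k Th i) \<le> (LBINT x. (glob D k U x - f 0 x)^2)"
proof -
 assume F: "finite F"
 have Le: "L2_on UNIV (%x. glob D k U x - f 0 x)" by (intro L2_on_diff LU L)
 have "D / (2 * real k + 1) * csq k Th i \<le> (LBINT x:cell D i. (glob D k U x - f 0 x)^2)" for i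
 proof -
  have "coef D i (%x. glob D k U x - f 0 x) q = Th i q" if "q \<le> k" for q
  proof -
   have "coef D i (%x. glob D k U x - f 0 x) q = coef D i (glob D k U) q - coef D i (f 0) q"
    using L2_on_subset[OF LU] L_cell by (intro coef_diff) auto
   also have "coef D i (glob D k U) q = coef D i (cell_poly D k i (U i)) q"
    by (rule coef_cong) (simp add: glob_cell[OF D])
   finally show ?thesis using that D by (simp add: coef_cell_poly Th_def Acoef_def)
  qed
  then have "(\<Sum>q\<le>k. D / (2 * real q + 1) * (Th i q)^2) \<le> (LBINT x:cell D i. (glob D k U x - f 0 x)^2)"
   using coef_Bessel[OF L2_on_subset[OF Le] D, of i k] by simp
  moreover have "D / (2 * real k + 1) * csq k Th i \<le> (\<Sum>q\<le>k. D / (2 * real q + 1) * (Th i q)^2)"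
   unfolding csq_def sum_distrib_left using D by (intro sum_mono mult_right_mono divide_left_mono) auto
  ultimately show ?thesis by linarith
 qed
 then show ?thesis using sum_cells_le_integral[OF Le D F] by (meson order_trans sum_mono)
qed

text \<open>The scheme minus the weak form of the equation on one cell. The volume term of the
  projection error drops out, since the derivative of a basis function is again a polynomial of
  degree at most \<open>k\<close> on the cell; this error survives only in the fluxes and in the
  pairing.\<close>

lemma cell_identity:
 assumes q: "q \<le> k"
 shows "D / (2 * real q + 1) * (U' i q - coef D i ut q)
  = c * (LBINT x:cell D i. cell_poly D k i (Th i) x * (2 / D * poly (pderiv (legendre q)) (ref_coord D i x)))
   + (- 1) ^ q * \<Phi> i - \<Phi> (i + 1) + (g_pairing lam (glob D k U) (basis_fun D q i) - g_pairing lam (f 0) (basis_fun D q i))"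
proof -
 let ?P = "%x. poly (legendre q) (ref_coord D i x)" and ?P' = "%x. 2 / D * poly (pderiv (legendre q)) (ref_coord D i x)"
 let ?b = "basis_fun D q i"
 obtain M where M: "!!x. \<bar>?b x\<bar> \<le> M" using basis_fun_test(2)[OF D] by blast
 have P': "\<exists>d. ?P' = cell_poly D k i d"
 proof -
  have "?P' = poly (smult (2 / D) (pcompose (pderiv (legendre q)) [:- 2 * grid D i / D - 1, 2 / D:]))"
   by (simp add: poly_pcompose ref_coord_def fun_eq_iff diff_divide_distrib algebra_simps)
  moreover have "degree (smult (2 / D) (pcompose (pderiv (legendre q)) [:- 2 * grid D i / D - 1, 2 / D:])) \<le> k"
   using degree_pcompose_le[of "pderiv (legendre q)" "[:- 2 * grid D i / D - 1, 2 / D:]"] q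
   by (auto simp: degree_pderiv degree_legendre split: if_splits)
  ultimately show ?thesis using polynomial_eq_cell_poly[OF D] by metis
 qed
 have LP': "L2_on (cell D i) ?P'" using P' L2_on_cell_poly(1) by metis
 have "D / (2 * real q + 1) * coef D i ut q = (LBINT x:cell D i. ut x * ?P x)"
  by (rule cell_integral_eq_coef[OF D, symmetric])
 also have "\<dots> = (LBINT x:cell D i. h x * ?P x - c * (f 1 x * ?P x))"
  unfolding set_lebesgue_integral_def
 proof (rule integral_cong_AE)
  have "L2_on UNIV h" using is_g by (simp add: is_g_def)
  then have hm [measurable]: "h \<in> borel_measurable borel" by (simp add: L2_on_UNIV)
  have fm [measurable]: "f 1 \<in> borel_measurable borel" using L(2) by (simp add: L2_on_UNIV)
  have um [measurable]: "ut \<in> borel_measurable borel" using L(4) by (simp add: L2_on_UNIV)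
  have Pm [measurable]: "?P \<in> borel_measurable borel"
   by (rule borel_measurable_continuous_onI) (intro continuous_intros)
  show "(%x. indicat_real (cell D i) x *\<^sub>R (h x * ?P x - c * (f 1 x * ?P x))) \<in> borel_measurable lborel"
   by measurable
  show "(%x. indicat_real (cell D i) x *\<^sub>R (ut x * ?P x)) \<in> borel_measurable lborel"
   by measurable
  show "AE x in lborel. indicat_real (cell D i) x *\<^sub>R (ut x * ?P x) = indicat_real (cell D i) x *\<^sub>R (h x * ?P x - c * (f 1 x * ?P x))"
   using eqn by eventually_elim (simp add: algebra_simps)
 qed
 also have "\<dots> = (LBINT x:cell D i. h x * ?P x) - c * (LBINT x:cell D i. f 1 x * ?P x)"
  using is_g L2_on_subset[of UNIV h "cell D i"] L_cell by (simp add: is_g_def set_integral_diff L2_on_mult)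
 also have "(LBINT x:cell D i. h x * ?P x) = (LBINT x. h x * ?b x)"
  unfolding set_lebesgue_integral_def
  by (rule LBINT_cong) (auto simp: indicator_def basis_fun_cell, simp add: basis_fun_def)
 also have "\<dots> = g_pairing lam (f 0) ?b"
  by (rule is_g_pairing[OF is_g basis_fun_test(1)[OF D] M basis_fun_test(3)[OF D], symmetric])
 also have "(LBINT x:cell D i. f 1 x * ?P x)
   = f 0 (grid D (i + 1)) * ?P (grid D (i + 1)) - f 0 (grid D i) * ?P (grid D i) - (LBINT x:cell D i. f 0 x * ?P' x)"
  unfolding cell_def
 proof (rule integration_by_parts_primitive)
  show "grid D i \<le> grid D (i + 1)" using D by (simp add: grid_Suc)
  show "f 0 y - f 0 x = (LBINT s:{x<..<y}. f 1 s)" if "x \<le> y" for x y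
   using chain that by (simp add: primitive_chain_def)
  show "L2_on {grid D i<..<grid D (i + 1)} (f 0)" "L2_on {grid D i<..<grid D (i + 1)} (f 1)"
   using L_cell by (auto simp: cell_def)
  show "(?P has_real_derivative ?P' x) (at x)" for x
   using DERIV_chain2[OF poly_DERIV[of "legendre q"] ref_coord_deriv[of D i x]] by (simp add: mult.commute)
 qed (intro continuous_intros)
 finally have A0: "D / (2 * real q + 1) * coef D i ut q
  = g_pairing lam (f 0) ?b - c * (f 0 (grid D (i + 1)) * ?P (grid D (i + 1)) - f 0 (grid D i) * ?P (grid D i)
    - (LBINT x:cell D i. f 0 x * ?P' x))" .
 have "ref_coord D i (grid D (i + 1)) = 1" "ref_coord D i (grid D i) = - 1" using D by (simp_all add: ref_coord_def grid_Suc)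
 then have e1: "?P (grid D (i + 1)) = 1" and e2: "?P (grid D i) = (- 1) ^ q"
  by (simp_all only: legendre_at_1 legendre_at_minus_1)
 have A': "D / (2 * real q + 1) * coef D i ut q
  = g_pairing lam (f 0) ?b - c * (f 0 (grid D (i + 1)) - f 0 (grid D i) * (- 1) ^ q - (LBINT x:cell D i. f 0 x * ?P' x))"
  using A0 unfolding e1 e2 mult_1_right .
 have proj0: "(LBINT x:cell D i. (f 0 x - cell_poly D k i (Acoef i) x) * ?P' x) = 0"
 proof -
  obtain d where d: "?P' = cell_poly D k i d" using P' by blast
  have d': "cell_poly D k i d x = ?P' x" for x using fun_cong[OF d, of x] by (rule sym)
  show ?thesis using proj_orth[OF L_cell(1) D, where i=i and k=k and c=d] unfolding proj_Acoef d' .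
 qed
 note i1 = L2_on_mult[OF L2_on_cell_poly(1)[of D i k "Th i"] LP']
 note i2 = L2_on_mult[OF L_cell(1)[of i] LP']
 note i3 = L2_on_mult[OF L2_on_diff[OF L_cell(1)[of i] L2_on_cell_poly(1)[of D i k "Acoef i"]] LP']
 have "(LBINT x:cell D i. c * glob D k U x * deriv ?b x) = (LBINT x:cell D i. c * (cell_poly D k i (U i) x * ?P' x))"
  by (rule cell_integral_cong) (simp add: glob_cell[OF D] deriv_basis_fun[OF D])
 also have "\<dots> = c * (LBINT x:cell D i. cell_poly D k i (U i) x * ?P' x)" by simp
 also have "(LBINT x:cell D i. cell_poly D k i (U i) x * ?P' x)
   = (LBINT x:cell D i. (cell_poly D k i (Th i) x * ?P' x + f 0 x * ?P' x) - (f 0 x - cell_poly D k i (Acoef i) x) * ?P' x)"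
 proof (rule cell_integral_cong)
  fix x
  have e: "cell_poly D k i (Th i) x = cell_poly D k i (U i) x - cell_poly D k i (Acoef i) x"
   by (simp add: Th_def[abs_def] cell_poly_diff)
  have "a * p = ((a - b) * p + z * p) - (z - b) * p" for a b p z :: real by algebra
  then show "cell_poly D k i (U i) x * ?P' x = (cell_poly D k i (Th i) x * ?P' x + f 0 x * ?P' x) - (f 0 x - cell_poly D k i (Acoef i) x) * ?P' x"
   unfolding e .
 qed
 also have "\<dots> = (LBINT x:cell D i. cell_poly D k i (Th i) x * ?P' x) + (LBINT x:cell D i. f 0 x * ?P' x)"
  unfolding set_integral_diff(2)[OF set_integral_add(1)[OF i1 i2] i3] set_integral_add(2)[OF i1 i2] proj0 by (rule diff_zero)
 finally have I: "(LBINT x:cell D i. c * glob D k U x * deriv ?b x)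
   = c * ((LBINT x:cell D i. cell_poly D k i (Th i) x * ?P' x) + (LBINT x:cell D i. f 0 x * ?P' x))" .
 \<comment> \<open>\<open>F\<close> stands for the volume term of the exact solution; it occurs in
   both equations and cancels in the difference.\<close>
 have alg: "d * (u - w) = c * P + s * (a - c * x) - (b - c * y) + (gU - gf)"
  if "d * u = c * (P + F) + s * a - b + gU" "d * w = gf - c * (y - x * s - F)"
  for d u w P s a x b y gU gf F :: real
  using that by algebra
 show ?thesis unfolding \<Phi>_def by (rule alg[OF dg[OF q, of i, unfolded I] A'])
qed

text \<open>With theta itself as test function the volume term is the integral of the derivative of
  half its square, so only the values at the two ends of the cell remain.\<close>

lemma cell_energy:
 "(\<Sum>q\<le>k. D / (2 * real q + 1) * Th i q * (U' i q - coef D i ut q))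
  = c / 2 * ((\<alpha> (i + 1))^2 - (\<beta> i)^2) + \<Phi> i * \<beta> i - \<Phi> (i + 1) * \<alpha> (i + 1)
   + (\<Sum>q\<le>k. Th i q * (g_pairing lam (glob D k U) (basis_fun D q i) - g_pairing lam (f 0) (basis_fun D q i)))"
proof -
 let ?p = "cell_poly D k i (Th i)"
 let ?P' = "%q x. 2 / D * poly (pderiv (legendre q)) (ref_coord D i x)"
 have LP': "L2_on (cell D i) (?P' q)" for q by (rule L2_on_cell_continuous) (intro continuous_intros)
 have "(\<Sum>q\<le>k. Th i q * (LBINT x:cell D i. ?p x * ?P' q x)) = (LBINT x:cell D i. ?p x * (\<Sum>q\<le>k. Th i q * ?P' q x))"
 proof -
  have "(LBINT x:cell D i. ?p x * (\<Sum>q\<le>k. Th i q * ?P' q x)) = (LBINT x:cell D i. (\<Sum>q\<le>k. Th i q * (?p x * ?P' q x)))"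
   by (simp add: sum_distrib_left mult.left_commute)
  also have "\<dots> = (\<Sum>q\<le>k. LBINT x:cell D i. Th i q * (?p x * ?P' q x))"
   by (intro set_integral_sum_real set_integrable_mult_right L2_on_mult LP' L2_on_cell_poly)
  finally show ?thesis by simp
 qed
 also have "\<dots> = (?p (grid D (i + 1)))^2 / 2 - (?p (grid D i))^2 / 2"
  unfolding cell_def
 proof (rule integral_FTC_open)
  show "grid D i \<le> grid D (i + 1)" using D by (simp add: grid_Suc)
  fix x
  show "((%x. (?p x)^2 / 2) has_real_derivative ?p x * (\<Sum>q\<le>k. Th i q * ?P' q x)) (at x)"
   using DERIV_cdivide[OF DERIV_power[OF cell_poly_deriv[of D k i "Th i" x], of 2], of 2] by (simp add: mult.commute)
 qed (intro continuous_intros)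
 also have "\<dots> = ((\<alpha> (i + 1))^2 - (\<beta> i)^2) / 2"
  by (simp add: cell_poly_ends[OF D] \<alpha>_def \<beta>_def diff_divide_distrib)
 finally have 1: "(\<Sum>q\<le>k. Th i q * (LBINT x:cell D i. ?p x * ?P' q x)) = ((\<alpha> (i + 1))^2 - (\<beta> i)^2) / 2" .
 have "(\<Sum>q\<le>k. D / (2 * real q + 1) * Th i q * (U' i q - coef D i ut q))
   = (\<Sum>q\<le>k. Th i q * (D / (2 * real q + 1) * (U' i q - coef D i ut q)))"
  by (simp add: mult_ac)
 also have "\<dots> = (\<Sum>q\<le>k. c * (Th i q * (LBINT x:cell D i. ?p x * ?P' q x)) + \<Phi> i * ((- 1) ^ q * Th i q) - \<Phi> (i + 1) * Th i q
   + Th i q * (g_pairing lam (glob D k U) (basis_fun D q i) - g_pairing lam (f 0) (basis_fun D q i)))"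
  by (intro sum.cong refl, subst cell_identity) (simp_all add: algebra_simps)
 also have "\<dots> = c * (\<Sum>q\<le>k. Th i q * (LBINT x:cell D i. ?p x * ?P' q x)) + \<Phi> i * \<beta> i - \<Phi> (i + 1) * \<alpha> (i + 1)
   + (\<Sum>q\<le>k. Th i q * (g_pairing lam (glob D k U) (basis_fun D q i) - g_pairing lam (f 0) (basis_fun D q i)))"
  unfolding \<alpha>_def \<beta>_def sum_distrib_left by (simp add: sum.distrib sum_subtractf)
 finally show ?thesis unfolding 1 by simp
qed

lemma Phi_eq: "\<Phi> i = flux c (\<alpha> i) (\<beta> i) - flux c (\<rho>l i) (\<rho>r i)"
proof -
 have "proj D k (i - 1) (f 0) (grid D i) = (\<Sum>q\<le>k. Acoef (i - 1) q)"
  using cell_poly_ends(2)[OF D, of k "i - 1" "Acoef (i - 1)"] by (simp add: proj_Acoef)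
 moreover have "proj D k i (f 0) (grid D i) = (\<Sum>q\<le>k. (- 1) ^ q * Acoef i q)"
  using cell_poly_ends(1)[OF D, of k i "Acoef i"] by (simp add: proj_Acoef)
 ultimately show ?thesis
  unfolding \<Phi>_def flux_at_glob[OF D] \<alpha>_def \<beta>_def \<rho>l_def \<rho>r_def Th_def flux_def
  by (simp add: sum_subtractf algebra_simps)
qed

text \<open>Completing the square in the jump of theta. For \<open>c \<ge> 0\<close> the upwind flux
  reads the left value, so only the left trace of the projection error remains; for negative
  \<open>c\<close> it is the right one. The sum of both squares covers the two cases in one
  formula.\<close>

lemma interface_bound:
 "c / 2 * ((\<alpha> i)^2 - (\<beta> i)^2) + \<Phi> i * (\<beta> i - \<alpha> i) \<le> \<bar>c\<bar> / 2 * ((\<rho>l i)^2 + (\<rho>r i)^2)"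
proof -
 have bound: "X \<le> L + R" if "X + A = L" "0 \<le> A" "0 \<le> R" for X A L R :: real using that by linarith
 have e: "c / 2 * (a^2 - b^2) + (flux c a b - flux c l r) * (b - a) \<le> \<bar>c\<bar> / 2 * (l^2 + r^2)" for a b l r :: real
 proof (cases "c \<ge> 0")
  case True
  have "c / 2 * (a^2 - b^2) + (flux c a b - flux c l r) * (b - a) + c / 2 * (b - a + l)^2 = c / 2 * l^2"
   using True by (simp add: flux_def power2_eq_square field_simps)
  from bound[OF this, of "c / 2 * r^2"] show ?thesis using True by (simp add: distrib_left)
 next
  case False
  have "c / 2 * (a\<^sup>2 - b\<^sup>2) + (flux c a b - flux c l r) * (b - a) + (- c) / 2 * (b - a - r)\<^sup>2 = (- c) / 2 * r\<^sup>2"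
   using False by (simp add: flux_def power2_eq_square field_simps)
  note n = this
  have p: "0 \<le> (- c) / 2 * x\<^sup>2" for x using False by (intro mult_nonneg_nonneg) auto
  have "c / 2 * (a\<^sup>2 - b\<^sup>2) + (flux c a b - flux c l r) * (b - a) \<le> (- c) / 2 * r\<^sup>2 + (- c) / 2 * l\<^sup>2"
   by (rule bound[OF n p p])
  moreover have "\<bar>c\<bar> / 2 * (l\<^sup>2 + r\<^sup>2) = (- c) / 2 * r\<^sup>2 + (- c) / 2 * l\<^sup>2" using False by (simp add: distrib_left)
  ultimately show ?thesis by simp
 qed
 show ?thesis unfolding Phi_eq by (rule e)
qed

end

text \<open>Fixing the constant of \<open>proj_error_pointwise\<close> by choice makes it a function
  of \<open>k\<close> alone, the same for all mesh sizes, cells and functions.\<close>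

definition proj_const :: "nat => real" where
 "proj_const k = (SOME C. C \<ge> 1 \<and> (\<forall>D>0. \<forall>i f. primitive_chain (Suc k) f --> L2_on (cell D i) (f (Suc k)) --> L2_on (cell D i) (f 0) -->
   (\<forall>x\<in>closed_cell D i. \<forall>y\<in>closed_cell D i.
    (f 0 x - proj D k i (f 0) x)^2 \<le> C * (D ^ (2 * k) * (LBINT x:cell D i. (f (Suc k) x)^2)) * D \<and>
    ((f 0 x - proj D k i (f 0) x) - (f 0 y - proj D k i (f 0) y))^2
     \<le> C * (D ^ (2 * k) * (LBINT x:cell D i. (f (Suc k) x)^2)) * \<bar>x - y\<bar>)))"

lemma proj_const:
 "proj_const k \<ge> 1"
 "D > 0 ==> primitive_chain (Suc k) f ==> L2_on (cell D i) (f (Suc k)) ==> L2_on (cell D i) (f 0) ==>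
   x \<in> closed_cell D i ==> (f 0 x - proj D k i (f 0) x)^2 \<le> proj_const k * (D ^ (2 * k) * (LBINT x:cell D i. (f (Suc k) x)^2)) * D"
 "D > 0 ==> primitive_chain (Suc k) f ==> L2_on (cell D i) (f (Suc k)) ==> L2_on (cell D i) (f 0) ==>
   x \<in> closed_cell D i ==> y \<in> closed_cell D i ==>
   ((f 0 x - proj D k i (f 0) x) - (f 0 y - proj D k i (f 0) y))^2
     \<le> proj_const k * (D ^ (2 * k) * (LBINT x:cell D i. (f (Suc k) x)^2)) * \<bar>x - y\<bar>"
 using someI_ex[OF proj_error_pointwise[of k], folded proj_const_def] by blast+

lemma sum_telescope_int:
 fixes z :: "int => real"
 shows "(\<Sum>i\<in>{- int N..<int N}. z (i + 1) - z i) = z (int N) - z (- int N)"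
proof (induction N)
 case (Suc N)
 have "{- int (Suc N)..<int (Suc N)} = insert (- int (Suc N)) (insert (int N) {- int N..<int N})" by auto
 then show ?case using Suc by (simp add: algebra_simps)
qed simp

lemma sum_square_le:
 fixes a :: "nat => real"
 shows "(\<Sum>q\<le>k. a q)^2 \<le> (real k + 1) * (\<Sum>q\<le>k. (a q)^2)"
 using sum_squared_le_sum_of_squares[of a "{..k}"] by (simp add: mult.commute add.commute)

lemma tendsto_0_square:
 fixes a b :: "nat => real"
 assumes "!!N. (a N)^2 \<le> K * b N" "b \<longlonglongrightarrow> 0"
 shows "a \<longlonglongrightarrow> 0"
proof -
 have "(%N. (a N)^2) \<longlonglongrightarrow> 0"
  by (rule tendsto_sandwich[OF _ _ tendsto_const tendsto_mult_right_zero[OF assms(2), of K]]) (use assms(1) in auto)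
 then have "(%N. sqrt ((a N)^2)) \<longlonglongrightarrow> sqrt 0" by (rule tendsto_real_sqrt)
 then show ?thesis by (simp add: tendsto_rabs_zero_iff)
qed

text \<open>Restricted to finitely many cells a piecewise polynomial is a finite combination of
  basis functions, to which linearity of the pairing applies.\<close>

lemma glob_truncate:
 assumes D: "D > 0" and I: "finite I"
 shows "glob D k (%i q. if i \<in> I then V i q else 0) x = (\<Sum>j\<in>I \<times> {..k}. V (fst j) (snd j) * basis_fun D (snd j) (fst j) x)"
proof (cases "\<exists>i. x \<in> cell D i")
 case True
 then obtain i0 where i0: "x \<in> cell D i0" by blast
 have "basis_fun D q i x = (if i = i0 then poly (legendre q) (ref_coord D i0 x) else 0)" for q i
 proof (cases "i = i0")
  case False
  then have "x \<notin> cell D i" using cell_floor[OF D i0] cell_floor[OF D, of x i] by blast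
  then show ?thesis using False by (simp add: basis_fun_def)
 qed (use i0 in \<open>simp add: basis_fun_cell\<close>)
 then have "(\<Sum>j\<in>I \<times> {..k}. V (fst j) (snd j) * basis_fun D (snd j) (fst j) x)
   = (\<Sum>j\<in>I \<times> {..k}. V (fst j) (snd j) * (if fst j = i0 then poly (legendre (snd j)) (ref_coord D i0 x) else 0))" by simp
 also have "\<dots> = (\<Sum>i\<in>I. \<Sum>q\<le>k. V i q * (if i = i0 then poly (legendre q) (ref_coord D i0 x) else 0))"
  by (simp add: sum.cartesian_product split_def)
 also have "\<dots> = (\<Sum>i\<in>I. if i = i0 then (\<Sum>q\<le>k. V i0 q * poly (legendre q) (ref_coord D i0 x)) else 0)"
  by (intro sum.cong refl) auto
 finally show ?thesis using I by (simp add: glob_cell[OF D i0] cell_poly_def)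
next
 case False
 then show ?thesis by (simp add: glob_outside basis_fun_def)
qed

context dg_slice
begin

text \<open>The budget of the projection error in the sense of \<open>cellwise\<close>.\<close>

definition "B i = proj_const k * (D ^ (2 * k) * Nsq i)"

lemma B_nonneg: "0 \<le> B i"
 using proj_const(1)[of k] Nsq_nonneg D by (simp add: B_def)

lemma sum_B: "finite F ==> sum B F \<le> proj_const k * (D ^ (2 * k) * N2)"
 using sum_Nsq proj_const(1)[of k] D unfolding B_def sum_distrib_left[symmetric] by (intro mult_left_mono) auto

lemma cellwise_rho: "cellwise D B \<rho>"
 unfolding cellwise_def
proof (intro conjI allI ballI B_nonneg)
 have [measurable]: "f 0 \<in> borel_measurable borel" using L by (simp add: L2_on_UNIV)
 show "\<rho> \<in> borel_measurable borel" unfolding \<rho>_def[abs_def] by measurable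
 fix i x assume x: "x \<in> cell D i"
 have e: "\<rho> x = f 0 x - proj D k i (f 0) x" if "x \<in> cell D i" for x
  by (simp add: \<rho>_def glob_cell[OF D that] proj_Acoef)
 have cx: "x \<in> closed_cell D i" if "x \<in> cell D i" for x using that cell_subset by blast
 show "(\<rho> x)^2 \<le> D * B i"
  using proj_const(2)[OF D chain L_cell(3,1) cx[OF x]] by (simp add: e[OF x] B_def Nsq_def mult_ac)
 fix y assume y: "y \<in> cell D i"
 show "(\<rho> x - \<rho> y)^2 \<le> B i * \<bar>x - y\<bar>"
  using proj_const(3)[OF D chain L_cell(3,1) cx[OF x] cx[OF y]] by (simp add: e[OF x] e[OF y] B_def Nsq_def)
qed

lemmas H_rho = cellwise_H_fourier[OF lam cellwise_rho D sum_B]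

lemma rho_trace: "(\<rho>l i)^2 \<le> D * B (i - 1)" "(\<rho>r i)^2 \<le> D * B i"
proof -
 have "grid D i \<in> closed_cell D (i - 1)" "grid D i \<in> closed_cell D i"
  using D by (auto simp: grid_def algebra_simps)
 then show "(\<rho>l i)^2 \<le> D * B (i - 1)" "(\<rho>r i)^2 \<le> D * B i"
  using proj_const(2)[OF D chain L_cell(3,1)] by (simp_all add: \<rho>l_def \<rho>r_def B_def Nsq_def mult_ac)
qed

lemma sum_csq: "finite F ==> sum (csq k Th) F \<le> (2 * real k + 1) / D * (LBINT x. (glob D k U x - f 0 x)^2)"
 using Th_Bessel[of F] D unfolding sum_distrib_left[symmetric] by (simp add: field_simps)

text \<open>\<open>z i\<close> is the part of the energy flux through interface \<open>i\<close>
  that telescopes. It is quadratic in traces whose squares are bounded by summable cell quantities,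
  so it vanishes at both ends of a growing window.\<close>

lemma trace_tendsto_0:
 assumes z: "!!i. z i = c / 2 * (\<alpha> i)^2 - \<Phi> i * \<alpha> i"
 shows "(%N. z (int N)) \<longlonglongrightarrow> 0" "(%N. z (- int N)) \<longlonglongrightarrow> 0"
proof -
 have a: "(\<alpha> i)^2 \<le> (real k + 1) * csq k Th (i - 1)" for i
  unfolding \<alpha>_def csq_def by (rule sum_square_le)
 have b: "(\<beta> i)^2 \<le> (real k + 1) * csq k Th i" for i
 proof -
  have "((- 1) ^ q * x)\<^sup>2 = x\<^sup>2" for q and x :: real by (cases "even q") auto
  then show ?thesis using sum_square_le[of "%q. (- 1) ^ q * Th i q" k] by (simp only: \<beta>_def csq_def)
 qed
 note t = int_family_tendsto_0[OF csq_nonneg sum_csq, of "- 1"] int_family_tendsto_0[OF csq_nonneg sum_csq, of 0]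
  int_family_tendsto_0[OF B_nonneg sum_B, of "- 1"] int_family_tendsto_0[OF B_nonneg sum_B, of 0]
 have 1: "(%N. z (m N)) \<longlonglongrightarrow> 0"
  if "(%N. csq k Th (m N - 1)) \<longlonglongrightarrow> 0" "(%N. csq k Th (m N)) \<longlonglongrightarrow> 0" "(%N. B (m N - 1)) \<longlonglongrightarrow> 0" "(%N. B (m N)) \<longlonglongrightarrow> 0"
  for m :: "nat => int"
 proof -
  have "(%N. \<alpha> (m N)) \<longlonglongrightarrow> 0" "(%N. \<beta> (m N)) \<longlonglongrightarrow> 0" "(%N. \<rho>l (m N)) \<longlonglongrightarrow> 0" "(%N. \<rho>r (m N)) \<longlonglongrightarrow> 0"
   by (rule tendsto_0_square[where b="%N. csq k Th (m N - 1)", OF a that(1)]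
     tendsto_0_square[where b="%N. csq k Th (m N)", OF b that(2)]
     tendsto_0_square[where b="%N. B (m N - 1)", OF rho_trace(1) that(3)]
     tendsto_0_square[where b="%N. B (m N)", OF rho_trace(2) that(4)])+
  then have "(%N. c / 2 * (\<alpha> (m N))^2 - (flux c (\<alpha> (m N)) (\<beta> (m N)) - flux c (\<rho>l (m N)) (\<rho>r (m N))) * \<alpha> (m N))
    \<longlonglongrightarrow> c / 2 * 0^2 - (flux c 0 0 - flux c 0 0) * 0"
   unfolding flux_def by (intro tendsto_intros)
  then show ?thesis by (simp add: z Phi_eq)
 qed
 show "(%N. z (int N)) \<longlonglongrightarrow> 0" "(%N. z (- int N)) \<longlonglongrightarrow> 0"
  using 1[of int] 1[of "%N. - int N"] t by simp_all
qed

lemma H_f: "H_fourier lam (f 0)"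
 by (rule is_g_H_fourier[OF is_g lam(1)])

lemma H_Th: "H_fourier lam (glob D k Th)"
proof -
 obtain M where M: "M \<ge> 1" "!!V. cellwise D (%i. M / D * csq k V i) (glob D k V)" using cellwise_glob D by blast
 show ?thesis
 proof (rule cellwise_H_fourier(1)[OF lam M(2) D])
  show "(\<Sum>i\<in>F. M / D * csq k Th i) \<le> M / D * ((2 * real k + 1) / D * (LBINT x. (glob D k U x - f 0 x)^2))"
   if "finite F" for F
   unfolding sum_distrib_left[symmetric] using sum_csq[OF that] M D by (intro mult_left_mono) auto
 qed
qed

lemma eta_eq: "glob D k U x - f 0 x = 1 * glob D k Th x + (- 1) * \<rho> x"
 by (simp add: glob_Th \<rho>_def)

text \<open>Theta and the projection error are both \<open>cellwise\<close>, so the total error has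
  a finite seminorm; adding the exact solution transfers this to the discrete one.\<close>

lemma H_eta: "H_fourier lam (%x. glob D k U x - f 0 x)"
 unfolding eta_eq by (rule H_fourier_lin[OF H_Th H_rho(1)])

lemma H_U: "H_fourier lam (glob D k U)"
 using H_fourier_lin[OF H_eta H_f, of 1 1] by simp

lemma H_basis: "H_fourier lam (basis_fun D q i)"
proof -
 obtain M where M: "M \<ge> 1" "!!V. cellwise D (%i. M / D * csq q V i) (glob D q V)" using cellwise_glob D by blast
 let ?V = "%j p. if j = i \<and> p = q then 1 else 0 :: real"
 have e: "csq q ?V j = (if j = i then 1 else 0)" for j
  unfolding csq_def by (auto simp: if_distrib[where f="%x. x^2"] sum.delta cong: if_cong)
 have "H_fourier lam (glob D q ?V)"
 proof (rule cellwise_H_fourier(1)[OF lam M(2) D])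
  show "(\<Sum>j\<in>F. M / D * csq q ?V j) \<le> M / D" if "finite F" for F
  proof -
   have "(\<Sum>j\<in>F. M / D * csq q ?V j) = (\<Sum>j\<in>F. if j = i then M / D else 0)" by (intro sum.cong) (auto simp: e)
   then show ?thesis using that M D by (simp add: sum.delta)
  qed
 qed
 moreover have "basis_fun D q i = glob D q ?V" using basis_fun_glob[OF D order_refl] by blast
 ultimately show ?thesis by simp
qed

text \<open>The finite sum is the pairing with theta restricted to the window. The part outside is a
  piecewise polynomial whose seminorm is bounded by the tail of the sums of \<open>csq k Th\<close>,
  so its pairing vanishes by Cauchy-Schwarz.\<close>

lemma pairing_limit:
 "(%N. \<Sum>i\<in>{- int N..<int N}. \<Sum>q\<le>k. Th i q * (g_pairing lam (glob D k U) (basis_fun D q i) - g_pairing lam (f 0) (basis_fun D q i)))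
   \<longlonglongrightarrow> g_pairing lam (%x. glob D k U x - f 0 x) (glob D k Th)"
proof -
 let ?\<eta> = "%x. glob D k U x - f 0 x"
 let ?T = "%N. glob D k (%i q. if i \<in> {- int N..<int N} then Th i q else 0)"
 let ?R = "%N. glob D k (%i q. if i \<in> {- int N..<int N} then 0 else Th i q)"
 obtain M where M: "M \<ge> 1" "!!V. cellwise D (%i. M / D * csq k V i) (glob D k V)" using cellwise_glob D by blast
 obtain \<tau> where \<tau>: "\<tau> \<longlonglongrightarrow> 0" "!!N F. finite F ==> F \<inter> {- int N..<int N} = {} ==> sum (csq k Th) F \<le> \<tau> N"
  using int_family_tails[OF csq_nonneg sum_csq] by blast
 have bR: "(\<Sum>i\<in>F. M / D * csq k (%i q. if i \<in> {- int N..<int N} then 0 else Th i q) i) \<le> M / D * \<tau> N" if F: "finite F" for F N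
 proof -
  have "(\<Sum>i\<in>F. csq k (%i q. if i \<in> {- int N..<int N} then 0 else Th i q) i) = sum (csq k Th) (F - {- int N..<int N})"
   using F by (intro sum.mono_neutral_cong_right) (auto simp: csq_def)
  also have "\<dots> \<le> \<tau> N" using F by (intro \<tau>(2)) auto
  finally show ?thesis unfolding sum_distrib_left[symmetric] using M D by (intro mult_left_mono) auto
 qed
 have HR: "H_fourier lam (?R N)" "semi_sq lam (?R N) \<le> 2 * gag_const lam * D powr (2 - lam) * (M / D * \<tau> N)" for N
  by (rule cellwise_H_fourier[OF lam M(2) D bR], assumption)+
 have RT: "?T N x = 1 * glob D k Th x + (- 1) * ?R N x" for N x
  using glob_diff[of D k Th x "%i q. if i \<in> {- int N..<int N} then 0 else Th i q"]
  by (simp add: if_distrib cong: if_cong)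
 have e: "(\<Sum>i\<in>{- int N..<int N}. \<Sum>q\<le>k. Th i q * (g_pairing lam (glob D k U) (basis_fun D q i) - g_pairing lam (f 0) (basis_fun D q i)))
   = g_pairing lam ?\<eta> (glob D k Th) - g_pairing lam ?\<eta> (?R N)" for N
 proof -
  have "g_pairing lam (glob D k U) (basis_fun D q i) - g_pairing lam (f 0) (basis_fun D q i) = g_pairing lam ?\<eta> (basis_fun D q i)" for i q
   using g_pairing_lin_left[OF H_U H_f H_basis, of 1 "- 1"] by simp
  then have "(\<Sum>i\<in>{- int N..<int N}. \<Sum>q\<le>k. Th i q * (g_pairing lam (glob D k U) (basis_fun D q i) - g_pairing lam (f 0) (basis_fun D q i)))
    = (\<Sum>j\<in>{- int N..<int N} \<times> {..k}. Th (fst j) (snd j) * g_pairing lam ?\<eta> (basis_fun D (snd j) (fst j)))"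
   by (simp add: sum.cartesian_product split_def)
  also have "\<dots> = g_pairing lam ?\<eta> (%x. \<Sum>j\<in>{- int N..<int N} \<times> {..k}. Th (fst j) (snd j) * basis_fun D (snd j) (fst j) x)"
   using g_pairing_sum_right[OF H_eta H_basis, of "{- int N..<int N} \<times> {..k}" "%j. Th (fst j) (snd j)" snd fst] by simp
  also have "\<dots> = g_pairing lam ?\<eta> (?T N)"
   by (rule arg_cong[where f="g_pairing lam ?\<eta>"], rule ext, rule glob_truncate[OF D, symmetric]) simp
  also have "\<dots> = g_pairing lam ?\<eta> (glob D k Th) - g_pairing lam ?\<eta> (?R N)"
   unfolding RT using g_pairing_lin_right[OF H_Th HR(1) H_eta, of 1 "- 1" N] by simp
  finally show ?thesis .
 qed
 have "(%N. g_pairing lam ?\<eta> (?R N)) \<longlonglongrightarrow> 0"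
 proof (rule tendsto_0_square[OF _ \<tau>(1)])
  fix N
  have "(2 * pi)^2 * (g_pairing lam ?\<eta> (?R N))^2 \<le> semi_sq lam ?\<eta> * semi_sq lam (?R N)"
   using g_pairing_Cauchy_Schwarz[OF H_eta HR(1)[of N]] by (simp add: power_mult_distrib)
  also have "\<dots> \<le> semi_sq lam ?\<eta> * (2 * gag_const lam * D powr (2 - lam) * (M / D * \<tau> N))"
   by (intro mult_left_mono HR semi_sq_nonneg)
  finally have "(g_pairing lam ?\<eta> (?R N))^2 \<le> (semi_sq lam ?\<eta> * (2 * gag_const lam * D powr (2 - lam) * (M / D * \<tau> N))) / (2 * pi)^2"
   by (subst pos_le_divide_eq) (simp_all add: mult.commute)
  also have "\<dots> = (semi_sq lam ?\<eta> * (2 * gag_const lam * D powr (2 - lam) * (M / D)) / (2 * pi)^2) * \<tau> N" by simp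
  finally show "(g_pairing lam ?\<eta> (?R N))^2 \<le> (semi_sq lam ?\<eta> * (2 * gag_const lam * D powr (2 - lam) * (M / D)) / (2 * pi)^2) * \<tau> N" .
 qed
 from tendsto_diff[OF tendsto_const this, of "g_pairing lam ?\<eta> (glob D k Th)"] show ?thesis unfolding e by simp
qed

text \<open>The pairing splits into minus the dissipation of theta and a cross term with the
  projection error. In the estimate of \<open>sqrt (R * S)\<close> by \<open>S + R / 4\<close> the
  weights are chosen so that the full dissipation absorbs the cross term.\<close>

lemma pairing_bound:
 "g_pairing lam (%x. glob D k U x - f 0 x) (glob D k Th) \<le> semi_sq lam \<rho> / (8 * pi)"
proof -
 let ?g = "g_pairing lam \<rho> (glob D k Th)" and ?S = "semi_sq lam (glob D k Th)" and ?R = "semi_sq lam \<rho>"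
 have "(2 * pi * ?g)^2 \<le> ?R * ?S" by (rule g_pairing_Cauchy_Schwarz[OF H_rho(1) H_Th])
 also have "\<dots> \<le> (?S + ?R / 4)^2"
  using zero_le_power2[of "?S - ?R / 4"] by (simp add: power2_eq_square algebra_simps)
 finally have "\<bar>2 * pi * ?g\<bar> \<le> \<bar>?S + ?R / 4\<bar>" by (simp add: abs_le_square_iff)
 then have "- (2 * pi * ?g) \<le> ?S + ?R / 4" using semi_sq_nonneg[of lam "glob D k Th"] semi_sq_nonneg[of lam \<rho>] by linarith
 moreover have "g_pairing lam (%x. glob D k U x - f 0 x) (glob D k Th) = - (?S / (2 * pi)) - ?g"
  using g_pairing_lin_left[OF H_Th H_rho(1) H_Th, of 1 "- 1"] by (simp add: eta_eq g_pairing_self)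
 moreover have "- ?g \<le> (?S + ?R / 4) / (2 * pi)"
  using \<open>- (2 * pi * ?g) \<le> ?S + ?R / 4\<close> by (subst pos_le_divide_eq) (simp_all add: mult.commute)
 moreover have "(?S + ?R / 4) / (2 * pi) = ?S / (2 * pi) + ?R / (8 * pi)" by (simp add: add_divide_distrib)
 ultimately show ?thesis by linarith
qed

text \<open>The jump terms of the upwind flux and the dissipation of the nonlocal operator absorb every contribution
 of the discrete error itself, so that only the projection error survives.\<close>

theorem energy_rate:
 assumes R: "(%N. \<Sum>i\<in>{- int N..<int N}. \<Sum>q\<le>k. D / (2 * real q + 1) * Th i q * (U' i q - coef D i ut q)) \<longlonglongrightarrow> R"
 shows "R \<le> \<bar>c\<bar> * proj_const k * D ^ (2 * k + 1) * N2 + semi_sq lam \<rho> / (8 * pi)"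
proof -
 \<comment> \<open>Adding and subtracting \<open>z\<close> regroups the sum over cells by
   interfaces: at interface \<open>i\<close> the expression of \<open>interface_bound\<close>
   appears, and the rest telescopes.\<close>
 define z where "z i = c / 2 * (\<alpha> i)^2 - \<Phi> i * \<alpha> i" for i
 let ?G = "%i. \<Sum>q\<le>k. Th i q * (g_pairing lam (glob D k U) (basis_fun D q i) - g_pairing lam (f 0) (basis_fun D q i))"
 let ?C = "proj_const k * (D ^ (2 * k) * N2)"
 have alg: "m * (a1 - b) + p * B - p1 * A1 = (m * (a - b) + p * (B - A)) + ((m * a1 - p1 * A1) - (m * a - p * A))"
  for m a a1 b p p1 B A A1 :: real by (simp add: algebra_simps)
 have arith: "X \<le> Y ==> e = X + Z ==> e + G \<le> Y + Z + G" for X Y Z G e :: real by simp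
 have le: "(\<Sum>i\<in>{- int N..<int N}. \<Sum>q\<le>k. D / (2 * real q + 1) * Th i q * (U' i q - coef D i ut q))
   \<le> \<bar>c\<bar> * D * ?C + (z (int N) - z (- int N)) + (\<Sum>i\<in>{- int N..<int N}. ?G i)" for N
 proof -
  have "(\<Sum>q\<le>k. D / (2 * real q + 1) * Th i q * (U' i q - coef D i ut q))
    \<le> \<bar>c\<bar> / 2 * D * (B (i - 1) + B i) + (z (i + 1) - z i) + ?G i" for i
  proof -
   have "\<bar>c\<bar> / 2 * ((\<rho>l i)^2 + (\<rho>r i)^2) \<le> \<bar>c\<bar> / 2 * (D * B (i - 1) + D * B i)"
    by (intro mult_left_mono add_mono rho_trace) auto
   then have "c / 2 * ((\<alpha> i)^2 - (\<beta> i)^2) + \<Phi> i * (\<beta> i - \<alpha> i) \<le> \<bar>c\<bar> / 2 * D * (B (i - 1) + B i)"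
    using interface_bound[of i] by (simp add: distrib_left)
   moreover have "c / 2 * ((\<alpha> (i + 1))^2 - (\<beta> i)^2) + \<Phi> i * \<beta> i - \<Phi> (i + 1) * \<alpha> (i + 1)
    = (c / 2 * ((\<alpha> i)^2 - (\<beta> i)^2) + \<Phi> i * (\<beta> i - \<alpha> i)) + (z (i + 1) - z i)"
    unfolding z_def by (rule alg)
   ultimately show ?thesis unfolding cell_energy by (rule arith)
  qed
  then have "(\<Sum>i\<in>{- int N..<int N}. \<Sum>q\<le>k. D / (2 * real q + 1) * Th i q * (U' i q - coef D i ut q))
   \<le> (\<Sum>i\<in>{- int N..<int N}. \<bar>c\<bar> / 2 * D * (B (i - 1) + B i) + (z (i + 1) - z i) + ?G i)" by (rule sum_mono)
  also have "\<dots> = \<bar>c\<bar> / 2 * D * ((\<Sum>i\<in>{- int N..<int N}. B (i - 1)) + sum B {- int N..<int N}) + (z (int N) - z (- int N)) + (\<Sum>i\<in>{- int N..<int N}. ?G i)"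
   unfolding sum.distrib sum_telescope_int by (simp add: sum_distrib_left sum.distrib distrib_left)
  also have "(\<Sum>i\<in>{- int N..<int N}. B (i - 1)) = sum B ((%i. i - 1) ` {- int N..<int N})"
   by (simp add: sum.reindex inj_on_def)
  also have "\<bar>c\<bar> / 2 * D * (sum B ((%i. i - 1) ` {- int N..<int N}) + sum B {- int N..<int N}) + (z (int N) - z (- int N)) + (\<Sum>i\<in>{- int N..<int N}. ?G i)
    \<le> \<bar>c\<bar> / 2 * D * (?C + ?C) + (z (int N) - z (- int N)) + (\<Sum>i\<in>{- int N..<int N}. ?G i)"
   using D by (intro add_right_mono mult_left_mono add_mono sum_B) auto
  also have "\<bar>c\<bar> / 2 * D * (?C + ?C) = \<bar>c\<bar> * D * ?C" by simp
  finally show ?thesis .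
 qed
 have t: "(%N. z (int N)) \<longlonglongrightarrow> 0" "(%N. z (- int N)) \<longlonglongrightarrow> 0"
  by (rule trace_tendsto_0, rule z_def)+
 have "(%N. \<bar>c\<bar> * D * ?C + (z (int N) - z (- int N)) + (\<Sum>i\<in>{- int N..<int N}. ?G i))
   \<longlonglongrightarrow> \<bar>c\<bar> * D * ?C + (0 - 0) + g_pairing lam (%x. glob D k U x - f 0 x) (glob D k Th)"
  by (rule tendsto_add[OF tendsto_add[OF tendsto_const tendsto_diff[OF t]] pairing_limit])
 then have "R \<le> \<bar>c\<bar> * D * ?C + (0 - 0) + g_pairing lam (%x. glob D k U x - f 0 x) (glob D k Th)"
  by (rule LIMSEQ_le[OF R]) (use le in blast)
 also have "\<dots> \<le> \<bar>c\<bar> * D * ?C + semi_sq lam \<rho> / (8 * pi)" using pairing_bound by simp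
 also have "\<bar>c\<bar> * D * ?C = \<bar>c\<bar> * proj_const k * D ^ (2 * k + 1) * N2" by simp
 finally show ?thesis .
qed

end

section \<open>The seminorm of the projection error for all mesh sizes\<close>

lemma cellwise_proj_error:
 assumes D: "D > 0" and chain: "primitive_chain (Suc k) f" and L: "L2_on UNIV (f 0)" "L2_on UNIV (f (Suc k))"
 shows "cellwise D (%i. proj_const k * (D ^ (2 * k) * (LBINT x:cell D i. (f (Suc k) x)^2))) (%x. f 0 x - glob D k (%i. coef D i (f 0)) x)"
 unfolding cellwise_def
proof (intro conjI allI ballI)
 have [measurable]: "f 0 \<in> borel_measurable borel" using L by (simp add: L2_on_UNIV)
 show "(%x. f 0 x - glob D k (%i. coef D i (f 0)) x) \<in> borel_measurable borel" by measurable
 show "0 \<le> proj_const k * (D ^ (2 * k) * (LBINT x:cell D i. (f (Suc k) x)^2))" for i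
  using proj_const(1)[of k] D by (intro mult_nonneg_nonneg L2_on_integral_nonneg) auto
 have Lc: "L2_on (cell D i) (f (Suc k))" "L2_on (cell D i) (f 0)" for i using L by (auto intro: L2_on_subset)
 fix i x assume x: "x \<in> cell D i"
 have e: "f 0 x - glob D k (%i. coef D i (f 0)) x = f 0 x - proj D k i (f 0) x" if "x \<in> cell D i" for x
  by (simp add: glob_cell[OF D that] proj_def)
 have cx: "x \<in> closed_cell D i" if "x \<in> cell D i" for x using that cell_subset by blast
 show "(f 0 x - glob D k (%i. coef D i (f 0)) x)^2 \<le> D * (proj_const k * (D ^ (2 * k) * (LBINT x:cell D i. (f (Suc k) x)^2)))"
  using proj_const(2)[OF D chain Lc cx[OF x]] unfolding e[OF x] by (simp only: mult.commute[of D])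
 fix y assume y: "y \<in> cell D i"
 show "((f 0 x - glob D k (%i. coef D i (f 0)) x) - (f 0 y - glob D k (%i. coef D i (f 0)) y))^2
   \<le> proj_const k * (D ^ (2 * k) * (LBINT x:cell D i. (f (Suc k) x)^2)) * \<bar>x - y\<bar>"
  using proj_const(3)[OF D chain Lc cx[OF x] cx[OF y]] unfolding e[OF x] e[OF y] .
qed

lemma H_proj_error:
 assumes lam: "0 < lam" "lam < 1" and D: "D > 0" and chain: "primitive_chain (Suc k) f" and L: "L2_on UNIV (f 0)" "L2_on UNIV (f (Suc k))"
 shows "H_fourier lam (%x. f 0 x - glob D k (%i. coef D i (f 0)) x)"
  "semi_sq lam (%x. f 0 x - glob D k (%i. coef D i (f 0)) x)
   \<le> 2 * gag_const lam * D powr (2 - lam) * (proj_const k * (D ^ (2 * k) * (LBINT x. (f (Suc k) x)^2)))"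
proof -
 have s: "(\<Sum>i\<in>F. proj_const k * (D ^ (2 * k) * (LBINT x:cell D i. (f (Suc k) x)^2)))
   \<le> proj_const k * (D ^ (2 * k) * (LBINT x. (f (Suc k) x)^2))" if "finite F" for F
  unfolding sum_distrib_left[symmetric] using proj_const(1)[of k] D
  by (intro mult_left_mono sum_cells_le_integral[OF L(2) D that]) auto
 show "H_fourier lam (%x. f 0 x - glob D k (%i. coef D i (f 0)) x)"
  "semi_sq lam (%x. f 0 x - glob D k (%i. coef D i (f 0)) x)
   \<le> 2 * gag_const lam * D powr (2 - lam) * (proj_const k * (D ^ (2 * k) * (LBINT x. (f (Suc k) x)^2)))"
  using cellwise_H_fourier[OF lam cellwise_proj_error[OF D chain L] D s] by blast+
qed

definition glob_const :: "nat => real" where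
 "glob_const k = (SOME M. M \<ge> 1 \<and> (\<forall>D>0. \<forall>V. cellwise D (%i. M / D * csq k V i) (glob D k V)))"

lemma glob_const: "glob_const k \<ge> 1" "D > 0 ==> cellwise D (%i. glob_const k / D * csq k V i) (glob D k V)"
 using someI_ex[OF cellwise_glob[of k], folded glob_const_def] by blast+

lemma sum_csq_coef:
 assumes D: "D > 0" and L: "L2_on UNIV g" and F: "finite F"
 shows "(\<Sum>i\<in>F. csq k (%i. coef D i g) i) \<le> (2 * real k + 1) / D * (LBINT x. (g x)^2)"
proof -
 have "D / (2 * real k + 1) * csq k (%i. coef D i g) i \<le> (LBINT x:cell D i. (g x)^2)" for i
 proof -
  have "D / (2 * real k + 1) * csq k (%i. coef D i g) i \<le> (\<Sum>q\<le>k. D / (2 * real q + 1) * (coef D i g q)^2)"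
   unfolding csq_def sum_distrib_left using D by (intro sum_mono mult_right_mono divide_left_mono) auto
  also have "\<dots> \<le> (LBINT x:cell D i. (g x)^2)"
   by (rule coef_Bessel[OF L2_on_subset[OF L] D]) auto
  finally show ?thesis .
 qed
 then have "D / (2 * real k + 1) * (\<Sum>i\<in>F. csq k (%i. coef D i g) i) \<le> (LBINT x. (g x)^2)"
  unfolding sum_distrib_left using sum_cells_le_integral[OF L D F] by (meson order_trans sum_mono)
 then show ?thesis using D by (simp add: field_simps)
qed

text \<open>For \<open>D \<ge> 1\<close> the power \<open>D powr (2 - lam)\<close> is dominated by
  the \<open>D^2\<close> which the scalings of budget and coefficients put into the denominator, so
  the bound is uniform in the mesh size.\<close>

lemma H_proj:
 assumes lam: "0 < lam" "lam < 1" and D: "D \<ge> 1" and L: "L2_on UNIV g"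
 shows "H_fourier lam (glob D k (%i. coef D i g))"
  "semi_sq lam (glob D k (%i. coef D i g)) \<le> 2 * gag_const lam * (glob_const k * (2 * real k + 1) * (LBINT x. (g x)^2))"
proof -
 have D0: "D > 0" using D by simp
 let ?N = "LBINT x. (g x)^2"
 have N: "0 \<le> ?N" by simp
 have s: "(\<Sum>i\<in>F. glob_const k / D * csq k (%i. coef D i g) i) \<le> glob_const k / D * ((2 * real k + 1) / D * ?N)" if "finite F" for F
  unfolding sum_distrib_left[symmetric] using glob_const(1)[of k] D
  by (intro mult_left_mono sum_csq_coef[OF D0 L that]) auto
 note c = cellwise_H_fourier[OF lam glob_const(2)[OF D0] D0 s]
 show "H_fourier lam (glob D k (%i. coef D i g))" by (rule c(1))
 have "semi_sq lam (glob D k (%i. coef D i g)) \<le> 2 * gag_const lam * D powr (2 - lam) * (glob_const k / D * ((2 * real k + 1) / D * ?N))"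
  by (rule c(2))
 also have "\<dots> = (D powr (2 - lam) / D^2) * (2 * gag_const lam * (glob_const k * (2 * real k + 1) * ?N))"
  using D by (simp add: power2_eq_square)
 also have "\<dots> \<le> 1 * (2 * gag_const lam * (glob_const k * (2 * real k + 1) * ?N))"
 proof (intro mult_right_mono mult_nonneg_nonneg)
  have "D powr (2 - lam) \<le> D powr 2" using D lam by (intro powr_mono) auto
  then show "D powr (2 - lam) / D^2 \<le> 1" using D0 by simp
 qed (use gag_const_nonneg[OF lam] glob_const(1)[of k] N in auto)
 finally show "semi_sq lam (glob D k (%i. coef D i g)) \<le> 2 * gag_const lam * (glob_const k * (2 * real k + 1) * ?N)" by simp
qed

text \<open>The sign \<open>s\<close> covers sums and differences. Expanding the square leaves a
  cross term, bounded by Cauchy-Schwarz and the inequality of means.\<close>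

lemma semi_sq_lin:
 assumes "H_fourier lam a" "H_fourier lam b" and s: "s^2 = 1"
 shows "semi_sq lam (%x. a x + s * b x) \<le> 2 * semi_sq lam a + 2 * semi_sq lam b"
proof -
 let ?A = "semi_sq lam a" and ?B = "semi_sq lam b" and ?g = "2 * pi * g_pairing lam a b"
 have "g_pairing lam (%x. 1 * a x + s * b x) (%x. 1 * a x + s * b x)
   = g_pairing lam a a + 2 * s * g_pairing lam a b + s^2 * g_pairing lam b b"
  unfolding g_pairing_lin_left[OF assms(1,2) H_fourier_lin[OF assms(1,2)]] g_pairing_lin_right[OF assms(1,2) assms(1)]
   g_pairing_lin_right[OF assms(1,2) assms(2)] g_pairing_commute[of lam b a]
  by (simp add: algebra_simps power2_eq_square)
 then have "- (2 * pi) * g_pairing lam (%x. a x + s * b x) (%x. a x + s * b x)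
   = - (2 * pi) * (g_pairing lam a a + 2 * s * g_pairing lam a b + 1 * g_pairing lam b b)" using s by simp
 then have e: "semi_sq lam (%x. a x + s * b x) = ?A + ?B - 2 * (s * ?g)"
  unfolding g_pairing_self by (simp add: algebra_simps)
 have "(s * ?g)^2 \<le> ?A * ?B" using g_pairing_Cauchy_Schwarz[OF assms(1,2)] s by (simp add: power_mult_distrib)
 also have "\<dots> \<le> ((?A + ?B) / 2)^2"
  using zero_le_power2[of "?A - ?B"] by (simp add: power2_eq_square field_simps)
 finally have "\<bar>s * ?g\<bar> \<le> \<bar>(?A + ?B) / 2\<bar>" by (simp only: abs_le_square_iff)
 moreover have "\<bar>X\<bar> \<le> \<bar>(A + B) / 2\<bar> ==> 0 \<le> A ==> 0 \<le> B ==> A + B - 2 * X \<le> 2 * A + 2 * B" for X A B :: real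
 proof -
  assume X: "\<bar>X\<bar> \<le> \<bar>(A + B) / 2\<bar>" "0 \<le> A" "0 \<le> B"
  then have "- X \<le> (A + B) / 2" using abs_ge_minus_self[of X] by (simp add: abs_of_nonneg)
  then show ?thesis by (simp add: field_simps)
 qed
 ultimately show ?thesis unfolding e using semi_sq_nonneg by blast
qed

text \<open>On coarse grids \<open>semi_sq_lin\<close> is applied twice, which gives 8 for the
  approximation part and 12, rounded up to 16, for the projection part. The factor 2 needed on fine
  grids is covered.\<close>

definition semi_const :: "real => nat => real" where
 "semi_const lam k = 8 * gag_const lam * (proj_const k + 2 * (glob_const k * (2 * real k + 1)))"

lemma semi_const_nonneg: "0 < lam ==> lam < 1 ==> 0 \<le> semi_const lam k"
 unfolding semi_const_def using gag_const_nonneg[of lam] proj_const(1)[of k] glob_const(1)[of k]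
 by (intro mult_nonneg_nonneg add_nonneg_nonneg) auto

text \<open>On coarse grids the approximation estimate has too high a power of the mesh size; there the seminorm of the
 projection is bounded directly and that of the function by comparison with the grid of size one.\<close>

lemma semi_sq_proj_error:
 assumes lam: "0 < lam" "lam < 1" and D: "D > 0" and chain: "primitive_chain (Suc k) f" and L: "L2_on UNIV (f 0)" "L2_on UNIV (f (Suc k))"
 shows "semi_sq lam (%x. f 0 x - glob D k (%i. coef D i (f 0)) x)
   \<le> semi_const lam k * D ^ (2 * k + 1) * ((LBINT x. (f (Suc k) x)^2) + (LBINT x. (f 0 x)^2))"
proof -
 let ?g = "gag_const lam" and ?p = "proj_const k" and ?m = "glob_const k * (2 * real k + 1)"
 let ?N = "LBINT x. (f (Suc k) x)^2" and ?Y = "LBINT x. (f 0 x)^2"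
 let ?P = "%D. glob D k (%i. coef D i (f 0))"
 have n: "0 \<le> ?g" "0 \<le> ?p" "0 \<le> ?m" "0 \<le> ?N" "0 \<le> ?Y"
  using gag_const_nonneg[OF lam] proj_const(1)[of k] glob_const(1)[of k] by auto
 have pos: "0 \<le> ?g * (?p * ?N)" "0 \<le> ?g * (?m * ?Y)" "0 \<le> ?g * (?p * ?Y)" "0 \<le> ?g * (?m * ?N)"
  by (intro mult_nonneg_nonneg n)+
 have exp: "semi_const lam k * (?N + ?Y) = 8 * (?g * (?p * ?N)) + 8 * (?g * (?p * ?Y)) + 16 * (?g * (?m * ?N)) + 16 * (?g * (?m * ?Y))"
  unfolding semi_const_def by (simp add: algebra_simps)
 show ?thesis
 proof (cases "D \<le> 1")
  case True
  \<comment> \<open>For \<open>D \<le> 1\<close> the exponent \<open>2 - lam\<close>, which exceeds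
    1, may be lowered to 1; with \<open>D ^ (2 * k)\<close> this makes the power
    \<open>2 * k + 1\<close>.\<close>
  have "D powr (2 - lam) \<le> D powr 1" using True D lam by (intro powr_mono') auto
  then have d: "D powr (2 - lam) \<le> D" using D by simp
  have "semi_sq lam (%x. f 0 x - ?P D x) \<le> 2 * ?g * D powr (2 - lam) * (?p * (D ^ (2 * k) * ?N))"
   by (rule H_proj_error(2)[OF lam D chain L])
  also have "\<dots> \<le> 2 * ?g * D * (?p * (D ^ (2 * k) * ?N))"
   using d n D by (intro mult_right_mono mult_left_mono) auto
  also have "\<dots> = D ^ (2 * k + 1) * (2 * (?g * (?p * ?N)))" by simp
  also have "\<dots> \<le> D ^ (2 * k + 1) * (semi_const lam k * (?N + ?Y))"
   unfolding exp using pos D by (intro mult_left_mono) auto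
  finally show ?thesis by (simp add: mult_ac)
 next
  case False
  then have D1: "1 \<le> D" by simp
  have one: "?g * 1 powr (2 - lam) = ?g" by simp
  have "semi_sq lam (%x. (f 0 x - ?P 1 x) + 1 * ?P 1 x) \<le> 2 * semi_sq lam (%x. f 0 x - ?P 1 x) + 2 * semi_sq lam (?P 1)"
   by (rule semi_sq_lin[OF H_proj_error(1)[OF lam _ chain L] H_proj(1)[OF lam _ L(1)]]) auto
  then have 1: "semi_sq lam (f 0) \<le> 4 * (?g * (?p * ?N)) + 4 * (?g * (?m * ?Y))"
   using H_proj_error(2)[OF lam _ chain L, of 1] H_proj(2)[OF lam _ L(1), of 1 k] by (simp add: mult_ac)
  have H0: "H_fourier lam (f 0)"
   using H_fourier_lin[OF H_proj_error(1)[OF lam _ chain L, of 1] H_proj(1)[OF lam _ L(1), of 1 k], of 1 1] by simp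
  have "semi_sq lam (%x. f 0 x + (- 1) * ?P D x) \<le> 2 * semi_sq lam (f 0) + 2 * semi_sq lam (?P D)"
   by (rule semi_sq_lin[OF H0 H_proj(1)[OF lam D1 L(1)]]) auto
  then have "semi_sq lam (%x. f 0 x - ?P D x) \<le> 8 * (?g * (?p * ?N)) + 12 * (?g * (?m * ?Y))"
   using 1 H_proj(2)[OF lam D1 L(1), of k] by (simp add: mult_ac)
  also have "\<dots> \<le> 1 * (semi_const lam k * (?N + ?Y))"
  proof -
   have "0 \<le> a ==> 0 \<le> b ==> 0 \<le> x ==> 0 \<le> y ==> 8 * a + 12 * b \<le> 1 * (8 * a + 8 * x + 16 * y + 16 * b)" for a b x y :: real by simp
   from this[OF pos] show ?thesis unfolding exp .
  qed
  also have "\<dots> \<le> D ^ (2 * k + 1) * (semi_const lam k * (?N + ?Y))"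
   using D1 n semi_const_nonneg[OF lam, of k] by (intro mult_right_mono one_le_power mult_nonneg_nonneg add_nonneg_nonneg) auto
  finally show ?thesis by (simp add: mult_ac)
 qed
qed

definition rate_const :: "real => real => nat => real" where
 "rate_const lam c k = \<bar>c\<bar> * proj_const k + semi_const lam k / (8 * pi)"

lemma (in dg_slice) energy_rate_bound:
 assumes R: "(%N. \<Sum>i\<in>{- int N..<int N}. \<Sum>q\<le>k. D / (2 * real q + 1) * Th i q * (U' i q - coef D i ut q)) \<longlonglongrightarrow> R"
 shows "R \<le> rate_const lam c k * D ^ (2 * k + 1) * ((LBINT x. (f (Suc k) x)^2) + (LBINT x. (f 0 x)^2))"
proof -
 let ?d = "D ^ (2 * k + 1)" and ?Y = "LBINT x. (f 0 x)^2"
 have A: "Acoef = (%i. coef D i (f 0))" by (simp add: Acoef_def fun_eq_iff)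
 have "semi_sq lam \<rho> \<le> semi_const lam k * ?d * (N2 + ?Y)"
  unfolding \<rho>_def[abs_def] A N2_def by (rule semi_sq_proj_error[OF lam D chain L(1,3)])
 then have "R \<le> \<bar>c\<bar> * proj_const k * ?d * N2 + semi_const lam k * ?d * (N2 + ?Y) / (8 * pi)"
  using energy_rate[OF R] by (meson add_left_mono divide_right_mono order_trans pi_ge_zero mult_nonneg_nonneg zero_le_numeral)
 also have "\<dots> \<le> \<bar>c\<bar> * proj_const k * ?d * (N2 + ?Y) + semi_const lam k * ?d * (N2 + ?Y) / (8 * pi)"
  using proj_const(1)[of k] D by (intro add_right_mono mult_left_mono mult_nonneg_nonneg) auto
 also have "\<dots> = rate_const lam c k * ?d * (N2 + ?Y)" by (simp add: rate_const_def algebra_simps)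
 finally show ?thesis by (simp add: N2_def)
qed

section \<open>Energy of absolutely continuous coefficients over time\<close>

lemma primitive_measurable:
 fixes r :: "real => real"
 assumes [measurable]: "r \<in> borel_measurable borel"
 shows "(%y. LBINT s. (if s < y then r s else 0)) \<in> borel_measurable borel"
 by measurable

text \<open>This integrates the derivative of half the square of a primitive. Instead of
  differentiating, Fubini exchanges the two factors: the integral of \<open>r\<close> beyond
  \<open>s\<close> is the total minus the primitive at \<open>s\<close>, so the unknown integral
  appears on both sides.\<close>

lemma AC_square:
 fixes r :: "real => real"
 assumes r: "integrable lborel r"
 shows "integrable lborel (%y. (LBINT s. (if s < y then r s else 0)) * r y)"
  "2 * (LBINT y. (LBINT s. (if s < y then r s else 0)) * r y) = (LBINT s. r s)^2"
proof -
 let ?P = "%y. LBINT s. (if s < y then r s else 0)" and ?I = "LBINT s. r s"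
 have m [measurable]: "r \<in> borel_measurable borel" using r by auto
 have ri: "integrable lborel (%s. if s < y then r s else 0)" for y
  by (rule integrable_le[OF r]) auto
 have b: "\<bar>?P y\<bar> \<le> (LBINT s. \<bar>r s\<bar>)" for y
 proof -
  have "\<bar>?P y\<bar> \<le> (LBINT s. \<bar>if s < y then r s else 0\<bar>)" by (rule integral_abs_bound)
  also have "\<dots> \<le> (LBINT s. \<bar>r s\<bar>)" using r ri by (intro integral_mono) auto
  finally show ?thesis .
 qed
 have "integrable lborel (%y. r y * ?P y)"
  by (rule integrable_mult_bounded[OF r _ b]) (use primitive_measurable[OF m] in simp)
 then show i: "integrable lborel (%y. ?P y * r y)" by (simp add: mult.commute)
 have "(LBINT y. ?P y * r y) = (LBINT s. r s * (LBINT y. indicator {s<..} y * r y))"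
  by (rule primitive_swap[OF r r])
 also have "\<dots> = (LBINT s. ?I * r s - ?P s * r s)"
 proof (rule LBINT_cong[OF refl])
  fix s
  have "(LBINT y. indicator {s<..} y * r y) = (LBINT y. r y - (if y < s then r y else 0))"
  proof (rule integral_cong_AE)
   show "AE y in lborel. indicator {s<..} y * r y = r y - (if y < s then r y else 0)"
    using AE_lborel_singleton[of s] by eventually_elim (auto simp: indicator_def)
  qed measurable
  also have "\<dots> = ?I - ?P s" using r ri by (rule Bochner_Integration.integral_diff)
  finally have e: "(LBINT y. indicator {s<..} y * r y) = ?I - ?P s" .
  show "r s * (LBINT y. indicator {s<..} y * r y) = ?I * r s - ?P s * r s" unfolding e by (simp add: algebra_simps)
 qed
 also have "\<dots> = ?I * ?I - (LBINT y. ?P y * r y)" using r i by simp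
 finally show "2 * (LBINT y. ?P y * r y) = ?I^2" by (simp add: power2_eq_square)
qed

lemma primitive_square_bound:
 fixes r :: "real => real"
 assumes [measurable]: "r \<in> borel_measurable borel" and i: "integrable lborel (%s. (r s)^2)" and z: "!!s. s \<notin> {0<..<T} ==> r s = 0" and T: "T > 0"
 shows "integrable lborel r" "(LBINT s. (if s < y then r s else 0))^2 \<le> T * (LBINT s. (r s)^2)"
proof -
 have ii: "integrable lborel (indicator {0<..<T} :: real => real)" by (rule integrable_real_indicator) (use T in auto)
 have sq: "(indicator A x)^2 = (indicator A x :: real)" for A and x :: real by (simp add: indicator_def)
 have "integrable lborel (%s. indicator {0<..<T} s * r s)"
  by (rule integrable_mult_square) (use ii i in \<open>simp_all add: sq\<close>)
 moreover have "(%s. indicator {0<..<T} s * r s) = r" using z by (auto simp: indicator_def fun_eq_iff)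
 ultimately show "integrable lborel r" by simp
 let ?A = "{0<..<T} \<inter> {..<y}"
 have iA: "integrable lborel (indicator ?A :: real => real)"
  by (rule integrable_le[OF ii]) (auto simp: indicator_def)
 have "(LBINT s. (if s < y then r s else 0)) = (LBINT s. indicator ?A s * r s)"
  by (rule LBINT_cong) (use z in \<open>auto simp: indicator_def\<close>)
 then have "(LBINT s. (if s < y then r s else 0))^2 \<le> (LBINT s. (indicator ?A s :: real)^2) * (LBINT s. (r s)^2)"
  using integral_Cauchy_Schwarz[of "indicator ?A" lborel r] iA i by (simp add: sq)
 also have "(LBINT s. (indicator ?A s :: real)^2) \<le> (LBINT s. indicator {0<..<T} s)"
  unfolding sq by (rule integral_mono[OF iA ii]) (auto simp: indicator_def)
 also have "(LBINT s. indicator {0<..<T} s) = T" using T by simp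
 finally show "(LBINT s. (if s < y then r s else 0))^2 \<le> T * (LBINT s. (r s)^2)"
  by (simp add: mult_right_mono)
qed

text \<open>Adding \<open>\<bar>a i\<bar>\<close> reduces the claim to non-negative families, whose
  symmetric partial sums are increasing and bounded.\<close>

lemma convergent_sum_int:
 fixes a :: "int => real"
 assumes M: "!!F. finite F ==> (\<Sum>i\<in>F. \<bar>a i\<bar>) \<le> M"
 shows "convergent (%N. \<Sum>i\<in>{- int N..<int N}. a i)"
proof -
 have pos: "convergent (%N. \<Sum>i\<in>{- int N..<int N}. b i)"
  if b: "!!i. 0 \<le> b i" and M: "!!F. finite F ==> sum b F \<le> M" for b :: "int => real" and M
 proof -
  have inc: "incseq (%N. \<Sum>i\<in>{- int N..<int N}. b i)" using b by (intro incseq_SucI sum_mono2) auto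
  have "\<forall>N. (\<Sum>i\<in>{- int N..<int N}. b i) \<le> M" using M by simp
  then show ?thesis using incseq_convergent[OF inc] unfolding convergent_def by metis
 qed
 have "(\<Sum>i\<in>F. \<bar>a i\<bar> + a i) \<le> 2 * M" if "finite F" for F
 proof -
  have "(\<Sum>i\<in>F. \<bar>a i\<bar> + a i) \<le> (\<Sum>i\<in>F. 2 * \<bar>a i\<bar>)" by (intro sum_mono) auto
  then show ?thesis using M[OF that] by (simp add: sum_distrib_left[symmetric])
 qed
 then have "convergent (%N. \<Sum>i\<in>{- int N..<int N}. \<bar>a i\<bar> + a i)" by (intro pos) auto
 from convergent_diff[OF this pos[of "%i. \<bar>a i\<bar>", OF _ M]] show ?thesis by (simp add: sum.distrib)
qed

text \<open>The finite partial sums over the cells satisfy the energy identity; dominated convergence passes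
 to the limit, where the energy rate is controlled.\<close>

lemma evolution_bound:
 fixes r :: "int => nat => real => real" and \<mu> :: "nat => real" and S e :: "real => real"
 defines "P i q y \<equiv> (LBINT s. (if s < y then r i q s else 0))"
 assumes T: "T > 0" and \<mu>: "!!q. 0 \<le> \<mu> q"
  and r: "!!i q. r i q \<in> borel_measurable borel" "!!i q. integrable lborel (%s. (r i q s)^2)" "!!i q s. s \<notin> {0<..<T} ==> r i q s = 0"
  and S: "integrable lborel S" "AE s in lborel. \<forall>F. finite F --> (\<Sum>i\<in>F. \<Sum>q\<le>k. \<mu> q * (r i q s)^2) \<le> S s"
  and rate: "AE s in lborel. s \<in> {0<..<T} --> (\<forall>R. (%N. \<Sum>i\<in>{- int N..<int N}. \<Sum>q\<le>k. \<mu> q * P i q s * r i q s) \<longlonglongrightarrow> R --> R \<le> e s)"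
  and e: "integrable lborel (%s. indicator {0<..<T} s * e s)" and F: "finite F"
 shows "(\<Sum>i\<in>F. \<Sum>q\<le>k. \<mu> q * (LBINT s. r i q s)^2) \<le> 2 * (LBINT s. indicator {0<..<T} s * e s)"
proof -
 define Z where "Z N s = (\<Sum>i\<in>{- int N..<int N}. \<Sum>q\<le>k. \<mu> q * P i q s * r i q s)" for N s
 note [measurable] = r(1)
 have Pm [measurable]: "P i q \<in> borel_measurable borel" for i q
  unfolding P_def[abs_def] by (rule primitive_measurable[OF r(1)])
 note ri = primitive_square_bound(1)[OF r(1,2,3) T]
 let ?K = "T * (LBINT s. S s)"
 \<comment> \<open>A bound uniform in time for the weighted squares of the primitives; together with
   \<open>S\<close> it dominates the partial sums of the energy rate.\<close>
 have PK: "(\<Sum>i\<in>F. \<Sum>q\<le>k. \<mu> q * (P i q y)^2) \<le> ?K" if "finite F" for F y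
 proof -
  have "(\<Sum>i\<in>F. \<Sum>q\<le>k. \<mu> q * (P i q y)^2) \<le> (\<Sum>i\<in>F. \<Sum>q\<le>k. \<mu> q * (T * (LBINT s. (r i q s)^2)))"
   unfolding P_def by (intro sum_mono mult_left_mono primitive_square_bound(2)[OF r(1,2,3) T] \<mu>)
  also have "\<dots> = T * (LBINT s. (\<Sum>i\<in>F. \<Sum>q\<le>k. \<mu> q * (r i q s)^2))"
   using r(2) by (simp add: sum_distrib_left mult.left_commute)
  also have "\<dots> \<le> ?K"
   using T S r(2) that by (intro mult_left_mono integral_mono_AE) auto
  finally show ?thesis .
 qed
 have ab: "AE s in lborel. \<forall>F. finite F --> (\<Sum>i\<in>F. \<bar>\<Sum>q\<le>k. \<mu> q * P i q s * r i q s\<bar>) \<le> ?K / 2 + S s / 2"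
  using S(2)
 proof eventually_elim
  fix s assume s: "\<forall>F. finite F --> (\<Sum>i\<in>F. \<Sum>q\<le>k. \<mu> q * (r i q s)^2) \<le> S s"
  show "\<forall>F. finite F --> (\<Sum>i\<in>F. \<bar>\<Sum>q\<le>k. \<mu> q * P i q s * r i q s\<bar>) \<le> ?K / 2 + S s / 2"
  proof (intro allI impI)
   fix F :: "int set" assume F: "finite F"
   have "(\<Sum>i\<in>F. \<bar>\<Sum>q\<le>k. \<mu> q * P i q s * r i q s\<bar>) \<le> (\<Sum>i\<in>F. \<Sum>q\<le>k. \<mu> q * (P i q s)^2 / 2 + \<mu> q * (r i q s)^2 / 2)"
   proof (intro sum_mono order_trans[OF sum_abs])
    fix i q
    have "\<bar>P i q s\<bar> * \<bar>r i q s\<bar> \<le> ((P i q s)^2 + (r i q s)^2) / 2"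
     using sum_squares_bound[of "\<bar>P i q s\<bar>" "\<bar>r i q s\<bar>"] by simp
    from mult_left_mono[OF this \<mu>[of q]] show "\<bar>\<mu> q * P i q s * r i q s\<bar> \<le> \<mu> q * (P i q s)^2 / 2 + \<mu> q * (r i q s)^2 / 2"
     using \<mu>[of q] by (simp add: abs_mult algebra_simps)
   qed
   also have "\<dots> = (\<Sum>i\<in>F. \<Sum>q\<le>k. \<mu> q * (P i q s)^2) / 2 + (\<Sum>i\<in>F. \<Sum>q\<le>k. \<mu> q * (r i q s)^2) / 2"
    by (simp add: sum.distrib sum_divide_distrib)
   also have "\<dots> \<le> ?K / 2 + S s / 2" using PK[OF F] s F by (intro add_mono divide_right_mono) auto
   finally show "(\<Sum>i\<in>F. \<bar>\<Sum>q\<le>k. \<mu> q * P i q s * r i q s\<bar>) \<le> ?K / 2 + S s / 2" .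
  qed
 qed
 have Zm: "Z N \<in> borel_measurable borel" for N unfolding Z_def[abs_def] by measurable
 have Zout: "Z N s = 0" if "s \<notin> {0<..<T}" for N s unfolding Z_def using r(3)[OF that] by simp
 let ?w = "%s. indicator {0<..<T} s * (?K / 2) + \<bar>S s\<bar> / 2"
 have Zl: "(%N. LBINT s. Z N s) \<longlonglongrightarrow> (LBINT s. lim (%N. Z N s))" and Zli: "integrable lborel (%s. lim (%N. Z N s))"
 proof -
  have m: "(%s. lim (%N. Z N s)) \<in> borel_measurable lborel" using Zm by (intro borel_measurable_lim_metric) simp
  have w: "integrable lborel ?w"
   using S(1) T by (intro Bochner_Integration.integrable_add integrable_mult_left integrable_divide integrable_abs integrable_real_indicator) auto
  have l: "AE s in lborel. (%N. Z N s) \<longlonglongrightarrow> lim (%N. Z N s)"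
   using ab
  proof eventually_elim
   fix s assume "\<forall>F. finite F --> (\<Sum>i\<in>F. \<bar>\<Sum>q\<le>k. \<mu> q * P i q s * r i q s\<bar>) \<le> ?K / 2 + S s / 2"
   then have "convergent (%N. Z N s)" unfolding Z_def by (intro convergent_sum_int[where M="?K / 2 + S s / 2"]) blast
   then show "(%N. Z N s) \<longlonglongrightarrow> lim (%N. Z N s)" by (simp add: convergent_LIMSEQ_iff)
  qed
  have bd: "AE s in lborel. norm (Z N s) \<le> ?w s" for N
   using ab
  proof eventually_elim
   fix s assume "\<forall>F. finite F --> (\<Sum>i\<in>F. \<bar>\<Sum>q\<le>k. \<mu> q * P i q s * r i q s\<bar>) \<le> ?K / 2 + S s / 2"
   then have "norm (Z N s) \<le> ?K / 2 + S s / 2"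
    unfolding Z_def using order_trans[OF sum_abs[of "%i. \<Sum>q\<le>k. \<mu> q * P i q s * r i q s" "{- int N..<int N}"]] by fastforce
   then show "norm (Z N s) \<le> ?w s" using Zout[of s N] by (cases "s \<in> {0<..<T}") auto
  qed
  have Zm': "Z N \<in> borel_measurable lborel" for N using Zm by simp
  show "(%N. LBINT s. Z N s) \<longlonglongrightarrow> (LBINT s. lim (%N. Z N s))"
   by (rule integral_dominated_convergence[OF m Zm' w l bd])
  show "integrable lborel (%s. lim (%N. Z N s))" by (rule integrable_dominated_convergence[OF m Zm' w l bd])
 qed
 have Ze: "(LBINT s. lim (%N. Z N s)) \<le> (LBINT s. indicator {0<..<T} s * e s)"
 proof (rule integral_mono_AE[OF Zli e])
  show "AE s in lborel. lim (%N. Z N s) \<le> indicator {0<..<T} s * e s"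
   using rate ab
  proof eventually_elim
   fix s assume 1: "s \<in> {0<..<T} --> (\<forall>R. (%N. \<Sum>i\<in>{- int N..<int N}. \<Sum>q\<le>k. \<mu> q * P i q s * r i q s) \<longlonglongrightarrow> R --> R \<le> e s)"
    and "\<forall>F. finite F --> (\<Sum>i\<in>F. \<bar>\<Sum>q\<le>k. \<mu> q * P i q s * r i q s\<bar>) \<le> ?K / 2 + S s / 2"
   then have "convergent (%N. Z N s)" unfolding Z_def by (intro convergent_sum_int[where M="?K / 2 + S s / 2"]) blast
   then have "(%N. Z N s) \<longlonglongrightarrow> lim (%N. Z N s)" by (simp add: convergent_LIMSEQ_iff)
   then show "lim (%N. Z N s) \<le> indicator {0<..<T} s * e s"
    using 1 Zout[of s] unfolding Z_def[symmetric] by (cases "s \<in> {0<..<T}") auto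
  qed
 qed
 have Zi: "2 * (LBINT s. Z N s) = (\<Sum>i\<in>{- int N..<int N}. \<Sum>q\<le>k. \<mu> q * (LBINT s. r i q s)^2)" for N
 proof -
  note A = AC_square[OF ri, folded P_def]
  have "(LBINT s. Z N s) = (\<Sum>i\<in>{- int N..<int N}. \<Sum>q\<le>k. \<mu> q * (LBINT s. P i q s * r i q s))"
   unfolding Z_def using A(1) by (simp add: mult.assoc)
  then show ?thesis using A(2)[symmetric] by (simp add: sum_distrib_left mult.left_commute)
 qed
 let ?E = "%N. \<Sum>i\<in>{- int N..<int N}. \<Sum>q\<le>k. \<mu> q * (LBINT s. r i q s)^2"
 have inc: "incseq ?E" using \<mu> by (intro incseq_SucI sum_mono2 sum_nonneg mult_nonneg_nonneg) auto
 have El: "?E \<longlonglongrightarrow> 2 * (LBINT s. lim (%N. Z N s))"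
  unfolding Zi[symmetric] by (rule tendsto_mult_left[OF Zl])
 obtain m where m: "!!i. i \<in> F ==> nat \<bar>i\<bar> \<le> m"
 proof -
  have "finite ((%i. nat \<bar>i\<bar>) ` F)" using F by simp
  then show ?thesis using that by (metis finite_nat_set_iff_bounded_le imageI)
 qed
 have "F \<subseteq> {- int (Suc m)..<int (Suc m)}"
 proof
  fix i assume "i \<in> F" then show "i \<in> {- int (Suc m)..<int (Suc m)}" using m[of i] by auto
 qed
 then have "(\<Sum>i\<in>F. \<Sum>q\<le>k. \<mu> q * (LBINT s. r i q s)^2) \<le> ?E (Suc m)"
  using \<mu> by (intro sum_mono2 sum_nonneg mult_nonneg_nonneg) auto
 also have "\<dots> \<le> 2 * (LBINT s. lim (%N. Z N s))" by (rule incseq_le[OF inc El])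
 finally show ?thesis using Ze by linarith
qed

section \<open>Regularity in space and in time\<close>

lemma L2_on_AE_cong:
 assumes g: "L2_on UNIV g" and [measurable]: "f \<in> borel_measurable borel" and e: "AE x in lborel. f x = (g x :: real)"
 shows "L2_on UNIV f" "(LBINT x. (f x)^2) = (LBINT x. (g x)^2)"
proof -
 have [measurable]: "g \<in> borel_measurable borel" and i: "integrable lborel (%x. (g x)^2)" using g by (auto simp: L2_on_UNIV)
 have e2: "AE x in lborel. (f x)^2 = (g x)^2" using e by eventually_elim simp
 have "integrable lborel (%x. (f x)^2)"
  using i by (subst integrable_cong_AE[OF _ _ e2]) auto
 then show "L2_on UNIV f" by (simp add: L2_on_UNIV)
 show "(LBINT x. (f x)^2) = (LBINT x. (g x)^2)" by (rule integral_cong_AE[OF _ _ e2]) auto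
qed

text \<open>Cauchy-Schwarz gives Hoelder continuity of order 1/2. Continuity provides Borel
  measurability of representatives that are known only through their increments.\<close>

lemma primitive_L2_continuous:
 assumes b: "L2_on UNIV b" and f: "!!x y. x \<le> y ==> f y - f x = (LBINT s:{x<..<y}. b s)"
 shows "continuous_on UNIV (f :: real => real)"
proof -
 let ?N = "LBINT x. (b x)^2"
 have 1: "(f y - f x)^2 \<le> (y - x) * ?N" if xy: "x \<le> y" for x y
 proof -
  have "(f y - f x)^2 \<le> (y - x) * (LBINT s:{x<..<y}. (b s)^2)"
   unfolding f[OF xy] using L2_on_interval_integral(2)[OF L2_on_subset[OF b] xy] by simp
  also have "\<dots> \<le> (y - x) * (LBINT s:UNIV. (b s)^2)"
   using xy by (intro mult_left_mono L2_on_integral_subset[OF b]) auto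
  finally show ?thesis by (simp add: set_lebesgue_integral_def)
 qed
 have 2: "\<bar>f y - f x\<bar> \<le> sqrt (\<bar>y - x\<bar> * ?N)" for x y
  using 1[of x y] 1[of y x] by (intro real_le_rsqrt) (auto simp: power2_commute[of "f x" "f y"] abs_if not_less split: if_splits)
 have "isCont f x" for x
  unfolding isCont_def
 proof (rule LIM_zero_cancel, rule tendsto_rabs_zero_cancel, rule tendsto_sandwich[OF _ _ tendsto_const])
  have "((%y. sqrt (\<bar>y - x\<bar> * ?N)) \<longlongrightarrow> sqrt (\<bar>x - x\<bar> * ?N)) (at x)" by (intro tendsto_intros)
  then show "((%y. sqrt (\<bar>y - x\<bar> * ?N)) \<longlongrightarrow> 0) (at x)" by simp
 qed (use 2 in auto)
 then show ?thesis by (simp add: continuous_at_imp_continuous_on)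
qed

text \<open>Each level below \<open>m\<close> is replaced by a primitive of the slice one level up,
  the top level by the slice itself. The choices are independent, but every level differs from its
  slice on a null set only, so the integrals of level \<open>j + 1\<close> are those of the slice
  and the chain is consistent.\<close>

lemma chain_slices:
 assumes T: "T > 0" and L: "!!j. j \<le> m ==> L2_on (Q T) (a j)" and w: "!!j. j < m ==> weak_x T (a j) (a (Suc j))"
 shows "AE t in lborel. t \<in> {0<..<T} --> (\<exists>f. primitive_chain m f \<and> (\<forall>j\<le>m. L2_on UNIV (f j) \<and> (AE x in lborel. f j x = a j (x, t))))"
proof -
 have 1: "AE t in lborel. \<forall>j\<in>{..<m}. t \<in> {0<..<T} --> (\<exists>f. (AE x in lborel. f x = a j (x, t)) \<and>
   (\<forall>x y. x \<le> y --> set_integrable lborel {x<..<y} (%s. a (Suc j) (s, t)) \<and> f y - f x = (LBINT s:{x<..<y}. a (Suc j) (s, t))))"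
 proof (rule AE_ball_countable')
  fix j assume "j \<in> {..<m}"
  then show "AE t in lborel. t \<in> {0<..<T} --> (\<exists>f. (AE x in lborel. f x = a j (x, t)) \<and>
   (\<forall>x y. x \<le> y --> set_integrable lborel {x<..<y} (%s. a (Suc j) (s, t)) \<and> f y - f x = (LBINT s:{x<..<y}. a (Suc j) (s, t))))"
   by (intro weak_x_representative[OF T L L w]) auto
 qed simp
 have 2: "AE t in lborel. \<forall>j\<in>{..m}. t \<in> {0<..<T} --> L2_on UNIV (%x. a j (x, t))"
  by (rule AE_ball_countable'[OF L2_on_Q_slices[OF L]]) auto
 show ?thesis using 1 2
 proof eventually_elim
  fix t
  assume A: "\<forall>j\<in>{..<m}. t \<in> {0<..<T} --> (\<exists>f. (AE x in lborel. f x = a j (x, t)) \<and>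
   (\<forall>x y. x \<le> y --> set_integrable lborel {x<..<y} (%s. a (Suc j) (s, t)) \<and> f y - f x = (LBINT s:{x<..<y}. a (Suc j) (s, t))))"
   and B: "\<forall>j\<in>{..m}. t \<in> {0<..<T} --> L2_on UNIV (%x. a j (x, t))"
  show "t \<in> {0<..<T} --> (\<exists>f. primitive_chain m f \<and> (\<forall>j\<le>m. L2_on UNIV (f j) \<and> (AE x in lborel. f j x = a j (x, t))))"
  proof
   assume t: "t \<in> {0<..<T}"
   have "\<forall>j\<in>{..<m}. \<exists>f. (AE x in lborel. f x = a j (x, t)) \<and>
     (\<forall>x y. x \<le> y --> set_integrable lborel {x<..<y} (%s. a (Suc j) (s, t)) \<and> f y - f x = (LBINT s:{x<..<y}. a (Suc j) (s, t)))"
    using A t by blast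
   from bchoice[OF this] obtain g where g: "!!j. j < m ==> AE x in lborel. g j x = a j (x, t)"
    "!!j x y. j < m ==> x \<le> y ==> set_integrable lborel {x<..<y} (%s. a (Suc j) (s, t))"
    "!!j x y. j < m ==> x \<le> y ==> g j y - g j x = (LBINT s:{x<..<y}. a (Suc j) (s, t))"
    by auto
   have La: "L2_on UNIV (%x. a j (x, t))" if "j \<le> m" for j using B t that by auto
   define f where "f j = (if j < m then g j else (%x. a j (x, t)))" for j
   have m: "f j \<in> borel_measurable borel" if j: "j \<le> m" for j
   proof (cases "j < m")
    case True
    have "continuous_on UNIV (g j)" by (rule primitive_L2_continuous[OF La[of "Suc j"] g(3)]) (use True in auto)
    then show ?thesis using True by (simp add: f_def borel_measurable_continuous_onI)
   next
    case False
    then show ?thesis using La[OF j] by (simp add: f_def L2_on_UNIV)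
   qed
   have e: "AE x in lborel. f j x = a j (x, t)" if "j \<le> m" for j
    using g(1)[of j] by (cases "j < m") (simp_all add: f_def)
   have "primitive_chain m f"
    unfolding primitive_chain_def
   proof (intro allI impI)
    fix j and x y :: real assume j: "j < m" and xy: "x \<le> y"
    have [measurable]: "f (Suc j) \<in> borel_measurable borel" "(%x. a (Suc j) (x, t)) \<in> borel_measurable borel"
     using m[of "Suc j"] La[of "Suc j"] j by (auto simp: L2_on_UNIV)
    have e': "AE s in lborel. indicator {x<..<y} s *\<^sub>R f (Suc j) s = indicator {x<..<y} s *\<^sub>R a (Suc j) (s, t)"
     using e[of "Suc j"] j by auto
    have i: "set_integrable lborel {x<..<y} (f (Suc j))"
     using g(2)[OF j xy] unfolding set_integrable_def by (subst integrable_cong_AE[OF _ _ e']) auto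
    have "(LBINT s:{x<..<y}. f (Suc j) s) = (LBINT s:{x<..<y}. a (Suc j) (s, t))"
     unfolding set_lebesgue_integral_def by (rule integral_cong_AE[OF _ _ e']) auto
    then show "set_integrable lborel {x<..<y} (f (Suc j)) \<and> f j y - f j x = (LBINT s:{x<..<y}. f (Suc j) s)"
     using i g(3)[OF j xy] j by (simp add: f_def[of j])
   qed
   then show "\<exists>f. primitive_chain m f \<and> (\<forall>j\<le>m. L2_on UNIV (f j) \<and> (AE x in lborel. f j x = a j (x, t)))"
    using e m L2_on_AE_cong(1)[OF La m e] by blast
  qed
 qed
qed

section \<open>Primitives in time, time traces and increments\<close>

definition tprim :: "(real \<times> real => real) => real => real => real" where
 "tprim b t x = (LBINT r. (if r < t then b (x, r) else 0))"

text \<open>\<open>b\<close> plays the role of the time derivative extended by zero outside the time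
  interval, so that \<open>tprim\<close> effectively starts at time 0 and is defined for all real
  times.\<close>

locale time_slab =
 fixes T :: real and b :: "real \<times> real => real"
 assumes T: "T > 0" and bm: "b \<in> borel_measurable borel" and bi: "integrable lborel (%w. (b w)^2)"
  and b0: "!!x r. r \<notin> {0<..<T} ==> b (x, r) = 0"
begin

abbreviation "P \<equiv> tprim b"

lemma bm2 [measurable]: "b \<in> borel_measurable (borel \<Otimes>\<^sub>M borel)"
 using bm by (simp add: borel_measurable_pair_iff)

lemma P_measurable2 [measurable]: "(%w. P (snd w) (fst w)) \<in> borel_measurable (borel \<Otimes>\<^sub>M borel)"
 unfolding tprim_def by measurable

lemma P_measurable [measurable]: "P t \<in> borel_measurable borel"
 unfolding tprim_def[abs_def] by measurable

lemma slice_measurable [measurable]: "(%r. b (x, r)) \<in> borel_measurable borel" "(%x. b (x, r)) \<in> borel_measurable borel"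
 by measurable

lemma time_slices: "AE x in lborel. integrable lborel (%r. (b (x, r))^2)"
 by (rule lborel2_Fubini(5)[OF bi])

lemma space_slices: "AE r in lborel. integrable lborel (%x. (b (x, r))^2)"
 by (rule lborel2_Fubini(2)[OF bi])

text \<open>Space integrals against a square-integrable \<open>e\<close> commute with the primitive
  in time by Fubini. Integrability over the strip holds because \<open>e\<close> times the indicator
  of the bounded time interval is square integrable there.\<close>

lemma pairing:
 assumes e: "e \<in> borel_measurable borel" "integrable lborel (%x. (e x)^2)"
 shows "integrable lborel (%r. LBINT x. e x * b (x, r))"
  "integrable lborel (%x. e x * P t x)"
  "(LBINT x. e x * P t x) = (LBINT r. (if r < t then (LBINT x. e x * b (x, r)) else 0))"
proof -
 note [measurable] = e(1) bm
 have [measurable]: "(fst :: real \<times> real => real) \<in> borel_measurable borel" "(snd :: real \<times> real => real) \<in> borel_measurable borel"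
  by (auto intro!: borel_measurable_continuous_onI continuous_intros)
 let ?I = "indicator {0<..<T} :: real => real"
 have iI: "integrable lborel ?I" by (rule integrable_real_indicator) (use T in auto)
 have main: "integrable lborel (%w. e (fst w) * (if snd w < t then b w else 0))" for t
 proof -
  have "integrable lborel (%w. (e (fst w) * ?I (snd w)) * (if snd w < t then b w else 0))"
  proof (rule integrable_mult_square)
   have "(?I s)^2 = ?I s" for s by (simp add: indicator_def)
   then show "integrable lborel (%w. (e (fst w) * ?I (snd w))^2)"
    using integrable_tensor[OF e(2) iI] by (simp add: power_mult_distrib)
   show "integrable lborel (%w. (if snd w < t then b w else 0)^2)"
    by (rule integrable_le[OF bi]) (auto, measurable)
  qed (simp_all, measurable)
  also have "(%w. (e (fst w) * ?I (snd w)) * (if snd w < t then b w else 0)) = (%w. e (fst w) * (if snd w < t then b w else 0))"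
   using b0 by (auto simp: fun_eq_iff indicator_def)
  finally show ?thesis .
 qed
 have "integrable lborel (%r. LBINT x. e x * (if r < T then b (x, r) else 0))"
  using lborel2_Fubini(3)[OF main[of T]] by simp
 moreover have "(if r < T then b (x, r) else 0) = b (x, r)" for x r using b0[of r x] by auto
 ultimately show "integrable lborel (%r. LBINT x. e x * b (x, r))" by (simp only:)
 have p: "(LBINT r. (if r < t then b (x, r) else 0)) = P t x" for x
  by (simp add: tprim_def)
 show "integrable lborel (%x. e x * P t x)" using lborel2_Fubini(6)[OF main[of t]] by (simp add: p)
 have "(LBINT x. e x * P t x) = (LBINT w. e (fst w) * (if snd w < t then b w else 0))"
  using lborel2_Fubini(4)[OF main[of t]] by (simp add: p)
 also have "\<dots> = (LBINT r. LBINT x. e x * (if r < t then b (x, r) else 0))"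
  using lborel2_Fubini(1)[OF main[of t]] by simp
 also have "\<dots> = (LBINT r. (if r < t then (LBINT x. e x * b (x, r)) else 0))"
  by (rule LBINT_cong) auto
 finally show "(LBINT x. e x * P t x) = (LBINT r. (if r < t then (LBINT x. e x * b (x, r)) else 0))" .
qed

text \<open>Cauchy-Schwarz in time at almost every \<open>x\<close>, integrated over space: Hoelder
  continuity of order 1/2 in time with values in the square-integrable functions.\<close>

lemma increment:
 assumes st: "s \<le> t"
 shows "L2_on UNIV (%x. P t x - P s x)" "(LBINT x. (P t x - P s x)^2) \<le> (t - s) * (LBINT w. (b w)^2)"
proof -
 have ae: "AE x in lborel. (P t x - P s x)^2 \<le> (t - s) * (LBINT r. (b (x, r))^2)"
  using time_slices
 proof eventually_elim
  fix x assume i: "integrable lborel (%r. (b (x, r))^2)"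
  have bx: "integrable lborel (%r. b (x, r))"
   by (rule primitive_square_bound(1)[OF _ i b0 T]) measurable
  have ib: "integrable lborel (%r. if r < t then b (x, r) else 0)" for t
   by (rule integrable_le[OF bx]) auto
  have I: "(indicator {s..<t} r)^2 = (indicator {s..<t} r :: real)" for r by (simp add: indicator_def)
  have "P t x - P s x = (LBINT r. (if r < t then b (x, r) else 0) - (if r < s then b (x, r) else 0))"
   unfolding tprim_def using ib by simp
  also have "\<dots> = (LBINT r. indicator {s..<t} r * b (x, r))"
   by (rule LBINT_cong) (use st in \<open>auto simp: indicator_def\<close>)
  finally have "(P t x - P s x)^2 = (LBINT r. indicator {s..<t} r * b (x, r))^2" by simp
  also have "\<dots> \<le> (LBINT r. (indicator {s..<t} r :: real)^2) * (LBINT r. (b (x, r))^2)"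
  proof (rule integral_Cauchy_Schwarz[OF _ _ _ i])
   show "integrable lborel (%r. (indicator {s..<t} r :: real)^2)" unfolding I by (rule integrable_real_indicator) (use st in auto)
  qed measurable
  also have "(LBINT r. (indicator {s..<t} r :: real)^2) = t - s" unfolding I using st by simp
  finally show "(P t x - P s x)^2 \<le> (t - s) * (LBINT r. (b (x, r))^2)" .
 qed
 have F: "integrable lborel (%x. (t - s) * (LBINT r. (b (x, r))^2))"
  using lborel2_Fubini(6)[OF bi] by simp
 have i: "integrable lborel (%x. (P t x - P s x)^2)"
 proof (rule integrable_le[OF F])
  show "AE x in lborel. norm ((P t x - P s x)^2) \<le> norm ((t - s) * (LBINT r. (b (x, r))^2))"
   using ae by eventually_elim (auto simp: abs_of_nonneg)
 qed measurable
 then show "L2_on UNIV (%x. P t x - P s x)" by (simp add: L2_on_UNIV)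
 have "(LBINT x. (P t x - P s x)^2) \<le> (LBINT x. (t - s) * (LBINT r. (b (x, r))^2))"
  by (rule integral_mono_AE[OF i F ae])
 then show "(LBINT x. (P t x - P s x)^2) \<le> (t - s) * (LBINT w. (b w)^2)"
  using lborel2_Fubini(4)[OF bi] by simp
qed

lemma time_representative:
 assumes u: "L2_on (Q T) u" and ut: "L2_on (Q T) ut" and w: "weak_t T u ut" and b: "!!x r. r \<in> {0<..<T} ==> b (x, r) = ut (x, r)"
 shows "\<exists>C. C \<in> borel_measurable borel \<and> (AE t in lborel. t \<in> {0<..<T} --> (AE x in lborel. u (x, t) = C x + P t x))"
proof -
 have um: "(%w. indicator (Q T) w * u w) \<in> borel_measurable (borel \<Otimes>\<^sub>M borel)"
  using u by (simp add: L2_on_def set_borel_measurable_def borel_measurable_pair_iff)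
 define g where "g w = indicator (Q T) w * u w - indicator {0<..<T} (snd w) * P (snd w) (fst w)" for w
 have gm [measurable]: "g \<in> borel_measurable (borel \<Otimes>\<^sub>M borel)" unfolding g_def[abs_def] using um by measurable
 \<comment> \<open>Averaging over time selects the constant in a measurable way; for almost every
   \<open>x\<close> it coincides with the one provided by the weak derivative.\<close>
 define C where "C x = 1 / T * (LBINT t. g (x, t))" for x
 have Cm [measurable]: "C \<in> borel_measurable borel" unfolding C_def[abs_def] by measurable
 have "AE x in lborel. AE t in lborel. t \<in> {0<..<T} --> g (x, t) = C x"
  using weak_t_representative[OF T u ut w]
 proof eventually_elim
  fix x assume "\<exists>C. AE t in lborel. t \<in> {0<..<T} --> u (x, t) = C + (LBINT s:{0<..<t}. ut (x, s))"
  then obtain C' where C': "AE t in lborel. t \<in> {0<..<T} --> u (x, t) = C' + (LBINT s:{0<..<t}. ut (x, s))" by blast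
  have ae: "AE t in lborel. g (x, t) = indicator {0<..<T} t * C'"
   using C'
  proof eventually_elim
   fix t assume A: "t \<in> {0<..<T} --> u (x, t) = C' + (LBINT s:{0<..<t}. ut (x, s))"
   show "g (x, t) = indicator {0<..<T} t * C'"
   proof (cases "t \<in> {0<..<T}")
    case True
    have "(LBINT s:{0<..<t}. ut (x, s)) = P t x"
     unfolding set_lebesgue_integral_def tprim_def
     by (rule LBINT_cong) (use True b b0 in \<open>auto simp: indicator_def\<close>)
    then show ?thesis using A True by (simp add: g_def Q_def)
   next
    case False
    then have "(x, t) \<notin> Q T" by (simp add: Q_def)
    then show ?thesis using False by (simp add: g_def)
   qed
  qed
  have "(LBINT t. g (x, t)) = (LBINT t. indicator {0<..<T} t * C')"
   by (rule integral_cong_AE[OF _ _ ae]) measurable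
  then have "C x = C'" using T by (simp add: C_def)
  with ae show "AE t in lborel. t \<in> {0<..<T} --> g (x, t) = C x" by auto
 qed
 \<comment> \<open>The order of the two variables is exchanged, which rests on joint measurability
   of \<open>g\<close>.\<close>
 then have "AE t in lborel. AE x in lborel. t \<in> {0<..<T} --> g (x, t) = C x"
 proof (subst (asm) lborel_pair.AE_commute)
  have "{w \<in> space (borel \<Otimes>\<^sub>M borel). snd w \<in> {0<..<T} --> g (fst w, snd w) = C (fst w)} \<in> sets (borel \<Otimes>\<^sub>M (borel :: real measure))"
   by measurable
  then show "{w \<in> space (lborel \<Otimes>\<^sub>M lborel). snd w \<in> {0<..<T} --> g (fst w, snd w) = C (fst w)} \<in> sets (lborel \<Otimes>\<^sub>M lborel)"
   by (simp add: space_pair_measure cong: sets_pair_measure_cong)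
 qed
 then have "AE t in lborel. t \<in> {0<..<T} --> (AE x in lborel. u (x, t) = C x + P t x)"
 proof eventually_elim
  fix t assume A: "AE x in lborel. t \<in> {0<..<T} --> g (x, t) = C x"
  show "t \<in> {0<..<T} --> (AE x in lborel. u (x, t) = C x + P t x)"
  proof
   assume t: "t \<in> {0<..<T}"
   show "AE x in lborel. u (x, t) = C x + P t x"
    using A by eventually_elim (use t in \<open>simp add: g_def Q_def\<close>)
  qed
 qed
 with Cm show ?thesis by blast
qed

lemma AE_interval_ex:
 assumes "AE t in lborel. t \<in> {0<..<T} --> R t" "p < q" "{p<..<q} \<subseteq> {0<..<T}"
 shows "\<exists>t. p < t \<and> t < q \<and> R t"
proof (rule ccontr)
 assume "\<not> ?thesis"
 then have "AE t in lborel. t \<notin> {p<..<q}" using assms(1,3) by (auto elim!: eventually_mono)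
 then have "{p<..<q} \<in> null_sets lborel" by (subst AE_iff_null_sets) auto
 then have "emeasure lborel {p<..<q} = 0" by (rule null_setsD1)
 then show False using assms(2) by simp
qed

text \<open>Both \<open>v\<close> and the representative are continuous in time in the mean and
  agree at almost every time, hence at every time, end points included. At the final time the
  approximating times are taken from the left, otherwise from the right.\<close>

lemma trace_representative:
 assumes C: "C \<in> borel_measurable borel" and rep: "AE t in lborel. t \<in> {0<..<T} --> (AE x in lborel. u (x, t) = C x + P t x)"
  and v: "!!t. t \<in> {0..T} ==> L2_on UNIV (v t)" "!!t. t \<in> {0..T} ==> ((%r. L2_norm (%x. v r x - v t x)) \<longlongrightarrow> 0) (at t within {0..T})"
  and vu: "AE t in lborel. t \<in> {0<..<T} --> (AE x in lborel. u (x, t) = v t x)" and t: "t \<in> {0..T}"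
 shows "L2_on UNIV (%x. C x + P t x)" "AE x in lborel. v t x = C x + P t x"
proof -
 note [measurable] = C
 let ?B = "LBINT w. (b w)^2"
 have good: "AE s in lborel. s \<in> {0<..<T} --> (AE x in lborel. v s x = C x + P s x)"
  using rep vu
 proof eventually_elim
  fix s assume 1: "s \<in> {0<..<T} --> (AE x in lborel. u (x, s) = C x + P s x)" "s \<in> {0<..<T} --> (AE x in lborel. u (x, s) = v s x)"
  show "s \<in> {0<..<T} --> (AE x in lborel. v s x = C x + P s x)"
  proof
   assume s: "s \<in> {0<..<T}"
   have "AE x in lborel. u (x, s) = C x + P s x" "AE x in lborel. u (x, s) = v s x" using 1 s by auto
   then show "AE x in lborel. v s x = C x + P s x" by eventually_elim simp
  qed
 qed
 have near: "\<exists>s\<in>{0<..<T}. \<bar>s - t\<bar> < d \<and> s \<noteq> t \<and> (AE x in lborel. v s x = C x + P s x)" if d: "d > 0" for d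
 proof (cases "t < T")
  case True
  from AE_interval_ex[OF good, of t "min T (t + d)"] True t d obtain s where "t < s" "s < min T (t + d)" "AE x in lborel. v s x = C x + P s x"
   by fastforce
  then show ?thesis using t by (intro bexI[of _ s]) auto
 next
  case False
  then have "t = T" using t by auto
  from AE_interval_ex[OF good, of "max 0 (T - d)" T] T d obtain s where "max 0 (T - d) < s" "s < T" "AE x in lborel. v s x = C x + P s x"
   by fastforce
  then show ?thesis using \<open>t = T\<close> by (intro bexI[of _ s]) auto
 qed
 have inc: "L2_on UNIV (%x. P t x - P s x)" "(LBINT x. (P t x - P s x)^2) \<le> \<bar>t - s\<bar> * ?B" for t s
 proof -
  have "L2_on UNIV (%x. P t x - P s x) \<and> (LBINT x. (P t x - P s x)^2) \<le> \<bar>t - s\<bar> * ?B"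
  proof (cases "s \<le> t")
   case True then show ?thesis using increment[OF True] by simp
  next
   case False
   then have st: "t \<le> s" by simp
   have "L2_on UNIV (%x. (- 1) * (P s x - P t x))" by (rule L2_on_cmult[OF increment(1)[OF st]])
   then show ?thesis using increment(2)[OF st] st by (simp add: power2_commute[of "P t _"])
  qed
  then show "L2_on UNIV (%x. P t x - P s x)" "(LBINT x. (P t x - P s x)^2) \<le> \<bar>t - s\<bar> * ?B" by auto
 qed
 have Lg: "L2_on UNIV (%x. C x + P s x)" if "s \<in> {0<..<T}" "AE x in lborel. v s x = C x + P s x" for s
 proof (rule L2_on_AE_cong(1)[OF v(1)])
  show "s \<in> {0..T}" using that by auto
  show "AE x in lborel. C x + P s x = v s x" using that(2) by eventually_elim simp
 qed measurable
 obtain s0 where s0: "s0 \<in> {0<..<T}" "AE x in lborel. v s0 x = C x + P s0 x" using near[of 1] by auto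
 have "L2_on UNIV (%x. (C x + P s0 x) + (P t x - P s0 x))" by (rule L2_on_add[OF Lg[OF s0] inc(1)])
 then show LV: "L2_on UNIV (%x. C x + P t x)" by simp
 let ?E = "LBINT x. (v t x - (C x + P t x))^2"
 have LE: "L2_on UNIV (%x. v t x - (C x + P t x))" by (rule L2_on_diff[OF v(1)[OF t] LV])
 have "?E \<le> e" if e: "e > 0" for e
 proof -
  have "\<forall>\<^sub>F r in at t within {0..T}. dist (L2_norm (%x. v r x - v t x)) 0 < sqrt (e / 4)"
   using v(2)[OF t] e by (intro tendstoD) auto
  then obtain d where d: "d > 0" "!!r. r \<in> {0..T} ==> r \<noteq> t ==> dist r t < d ==> \<bar>L2_norm (%x. v r x - v t x)\<bar> < sqrt (e / 4)"
   unfolding eventually_at by auto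
  have B: "0 \<le> ?B" by simp
  \<comment> \<open>The tolerances make both parts of the squared triangle inequality at most
    \<open>e / 4\<close>; with the factors 2 they add up to \<open>e\<close>. The \<open>+ 1\<close>
    covers a vanishing integral of \<open>b\<close>.\<close>
  obtain s where s: "s \<in> {0<..<T}" "\<bar>s - t\<bar> < min d (e / (4 * (?B + 1)))" "s \<noteq> t" "AE x in lborel. v s x = C x + P s x"
   using near[of "min d (e / (4 * (?B + 1)))"] d(1) e B by auto
  have Ls: "L2_on UNIV (%x. v s x - v t x)" by (rule L2_on_diff[OF v(1) v(1)[OF t]]) (use s in auto)
  have "(LBINT x. (v s x - v t x)^2) = (L2_norm (%x. v s x - v t x))^2" by (simp add: L2_norm_def)
  also have "\<dots> \<le> (sqrt (e / 4))^2"
   using d(2)[of s] s by (intro power2_le_iff_abs_le[THEN iffD2]) (auto simp: dist_real_def e less_imp_le)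
  finally have 1: "(LBINT x. (v s x - v t x)^2) \<le> e / 4" using e by simp
  have "(LBINT x. (P s x - P t x)^2) \<le> \<bar>s - t\<bar> * ?B" by (rule inc(2))
  also have "\<dots> \<le> e / (4 * (?B + 1)) * (?B + 1)" using s(2) B by (intro mult_mono) auto
  also have "\<dots> = e / 4"
   unfolding times_divide_eq_left by (rule nonzero_mult_divide_mult_cancel_right) (use B in linarith)
  finally have 2: "(LBINT x. (P s x - P t x)^2) \<le> e / 4" .
  have "?E \<le> (LBINT x. 2 * (P s x - P t x)^2 + 2 * (v s x - v t x)^2)"
  proof (rule integral_mono_AE)
   show "integrable lborel (%x. (v t x - (C x + P t x))^2)" using LE by (simp add: L2_on_UNIV)
   show "integrable lborel (%x. 2 * (P s x - P t x)^2 + 2 * (v s x - v t x)^2)"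
    using Ls inc(1)[of s t] by (simp add: L2_on_UNIV)
   show "AE x in lborel. (v t x - (C x + P t x))^2 \<le> 2 * (P s x - P t x)^2 + 2 * (v s x - v t x)^2"
    using s(4)
   proof eventually_elim
    fix x assume "v s x = C x + P s x"
    then have "v t x - (C x + P t x) = (P s x - P t x) - (v s x - v t x)" by simp
    then show "(v t x - (C x + P t x))^2 \<le> 2 * (P s x - P t x)^2 + 2 * (v s x - v t x)^2" using square_diff_le by metis
   qed
  qed
  also have "\<dots> = 2 * (LBINT x. (P s x - P t x)^2) + 2 * (LBINT x. (v s x - v t x)^2)"
   using Ls inc(1)[of s t] by (simp add: L2_on_UNIV)
  finally show ?thesis using 1 2 by linarith
 qed
 then have "?E \<le> 0" by (rule field_le_epsilon[where y=0, simplified])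
 then have "?E = 0" by (simp add: order_antisym)
 then have "AE x in lborel. (v t x - (C x + P t x))^2 = 0"
  using LE by (subst (asm) integral_nonneg_eq_0_iff_AE) (auto simp: L2_on_UNIV)
 then show "AE x in lborel. v t x = C x + P t x" by eventually_elim simp
qed

text \<open>Testing with the projection error itself avoids interchanging the projection with the integral over time.\<close>

lemma increment_proj_error:
 assumes D: "D > 0" and st: "0 \<le> s" "s < t" "t \<le> T"
  and N: "AE r in lborel. r \<in> {0<..<T} --> L2_on UNIV (%x. b (x, r)) \<and> (LBINT x:cell D i. (b (x, r) - proj D k i (%x. b (x, r)) x)^2) \<le> N r"
  and Ni: "integrable lborel (%r. indicator {0<..<T} r * N r)" "!!r. 0 \<le> N r"
 defines "G \<equiv> %x. P t x - P s x"
 shows "(LBINT x:cell D i. (G x - proj D k i G x)^2) \<le> (t - s) * (LBINT r. indicator {0<..<T} r * N r)"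
proof -
 let ?c = "cell D i" and ?d = "t - s"
 \<comment> \<open>The projection error of the increment, cut off to the cell, is the fixed function
   against which the space integrals at all times are formed.\<close>
 define e where "e x = indicator ?c x * (G x - proj D k i G x)" for x
 let ?E = "LBINT x:?c. (G x - proj D k i G x)^2"
 have LG: "L2_on ?c G" unfolding G_def by (rule L2_on_subset[OF increment(1)]) (use st in auto)
 have Le: "L2_on ?c (%x. G x - proj D k i G x)" by (rule L2_on_diff[OF LG L2_on_proj])
 have em: "e \<in> borel_measurable borel" and ei: "integrable lborel (%x. (e x)^2)"
 proof -
  show "e \<in> borel_measurable borel" using Le by (simp add: e_def[abs_def] L2_on_def set_borel_measurable_def)
  have "(%x. (e x)^2) = (%x. indicator ?c x *\<^sub>R (G x - proj D k i G x)^2)" by (auto simp: e_def fun_eq_iff indicator_def)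
  then show "integrable lborel (%x. (e x)^2)" using Le by (simp add: L2_on_def set_integrable_def)
 qed
 define p where "p r = (LBINT x. e x * b (x, r))" for r
 have pi: "integrable lborel p" unfolding p_def[abs_def] by (rule pairing(1)[OF em ei])
 have pit: "integrable lborel (%r. if r < t then p r else 0)" for t
  by (rule integrable_le[OF pi]) (use pi in auto)
 have "?E = (LBINT x:?c. (G x - proj D k i G x) * G x - (G x - proj D k i G x) * proj D k i G x)"
  by (simp only: power2_eq_square right_diff_distrib)
 also have "\<dots> = (LBINT x:?c. (G x - proj D k i G x) * G x)"
  unfolding set_integral_diff(2)[OF L2_on_mult[OF Le LG] L2_on_mult[OF Le L2_on_proj]]
   proj_orth[OF LG D, of k "coef D i G", folded proj_def] by (rule diff_zero)
 also have "\<dots> = (LBINT x. e x * P t x - e x * P s x)"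
  unfolding set_lebesgue_integral_def
 proof (rule LBINT_cong[OF refl])
  fix x
  have "z *\<^sub>R (y * (p - q)) = (z * y) * p - (z * y) * q" for z y p q :: real by (simp add: algebra_simps)
  then show "indicator ?c x *\<^sub>R ((G x - proj D k i G x) * G x) = e x * P t x - e x * P s x"
   unfolding e_def G_def .
 qed
 also have "\<dots> = (LBINT x. e x * P t x) - (LBINT x. e x * P s x)"
  by (rule Bochner_Integration.integral_diff[OF pairing(2)[OF em ei] pairing(2)[OF em ei]])
 also have "\<dots> = (LBINT r. (if r < t then p r else 0) - (if r < s then p r else 0))"
  unfolding pairing(3)[OF em ei] p_def[symmetric] by (rule Bochner_Integration.integral_diff[OF pit pit, symmetric])
 \<comment> \<open>Young's inequality with weight \<open>t - s\<close>: integrated over the interval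
   the first term amounts to half of \<open>?E\<close> and is absorbed at the end.\<close>
 also have "\<dots> \<le> (LBINT r. indicator {s..<t} r * (?E / (2 * ?d)) + ?d / 2 * (indicator {0<..<T} r * N r))"
 proof (rule integral_mono_AE)
  show "integrable lborel (%r. (if r < t then p r else 0) - (if r < s then p r else 0))" using pit by simp
  show "integrable lborel (%r. indicator {s..<t} r * (?E / (2 * ?d)) + ?d / 2 * (indicator {0<..<T} r * N r))"
   using Ni st by (intro Bochner_Integration.integrable_add integrable_mult_left integrable_mult_right integrable_real_indicator) auto
  show "AE r in lborel. (if r < t then p r else 0) - (if r < s then p r else 0) \<le> indicator {s..<t} r * (?E / (2 * ?d)) + ?d / 2 * (indicator {0<..<T} r * N r)"
   using N AE_lborel_singleton[of 0]
  proof eventually_elim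
   fix r assume A: "r \<in> {0<..<T} --> L2_on UNIV (%x. b (x, r)) \<and> (LBINT x:?c. (b (x, r) - proj D k i (%x. b (x, r)) x)^2) \<le> N r"
    and "r \<noteq> 0"
   show "(if r < t then p r else 0) - (if r < s then p r else 0) \<le> indicator {s..<t} r * (?E / (2 * ?d)) + ?d / 2 * (indicator {0<..<T} r * N r)"
   proof (cases "s \<le> r \<and> r < t")
    case False
    then show ?thesis using st Ni(2)[of r] by (auto simp: indicator_def)
   next
    case True
    then have r: "r \<in> {0<..<T}" using st \<open>r \<noteq> 0\<close> by auto
    let ?f = "%x. b (x, r)"
    have Lb: "L2_on ?c ?f" using A r L2_on_subset[of UNIV ?f ?c] by simp
    have Lr: "L2_on ?c (%x. ?f x - proj D k i ?f x)" by (rule L2_on_diff[OF Lb L2_on_proj])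
    have "p r = (LBINT x:?c. (G x - proj D k i G x) * (?f x - proj D k i ?f x) + (G x - proj D k i G x) * proj D k i ?f x)"
     unfolding p_def set_lebesgue_integral_def
    proof (rule LBINT_cong[OF refl])
     fix x
     have "(z * y) * p = z *\<^sub>R (y * (p - q) + y * q)" for z y p q :: real by (simp add: algebra_simps)
     then show "e x * ?f x = indicator ?c x *\<^sub>R ((G x - proj D k i G x) * (?f x - proj D k i ?f x) + (G x - proj D k i G x) * proj D k i ?f x)"
      unfolding e_def .
    qed
    also have "\<dots> = (LBINT x:?c. (G x - proj D k i G x) * (?f x - proj D k i ?f x))"
     unfolding set_integral_add(2)[OF L2_on_mult[OF Le Lr] L2_on_mult[OF Le L2_on_proj]]
      proj_orth[OF LG D, of k "coef D i ?f", folded proj_def] by (rule add_0_right)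
    also have "\<dots> \<le> (LBINT x:?c. 1 / (2 * ?d) * (G x - proj D k i G x)^2 + ?d / 2 * (?f x - proj D k i ?f x)^2)"
    proof (rule set_integral_mono)
     show "set_integrable lborel ?c (%x. (G x - proj D k i G x) * (?f x - proj D k i ?f x))" by (rule L2_on_mult[OF Le Lr])
     show "set_integrable lborel ?c (%x. 1 / (2 * ?d) * (G x - proj D k i G x)^2 + ?d / 2 * (?f x - proj D k i ?f x)^2)"
      using Le Lr by (intro set_integral_add set_integrable_mult_right) (auto simp: L2_on_def)
     fix x
     have "y * z \<le> 1 / (2 * d) * y^2 + d / 2 * z^2" if "d > 0" for y z d :: real
     proof -
      have "0 \<le> (y - d * z)^2 / (2 * d)" using that by simp
      also have "\<dots> = 1 / (2 * d) * y^2 + d / 2 * z^2 - y * z" using that by (simp add: power2_eq_square field_simps)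
      finally show ?thesis by simp
     qed
     from this[of ?d] st
     show "(G x - proj D k i G x) * (?f x - proj D k i ?f x) \<le> 1 / (2 * ?d) * (G x - proj D k i G x)^2 + ?d / 2 * (?f x - proj D k i ?f x)^2" by simp
    qed
    also have "\<dots> = ?E / (2 * ?d) + ?d / 2 * (LBINT x:?c. (?f x - proj D k i ?f x)^2)"
     using Le Lr by (subst set_integral_add(2)) (auto simp: L2_on_def intro!: set_integrable_mult_right)
    also have "\<dots> \<le> ?E / (2 * ?d) + ?d / 2 * N r" using A r st by (intro add_left_mono mult_left_mono) auto
    finally have "p r \<le> ?E / (2 * ?d) + ?d / 2 * N r" .
    moreover have "(if r < t then p r else 0) - (if r < s then p r else 0) = p r"
     "indicator {s..<t} r = (1 :: real)" "indicator {0<..<T} r = (1 :: real)" using True r by auto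
    ultimately show ?thesis by (simp only: mult_1)
   qed
  qed
 qed
 also have "\<dots> = ?d * (?E / (2 * ?d)) + ?d / 2 * (LBINT r. indicator {0<..<T} r * N r)"
 proof -
  have "integrable lborel (%r. indicator {s..<t} r * (?E / (2 * ?d)))"
   using st by (intro integrable_mult_left integrable_real_indicator) auto
  then show ?thesis using Ni(1) st by (subst Bochner_Integration.integral_add) auto
 qed
 finally have "?E \<le> ?d * (?E / (2 * ?d)) + ?d / 2 * (LBINT r. indicator {0<..<T} r * N r)" .
 moreover have "E \<le> d * (E / (2 * d)) + d / 2 * I ==> d > 0 ==> E \<le> d * I" for E d I :: real
  by simp
 moreover have "?d > 0" using st by simp
 ultimately show ?thesis by blast
qed

end

section \<open>The discrete solution as a curve\<close>

lemma L2_norm_square: "(L2_norm f)^2 = (LBINT x. (f x)^2)"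
 by (simp add: L2_norm_def)

lemma L2_norm_nonneg: "0 \<le> L2_norm f"
 by (simp add: L2_norm_def)

lemma L2_norm_le_H_frac_norm: "L2_norm f \<le> H_frac_norm lam f"
proof -
 have "0 \<le> (LBINT p. gagliardo_quotient lam f p)"
  by (rule Bochner_Integration.integral_nonneg) (auto simp: gagliardo_quotient_def split: prod.split)
 then have "sqrt ((L2_norm f)^2) \<le> H_frac_norm lam f" unfolding H_frac_norm_def by (intro real_sqrt_le_mono) simp
 then show ?thesis using L2_norm_nonneg[of f] by simp
qed

lemma infsum_basis_fun:
 assumes D: "D > 0"
 shows "(\<Sum>\<^sub>\<infinity>i. \<Sum>p\<le>k. V i p * basis_fun D p i x) = glob D k V x"
proof (cases "\<exists>i. x \<in> cell D i")
 case True
 then obtain j where j: "x \<in> cell D j" by blast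
 have "(\<Sum>\<^sub>\<infinity>i. \<Sum>p\<le>k. V i p * basis_fun D p i x) = (\<Sum>\<^sub>\<infinity>i\<in>{j}. \<Sum>p\<le>k. V i p * basis_fun D p i x)"
 proof (rule infsum_cong_neutral)
  fix i assume "i \<in> UNIV - {j}"
  then have "x \<notin> cell D i" using cell_floor[OF D j] cell_floor[OF D, of x i] by blast
  then show "(\<Sum>p\<le>k. V i p * basis_fun D p i x) = 0" by (simp add: basis_fun_def)
 qed auto
 also have "\<dots> = glob D k V x" using j by (simp add: glob_cell[OF D j] cell_poly_def basis_fun_cell)
 finally show ?thesis .
next
 case False
 then show ?thesis by (simp add: glob_outside basis_fun_def)
qed

lemma coef_glob: "D > 0 ==> q \<le> k ==> coef D i (glob D k V) q = V i q"
 using coef_cong[of D i "glob D k V" "cell_poly D k i (V i)" q] by (simp add: glob_cell coef_cell_poly)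

lemma coef_lborel: "coef D i f q = (2 * real q + 1) / D * (LBINT x. basis_fun D q i x * f x)"
proof -
 have "(LBINT x:cell D i. f x * basis_fun D q i x) = (LBINT x. basis_fun D q i x * f x)"
  unfolding set_lebesgue_integral_def
  by (rule LBINT_cong) (auto simp: basis_fun_def indicator_def)
 then show ?thesis by (simp add: coef_def)
qed

lemma coef_AE:
 assumes "AE x in lborel. f x = g x" "f \<in> borel_measurable borel" "g \<in> borel_measurable borel" "D > 0"
 shows "coef D i f q = coef D i g q"
proof -
 have [measurable]: "basis_fun D q i \<in> borel_measurable borel" using basis_fun_test(1)[OF assms(4)] by (simp add: L2c_def)
 note [measurable] = assms(2,3)
 have "(LBINT x. basis_fun D q i x * f x) = (LBINT x. basis_fun D q i x * g x)"
 proof (rule integral_cong_AE)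
  show "AE x in lborel. basis_fun D q i x * f x = basis_fun D q i x * g x" using assms(1) by eventually_elim simp
 qed measurable
 then show ?thesis by (simp add: coef_lborel)
qed

lemma proj_error_AE:
 assumes "AE x in lborel. f x = g x" "f \<in> borel_measurable borel" "g \<in> borel_measurable borel" "D > 0"
 shows "(LBINT x:cell D i. (f x - proj D k i f x)^2) = (LBINT x:cell D i. (g x - proj D k i g x)^2)"
proof -
 have p: "proj D k i f = proj D k i g"
  unfolding proj_def using coef_AE[OF assms] by (simp add: fun_eq_iff cell_poly_def)
 have [measurable]: "proj D k i g \<in> borel_measurable borel"
  unfolding proj_def by (rule borel_measurable_continuous_onI[OF continuous_cell_poly])
 note [measurable] = assms(2,3)
 show ?thesis unfolding p set_lebesgue_integral_def
 proof (rule integral_cong_AE)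
  show "AE x in lborel. indicator (cell D i) x *\<^sub>R (f x - proj D k i g x)^2 = indicator (cell D i) x *\<^sub>R (g x - proj D k i g x)^2"
   using assms(1) by eventually_elim simp
 qed measurable
qed

lemma coef_square_le:
 assumes "D > 0" "L2_on UNIV f"
 shows "(coef D i f q)^2 \<le> (2 * real q + 1) / D * (LBINT x. (f x)^2)"
proof -
 have Lc: "L2_on (cell D i) f" by (rule L2_on_subset[OF assms(2)]) auto
 have "D / (2 * real q + 1) * (coef D i f q)^2 \<le> (\<Sum>p\<le>q. D / (2 * real p + 1) * (coef D i f p)^2)"
  using assms(1) member_le_sum[of q "{..q}" "%p. D / (2 * real p + 1) * (coef D i f p)^2"] by simp
 also have "\<dots> \<le> (LBINT x:cell D i. (f x)^2)" by (rule coef_Bessel[OF Lc assms(1)])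
 also have "\<dots> \<le> (LBINT x. (f x)^2)"
  using L2_on_integral_subset[OF assms(2), of "cell D i"] by (simp add: set_lebesgue_integral_def)
 finally have "D / (2 * real q + 1) * (coef D i f q)^2 \<le> (LBINT x. (f x)^2)" .
 moreover have "d > 0 ==> D / d * y \<le> I ==> y \<le> d / D * I" for d y I :: real using assms(1) by (simp add: field_simps)
 ultimately show ?thesis by simp
qed

lemma coef_tendsto:
 assumes D: "D > 0" and L: "\<forall>\<^sub>F s in F. L2_on UNIV (f s)" and lim: "((%s. L2_norm (f s)) \<longlongrightarrow> 0) F"
 shows "((%s. coef D i (f s) q) \<longlongrightarrow> 0) F"
proof (rule tendsto_rabs_zero_cancel, rule tendsto_sandwich[OF _ _ tendsto_const])
 show "((%s. sqrt ((2 * real q + 1) / D) * L2_norm (f s)) \<longlongrightarrow> 0) F" by (rule tendsto_mult_right_zero[OF lim])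
 show "\<forall>\<^sub>F s in F. \<bar>coef D i (f s) q\<bar> \<le> sqrt ((2 * real q + 1) / D) * L2_norm (f s)"
  using L
 proof eventually_elim
  fix s assume "L2_on UNIV (f s)"
  then have "(coef D i (f s) q)^2 \<le> (2 * real q + 1) / D * (L2_norm (f s))^2"
   unfolding L2_norm_square by (rule coef_square_le[OF D])
  then have "sqrt ((coef D i (f s) q)^2) \<le> sqrt ((2 * real q + 1) / D * (L2_norm (f s))^2)" by (rule real_sqrt_le_mono)
  then show "\<bar>coef D i (f s) q\<bar> \<le> sqrt ((2 * real q + 1) / D) * L2_norm (f s)"
   using L2_norm_nonneg[of "f s"] by (simp only: real_sqrt_mult real_sqrt_abs abs_of_nonneg)
 qed
qed auto

text \<open>Coefficients depend continuously on the function in the mean, so the difference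
  quotients of \<open>U\<close> converge to the coefficient of \<open>w'\<close>; limits within the
  interval are unique, also at its end points.\<close>

lemma coef_derivative:
 assumes D: "D > 0" and T: "T > 0" and t: "t \<in> {0..T}" and Lw: "!!s. s \<in> {0..T} ==> L2_on UNIV (w s)" and Lw': "L2_on UNIV w'"
  and lim: "((%s. L2_norm (%x. (w s x - w t x) / (s - t) - w' x)) \<longlongrightarrow> 0) (at t within {0..T})"
  and U: "!!s. s \<in> {0..T} ==> coef D i (w s) q = U s" and d: "(U has_real_derivative U') (at t within {0..T})"
 shows "U' = coef D i w' q"
proof -
 let ?F = "at t within {0..T}"
 have Lc: "L2_on (cell D i) f" if "L2_on UNIV f" for f by (rule L2_on_subset[OF that]) auto
 have ev: "\<forall>\<^sub>F s in ?F. s \<in> {0..T}" by (auto simp: eventually_at_filter)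
 have Lq: "L2_on UNIV (%x. 1 / (s - t) * (w s x - w t x) - w' x)" if "s \<in> {0..T}" for s
  by (rule L2_on_diff[OF L2_on_cmult[OF L2_on_diff[OF Lw[OF that] Lw[OF t]]] Lw'])
 have "((%s. coef D i (%x. 1 / (s - t) * (w s x - w t x) - w' x) q) \<longlongrightarrow> 0) ?F"
 proof (rule coef_tendsto[OF D eventually_mono[OF ev Lq]])
  show "((%s. L2_norm (%x. 1 / (s - t) * (w s x - w t x) - w' x)) \<longlongrightarrow> 0) ?F" using lim by simp
 qed
 moreover have "\<forall>\<^sub>F s in ?F. coef D i (%x. 1 / (s - t) * (w s x - w t x) - w' x) q = (U s - U t) / (s - t) - coef D i w' q"
  using ev
 proof eventually_elim
  fix s assume s: "s \<in> {0..T}"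
  have "coef D i (%x. 1 / (s - t) * (w s x - w t x) - w' x) q = coef D i (%x. 1 / (s - t) * (w s x - w t x)) q - coef D i w' q"
   by (rule coef_diff[OF Lc[OF L2_on_cmult[OF L2_on_diff[OF Lw[OF s] Lw[OF t]]]] Lc[OF Lw']])
  also have "coef D i (%x. 1 / (s - t) * (w s x - w t x)) q = 1 / (s - t) * coef D i (%x. w s x - w t x) q" by (rule coef_cmult)
  also have "coef D i (%x. w s x - w t x) q = U s - U t"
   using coef_diff[OF Lc[OF Lw[OF s]] Lc[OF Lw[OF t]]] U[OF s] U[OF t] by simp
  finally show "coef D i (%x. 1 / (s - t) * (w s x - w t x) - w' x) q = (U s - U t) / (s - t) - coef D i w' q" by simp
 qed
 ultimately have "((%s. (U s - U t) / (s - t) - coef D i w' q) \<longlongrightarrow> 0) ?F" by (rule Lim_transform_eventually)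
 then have 1: "((%s. (U s - U t) / (s - t)) \<longlongrightarrow> coef D i w' q) ?F" by (rule LIM_zero_cancel)
 have 2: "((%s. (U s - U t) / (s - t)) \<longlongrightarrow> U') ?F" using d unfolding has_field_derivative_iff .
 have 3: "?F \<noteq> bot" using t T by (simp add: trivial_limit_within islimpt_Icc)
 show ?thesis by (rule tendsto_unique[OF 3 2 1])
qed

lemma coef_continuous:
 assumes D: "D > 0" and L: "!!s. s \<in> {0..T} ==> L2_on UNIV (w' s)"
  and lim: "!!t. t \<in> {0..T} ==> ((%s. L2_norm (%x. w' s x - w' t x)) \<longlongrightarrow> 0) (at t within {0..T})"
 shows "continuous_on {0..T} (%s. coef D i (w' s) q)"
 unfolding continuous_on_def
proof (intro ballI, rule LIM_zero_cancel)
 fix t assume t: "t \<in> {0..T}"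
 let ?F = "at t within {0..T}"
 have Lc: "L2_on (cell D i) f" if "L2_on UNIV f" for f by (rule L2_on_subset[OF that]) auto
 have ev: "\<forall>\<^sub>F s in ?F. s \<in> {0..T}" by (auto simp: eventually_at_filter)
 have "((%s. coef D i (%x. w' s x - w' t x) q) \<longlongrightarrow> 0) ?F"
  by (rule coef_tendsto[OF D eventually_mono[OF ev] lim[OF t]]) (rule L2_on_diff[OF L L[OF t]])
 moreover have "\<forall>\<^sub>F s in ?F. coef D i (%x. w' s x - w' t x) q = coef D i (w' s) q - coef D i (w' t) q"
  by (rule eventually_mono[OF ev]) (rule coef_diff[OF Lc[OF L] Lc[OF L[OF t]]])
 ultimately show "((%s. coef D i (w' s) q - coef D i (w' t) q) \<longlongrightarrow> 0) ?F" by (rule Lim_transform_eventually)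
qed

text \<open>Otherwise the norms along a sequence of times would be unbounded. A subsequence of the
  times converges by compactness, and continuity at the limit bounds the norms nearby.\<close>

lemma bounded_curve:
 assumes L: "!!s. s \<in> {0..T} ==> L2_on UNIV (w' s)"
  and lim: "!!t. t \<in> {0..T} ==> ((%s. L2_norm (%x. w' s x - w' t x)) \<longlongrightarrow> 0) (at t within {0..T})"
 shows "\<exists>M. \<forall>s\<in>{0..T::real}. (LBINT x. (w' s x)^2) \<le> M"
proof (rule ccontr)
 assume neg: "\<not> ?thesis"
 have "\<forall>n::nat. \<exists>s. s \<in> {0..T} \<and> real n < (LBINT x. (w' s x)^2)"
 proof
  fix n :: nat
  have "\<exists>s\<in>{0..T}. \<not> (LBINT x. (w' s x)^2) \<le> real n" using neg by blast
  then show "\<exists>s. s \<in> {0..T} \<and> real n < (LBINT x. (w' s x)^2)" by (auto simp: not_le)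
 qed
 from choice[OF this] obtain s where s: "!!n::nat. s n \<in> {0..T}" "!!n. real n < (LBINT x. (w' (s n) x)^2)" by blast
 have "seq_compact {0..T}" by (simp add: compact_imp_seq_compact)
 then obtain l r where l: "l \<in> {0..T}" "strict_mono r" "(s \<circ> r) \<longlonglongrightarrow> l"
  by (rule seq_compactE[where f=s]) (use s(1) in blast)
 let ?I = "%s. LBINT x. (w' s x)^2"
 have "\<forall>\<^sub>F t in at l within {0..T}. dist (L2_norm (%x. w' t x - w' l x)) 0 < 1" by (rule tendstoD[OF lim[OF l(1)]]) simp
 then obtain d where d: "d > 0" "!!t. t \<in> {0..T} ==> t \<noteq> l ==> dist t l < d ==> \<bar>L2_norm (%x. w' t x - w' l x)\<bar> < 1"
  unfolding eventually_at by auto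
 have near: "?I t \<le> 2 * ?I l + 2" if t: "t \<in> {0..T}" "dist t l < d" for t
 proof (cases "t = l")
  case True
  have "0 \<le> ?I l" by simp
  then show ?thesis using True by simp
 next
  case False
  have "L2_norm (%x. w' t x - w' l x) \<le> 1" using d(2)[OF t(1) False t(2)] by simp
  then have "(L2_norm (%x. w' t x - w' l x))^2 \<le> 1" using L2_norm_nonneg by (simp add: power_le_one)
  then have b: "(LBINT x. (w' t x - w' l x)^2) \<le> 1" by (simp add: L2_norm_square)
  have Ld: "L2_on UNIV (%x. w' t x - w' l x)" by (intro L2_on_diff L t l)
  have "?I t \<le> (LBINT x. 2 * (w' l x)^2 + 2 * (w' t x - w' l x)^2)"
  proof (rule integral_mono)
   fix x
   have "(w' t x)^2 = (w' l x - (w' l x - w' t x))^2" by simp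
   also have "\<dots> \<le> 2 * (w' l x)^2 + 2 * (w' l x - w' t x)^2" by (rule square_diff_le)
   finally show "(w' t x)^2 \<le> 2 * (w' l x)^2 + 2 * (w' t x - w' l x)^2" by (simp only: power2_commute[of "w' l x"])
  qed (use L[OF t(1)] L[OF l(1)] Ld in \<open>simp_all add: L2_on_UNIV\<close>)
  also have "\<dots> = 2 * ?I l + 2 * (LBINT x. (w' t x - w' l x)^2)" using L[OF l(1)] Ld by (simp add: L2_on_UNIV)
  finally show ?thesis using b by simp
 qed
 obtain n0 where n0: "!!n. n \<ge> n0 ==> dist (s (r n)) l < d"
  using metric_LIMSEQ_D[OF l(3) d(1)] by auto
 obtain m :: nat where m: "2 * ?I l + 2 < real m" using reals_Archimedean2 by blast
 let ?n = "max n0 m"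
 have "real ?n \<le> real (r ?n)" using seq_suble[OF l(2)] by simp
 then show False using near[OF s(1) n0[of ?n]] s(2)[of "r ?n"] m by simp
qed

lemma cells_L2_le:
 assumes D: "D > 0" and L: "L2_on UNIV f" and M: "!!F. finite F ==> (\<Sum>i\<in>F. LBINT x:cell D i. (f x)^2) \<le> M"
 shows "(LBINT x. (f x)^2) \<le> M"
proof -
 have [measurable]: "f \<in> borel_measurable borel" and i: "integrable lborel (%x. (f x)^2)" using L by (auto simp: L2_on_UNIV)
 have M0: "0 \<le> M" using M[of "{}"] by simp
 have ii: "integrable lborel (%x. indicator (cell D j) x *\<^sub>R (f x)^2)" for j
  using L2_on_subset[OF L, of "cell D j"] by (simp add: L2_on_def set_integrable_def)
 have c: "(\<integral>\<^sup>+ x. ennreal ((f x)^2) * indicator (cell D j) x \<partial>lborel) = ennreal (LBINT x:cell D j. (f x)^2)" for j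
  unfolding set_lebesgue_integral_def using ii[of j]
  by (subst nn_integral_eq_integral[symmetric]) (auto simp: indicator_def intro!: nn_integral_cong)
 have "(\<integral>\<^sup>+ x. ennreal ((f x)^2) \<partial>lborel) \<le> ennreal M"
 proof (rule nn_integral_cells_le[OF D])
  fix F :: "int set" assume "finite F"
  then show "(\<Sum>i\<in>F. \<integral>\<^sup>+ x. ennreal ((f x)^2) * indicator (cell D i) x \<partial>lborel) \<le> ennreal M"
   unfolding c using M by (subst sum_ennreal) (auto intro: ennreal_leI L2_on_integral_nonneg)
 qed measurable
 then show ?thesis using nn_integral_eq_integral[OF i] M0 by simp
qed

lemma coef_FTC:
 assumes t: "0 \<le> t" "t \<le> T" and d: "!!s. s \<in> {0..T} ==> (U has_real_derivative V s) (at s within {0..T})" and c: "continuous_on {0..T} V"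
 shows "integrable lborel (%s. indicator {0<..<T} s * V s)"
  "(LBINT s. (if s < t then indicator {0<..<T} s * V s else 0)) = U t - U 0"
proof -
 have i: "set_integrable lborel {0..T} V" using c by (rule borel_integrable_atLeastAtMost')
 have "set_integrable lborel {0<..<T} V" by (rule set_integrable_subset[OF i]) auto
 then show j: "integrable lborel (%s. indicator {0<..<T} s * V s)" by (simp add: set_integrable_def)
 have "set_integrable lborel {0..t} V" by (rule set_integrable_subset[OF i]) (use t in auto)
 then have m1: "(%s. indicator {0..t} s *\<^sub>R V s) \<in> borel_measurable lborel" by (auto simp: set_integrable_def)
 have [measurable]: "(%s. indicator {0<..<T} s * V s) \<in> borel_measurable borel" using j by auto
 have "(LBINT s. (if s < t then indicator {0<..<T} s * V s else 0)) = (LBINT s. indicator {0..t} s *\<^sub>R V s)"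
 proof (rule integral_cong_AE[OF _ m1])
  show "AE s in lborel. (if s < t then indicator {0<..<T} s * V s else 0) = indicator {0..t} s *\<^sub>R V s"
   using AE_lborel_singleton[of 0] AE_lborel_singleton[of t]
   by eventually_elim (use t in \<open>auto simp: indicator_def\<close>)
 qed measurable
 also have "\<dots> = U t - U 0"
 proof (rule integral_FTC_atLeastAtMost)
  show "continuous_on {0..t} V" by (rule continuous_on_subset[OF c]) (use t in auto)
  fix s assume s: "0 \<le> s" "s \<le> t"
  then have "(U has_real_derivative V s) (at s within {0..t})"
   using t by (intro DERIV_subset[OF d]) auto
  then show "(U has_vector_derivative V s) (at s within {0..t})" by (simp add: has_real_derivative_iff_has_vector_derivative)
 qed (use t in auto)
 finally show "(LBINT s. (if s < t then indicator {0<..<T} s * V s else 0)) = U t - U 0" .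
qed

section \<open>The error estimate\<close>

lemma (in dg_slice) energy_rate_coef:
 assumes "(%N. \<Sum>i\<in>{- int N..<int N}. \<Sum>q\<le>k. D / (2 * real q + 1) * (U i q - coef D i (f 0) q) * (U' i q - coef D i ut q)) \<longlonglongrightarrow> R"
 shows "R \<le> rate_const lam c k * D ^ (2 * k + 1) * ((LBINT x. (f (Suc k) x)^2) + (LBINT x. (f 0 x)^2))"
 by (rule energy_rate_bound) (use assms in \<open>simp add: Th_def Acoef_def\<close>)

lemma slab_integral:
 assumes a: "L2_on (Q T) a" and S: "S \<in> sets (borel :: real measure)"
 shows "integrable lborel (%s. indicator {0<..<T} s * (LBINT x:S. (a (x, s))^2))"
  "(LBINT s. indicator {0<..<T} s * (LBINT x:S. (a (x, s))^2)) = (LBINT w:S \<times> {0<..<T}. (a w)^2)"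
proof -
 have "set_integrable lborel (S \<times> {0<..<T}) (%w. (a w)^2)"
 proof (rule set_integrable_subset[of _ "Q T"])
  show "set_integrable lborel (Q T) (%w. (a w)^2)" using a by (simp add: L2_on_def)
  show "S \<times> {0<..<T} \<in> sets lborel" using S by (simp add: borel_Times)
 qed (auto simp: Q_def)
 then have i: "integrable lborel (%w. indicator (S \<times> {0<..<T}) w *\<^sub>R (a w)^2)" by (simp add: set_integrable_def)
 have e: "(LBINT x. indicator (S \<times> {0<..<T}) (x, s) *\<^sub>R (a (x, s))^2) = indicator {0<..<T} s * (LBINT x:S. (a (x, s))^2)" for s
  by (cases "s \<in> {0<..<T}") (auto simp: set_lebesgue_integral_def indicator_def intro!: LBINT_cong)
 show "integrable lborel (%s. indicator {0<..<T} s * (LBINT x:S. (a (x, s))^2))"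
  using lborel2_Fubini(3)[OF i] unfolding e .
 show "(LBINT s. indicator {0<..<T} s * (LBINT x:S. (a (x, s))^2)) = (LBINT w:S \<times> {0<..<T}. (a w)^2)"
  using lborel2_Fubini(1)[OF i] unfolding e set_lebesgue_integral_def by simp
qed

lemma H_frac_tendsto:
 assumes "((%s. H_frac_norm lam (f s)) \<longlongrightarrow> 0) F"
 shows "((%s. L2_norm (f s)) \<longlongrightarrow> 0) F"
 by (rule tendsto_sandwich[OF _ _ tendsto_const assms]) (simp_all add: L2_norm_nonneg L2_norm_le_H_frac_norm)

text \<open>\<open>A j\<close> is the derivative of order \<open>j\<close> of \<open>u\<close> in
  \<open>x\<close>, \<open>Bt j\<close> that of \<open>ut\<close>; the latter stops at order
  \<open>k\<close> because the time derivative uses up one order. The lowest members are tied to the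
  functions in the equation, since weak derivatives are determined only up to null sets.\<close>

locale exact_solution =
 fixes lam c T :: real and k :: nat and u ut ux :: "real \<times> real => real" and A Bt :: "nat => real \<times> real => real"
  and u0 uT :: "real => real"
 assumes lam: "0 < lam" "lam < 1" and T0: "0 < T"
  and A: "!!j. j \<le> Suc k ==> L2_on (Q T) (A j)" "A 0 = u" "A (Suc 0) = ux" "!!j. j < Suc k ==> weak_x T (A j) (A (Suc j))"
  and Bt: "!!j. j \<le> k ==> L2_on (Q T) (Bt j)" "Bt 0 = ut" "!!j. j < k ==> weak_x T (Bt j) (Bt (Suc j))"
  and wt: "weak_t T u ut"
  and eqn: "AE t in lborel. t \<in> {0<..<T} --> is_g lam (%x. u (x, t)) (%x. ut (x, t) + c * ux (x, t))"
  and tr: "time_trace T u 0 u0" "time_trace T u T uT"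
begin

definition b where "b w = indicator (Q T) w * ut w"

lemma Lu: "L2_on (Q T) u" and Lut: "L2_on (Q T) ut"
 using A(1)[of 0] A(2) Bt(1)[of 0] Bt(2) by auto

sublocale time_slab T b
proof
 show "b \<in> borel_measurable borel" using Lut by (simp add: b_def[abs_def] L2_on_def set_borel_measurable_def)
 have "(%w. (b w)^2) = (%w. indicator (Q T) w *\<^sub>R (ut w)^2)" by (auto simp: b_def fun_eq_iff indicator_def)
 then show "integrable lborel (%w. (b w)^2)" using Lut by (simp add: L2_on_def set_integrable_def)
qed (auto simp: T0 b_def Q_def)

lemma b_eq: "r \<in> {0<..<T} ==> b (x, r) = ut (x, r)"
 by (simp add: b_def Q_def)

definition C0 where "C0 = (SOME C. C \<in> borel_measurable borel \<and> (AE t in lborel. t \<in> {0<..<T} --> (AE x in lborel. u (x, t) = C x + P t x)))"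

lemma C0: "C0 \<in> borel_measurable borel" "AE t in lborel. t \<in> {0<..<T} --> (AE x in lborel. u (x, t) = C0 x + P t x)"
 using someI_ex[OF time_representative[OF Lu Lut wt b_eq], folded C0_def] by auto

text \<open>The representative of \<open>u\<close> with a value at every time; the given traces at
  times 0 and \<open>T\<close> differ from it on null sets only.\<close>

definition V where "V t x = C0 x + P t x"

lemma V_trace:
 assumes "time_trace T u s w" "s \<in> {0..T}"
 shows "t \<in> {0..T} ==> L2_on UNIV (V t)" "L2_on UNIV w" "AE x in lborel. w x = V s x"
proof -
 obtain v where v: "\<forall>t\<in>{0..T}. L2_on UNIV (v t) \<and> ((%r. L2_norm (%x. v r x - v t x)) \<longlongrightarrow> 0) (at t within {0..T})"
  "AE t in lborel. t \<in> {0<..<T} --> (AE x in lborel. u (x, t) = v t x)" "w = v s"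
  using assms(1) unfolding time_trace_def by blast
 have v1: "L2_on UNIV (v t)" "((%r. L2_norm (%x. v r x - v t x)) \<longlongrightarrow> 0) (at t within {0..T})" if "t \<in> {0..T}" for t
  using v(1) that by auto
 note R = trace_representative[OF C0 v1 v(2)]
 show "L2_on UNIV (V t)" if "t \<in> {0..T}" unfolding V_def[abs_def] by (rule R(1)[OF _ _ that])
 show "L2_on UNIV w" unfolding v(3) by (rule v1(1)[OF assms(2)])
 show "AE x in lborel. w x = V s x" unfolding v(3) V_def by (rule R(2)[OF _ _ assms(2)])
qed

lemma LV: "t \<in> {0..T} ==> L2_on UNIV (V t)"
 by (rule V_trace(1)[OF tr(1)]) (use T0 in auto)

lemma V_measurable [measurable]: "V t \<in> borel_measurable borel"
 unfolding V_def[abs_def] using C0(1) by measurable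

lemma P0: "P 0 x = 0"
proof -
 have "(if r < 0 then b (x, r) else 0) = 0" for r by (auto simp: b0)
 then show ?thesis unfolding tprim_def by simp
qed

lemma slices_chain:
 "AE s in lborel. s \<in> {0<..<T} --> (\<exists>f. primitive_chain (Suc k) f \<and> (\<forall>j\<le>Suc k. L2_on UNIV (f j) \<and> (AE x in lborel. f j x = A j (x, s))))"
 "AE s in lborel. s \<in> {0<..<T} --> (\<exists>f. primitive_chain k f \<and> (\<forall>j\<le>k. L2_on UNIV (f j) \<and> (AE x in lborel. f j x = Bt j (x, s))))"
 by (rule chain_slices[OF T0]; rule A Bt; assumption)+

text \<open>What makes \<open>s\<close> a good time: a chain of representatives starting from
  \<open>V s\<close>, the equation for it, and the norms of the original slices, which are the ones
  that can be integrated over time.\<close>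

definition slice where
 "slice s f \<longleftrightarrow> primitive_chain (Suc k) f \<and> (\<forall>j\<le>Suc k. L2_on UNIV (f j)) \<and>
   (AE x in lborel. f 0 x = V s x) \<and> (AE x in lborel. f (Suc 0) x = ux (x, s)) \<and> is_g lam (f 0) (%x. ut (x, s) + c * ux (x, s)) \<and>
   (LBINT x. (f 0 x)^2) = (LBINT x. (u (x, s))^2) \<and>
   (LBINT x. (f (Suc k) x)^2) = (LBINT x. (A (Suc k) (x, s))^2)"

lemma slices:
 "AE s in lborel. s \<in> {0<..<T} --> (\<exists>f. slice s f)"
 using slices_chain(1) eqn C0(2) L2_on_Q_slices[OF A(1)[OF order_refl]]
proof eventually_elim
 fix s
 assume 1: "s \<in> {0<..<T} --> (\<exists>f. primitive_chain (Suc k) f \<and> (\<forall>j\<le>Suc k. L2_on UNIV (f j) \<and> (AE x in lborel. f j x = A j (x, s))))"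
  and 2: "s \<in> {0<..<T} --> is_g lam (%x. u (x, s)) (%x. ut (x, s) + c * ux (x, s))"
  and 3: "s \<in> {0<..<T} --> (AE x in lborel. u (x, s) = C0 x + P s x)"
  and 4: "s \<in> {0<..<T} --> L2_on UNIV (%x. A (Suc k) (x, s))"
 show "s \<in> {0<..<T} --> (\<exists>f. slice s f)"
 proof
  assume s: "s \<in> {0<..<T}"
  then obtain f where f: "primitive_chain (Suc k) f" "!!j. j \<le> Suc k ==> L2_on UNIV (f j)" "!!j. j \<le> Suc k ==> AE x in lborel. f j x = A j (x, s)"
   using 1 by blast
  have g: "is_g lam (%x. u (x, s)) (%x. ut (x, s) + c * ux (x, s))" using 2 s by blast
  then have Lus: "L2_on UNIV (%x. u (x, s))" by (simp add: is_g_def)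
  have m: "f j \<in> borel_measurable borel" if "j \<le> Suc k" for j using f(2)[OF that] by (simp add: L2_on_UNIV)
  have e0: "AE x in lborel. f 0 x = u (x, s)" using f(3)[of 0] by (simp add: A(2))
  have u3: "AE x in lborel. u (x, s) = C0 x + P s x" using 3 s by blast
  \<comment> \<open>\<open>is_g\<close> refers to the chosen transform, which is the same function
    for arguments equal almost everywhere, so the equation passes to the representative.\<close>
  have "fourier (f 0) = fourier (%x. u (x, s))"
   by (rule fourier_cong_AE[OF e0 m]) (use Lus in \<open>auto simp: L2_on_UNIV\<close>)
  then have ig: "is_g lam (f 0) (%x. ut (x, s) + c * ux (x, s))"
   using g f(2)[of 0] by (simp add: is_g_def fourier_g_def)
  have LA: "L2_on UNIV (%x. A (Suc k) (x, s))" using 4 s by blast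
  have "AE x in lborel. f 0 x = V s x" using e0 u3 by eventually_elim (simp add: V_def)
  moreover have "AE x in lborel. f (Suc 0) x = ux (x, s)" using f(3)[of "Suc 0"] by (simp add: A(3))
  ultimately show "\<exists>f. slice s f"
   unfolding slice_def using f(1,2) ig L2_on_AE_cong(2)[OF Lus m e0] L2_on_AE_cong(2)[OF LA m f(3)]
   by (intro exI[of _ f] conjI) blast+
 qed
qed

definition \<Gamma> where "\<Gamma> = (LBINT w:Q T. (A (Suc k) w)^2) + (LBINT w:Q T. (u w)^2)"

lemma Gamma_nonneg: "0 \<le> (LBINT w:Q T. (A (Suc k) w)^2)" "0 \<le> (LBINT w:Q T. (u w)^2)" "0 \<le> \<Gamma>"
 unfolding \<Gamma>_def by (intro add_nonneg_nonneg L2_on_integral_nonneg)+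

lemma Q_integral:
 assumes "L2_on (Q T) a"
 shows "integrable lborel (%s. indicator {0<..<T} s * (LBINT x. (a (x, s))^2))"
  "(LBINT s. indicator {0<..<T} s * (LBINT x. (a (x, s))^2)) = (LBINT w:Q T. (a w)^2)"
 using slab_integral[OF assms, of UNIV] unfolding Q_def[symmetric] by (simp_all add: set_lebesgue_integral_def)

text \<open>Coefficients are integrals against basis functions, so \<open>pairing\<close> moves them
  inside the primitive in time.\<close>

lemma coef_P:
 assumes D: "D > 0"
 shows "integrable lborel (%r. coef D i (%x. b (x, r)) q)"
  "coef D i (P t) q = (LBINT r. (if r < t then coef D i (%x. b (x, r)) q else 0))"
proof -
 have e: "basis_fun D q i \<in> borel_measurable borel" "integrable lborel (%x. (basis_fun D q i x)^2)"
  using basis_fun_test(1)[OF D, of q i] by (auto simp: L2c_def)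
 show "integrable lborel (%r. coef D i (%x. b (x, r)) q)"
  unfolding coef_lborel by (rule integrable_mult_right[OF pairing(1)[OF e]])
 let ?c = "(2 * real q + 1) / D"
 have "coef D i (P t) q = ?c * (LBINT r. (if r < t then (LBINT x. basis_fun D q i x * b (x, r)) else 0))"
  unfolding coef_lborel pairing(3)[OF e] ..
 also have "\<dots> = (LBINT r. ?c * (if r < t then (LBINT x. basis_fun D q i x * b (x, r)) else 0))"
  by (rule integral_mult_right_zero[symmetric])
 also have "\<dots> = (LBINT r. (if r < t then coef D i (%x. b (x, r)) q else 0))"
  by (rule LBINT_cong) (simp_all add: coef_lborel)
 finally show "coef D i (P t) q = (LBINT r. (if r < t then coef D i (%x. b (x, r)) q else 0))" .
qed

text \<open>The coefficients of theta are primitives of \<open>r\<close>, so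
  \<open>evolution_bound\<close> turns the energy rate, available at almost every time only, into a
  bound at the final time.\<close>

lemma theta_bound:
 assumes D: "D > 0" and C1: "C1_H_frac lam T w" and dg: "dg_solution lam c k D T u0 w"
 shows "L2_on UNIV (w T)" "\<exists>U. w T = glob D k U \<and> (\<forall>F. finite F -->
   (\<Sum>i\<in>F. \<Sum>q\<le>k. D / (2 * real q + 1) * (U i q - coef D i (V T) q)^2) \<le> 2 * (rate_const lam c k * D ^ (2 * k + 1) * \<Gamma>))"
proof -
 let ?I = "indicator {0<..<T} :: real => real"
 obtain U where U1: "!!t x. t \<in> {0..T} ==> w t x = (\<Sum>\<^sub>\<infinity>i. \<Sum>p\<le>k. U p i t * basis_fun D p i x)"
  and U2: "!!q i t. q \<le> k ==> t \<in> {0..T} ==> \<exists>U'. (U q i has_real_derivative U') (at t within {0..T}) \<and>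
      D / (2 * real q + 1) * U' = (LBINT x:cell D i. c * w t x * deriv (basis_fun D q i) x)
       + (- 1) ^ q * flux_at c D (w t) i - flux_at c D (w t) (i + 1) + g_pairing lam (w t) (basis_fun D q i)"
  and U3: "!!q i. q \<le> k ==> U q i 0 = (2 * real q + 1) / D * (LBINT x:cell D i. u0 x * basis_fun D q i x)"
  using dg unfolding dg_solution_def by blast
 obtain w' where w: "!!t. t \<in> {0..T} ==> w t \<in> H_frac lam" and w': "!!t. t \<in> {0..T} ==> w' t \<in> H_frac lam"
  and l1: "!!t. t \<in> {0..T} ==> ((%s. H_frac_norm lam (%x. (w s x - w t x) / (s - t) - w' t x)) \<longlongrightarrow> 0) (at t within {0..T})"
  and l2: "!!t. t \<in> {0..T} ==> ((%s. H_frac_norm lam (%x. w' s x - w' t x)) \<longlongrightarrow> 0) (at t within {0..T})"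
  using C1 unfolding C1_H_frac_def by blast
 have Lw: "L2_on UNIV (w t)" and Lw': "L2_on UNIV (w' t)" if "t \<in> {0..T}" for t
  using w[OF that] w'[OF that] by (auto simp: H_frac_def)
 have wg: "w t = glob D k (%i q. U q i t)" if "t \<in> {0..T}" for t
  using U1[OF that] infsum_basis_fun[OF D, where V="%i q. U q i t"] by (simp add: fun_eq_iff)
 have cU: "coef D i (w s) q = U q i s" if "q \<le> k" "s \<in> {0..T}" for q i s
  unfolding wg[OF that(2)] using coef_glob[OF D that(1), of i "%i q. U q i s"] by simp
 have dU: "(U q i has_real_derivative coef D i (w' t) q) (at t within {0..T}) \<and>
      D / (2 * real q + 1) * coef D i (w' t) q = (LBINT x:cell D i. c * w t x * deriv (basis_fun D q i) x)
       + (- 1) ^ q * flux_at c D (w t) i - flux_at c D (w t) (i + 1) + g_pairing lam (w t) (basis_fun D q i)"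
  if q: "q \<le> k" and t: "t \<in> {0..T}" for q i t
 proof -
  obtain U' where U': "(U q i has_real_derivative U') (at t within {0..T})"
   "D / (2 * real q + 1) * U' = (LBINT x:cell D i. c * w t x * deriv (basis_fun D q i) x)
       + (- 1) ^ q * flux_at c D (w t) i - flux_at c D (w t) (i + 1) + g_pairing lam (w t) (basis_fun D q i)"
   using U2[OF q t] by blast
  have e: "U' = coef D i (w' t) q"
   by (rule coef_derivative[OF D T0 t Lw Lw'[OF t] H_frac_tendsto[OF l1[OF t]] cU[OF q] U'(1)])
  show ?thesis using U' unfolding e by (rule conjI)
 qed
 have cc: "continuous_on {0..T} (%s. coef D i (w' s) q)" for i q
  by (rule coef_continuous[OF D Lw' H_frac_tendsto[OF l2]])
 obtain M where M: "!!s. s \<in> {0..T} ==> (LBINT x. (w' s x)^2) \<le> M"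
  using bounded_curve[OF Lw' H_frac_tendsto[OF l2]] by blast
 \<comment> \<open>These are the coefficients of the time derivative of the exact solution, so
   \<open>r\<close> is the time derivative of the coefficients of theta, set to zero outside the
   time interval.\<close>
 define cb where "cb i q s = coef D i (%x. b (x, s)) q" for i q s
 define r where "r i q s = ?I s * (coef D i (w' s) q - cb i q s)" for i q s
 have cbi: "integrable lborel (cb i q)" for i q unfolding cb_def[abs_def] by (rule coef_P(1)[OF D])
 have cb0: "cb i q s = 0" if "s \<notin> {0<..<T}" for i q s unfolding cb_def coef_lborel by (simp add: b0[OF that])
 have req: "r i q s = ?I s * coef D i (w' s) q - cb i q s" for i q s
  using cb0[of s i q] by (cases "s \<in> {0<..<T}") (auto simp: r_def)
 have wm: "(%s. ?I s * coef D i (w' s) q) \<in> borel_measurable borel" for i q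
 proof -
  have "{0<..<T} \<subseteq> {0..T}" by auto
  from borel_measurable_continuous_on_indicator[OF _ continuous_on_subset[OF cc this]] show ?thesis by simp
 qed
 have rm: "r i q \<in> borel_measurable borel" for i q
  unfolding req[abs_def] using wm cbi[of i q] by auto
 have r0: "r i q s = 0" if "s \<notin> {0<..<T}" for i q s using that by (simp add: r_def)
 \<comment> \<open>An integrable majorant for the summed squares of \<open>r\<close>, from
   boundedness of \<open>w'\<close> in the mean and square integrability of \<open>b\<close> over
   the strip.\<close>
 define S where "S s = 2 * M * ?I s + 2 * (LBINT x. (b (x, s))^2)" for s
 have Si: "integrable lborel S"
  unfolding S_def[abs_def] using lborel2_Fubini(3)[OF bi] T0
  by (intro Bochner_Integration.integrable_add integrable_mult_right integrable_real_indicator) auto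
 \<comment> \<open>The degree bound is quantified too: \<open>evolution_bound\<close> asks for
   square integrability of \<open>r i q\<close> for every \<open>q\<close>, also beyond
   \<open>k\<close>.\<close>
 have bes: "AE s in lborel. \<forall>F k'. finite F --> (\<Sum>i\<in>F. \<Sum>q\<le>k'. D / (2 * real q + 1) * (r i q s)^2) \<le> S s"
  using space_slices
 proof eventually_elim
  fix s assume ib: "integrable lborel (%x. (b (x, s))^2)"
  show "\<forall>F k'. finite F --> (\<Sum>i\<in>F. \<Sum>q\<le>k'. D / (2 * real q + 1) * (r i q s)^2) \<le> S s"
  proof (intro allI impI)
   fix F :: "int set" and k' :: nat assume F: "finite F"
   show "(\<Sum>i\<in>F. \<Sum>q\<le>k'. D / (2 * real q + 1) * (r i q s)^2) \<le> S s"
   proof (cases "s \<in> {0<..<T}")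
    case False
    then show ?thesis using r0[OF False] by (simp add: S_def)
   next
    case True
    then have sT: "s \<in> {0..T}" by auto
    have Lb: "L2_on UNIV (%x. b (x, s))" using ib slice_measurable(2)[of s] by (simp add: L2_on_UNIV)
    have Lg: "L2_on UNIV (%x. w' s x - b (x, s))" by (rule L2_on_diff[OF Lw'[OF sT] Lb])
    have Lc: "L2_on (cell D i) f" if "L2_on UNIV f" for f i by (rule L2_on_subset[OF that]) auto
    have re: "r i q s = coef D i (%x. w' s x - b (x, s)) q" for i q
     using coef_diff[OF Lc[OF Lw'[OF sT]] Lc[OF Lb]] True by (simp add: r_def cb_def)
    have "(\<Sum>i\<in>F. \<Sum>q\<le>k'. D / (2 * real q + 1) * (r i q s)^2) \<le> (\<Sum>i\<in>F. LBINT x:cell D i. (w' s x - b (x, s))^2)"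
     unfolding re by (intro sum_mono coef_Bessel Lc[OF Lg] D)
    also have "\<dots> \<le> (LBINT x. (w' s x - b (x, s))^2)" by (rule sum_cells_le_integral[OF Lg D F])
    also have "\<dots> \<le> (LBINT x. 2 * (w' s x)^2 + 2 * (b (x, s))^2)"
     using Lg Lw'[OF sT] ib by (intro integral_mono square_diff_le) (auto simp: L2_on_UNIV)
    also have "\<dots> = 2 * (LBINT x. (w' s x)^2) + 2 * (LBINT x. (b (x, s))^2)"
     using Lw'[OF sT] ib by (simp add: L2_on_UNIV)
    also have "\<dots> \<le> S s" using M[OF sT] True by (simp add: S_def)
    finally show ?thesis .
   qed
  qed
 qed
 have ri: "integrable lborel (%s. (r i q s)^2)" for i q
 proof (rule integrable_le)
  show "integrable lborel (%s. (2 * real q + 1) / D * S s)" using Si by (rule integrable_mult_right)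
  show "(%s. (r i q s)^2) \<in> borel_measurable lborel" using rm[of i q] by auto
  show "AE s in lborel. norm ((r i q s)^2) \<le> norm ((2 * real q + 1) / D * S s)"
   using bes
  proof eventually_elim
   fix s assume "\<forall>F k'. finite F --> (\<Sum>i\<in>F. \<Sum>q\<le>k'. D / (2 * real q + 1) * (r i q s)^2) \<le> S s"
   then have "(\<Sum>q\<le>q. D / (2 * real q + 1) * (r i q s)^2) \<le> S s"
    by (auto dest: spec[of _ "{i}"])
   then have "D / (2 * real q + 1) * (r i q s)^2 \<le> S s"
    using member_le_sum[of q "{..q}" "%p. D / (2 * real p + 1) * (r i p s)^2"] D by simp
   moreover have "d > 0 ==> D / d * y \<le> x ==> y \<le> d / D * x" for d y x :: real using D by (simp add: field_simps)
   ultimately have "(r i q s)^2 \<le> (2 * real q + 1) / D * S s" by simp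
   then show "norm ((r i q s)^2) \<le> norm ((2 * real q + 1) / D * S s)"
    unfolding real_norm_def using abs_ge_self[of "(2 * real q + 1) / D * S s"] by (simp only: abs_power2)
  qed
 qed
 have th: "(LBINT s. (if s < y then r i q s else 0)) = U q i y - coef D i (V y) q" if q: "q \<le> k" and y: "y \<in> {0..T}" for i q y
 proof -
  have y0: "(0 :: real) \<in> {0..T}" using T0 by simp
  note F = coef_FTC[of y T "U q i" "%s. coef D i (w' s) q", OF _ _ _ cc]
  have d: "(U q i has_real_derivative coef D i (w' s) q) (at s within {0..T})" if "s \<in> {0..T}" for s using dU[OF q that] by blast
  have i1: "integrable lborel (%s. ?I s * coef D i (w' s) q)" by (rule F(1)) (use y d in auto)
  have j1: "integrable lborel (%s. if s < y then ?I s * coef D i (w' s) q else 0)"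
   by (rule integrable_le[OF i1]) (use wm[of i q] in auto)
  have j2: "integrable lborel (%s. if s < y then cb i q s else 0)"
   by (rule integrable_le[OF cbi]) (use cbi[of i q] in auto)
  have "(LBINT s. (if s < y then r i q s else 0)) = (LBINT s. (if s < y then ?I s * coef D i (w' s) q else 0) - (if s < y then cb i q s else 0))"
   by (rule LBINT_cong) (auto simp: req)
  also have "\<dots> = (LBINT s. (if s < y then ?I s * coef D i (w' s) q else 0)) - (LBINT s. (if s < y then cb i q s else 0))"
   by (rule Bochner_Integration.integral_diff[OF j1 j2])
  also have "(LBINT s. (if s < y then ?I s * coef D i (w' s) q else 0)) = U q i y - U q i 0"
   by (rule F(2)) (use y d in auto)
  also have "(LBINT s. (if s < y then cb i q s else 0)) = coef D i (P y) q"
   unfolding cb_def by (rule coef_P(2)[OF D, symmetric])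
  \<comment> \<open>The initial coefficients are those of \<open>u0\<close>, which agrees with
    \<open>V 0\<close> almost everywhere; so theta starts from zero.\<close>
  also have "U q i 0 = coef D i u0 q" using U3[OF q] by (simp add: coef_def)
  also have "\<dots> = coef D i (V 0) q"
   by (rule coef_AE[OF V_trace(3)[OF tr(1)] _ _ D]) (use V_trace(2)[OF tr(1)] y0 in \<open>auto simp: L2_on_UNIV\<close>)
  also have "coef D i (P y) q = coef D i (V y) q - coef D i (V 0) q"
  proof -
   have Lc: "L2_on (cell D i) f" if "L2_on UNIV f" for f by (rule L2_on_subset[OF that]) auto
   have "P y = (%x. V y x - V 0 x)" by (simp add: V_def P0 fun_eq_iff)
   then show ?thesis using coef_diff[OF Lc[OF LV[OF y]] Lc[OF LV[OF y0]]] by simp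
  qed
  finally show ?thesis by simp
 qed
 define e where "e s = rate_const lam c k * D ^ (2 * k + 1) * ((LBINT x. (A (Suc k) (x, s))^2) + (LBINT x. (u (x, s))^2))" for s
 have ee: "?I s * e s = rate_const lam c k * D ^ (2 * k + 1) * (?I s * (LBINT x. (A (Suc k) (x, s))^2) + ?I s * (LBINT x. (u (x, s))^2))" for s
  by (simp add: e_def algebra_simps)
 note QA = Q_integral[OF A(1)[OF order_refl]] and Qu = Q_integral[OF Lu]
 have ei: "integrable lborel (%s. ?I s * e s)"
  unfolding ee by (intro integrable_mult_right Bochner_Integration.integrable_add QA(1) Qu(1))
 have eI: "(LBINT s. ?I s * e s) = rate_const lam c k * D ^ (2 * k + 1) * \<Gamma>"
  unfolding ee integral_mult_right_zero Bochner_Integration.integral_add[OF QA(1) Qu(1)] QA(2) Qu(2) \<Gamma>_def ..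
 have rate: "AE s in lborel. s \<in> {0<..<T} --> (\<forall>R. (%N. \<Sum>i\<in>{- int N..<int N}. \<Sum>q\<le>k. D / (2 * real q + 1) *
   (LBINT z. (if z < s then r i q z else 0)) * r i q s) \<longlonglongrightarrow> R --> R \<le> e s)"
  using slices space_slices
 proof eventually_elim
  fix s
  assume sl: "s \<in> {0<..<T} --> (\<exists>f. slice s f)"
   and ib: "integrable lborel (%x. (b (x, s))^2)"
  show "s \<in> {0<..<T} --> (\<forall>R. (%N. \<Sum>i\<in>{- int N..<int N}. \<Sum>q\<le>k. D / (2 * real q + 1) *
   (LBINT z. (if z < s then r i q z else 0)) * r i q s) \<longlonglongrightarrow> R --> R \<le> e s)"
  proof (intro impI allI)
   fix R
   assume s: "s \<in> {0<..<T}" and R: "(%N. \<Sum>i\<in>{- int N..<int N}. \<Sum>q\<le>k. D / (2 * real q + 1) *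
    (LBINT z. (if z < s then r i q z else 0)) * r i q s) \<longlonglongrightarrow> R"
   have sT: "s \<in> {0..T}" using s by auto
   obtain f where f: "primitive_chain (Suc k) f" "!!j. j \<le> Suc k ==> L2_on UNIV (f j)" "AE x in lborel. f 0 x = V s x"
    "AE x in lborel. f (Suc 0) x = ux (x, s)" "is_g lam (f 0) (%x. ut (x, s) + c * ux (x, s))"
    "(LBINT x. (f 0 x)^2) = (LBINT x. (u (x, s))^2)"
    "(LBINT x. (f (Suc k) x)^2) = (LBINT x. (A (Suc k) (x, s))^2)" using sl s unfolding slice_def by blast
   have Lb: "L2_on UNIV (%x. b (x, s))" using ib slice_measurable(2)[of s] by (simp add: L2_on_UNIV)
   have dgs: "dg_slice lam c D k f (%x. b (x, s)) (%x. ut (x, s) + c * ux (x, s)) (%i q. U q i s) (%i q. coef D i (w' s) q)"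
   proof (unfold_locales)
    show "AE x in lborel. ut (x, s) + c * ux (x, s) = b (x, s) + c * f 1 x"
     using f(4) by eventually_elim (simp add: b_eq[OF s])
    show "L2_on UNIV (glob D k (%i q. U q i s))" using Lw[OF sT] unfolding wg[OF sT] .
    show "D / (2 * real q + 1) * coef D i (w' s) q = (LBINT x:cell D i. c * glob D k (%i q. U q i s) x * deriv (basis_fun D q i) x)
     + (- 1) ^ q * flux_at c D (glob D k (%i q. U q i s)) i - flux_at c D (glob D k (%i q. U q i s)) (i + 1)
     + g_pairing lam (glob D k (%i q. U q i s)) (basis_fun D q i)" if "q \<le> k" for q i
     using dU[OF that sT, of i] unfolding wg[OF sT] by blast
   qed (use lam D f Lb in auto)
   have cf: "coef D i (V s) q = coef D i (f 0) q" for i q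
    by (rule coef_AE[OF f(3) _ _ D, symmetric]) (use f(2)[of 0] in \<open>auto simp: L2_on_UNIV\<close>)
   have eq: "(\<Sum>q\<le>k. D / (2 * real q + 1) * (LBINT z. (if z < s then r i q z else 0)) * r i q s)
    = (\<Sum>q\<le>k. D / (2 * real q + 1) * (U q i s - coef D i (f 0) q) * (coef D i (w' s) q - coef D i (%x. b (x, s)) q))" for i
    by (intro sum.cong refl) (use s in \<open>simp add: th[OF _ sT] cf r_def cb_def\<close>)
   show "R \<le> e s"
    using dg_slice.energy_rate_coef[OF dgs] R unfolding eq e_def f(6,7) by blast
  qed
 qed
 have ev: "(\<Sum>i\<in>F. \<Sum>q\<le>k. D / (2 * real q + 1) * (LBINT s. r i q s)^2) \<le> 2 * (LBINT s. ?I s * e s)" if F: "finite F" for F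
 proof (rule evolution_bound[where S=S and \<mu>="%q. D / (2 * real q + 1)", OF T0 _ rm ri r0 Si _ rate ei F])
  show "0 \<le> D / (2 * real q + 1)" for q using D by simp
  show "AE s in lborel. \<forall>F. finite F --> (\<Sum>i\<in>F. \<Sum>q\<le>k. D / (2 * real q + 1) * (r i q s)^2) \<le> S s"
   using bes by eventually_elim blast
 qed
 have TT: "T \<in> {0..T}" using T0 by simp
 have rT: "(LBINT s. r i q s) = U q i T - coef D i (V T) q" if "q \<le> k" for i q
 proof -
  have "(LBINT s. r i q s) = (LBINT s. (if s < T then r i q s else 0))"
   by (rule LBINT_cong) (auto simp: r0)
  then show ?thesis by (simp add: th[OF that TT])
 qed
 show "L2_on UNIV (w T)" by (rule Lw[OF TT])
 show "\<exists>U. w T = glob D k U \<and> (\<forall>F. finite F -->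
   (\<Sum>i\<in>F. \<Sum>q\<le>k. D / (2 * real q + 1) * (U i q - coef D i (V T) q)^2) \<le> 2 * (rate_const lam c k * D ^ (2 * k + 1) * \<Gamma>))"
 proof (intro exI conjI allI impI)
  show "w T = glob D k (%i q. U q i T)" by (rule wg[OF TT])
  fix F :: "int set" assume "finite F"
  from ev[OF this] show "(\<Sum>i\<in>F. \<Sum>q\<le>k. D / (2 * real q + 1) * (U q i T - coef D i (V T) q)^2) \<le> 2 * (rate_const lam c k * D ^ (2 * k + 1) * \<Gamma>)"
   unfolding eI by (simp add: rT)
 qed
qed

text \<open>All mesh sizes and cells share one null set of times, since the projection estimate
  holds for each of them once the chain of representatives exists.\<close>

lemma slices_t:
 "AE s in lborel. s \<in> {0<..<T} --> L2_on UNIV (%x. Bt k (x, s)) \<and> L2_on UNIV (%x. b (x, s)) \<and>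
   (\<forall>D>0. \<forall>i. (LBINT x:cell D i. (b (x, s) - proj D k i (%x. b (x, s)) x)^2) \<le> D ^ (2 * k) * (LBINT x:cell D i. (Bt k (x, s))^2))"
 using slices_chain(2) L2_on_Q_slices[OF Bt(1)[OF order_refl]]
proof eventually_elim
 fix s
 assume 1: "s \<in> {0<..<T} --> (\<exists>f. primitive_chain k f \<and> (\<forall>j\<le>k. L2_on UNIV (f j) \<and> (AE x in lborel. f j x = Bt j (x, s))))"
  and 4: "s \<in> {0<..<T} --> L2_on UNIV (%x. Bt k (x, s))"
 show "s \<in> {0<..<T} --> L2_on UNIV (%x. Bt k (x, s)) \<and> L2_on UNIV (%x. b (x, s)) \<and>
   (\<forall>D>0. \<forall>i. (LBINT x:cell D i. (b (x, s) - proj D k i (%x. b (x, s)) x)^2) \<le> D ^ (2 * k) * (LBINT x:cell D i. (Bt k (x, s))^2))"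
 proof
  assume s: "s \<in> {0<..<T}"
  then obtain f where f: "primitive_chain k f" "!!j. j \<le> k ==> L2_on UNIV (f j)" "!!j. j \<le> k ==> AE x in lborel. f j x = Bt j (x, s)"
   using 1 by blast
  have LB: "L2_on UNIV (%x. Bt k (x, s))" using 4 s by blast
  have [measurable]: "f k \<in> borel_measurable borel" "(%x. Bt k (x, s)) \<in> borel_measurable borel"
   using f(2)[OF order_refl] LB by (auto simp: L2_on_UNIV)
  have f0: "f 0 \<in> borel_measurable borel" using f(2)[of 0] by (simp add: L2_on_UNIV)
  have e: "AE x in lborel. b (x, s) = f 0 x" using f(3)[of 0] by (simp add: Bt(2) b_eq[OF s] eq_commute)
  have Lb: "L2_on UNIV (%x. b (x, s))" by (rule L2_on_AE_cong(1)[OF f(2) _ e]) (use slice_measurable in auto)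
  have "(LBINT x:cell D i. (b (x, s) - proj D k i (%x. b (x, s)) x)^2) \<le> D ^ (2 * k) * (LBINT x:cell D i. (Bt k (x, s))^2)"
   if D: "D > 0" for D i
  proof -
   have "(LBINT x:cell D i. (b (x, s) - proj D k i (%x. b (x, s)) x)^2) = (LBINT x:cell D i. (f 0 x - proj D k i (f 0) x)^2)"
    by (rule proj_error_AE[OF e _ f0 D]) (use slice_measurable in auto)
   also have "\<dots> \<le> D ^ (2 * k) * (LBINT x:cell D i. (f k x)^2)"
    by (rule proj_error_L2[OF D _ f(1) L2_on_subset[OF f(2)] L2_on_subset[OF f(2)]]) auto
   also have "(LBINT x:cell D i. (f k x)^2) = (LBINT x:cell D i. (Bt k (x, s))^2)"
    unfolding set_lebesgue_integral_def
   proof (rule integral_cong_AE)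
    show "AE x in lborel. indicator (cell D i) x *\<^sub>R (f k x)^2 = indicator (cell D i) x *\<^sub>R (Bt k (x, s))^2"
     using f(3)[OF order_refl] by eventually_elim simp
   qed measurable
   finally show ?thesis .
  qed
  with LB Lb show "L2_on UNIV (%x. Bt k (x, s)) \<and> L2_on UNIV (%x. b (x, s)) \<and>
   (\<forall>D>0. \<forall>i. (LBINT x:cell D i. (b (x, s) - proj D k i (%x. b (x, s)) x)^2) \<le> D ^ (2 * k) * (LBINT x:cell D i. (Bt k (x, s))^2))" by blast
 qed
qed

definition KB where "KB = (LBINT w:Q T. (Bt k w)^2)"

text \<open>The integrands are summed over the cells before integrating in time, so the cellwise
  bounds combine into one integral over the strip.\<close>

lemma sum_increment_errors:
 assumes D: "D > 0" and s: "0 \<le> s" "s < T" and F: "finite F"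
 shows "(\<Sum>i\<in>F. LBINT x:cell D i. ((P T x - P s x) - proj D k i (%x. P T x - P s x) x)^2) \<le> (T - s) * (D ^ (2 * k) * KB)"
proof -
 let ?I = "indicator {0<..<T} :: real => real"
 let ?c = "%i r. LBINT x:cell D i. (Bt k (x, r))^2"
 have cell: "cell D i \<in> sets borel" for i by simp
 note si = slab_integral(1)[OF Bt(1)[OF order_refl] cell]
 have ii: "integrable lborel (%r. ?I r * (D ^ (2 * k) * ?c i r))" for i
  using integrable_mult_right[OF si, of "D ^ (2 * k)" i] by (simp only: mult.left_commute)
 have 1: "(LBINT x:cell D i. ((P T x - P s x) - proj D k i (%x. P T x - P s x) x)^2)
   \<le> (T - s) * (LBINT r. ?I r * (D ^ (2 * k) * ?c i r))" for i
 proof -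
  have n1: "AE r in lborel. r \<in> {0<..<T} --> L2_on UNIV (%x. b (x, r)) \<and>
    (LBINT x:cell D i. (b (x, r) - proj D k i (%x. b (x, r)) x)^2) \<le> D ^ (2 * k) * ?c i r"
   using slices_t by eventually_elim (use D in blast)
  have n2: "0 \<le> D ^ (2 * k) * ?c i r" for r using D by (intro mult_nonneg_nonneg L2_on_integral_nonneg) auto
  show ?thesis by (rule increment_proj_error[where N="%r. D ^ (2 * k) * ?c i r", OF D s order_refl n1 ii n2])
 qed
 have "(\<Sum>i\<in>F. LBINT r. ?I r * (D ^ (2 * k) * ?c i r)) = (LBINT r. (\<Sum>i\<in>F. ?I r * (D ^ (2 * k) * ?c i r)))"
  by (rule Bochner_Integration.integral_sum[symmetric]) (rule ii)
 also have "\<dots> \<le> (LBINT r. D ^ (2 * k) * (?I r * (LBINT x. (Bt k (x, r))^2)))"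
 proof (rule integral_mono_AE)
  show "integrable lborel (%r. \<Sum>i\<in>F. ?I r * (D ^ (2 * k) * ?c i r))" by (rule Bochner_Integration.integrable_sum) (rule ii)
  show "integrable lborel (%r. D ^ (2 * k) * (?I r * (LBINT x. (Bt k (x, r))^2)))"
   by (rule integrable_mult_right[OF Q_integral(1)[OF Bt(1)[OF order_refl]]])
  show "AE r in lborel. (\<Sum>i\<in>F. ?I r * (D ^ (2 * k) * ?c i r)) \<le> D ^ (2 * k) * (?I r * (LBINT x. (Bt k (x, r))^2))"
   using slices_t
  proof eventually_elim
   fix r
   assume A: "r \<in> {0<..<T} --> L2_on UNIV (%x. Bt k (x, r)) \<and> L2_on UNIV (%x. b (x, r)) \<and>
    (\<forall>D>0. \<forall>i. (LBINT x:cell D i. (b (x, r) - proj D k i (%x. b (x, r)) x)^2) \<le> D ^ (2 * k) * (LBINT x:cell D i. (Bt k (x, r))^2))"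
   show "(\<Sum>i\<in>F. ?I r * (D ^ (2 * k) * ?c i r)) \<le> D ^ (2 * k) * (?I r * (LBINT x. (Bt k (x, r))^2))"
   proof (cases "r \<in> {0<..<T}")
    case True
    have L: "L2_on UNIV (%x. Bt k (x, r))" using A True by blast
    have "D ^ (2 * k) * (\<Sum>i\<in>F. ?c i r) \<le> D ^ (2 * k) * (LBINT x. (Bt k (x, r))^2)"
     using sum_cells_le_integral[OF L D F] D by (intro mult_left_mono) auto
    then show ?thesis using True by (simp add: sum_distrib_left)
   qed simp
  qed
 qed
 also have "\<dots> = D ^ (2 * k) * KB"
  unfolding integral_mult_right_zero Q_integral(2)[OF Bt(1)[OF order_refl]] KB_def ..
 finally have 2: "(\<Sum>i\<in>F. LBINT r. ?I r * (D ^ (2 * k) * ?c i r)) \<le> D ^ (2 * k) * KB" .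
 have "(\<Sum>i\<in>F. LBINT x:cell D i. ((P T x - P s x) - proj D k i (%x. P T x - P s x) x)^2)
   \<le> (T - s) * (\<Sum>i\<in>F. LBINT r. ?I r * (D ^ (2 * k) * ?c i r))"
  unfolding sum_distrib_left by (rule sum_mono[OF 1])
 also have "\<dots> \<le> (T - s) * (D ^ (2 * k) * KB)" using s by (intro mult_left_mono 2) auto
 finally show ?thesis .
qed

text \<open>The trace at the final time is compared with a slice at a well-chosen time less than one mesh size earlier.\<close>

lemma good_time:
 assumes D: "D > 0" "D \<le> T"
 shows "\<exists>s f. T - D < s \<and> s < T \<and> D * (LBINT x. (f (Suc k) x)^2) \<le> \<Gamma> + 1 \<and> primitive_chain (Suc k) f \<and>
   L2_on UNIV (f 0) \<and> L2_on UNIV (f (Suc k)) \<and> (AE x in lborel. f 0 x = V s x)"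
proof (rule ccontr)
 assume neg: "\<not> ?thesis"
 let ?I = "indicator {0<..<T} :: real => real" and ?J = "indicator {T - D<..<T} :: real => real"
 let ?N = "%s. LBINT x. (A (Suc k) (x, s))^2"
 note QA = Q_integral[OF A(1)[OF order_refl]]
 \<comment> \<open>An averaging argument: if no time in the last interval of length \<open>D\<close>
   were suitable, the squared top derivative would have an integral of at least
   \<open>\<Gamma> + 1\<close>, although \<open>\<Gamma>\<close> bounds it.\<close>
 have "D * (\<Gamma> + 1) = (LBINT s. ?J s * (\<Gamma> + 1))" using D by simp
 also have "\<dots> \<le> (LBINT s. D * (?I s * ?N s))"
 proof (rule integral_mono_AE)
  show "integrable lborel (%s. ?J s * (\<Gamma> + 1))" by (intro integrable_mult_left integrable_real_indicator) (use D in auto)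
  show "integrable lborel (%s. D * (?I s * ?N s))" by (rule integrable_mult_right[OF QA(1)])
  show "AE s in lborel. ?J s * (\<Gamma> + 1) \<le> D * (?I s * ?N s)"
   using slices
  proof eventually_elim
   fix s
   assume sl: "s \<in> {0<..<T} --> (\<exists>f. slice s f)"
   show "?J s * (\<Gamma> + 1) \<le> D * (?I s * ?N s)"
   proof (cases "s \<in> {T - D<..<T}")
    case True
    then have s: "s \<in> {0<..<T}" using D by auto
    then obtain f where f: "primitive_chain (Suc k) f" "\<forall>j\<le>Suc k. L2_on UNIV (f j)" "AE x in lborel. f 0 x = V s x"
     "(LBINT x. (f (Suc k) x)^2) = ?N s" using sl unfolding slice_def by blast
    have "L2_on UNIV (f 0)" "L2_on UNIV (f (Suc k))" using f(2) by auto
    then have "\<not> D * ?N s \<le> \<Gamma> + 1" using neg f(1,3) True unfolding f(4)[symmetric] by auto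
    then show ?thesis using True s by simp
   next
    case False
    then show ?thesis using D by (simp add: mult_nonneg_nonneg)
   qed
  qed
 qed
 also have "\<dots> = D * (LBINT w:Q T. (A (Suc k) w)^2)" unfolding integral_mult_right_zero QA(2) ..
 also have "\<dots> \<le> D * \<Gamma>" using D Gamma_nonneg by (intro mult_left_mono) (auto simp: \<Gamma>_def)
 finally show False using D by (simp add: distrib_left)
qed

text \<open>For \<open>D \<le> T\<close> the slice gains \<open>D ^ (2 * k + 2)\<close>, of which
  one factor \<open>D\<close> pays for the size of its top derivative; the increment gains
  \<open>D ^ (2 * k)\<close> and one factor \<open>D\<close> from its duration. For
  \<open>D > T\<close> the plain norm suffices, because \<open>D / T\<close> exceeds 1.\<close>

lemma rho_bound:
 assumes D: "D > 0" and F: "finite F"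
 shows "(\<Sum>i\<in>F. LBINT x:cell D i. (V T x - proj D k i (V T) x)^2)
   \<le> (2 * (\<Gamma> + 1) + 2 * KB + (LBINT x. (V T x)^2) / T ^ (2 * k + 1)) * D ^ (2 * k + 1)"
proof -
 have TT: "T \<in> {0..T}" using T0 by simp
 have Lc: "L2_on (cell D i) f" if "L2_on UNIV f" for f i by (rule L2_on_subset[OF that]) auto
 have KB: "0 \<le> KB" unfolding KB_def by (rule L2_on_integral_nonneg)
 have Y: "0 \<le> (LBINT x. (V T x)^2) / T ^ (2 * k + 1)" using T0 by simp
 have d: "0 \<le> D ^ (2 * k + 1)" using D by simp
 show ?thesis
 proof (cases "D \<le> T")
  case True
  obtain s f where s: "T - D < s" "s < T" and fN: "D * (LBINT x. (f (Suc k) x)^2) \<le> \<Gamma> + 1"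
   and f: "primitive_chain (Suc k) f" "L2_on UNIV (f 0)" "L2_on UNIV (f (Suc k))" "AE x in lborel. f 0 x = V s x"
   using good_time[OF D True] by blast
  have sT: "s \<in> {0..T}" using s True by auto
  let ?G = "%x. P T x - P s x"
  have G: "?G = (%x. V T x - V s x)" by (simp add: V_def fun_eq_iff)
  have LG: "L2_on UNIV ?G" unfolding G by (rule L2_on_diff[OF LV[OF TT] LV[OF sT]])
  have Vs: "(LBINT x:cell D i. (V s x - proj D k i (V s) x)^2) \<le> D ^ (2 * Suc k) * (LBINT x:cell D i. (f (Suc k) x)^2)" for i
  proof -
   have "(LBINT x:cell D i. (V s x - proj D k i (V s) x)^2) = (LBINT x:cell D i. (f 0 x - proj D k i (f 0) x)^2)"
    by (rule proj_error_AE[OF f(4) _ _ D, symmetric]) (use f(2) in \<open>auto simp: L2_on_UNIV\<close>)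
   also have "\<dots> \<le> D ^ (2 * Suc k) * (LBINT x:cell D i. (f (Suc k) x)^2)"
    by (rule proj_error_L2[OF D order_refl f(1) Lc[OF f(3)] Lc[OF f(2)]])
   finally show ?thesis .
  qed
  have "(LBINT x:cell D i. (V T x - proj D k i (V T) x)^2)
    \<le> 2 * (LBINT x:cell D i. (V s x - proj D k i (V s) x)^2) + 2 * (LBINT x:cell D i. (?G x - proj D k i ?G x)^2)" for i
  proof -
   have p: "proj D k i ?G x = proj D k i (V T) x - proj D k i (V s) x" for x
    unfolding proj_def cell_poly_diff G using coef_diff[OF Lc[OF LV[OF TT]] Lc[OF LV[OF sT]]] by (simp add: cell_poly_def)
   have L1: "L2_on (cell D i) (%x. V s x - proj D k i (V s) x)" and L2: "L2_on (cell D i) (%x. ?G x - proj D k i ?G x)"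
    and L3: "L2_on (cell D i) (%x. V T x - proj D k i (V T) x)"
    by (rule L2_on_diff[OF Lc[OF LV[OF sT]] L2_on_proj] L2_on_diff[OF Lc[OF LG] L2_on_proj] L2_on_diff[OF Lc[OF LV[OF TT]] L2_on_proj])+
   have "(LBINT x:cell D i. (V T x - proj D k i (V T) x)^2)
    \<le> (LBINT x:cell D i. 2 * (V s x - proj D k i (V s) x)^2 + 2 * (?G x - proj D k i ?G x)^2)"
   proof (rule set_integral_mono)
    show "set_integrable lborel (cell D i) (%x. (V T x - proj D k i (V T) x)^2)" using L3 by (simp add: L2_on_def)
    show "set_integrable lborel (cell D i) (%x. 2 * (V s x - proj D k i (V s) x)^2 + 2 * (?G x - proj D k i ?G x)^2)"
     using L1 L2 by (intro set_integral_add set_integrable_mult_right) (auto simp: L2_on_def)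
    fix x
    have e: "V T x - proj D k i (V T) x = (V s x - proj D k i (V s) x) - (- (?G x - proj D k i ?G x))"
     unfolding p by (simp add: V_def)
    show "(V T x - proj D k i (V T) x)^2 \<le> 2 * (V s x - proj D k i (V s) x)^2 + 2 * (?G x - proj D k i ?G x)^2"
     unfolding e using square_diff_le[of "V s x - proj D k i (V s) x" "- (?G x - proj D k i ?G x)"] by (simp only: power2_minus)
   qed
   also have "\<dots> = 2 * (LBINT x:cell D i. (V s x - proj D k i (V s) x)^2) + 2 * (LBINT x:cell D i. (?G x - proj D k i ?G x)^2)"
    using L1 L2 by (subst set_integral_add(2)) (auto simp: L2_on_def intro!: set_integrable_mult_right)
   finally show ?thesis .
  qed
  then have "(\<Sum>i\<in>F. LBINT x:cell D i. (V T x - proj D k i (V T) x)^2)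
   \<le> (\<Sum>i\<in>F. 2 * (D ^ (2 * Suc k) * (LBINT x:cell D i. (f (Suc k) x)^2)) + 2 * (LBINT x:cell D i. (?G x - proj D k i ?G x)^2))"
   using Vs by (intro sum_mono) (meson add_right_mono mult_left_mono order_trans zero_le_numeral)
  also have "\<dots> = 2 * (D ^ (2 * Suc k) * (\<Sum>i\<in>F. LBINT x:cell D i. (f (Suc k) x)^2)) + 2 * (\<Sum>i\<in>F. LBINT x:cell D i. (?G x - proj D k i ?G x)^2)"
   by (simp add: sum.distrib sum_distrib_left)
  also have "\<dots> \<le> 2 * (D ^ (2 * Suc k) * (LBINT x. (f (Suc k) x)^2)) + 2 * ((T - s) * (D ^ (2 * k) * KB))"
   using sT s D by (intro add_mono mult_left_mono sum_cells_le_integral[OF f(3) D F] sum_increment_errors[OF D _ s(2) F]) auto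
  also have "\<dots> \<le> 2 * (D ^ (2 * k + 1) * (\<Gamma> + 1)) + 2 * (D * (D ^ (2 * k) * KB))"
  proof (intro add_mono mult_left_mono mult_right_mono)
   have "D ^ (2 * Suc k) * (LBINT x. (f (Suc k) x)^2) = D ^ (2 * k + 1) * (D * (LBINT x. (f (Suc k) x)^2))" by simp
   also have "\<dots> \<le> D ^ (2 * k + 1) * (\<Gamma> + 1)" by (rule mult_left_mono[OF fN d])
   finally show "D ^ (2 * Suc k) * (LBINT x. (f (Suc k) x)^2) \<le> D ^ (2 * k + 1) * (\<Gamma> + 1)" .
  qed (use s D KB in auto)
  also have "\<dots> = (2 * (\<Gamma> + 1) + 2 * KB) * D ^ (2 * k + 1)" by (simp add: algebra_simps)
  also have "\<dots> \<le> (2 * (\<Gamma> + 1) + 2 * KB + (LBINT x. (V T x)^2) / T ^ (2 * k + 1)) * D ^ (2 * k + 1)"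
   by (rule mult_right_mono[OF _ d]) (use Y in simp)
  finally show ?thesis .
 next
  case False
  have "(\<Sum>i\<in>F. LBINT x:cell D i. (V T x - proj D k i (V T) x)^2) \<le> (\<Sum>i\<in>F. LBINT x:cell D i. (V T x)^2)"
   by (intro sum_mono proj_le Lc LV TT D)
  also have "\<dots> \<le> (LBINT x. (V T x)^2)" by (rule sum_cells_le_integral[OF LV[OF TT] D F])
  also have "\<dots> = (LBINT x. (V T x)^2) / T ^ (2 * k + 1) * T ^ (2 * k + 1)" using T0 by simp
  also have "\<dots> \<le> (LBINT x. (V T x)^2) / T ^ (2 * k + 1) * D ^ (2 * k + 1)"
   by (intro mult_left_mono power_mono Y) (use False T0 in auto)
  also have "\<dots> \<le> (2 * (\<Gamma> + 1) + 2 * KB + (LBINT x. (V T x)^2) / T ^ (2 * k + 1)) * D ^ (2 * k + 1)"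
   by (rule mult_right_mono[OF _ d]) (use KB Gamma_nonneg(3) in simp)
  finally show ?thesis .
 qed
qed

theorem error_estimate:
 "\<exists>C>0. \<forall>D>0. \<forall>w. C1_H_frac lam T w --> dg_solution lam c k D T u0 w -->
   L2_norm (%x. uT x - w T x) \<le> C * D powr (real k + 1 / 2)"
proof -
 \<comment> \<open>Twice the constant of \<open>rho_bound\<close> plus twice that of
   \<open>theta_bound\<close>, the latter being itself
   \<open>2 * (rate_const lam c k * \<Gamma>)\<close>.\<close>
 define K where "K = 2 * (2 * (\<Gamma> + 1) + 2 * KB + (LBINT x. (V T x)^2) / T ^ (2 * k + 1)) + 4 * (rate_const lam c k * \<Gamma>)"
 have TT: "T \<in> {0..T}" using T0 by simp
 have "L2_norm (%x. uT x - w T x) \<le> (sqrt \<bar>K\<bar> + 1) * D powr (real k + 1 / 2)"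
  if D: "D > 0" and C1: "C1_H_frac lam T w" and dg: "dg_solution lam c k D T u0 w" for D w
 proof -
  have Lw: "L2_on UNIV (w T)" by (rule theta_bound(1)[OF D C1 dg])
  obtain U where U: "w T = glob D k U" "!!F. finite F ==>
   (\<Sum>i\<in>F. \<Sum>q\<le>k. D / (2 * real q + 1) * (U i q - coef D i (V T) q)^2) \<le> 2 * (rate_const lam c k * D ^ (2 * k + 1) * \<Gamma>)"
   using theta_bound(2)[OF D C1 dg] by blast
  have Lc: "L2_on (cell D i) f" if "L2_on UNIV f" for f i by (rule L2_on_subset[OF that]) auto
  have Le: "L2_on UNIV (%x. V T x - w T x)" by (rule L2_on_diff[OF LV[OF TT] Lw])
  have cellb: "(LBINT x:cell D i. (V T x - w T x)^2) \<le> 2 * (LBINT x:cell D i. (V T x - proj D k i (V T) x)^2)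
    + 2 * (\<Sum>q\<le>k. D / (2 * real q + 1) * (U i q - coef D i (V T) q)^2)" for i
  proof -
   let ?t = "cell_poly D k i (%q. U i q - coef D i (V T) q)"
   have L1: "L2_on (cell D i) (%x. V T x - proj D k i (V T) x)" by (rule L2_on_diff[OF Lc[OF LV[OF TT]] L2_on_proj])
   have L2: "L2_on (cell D i) ?t" by (rule L2_on_cell_poly(1))
   have "(LBINT x:cell D i. (V T x - w T x)^2) \<le> (LBINT x:cell D i. 2 * (V T x - proj D k i (V T) x)^2 + 2 * (?t x)^2)"
   proof (rule set_integral_mono)
    show "set_integrable lborel (cell D i) (%x. (V T x - w T x)^2)" using Lc[OF Le] by (simp add: L2_on_def)
    show "set_integrable lborel (cell D i) (%x. 2 * (V T x - proj D k i (V T) x)^2 + 2 * (?t x)^2)"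
     using L1 L2 by (intro set_integral_add set_integrable_mult_right) (auto simp: L2_on_def)
    fix x assume x: "x \<in> cell D i"
    have "V T x - w T x = (V T x - proj D k i (V T) x) - ?t x"
     unfolding U(1) glob_cell[OF D x] cell_poly_diff[symmetric] proj_def by simp
    then show "(V T x - w T x)^2 \<le> 2 * (V T x - proj D k i (V T) x)^2 + 2 * (?t x)^2" by (simp only: square_diff_le)
   qed
   also have "\<dots> = 2 * (LBINT x:cell D i. (V T x - proj D k i (V T) x)^2) + 2 * (LBINT x:cell D i. (?t x)^2)"
    using L1 L2 by (subst set_integral_add(2)) (auto simp: L2_on_def intro!: set_integrable_mult_right)
   finally show ?thesis by (simp only: cell_poly_square[OF D])
  qed
  have "(LBINT x. (V T x - w T x)^2) \<le> K * D ^ (2 * k + 1)"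
  proof (rule cells_L2_le[OF D Le])
   fix F :: "int set" assume F: "finite F"
   have "(\<Sum>i\<in>F. LBINT x:cell D i. (V T x - w T x)^2) \<le> 2 * (\<Sum>i\<in>F. LBINT x:cell D i. (V T x - proj D k i (V T) x)^2)
    + 2 * (\<Sum>i\<in>F. \<Sum>q\<le>k. D / (2 * real q + 1) * (U i q - coef D i (V T) q)^2)"
    unfolding sum_distrib_left[of 2] sum.distrib[symmetric] by (rule sum_mono) (use cellb in \<open>simp add: sum_distrib_left\<close>)
   also have "\<dots> \<le> 2 * ((2 * (\<Gamma> + 1) + 2 * KB + (LBINT x. (V T x)^2) / T ^ (2 * k + 1)) * D ^ (2 * k + 1))
    + 2 * (2 * (rate_const lam c k * D ^ (2 * k + 1) * \<Gamma>))"
    by (intro add_mono mult_left_mono rho_bound[OF D F] U(2)[OF F]) auto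
   also have "\<dots> = K * D ^ (2 * k + 1)"
   proof -
    have "2 * (a * d) + 2 * (2 * (r * d * g)) = (2 * a + 4 * (r * g)) * d" for a d r g :: real by (simp add: algebra_simps)
    then show ?thesis unfolding K_def .
   qed
   finally show "(\<Sum>i\<in>F. LBINT x:cell D i. (V T x - w T x)^2) \<le> K * D ^ (2 * k + 1)" .
  qed
  also have "\<dots> \<le> \<bar>K\<bar> * D ^ (2 * k + 1)" using D by (intro mult_right_mono) auto
  also have "D ^ (2 * k + 1) = (D powr (real k + 1 / 2))^2"
  proof -
   have "(D powr (real k + 1 / 2))^2 = D powr (real (2 * k + 1))"
    unfolding power2_eq_square powr_add[symmetric] by (simp add: add.commute)
   also have "\<dots> = D ^ (2 * k + 1)" using D by (rule powr_realpow)
   finally show ?thesis by simp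
  qed
  finally have "sqrt (LBINT x. (V T x - w T x)^2) \<le> sqrt (\<bar>K\<bar> * (D powr (real k + 1 / 2))^2)" by (rule real_sqrt_le_mono)
  also have "\<dots> = sqrt \<bar>K\<bar> * D powr (real k + 1 / 2)" by (simp add: real_sqrt_mult)
  also have "\<dots> \<le> (sqrt \<bar>K\<bar> + 1) * D powr (real k + 1 / 2)" by (rule mult_right_mono) auto
  finally have "sqrt (LBINT x. (V T x - w T x)^2) \<le> (sqrt \<bar>K\<bar> + 1) * D powr (real k + 1 / 2)" .
  moreover have "(LBINT x. (uT x - w T x)^2) = (LBINT x. (V T x - w T x)^2)"
  proof (rule integral_cong_AE)
   show "AE x in lborel. (uT x - w T x)^2 = (V T x - w T x)^2"
    using V_trace(3)[OF tr(2) TT] by eventually_elim simp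
   show "(%x. (uT x - w T x)^2) \<in> borel_measurable lborel"
    using V_trace(2)[OF tr(2) TT] Lw by (auto simp: L2_on_UNIV)
   show "(%x. (V T x - w T x)^2) \<in> borel_measurable lborel" using Le by (auto simp: L2_on_UNIV)
  qed
  ultimately show ?thesis by (simp add: L2_norm_def)
 qed
 \<comment> \<open>The absolute value under the root saves a discussion of the sign of
   \<open>K\<close>, and adding 1 makes the constant positive.\<close>
 then show ?thesis by (intro exI[of _ "sqrt \<bar>K\<bar> + 1"]) (auto intro!: add_nonneg_pos)
qed

end

theorem theorem3p3:
  fixes lam c T :: real and k :: nat
    and u :: "real \<times> real \<Rightarrow> real" and u0 uT :: "real \<Rightarrow> real"
  assumes "0 < lam" and "lam < 1" and "0 < T"
    and "u \<in> sobolev (k + 1) (Q T)"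
    and "solves_equation lam c T u"
    and "time_trace T u 0 u0" and "time_trace T u T uT"
  shows "\<exists>C>0. \<forall>\<Delta>x>0. \<forall>w. C1_H_frac lam T w \<longrightarrow> dg_solution lam c k \<Delta>x T u0 w \<longrightarrow>
           L2_norm (\<lambda>x. uT x - w T x) \<le> C * \<Delta>x powr (real k + 1 / 2)"
proof -
 \<comment> \<open>In mixed derivatives the time direction stands at the head of the list, so that
   further derivatives in \<open>x\<close> are appended at the end, as
   \<open>weak_derivative_weak_x\<close> expects.\<close>
 let ?r = "%j. replicate j (1 :: real, 0 :: real)"
 have Lu: "L2_on (Q T) u" and sob: "!!bs. set bs \<subseteq> Basis ==> length bs \<le> k + 1 ==> \<exists>g. L2_on (Q T) g \<and> weak_derivative (Q T) bs u g"
  using assms(4) unfolding sobolev_def by blast+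
 obtain ut ux where ut: "L2_on (Q T) ut" "weak_derivative (Q T) [(0, 1)] u ut"
  and ux: "L2_on (Q T) ux" "weak_derivative (Q T) [(1, 0)] u ux"
  and eqn: "AE t in lborel. t \<in> {0<..<T} --> is_g lam (%x. u (x, t)) (%x. ut (x, t) + c * ux (x, t))"
  using assms(5) unfolding solves_equation_def by blast
 have "\<forall>j. \<exists>g. j \<le> k + 1 --> L2_on (Q T) g \<and> weak_derivative (Q T) (?r j) u g"
 proof
  fix j
  have "set (?r j) \<subseteq> Basis" by (auto simp: Basis_real2)
  from sob[OF this] show "\<exists>g. j \<le> k + 1 --> L2_on (Q T) g \<and> weak_derivative (Q T) (?r j) u g" by auto
 qed
 from choice[OF this] obtain G where G: "!!j. j \<le> k + 1 ==> L2_on (Q T) (G j) \<and> weak_derivative (Q T) (?r j) u (G j)" by blast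
 have "\<forall>j. \<exists>g. j \<le> k --> L2_on (Q T) g \<and> weak_derivative (Q T) ((0, 1) # ?r j) u g"
 proof
  fix j
  have "set ((0, 1) # ?r j) \<subseteq> Basis" by (auto simp: Basis_real2)
  from sob[OF this] show "\<exists>g. j \<le> k --> L2_on (Q T) g \<and> weak_derivative (Q T) ((0, 1) # ?r j) u g" by auto
 qed
 from choice[OF this] obtain H where H: "!!j. j \<le> k ==> L2_on (Q T) (H j) \<and> weak_derivative (Q T) ((0, 1) # ?r j) u (H j)" by blast
 \<comment> \<open>At orders 0 and 1 the functions from the equation itself are taken instead of
   arbitrary weak derivatives, so that chain and equation speak of the same functions.\<close>
 define A where "A j = (if j = 0 then u else if j = 1 then ux else G j)" for j
 define Bt where "Bt j = (if j = 0 then ut else H j)" for j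
 have A: "L2_on (Q T) (A j) \<and> weak_derivative (Q T) (?r j) u (A j)" if "j \<le> Suc k" for j
  using that G[of j] Lu ux by (auto simp: A_def weak_derivative_Nil)
 have Bt: "L2_on (Q T) (Bt j) \<and> weak_derivative (Q T) ((0, 1) # ?r j) u (Bt j)" if "j \<le> k" for j
  using that H[of j] ut by (auto simp: Bt_def)
 have app: "?r (Suc j) = ?r j @ [(1, 0)]" for j by (simp add: replicate_append_same)
 interpret exact_solution lam c T k u ut ux A Bt u0 uT
 proof unfold_locales
  show "weak_x T (A j) (A (Suc j))" if "j < Suc k" for j
  proof -
   have "weak_derivative (Q T) (?r j) u (A j)" "weak_derivative (Q T) (?r j @ [(1, 0)]) u (A (Suc j))"
    using A[of j] A[of "Suc j"] that unfolding app by auto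
   then show ?thesis by (rule weak_derivative_weak_x)
  qed
  show "weak_x T (Bt j) (Bt (Suc j))" if "j < k" for j
  proof -
   have "weak_derivative (Q T) ((0, 1) # ?r j) u (Bt j)" "weak_derivative (Q T) (((0, 1) # ?r j) @ [(1, 0)]) u (Bt (Suc j))"
    using Bt[of j] Bt[of "Suc j"] that unfolding app by auto
   then show ?thesis by (rule weak_derivative_weak_x)
  qed
  show "weak_t T u ut" by (rule weak_derivative_weak_t[OF ut(2)])
 qed (use assms A Bt eqn in \<open>auto simp: A_def Bt_def\<close>)
 show ?thesis by (rule error_estimate)
qed

end
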